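(* Let $R$ be a one-dimensional Cohen-Macaulay local ring with a canonical ideal $\omega_R$, and let $M$ be an $\omega_R$-Ulrich (maximal Cohen-Macaulay) $R$-module. Then $M$ is reflexive.
   Context: All rings are commutative Noetherian with unity and modules are finitely generated. A canonical ideal $\omega_R$ is an ideal of $R$ isomorphic to a canonical module of $R$; it contains a nonzerodivisor. For an ideal $I$ containing a nonzerodivisor, a maximal Cohen-Macaulay $R$-module $M$ is $I$-Ulrich if $e_I(M)=\ell(M/IM)$, where $\ell$ is length and $e_I(M)$ is the Hilbert-Samuel multiplicity, i.e. the eventual constant value of $\ell(I^nM/I^{n+1}M)$ for $n\gg0$. $M$ is reflexive if the natural map $M\to M^{**}$ is an isomorphism, with $M^*=\mathrm{Hom}_R(M,R)$. *)

theory Defs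
  imports "HOL-Algebra.Algebra" "HOL-Library.Extended_Nat"
begin

section \<open>Modules over a commutative ring\<close>

definition self_module :: "('a, 'r) ring_scheme \<Rightarrow> ('a, 'a) module" where
  "self_module R = \<lparr>carrier = carrier R, monoid.mult = monoid.mult R, one = one R,
     ring.zero = ring.zero R, add = add R, smult = monoid.mult R\<rparr>"

text \<open>An ideal or submodule \<open>N\<close> of \<open>M\<close>, seen as a module, is \<open>M\<lparr>carrier := N\<rparr>\<close>.\<close>

abbreviation ideal_module :: "('a, 'r) ring_scheme \<Rightarrow> 'a set \<Rightarrow> ('a, 'a) module" where
  "ideal_module R I \<equiv> (self_module R)\<lparr>carrier := I\<rparr>"

text \<open>The fields \<open>mult\<close> and \<open>one\<close> of a module record are never used, so they are left
  unspecified below.\<close>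

definition quot_module :: "('a, 'b) module \<Rightarrow> 'b set \<Rightarrow> ('a, 'b set) module" where
  "quot_module M N = \<lparr>carrier = a_rcosets\<^bsub>M\<^esub> N, monoid.mult = undefined, one = undefined,
     ring.zero = N, add = (<+>\<^bsub>M\<^esub>), smult = (\<lambda>a U. \<Union>x\<in>U. N +>\<^bsub>M\<^esub> (a \<odot>\<^bsub>M\<^esub> x))\<rparr>"

text \<open>Homomorphisms are extensional on the carrier, so that equality of functions is equality of
  homomorphisms.\<close>

definition mhom :: "('a, 'r) ring_scheme \<Rightarrow> ('a, 'b) module \<Rightarrow> ('a, 'c) module \<Rightarrow> ('b \<Rightarrow> 'c) set" where
  "mhom R M N = {f \<in> carrier M \<rightarrow>\<^sub>E carrier N.
     (\<forall>x\<in>carrier M. \<forall>y\<in>carrier M. f (x \<oplus>\<^bsub>M\<^esub> y) = f x \<oplus>\<^bsub>N\<^esub> f y) \<and>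
     (\<forall>a\<in>carrier R. \<forall>x\<in>carrier M. f (a \<odot>\<^bsub>M\<^esub> x) = a \<odot>\<^bsub>N\<^esub> f x)}"

definition miso :: "('a, 'r) ring_scheme \<Rightarrow> ('a, 'b) module \<Rightarrow> ('a, 'c) module \<Rightarrow> ('b \<Rightarrow> 'c) set" where
  "miso R M N = {f \<in> mhom R M N. bij_betw f (carrier M) (carrier N)}"

definition Hom_module ::
  "('a, 'r) ring_scheme \<Rightarrow> ('a, 'b) module \<Rightarrow> ('a, 'c) module \<Rightarrow> ('a, 'b \<Rightarrow> 'c) module" where
  "Hom_module R M N = \<lparr>carrier = mhom R M N, monoid.mult = undefined, one = undefined,
     ring.zero = (\<lambda>x\<in>carrier M. \<zero>\<^bsub>N\<^esub>),
     add = (\<lambda>f g. \<lambda>x\<in>carrier M. f x \<oplus>\<^bsub>N\<^esub> g x),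
     smult = (\<lambda>a f. \<lambda>x\<in>carrier M. a \<odot>\<^bsub>N\<^esub> f x)\<rparr>"

definition mspan :: "('a, 'r) ring_scheme \<Rightarrow> ('a, 'b) module \<Rightarrow> 'b set \<Rightarrow> 'b set" where
  "mspan R M S = \<Inter>{N. submodule N R M \<and> S \<subseteq> N}"

definition fg_module :: "('a, 'r) ring_scheme \<Rightarrow> ('a, 'b) module \<Rightarrow> bool" where
  "fg_module R M \<longleftrightarrow> module R M \<and> (\<exists>S. finite S \<and> S \<subseteq> carrier M \<and> mspan R M S = carrier M)"

definition ideal_smult :: "('a, 'r) ring_scheme \<Rightarrow> 'a set \<Rightarrow> ('a, 'b) module \<Rightarrow> 'b set" where
  "ideal_smult R I M = mspan R M {a \<odot>\<^bsub>M\<^esub> x | a x. a \<in> I \<and> x \<in> carrier M}"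

definition nzd_on :: "('a, 'r) ring_scheme \<Rightarrow> ('a, 'b) module \<Rightarrow> 'a \<Rightarrow> bool" where
  "nzd_on R M a \<longleftrightarrow> a \<in> carrier R \<and> (\<forall>x\<in>carrier M. a \<odot>\<^bsub>M\<^esub> x = \<zero>\<^bsub>M\<^esub> \<longrightarrow> x = \<zero>\<^bsub>M\<^esub>)"


section \<open>Length, dimension, depth\<close>

text \<open>Supremum of the lengths \<open>n\<close> of strict chains \<open>c 0 \<subset> \<dots> \<subset> c n\<close> of sets satisfying \<open>P\<close>.\<close>

definition chain_sup :: "('x set \<Rightarrow> bool) \<Rightarrow> enat" where
  "chain_sup P = (SUP n \<in> {n. \<exists>c :: nat \<Rightarrow> 'x set. (\<forall>i\<le>n. P (c i)) \<and> (\<forall>i<n. c i \<subset> c (Suc i))}. enat n)"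

definition krull_dim :: "('a, 'r) ring_scheme \<Rightarrow> enat" where
  "krull_dim R = chain_sup (\<lambda>p. primeideal p R)"

definition module_length :: "('a, 'r) ring_scheme \<Rightarrow> ('a, 'b) module \<Rightarrow> enat" where
  "module_length R M = chain_sup (\<lambda>N. submodule N R M)"

definition max_ideal :: "('a, 'r) ring_scheme \<Rightarrow> 'a set" where
  "max_ideal R = (THE m. maximalideal m R)"

definition noetherian_local_ring :: "('a, 'r) ring_scheme \<Rightarrow> bool" where
  "noetherian_local_ring R \<longleftrightarrow> cring R \<and> noetherian_ring R \<and> (\<exists>!m. maximalideal m R)"

definition residue_module :: "('a, 'r) ring_scheme \<Rightarrow> ('a, 'a set) module" where
  "residue_module R = quot_module (self_module R) (max_ideal R)"

definition regular_sequence :: "('a, 'r) ring_scheme \<Rightarrow> ('a, 'b) module \<Rightarrow> 'a list \<Rightarrow> bool" where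
  "regular_sequence R M xs \<longleftrightarrow> set xs \<subseteq> carrier R \<and>
     (\<forall>i<length xs. nzd_on R (quot_module M (ideal_smult R (genideal R (set (take i xs))) M)) (xs ! i)) \<and>
     ideal_smult R (genideal R (set xs)) M \<noteq> carrier M"

definition depth :: "('a, 'r) ring_scheme \<Rightarrow> ('a, 'b) module \<Rightarrow> enat" where
  "depth R M = (SUP xs \<in> {xs. set xs \<subseteq> max_ideal R \<and> regular_sequence R M xs}. enat (length xs))"

text \<open>The zero module is excluded explicitly: it has no regular sequences, hence depth \<open>0\<close> above.\<close>

definition maximal_CM :: "('a, 'r) ring_scheme \<Rightarrow> ('a, 'b) module \<Rightarrow> bool" where
  "maximal_CM R M \<longleftrightarrow> fg_module R M \<and> carrier M \<noteq> {\<zero>\<^bsub>M\<^esub>} \<and> depth R M = krull_dim R"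

definition CM_local_ring :: "('a, 'r) ring_scheme \<Rightarrow> bool" where
  "CM_local_ring R \<longleftrightarrow> noetherian_local_ring R \<and> maximal_CM R (self_module R)"


section \<open>Canonical modules\<close>

text \<open>The extension property is quantified over monomorphisms \<open>A \<rightarrow> B\<close> of modules living in the type
  of \<open>R\<close>. By Baer's criterion this is injectivity in the usual sense, since \<open>R\<close> and its ideals are
  among these modules.\<close>

definition injective_module :: "('a, 'r) ring_scheme \<Rightarrow> ('a, 'c) module \<Rightarrow> bool" where
  "injective_module R E \<longleftrightarrow> module R E \<and>
     (\<forall>(A :: ('a, 'a) module) (B :: ('a, 'a) module) i f.
        module R A \<and> module R B \<and> i \<in> mhom R A B \<and> inj_on i (carrier A) \<and> f \<in> mhom R A E \<longrightarrow>
        (\<exists>g\<in>mhom R B E. \<forall>x\<in>carrier A. g (i x) = f x))"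

definition injective_resolution :: "('a, 'r) ring_scheme \<Rightarrow> ('a, 'b) module \<Rightarrow> ('b \<Rightarrow> 'c) \<Rightarrow>
    (nat \<Rightarrow> ('a, 'c) module) \<Rightarrow> (nat \<Rightarrow> 'c \<Rightarrow> 'c) \<Rightarrow> bool" where
  "injective_resolution R C \<eta> E d \<longleftrightarrow>
     (\<forall>i. injective_module R (E i)) \<and>
     \<eta> \<in> mhom R C (E 0) \<and> (\<forall>i. d i \<in> mhom R (E i) (E (Suc i))) \<and>
     inj_on \<eta> (carrier C) \<and>
     \<eta> ` carrier C = {x \<in> carrier (E 0). d 0 x = \<zero>\<^bsub>E 1\<^esub>} \<and>
     (\<forall>i. d i ` carrier (E i) = {x \<in> carrier (E (Suc i)). d (Suc i) x = \<zero>\<^bsub>E (Suc (Suc i))\<^esub>})"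

text \<open>If \<open>(E, d)\<close> is an injective resolution of \<open>C\<close>, then \<open>Ext_module R N E d i\<close>, the \<open>i\<close>-th cohomology
  of the complex \<open>Hom(N, E)\<close>, is \<open>Ext\<^sup>i(N, C)\<close>.\<close>

definition Ext_cycles :: "('a, 'r) ring_scheme \<Rightarrow> ('a, 'b) module \<Rightarrow>
    (nat \<Rightarrow> ('a, 'c) module) \<Rightarrow> (nat \<Rightarrow> 'c \<Rightarrow> 'c) \<Rightarrow> nat \<Rightarrow> ('b \<Rightarrow> 'c) set" where
  "Ext_cycles R N E d i =
     {f \<in> mhom R N (E i). \<forall>x\<in>carrier N. d i (f x) = \<zero>\<^bsub>E (Suc i)\<^esub>}"

definition Ext_boundaries :: "('a, 'r) ring_scheme \<Rightarrow> ('a, 'b) module \<Rightarrow>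
    (nat \<Rightarrow> ('a, 'c) module) \<Rightarrow> (nat \<Rightarrow> 'c \<Rightarrow> 'c) \<Rightarrow> nat \<Rightarrow> ('b \<Rightarrow> 'c) set" where
  "Ext_boundaries R N E d i = (case i of
       0 \<Rightarrow> {\<lambda>x\<in>carrier N. \<zero>\<^bsub>E 0\<^esub>}
     | Suc j \<Rightarrow> (\<lambda>f. compose (carrier N) (d j) f) ` mhom R N (E j))"

definition Ext_module :: "('a, 'r) ring_scheme \<Rightarrow> ('a, 'b) module \<Rightarrow>
    (nat \<Rightarrow> ('a, 'c) module) \<Rightarrow> (nat \<Rightarrow> 'c \<Rightarrow> 'c) \<Rightarrow> nat \<Rightarrow> ('a, ('b \<Rightarrow> 'c) set) module" where
  "Ext_module R N E d i =
     quot_module ((Hom_module R N (E i))\<lparr>carrier := Ext_cycles R N E d i\<rparr>) (Ext_boundaries R N E d i)"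

text \<open>A canonical module over a Cohen-Macaulay local ring \<open>R\<close> of dimension \<open>t\<close> is a maximal
  Cohen-Macaulay module \<open>C\<close> of finite injective dimension and type one, that is,
  \<open>dim\<^sub>k Ext\<^sup>t(k, C) = 1\<close> for the residue field \<open>k\<close>. This \<open>Ext\<close> is annihilated by the maximal ideal, so
  its dimension over \<open>k\<close> is its length over \<open>R\<close>; it does not depend on the resolution.

  The type \<open>'c\<close> carries the modules of the injective resolution. As a hypothesis with \<open>'c\<close> arbitrary,
  the predicate says that a suitable resolution exists in some type.\<close>

definition canonical_module :: "'c itself \<Rightarrow> ('a, 'r) ring_scheme \<Rightarrow> ('a, 'b) module \<Rightarrow> bool" where
  "canonical_module TYPE('c) R C \<longleftrightarrow> maximal_CM R C \<and>
     (\<exists>(\<eta> :: 'b \<Rightarrow> 'c) E d.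
        injective_resolution R C \<eta> E d \<and>
        (\<exists>n. \<forall>i>n. carrier (E i) = {\<zero>\<^bsub>E i\<^esub>}) \<and>
        (\<exists>t. krull_dim R = enat t \<and> module_length R (Ext_module R (residue_module R) E d t) = 1))"

text \<open>It is enough to consider canonical modules living in the type of \<open>R\<close>, as \<open>I\<close> does.\<close>

definition canonical_ideal :: "'c itself \<Rightarrow> ('a, 'r) ring_scheme \<Rightarrow> 'a set \<Rightarrow> bool" where
  "canonical_ideal TYPE('c) R I \<longleftrightarrow> ideal I R \<and>
     (\<exists>C :: ('a, 'a) module. canonical_module TYPE('c) R C \<and> miso R (ideal_module R I) C \<noteq> {})"


section \<open>Ulrich and reflexive modules\<close>

text \<open>\<open>ideals_set R\<close> is the monoid of ideals under the ideal product, so the following is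
  \<open>I\<^sup>n M\<close>, with \<open>I\<^sup>0 = R\<close>.\<close>

definition ideal_pow_smult ::
  "('a, 'r) ring_scheme \<Rightarrow> 'a set \<Rightarrow> nat \<Rightarrow> ('a, 'b) module \<Rightarrow> 'b set" where
  "ideal_pow_smult R I n M = ideal_smult R (I [^]\<^bsub>ideals_set R\<^esub> n) M"

text \<open>\<open>e\<close> is the Hilbert-Samuel multiplicity of \<open>M\<close> with respect to \<open>I\<close> (in dimension one).\<close>

definition has_multiplicity ::
  "('a, 'r) ring_scheme \<Rightarrow> 'a set \<Rightarrow> ('a, 'b) module \<Rightarrow> enat \<Rightarrow> bool" where
  "has_multiplicity R I M e \<longleftrightarrow>
     (\<forall>\<^sub>F n in sequentially.
        module_length R (quot_module (M\<lparr>carrier := ideal_pow_smult R I n M\<rparr>)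
                                     (ideal_pow_smult R I (Suc n) M)) = e)"

definition Ulrich_module :: "('a, 'r) ring_scheme \<Rightarrow> 'a set \<Rightarrow> ('a, 'b) module \<Rightarrow> bool" where
  "Ulrich_module R I M \<longleftrightarrow>
     ideal I R \<and> (\<exists>a\<in>I. nzd_on R (self_module R) a) \<and> maximal_CM R M \<and>
     has_multiplicity R I M (module_length R (quot_module M (ideal_smult R I M)))"

definition dual_module :: "('a, 'r) ring_scheme \<Rightarrow> ('a, 'b) module \<Rightarrow> ('a, 'b \<Rightarrow> 'a) module" where
  "dual_module R M = Hom_module R M (self_module R)"

definition reflexive_module :: "('a, 'r) ring_scheme \<Rightarrow> ('a, 'b) module \<Rightarrow> bool" where
  "reflexive_module R M \<longleftrightarrow>
     (\<lambda>x\<in>carrier M. \<lambda>f\<in>carrier (dual_module R M). f x)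
       \<in> miso R M (dual_module R (dual_module R M))"

end

theory Submission
  imports Defs
begin

text \<open>
  Put \<open>T = M\<^sup>*\<^sup>*\<close>. Since \<open>\<omega>\<close> is a canonical module, \<open>Hom(-, \<omega>)\<close> is a duality on torsion-free modules.
  In particular \<open>M\<close> embeds into \<open>T\<close> and \<open>End(\<omega>) = R\<close>, so that \<open>Hom(M, R) = Hom(\<omega>M, \<omega>)\<close>; biduality for
  \<open>\<omega>M\<close> then gives \<open>\<omega>T = \<omega>M\<close>, hence \<open>\<omega>\<^sup>nT = \<omega>\<^sup>nM\<close> for \<open>n \<ge> 1\<close>. For every torsion-free \<open>T\<close> the
  length of \<open>T/\<omega>T\<close> is at most that of \<open>\<omega>\<^sup>nT/\<omega>\<^sup>n\<^sup>+\<^sup>1T\<close> for large \<open>n\<close>. As \<open>M\<close> is Ulrich, the latter is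
  the length of \<open>M/\<omega>M = M/\<omega>T\<close>, and so \<open>T = M\<close>.

  The inequality of lengths would be immediate from a principal reduction of \<open>\<omega>\<close>, which need not exist
  over a finite residue field. Instead, fix a nonzerodivisor \<open>a\<close> in the ideal \<open>I\<close>. For large \<open>n\<close>,
  multiplication by \<open>I\<close> does not decrease the length of submodules of \<open>I\<^sup>nT/aI\<^sup>nT\<close>; these quotients all
  have the same finite length. By induction this holds for powers of \<open>a\<close> too, and it is applied to the
  submodule \<open>a\<^sup>nT\<close> of \<open>I\<^sup>nT\<close>.

  For the duality, let \<open>a\<close> be a nonzerodivisor in the maximal ideal. The finite injective resolution
  shows that Ext in degrees at least 2 of \<open>R/J\<close> with values in \<open>\<omega>\<close> vanishes for all ideals \<open>J\<close> that
  contain \<open>a\<close>. So \<open>\<omega>/a\<omega>\<close> is injective over \<open>R/aR\<close>; its socle is simple because \<open>\<omega>\<close> has type one. This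
  yields biduality over \<open>R/aR\<close> by counting lengths, which lifts to \<open>R\<close> by Nakayama's lemma.
\<close>

section \<open>Submodules and linear maps\<close>

text \<open>The main use of dimension one is that a nonzerodivisor in the maximal ideal lies in no
  other prime. Dividing a noetherian module by it leaves finite length, and every nonzero quotient
  that it kills contains a copy of the residue field. Two nonzerodivisors occur: one in the maximal
  ideal, supplied by the depth of \<open>R\<close>, for the duality, and one in \<omega> for the
  count of lengths. The vanishing of Ext is a descending induction on the degree, started beyond the
  end of the resolution. The residue field embeds in \<open>R\<close>/\<open>aR\<close> with a
  cokernel treated in the next degree, while \<open>R\<close>/\<open>aR\<close> has no Ext above
  degree 1 because injective modules are divisible by \<open>a\<close>; the other ideals containing
  \<open>a\<close> follow by noetherian induction. Injectivity can be tested only on modules in the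
  type of \<open>R\<close>, whereas \<open>M\<close> and its duals live in other types. Hence a Baer
  criterion for ideals is proved for \<omega>/a\<omega>, and from it maps out of noetherian modules
  of any type are extended.\<close>

locale plain_module = module R M
  for R :: "('a, 'r) ring_scheme" (structure) and M :: "('a, 'b) module" (structure)
begin

lemma submodule_subset: "submodule N R M \<Longrightarrow> N \<subseteq> carrier M"
  by (rule submoduleE(1))

lemma submodule_mem: "submodule N R M \<Longrightarrow> x \<in> N \<Longrightarrow> x \<in> carrier M"
  using submodule_subset by blast

lemma submodule_zero: "submodule N R M \<Longrightarrow> \<zero>\<^bsub>M\<^esub> \<in> N"
  using submoduleE(2,4) submodule_mem smult_l_null R.zero_closed
  by (metis all_not_in_conv)

lemma submodule_add: "submodule N R M \<Longrightarrow> x \<in> N \<Longrightarrow> y \<in> N \<Longrightarrow> x \<oplus>\<^bsub>M\<^esub> y \<in> N"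
  by (rule submoduleE(5))

lemma submodule_smult: "submodule N R M \<Longrightarrow> r \<in> carrier R \<Longrightarrow> x \<in> N \<Longrightarrow> r \<odot>\<^bsub>M\<^esub> x \<in> N"
  by (rule submoduleE(4))

lemma submodule_neg: "submodule N R M \<Longrightarrow> x \<in> N \<Longrightarrow> \<ominus>\<^bsub>M\<^esub> x \<in> N"
  by (rule submoduleE(3))

lemma submodule_minus: "submodule N R M \<Longrightarrow> x \<in> N \<Longrightarrow> y \<in> N \<Longrightarrow> x \<ominus>\<^bsub>M\<^esub> y \<in> N"
  by (simp add: a_minus_def submodule_add submodule_neg)

lemma submodule_criterion:
  assumes "N \<subseteq> carrier M" "\<zero>\<^bsub>M\<^esub> \<in> N" "\<And>x y. x \<in> N \<Longrightarrow> y \<in> N \<Longrightarrow> x \<oplus>\<^bsub>M\<^esub> y \<in> N"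
    "\<And>r x. r \<in> carrier R \<Longrightarrow> x \<in> N \<Longrightarrow> r \<odot>\<^bsub>M\<^esub> x \<in> N"
  shows "submodule N R M"
proof (rule submoduleI)
  fix x assume x: "x \<in> N"
  then have "\<ominus>\<^bsub>M\<^esub> x = (\<ominus> \<one>) \<odot>\<^bsub>M\<^esub> x"
    using assms(1) by (subst smult_l_minus) auto
  then show "\<ominus>\<^bsub>M\<^esub> x \<in> N" using assms(4) x by simp
qed (use assms in auto)

lemma minus_add_cancel: "x \<in> carrier M \<Longrightarrow> y \<in> carrier M \<Longrightarrow> (x \<ominus>\<^bsub>M\<^esub> y) \<oplus>\<^bsub>M\<^esub> y = x"
  by (simp add: a_minus_def M.a_assoc M.l_neg)

lemma add_minus_cancel: "x \<in> carrier M \<Longrightarrow> y \<in> carrier M \<Longrightarrow> (x \<oplus>\<^bsub>M\<^esub> y) \<ominus>\<^bsub>M\<^esub> y = x"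
  by (simp add: a_minus_def M.a_assoc M.r_neg)

lemma add_minus_cancel_left: "x \<in> carrier M \<Longrightarrow> y \<in> carrier M \<Longrightarrow> (x \<oplus>\<^bsub>M\<^esub> y) \<ominus>\<^bsub>M\<^esub> x = y"
  by (metis M.a_comm add_minus_cancel)

lemma minus_closed': "x \<in> carrier M \<Longrightarrow> y \<in> carrier M \<Longrightarrow> x \<ominus>\<^bsub>M\<^esub> y \<in> carrier M"
  by simp

lemma minus_eq_zero_iff: "x \<in> carrier M \<Longrightarrow> y \<in> carrier M \<Longrightarrow> x \<ominus>\<^bsub>M\<^esub> y = \<zero>\<^bsub>M\<^esub> \<longleftrightarrow> x = y"
  using minus_add_cancel[of x y] by (auto simp: a_minus_def M.r_neg)

lemma smult_minus_distr: "r \<in> carrier R \<Longrightarrow> x \<in> carrier M \<Longrightarrow> y \<in> carrier M \<Longrightarrow>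
    r \<odot>\<^bsub>M\<^esub> (x \<ominus>\<^bsub>M\<^esub> y) = r \<odot>\<^bsub>M\<^esub> x \<ominus>\<^bsub>M\<^esub> r \<odot>\<^bsub>M\<^esub> y"
  by (simp add: a_minus_def smult_r_distr smult_r_minus)

lemma smult_minus_distr_left: "r \<in> carrier R \<Longrightarrow> t \<in> carrier R \<Longrightarrow> x \<in> carrier M \<Longrightarrow>
    (r \<ominus> t) \<odot>\<^bsub>M\<^esub> x = r \<odot>\<^bsub>M\<^esub> x \<ominus>\<^bsub>M\<^esub> t \<odot>\<^bsub>M\<^esub> x"
  by (simp add: a_minus_def smult_l_distr smult_l_minus)

lemma minus_add_distr: "\<lbrakk>u \<in> carrier M; v \<in> carrier M; x \<in> carrier M; y \<in> carrier M\<rbrakk> \<Longrightarrow>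
    (u \<oplus>\<^bsub>M\<^esub> v) \<ominus>\<^bsub>M\<^esub> (x \<oplus>\<^bsub>M\<^esub> y) = (u \<ominus>\<^bsub>M\<^esub> x) \<oplus>\<^bsub>M\<^esub> (v \<ominus>\<^bsub>M\<^esub> y)"
  by (simp add: a_minus_def M.minus_add M.a_ac)

lemma submodule_add_cancel: "submodule N R M \<Longrightarrow> x \<in> carrier M \<Longrightarrow> y \<in> N \<Longrightarrow> x \<oplus>\<^bsub>M\<^esub> y \<in> N \<Longrightarrow> x \<in> N"
  using submodule_minus[of N "x \<oplus>\<^bsub>M\<^esub> y" y] submodule_mem[of N y] add_minus_cancel by fastforce

lemma submodule_add_cancel_left: "submodule N R M \<Longrightarrow> x \<in> carrier M \<Longrightarrow> y \<in> N \<Longrightarrow> y \<oplus>\<^bsub>M\<^esub> x \<in> N \<Longrightarrow> x \<in> N"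
  using submodule_add_cancel[of N x y] submodule_mem[of N y] M.a_comm by fastforce

lemma submodule_minus_cancel: "submodule N R M \<Longrightarrow> x \<in> carrier M \<Longrightarrow> y \<in> N \<Longrightarrow> x \<ominus>\<^bsub>M\<^esub> y \<in> N \<Longrightarrow> x \<in> N"
  using submodule_add[of N "x \<ominus>\<^bsub>M\<^esub> y" y] submodule_mem[of N y] minus_add_cancel by fastforce

lemma smult_commute: "r \<in> carrier R \<Longrightarrow> t \<in> carrier R \<Longrightarrow> x \<in> carrier M \<Longrightarrow>
    r \<odot>\<^bsub>M\<^esub> (t \<odot>\<^bsub>M\<^esub> x) = t \<odot>\<^bsub>M\<^esub> (r \<odot>\<^bsub>M\<^esub> x)"
  by (metis R.m_comm smult_assoc1)

lemma submodule_zero_set: "submodule {\<zero>\<^bsub>M\<^esub>} R M"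
  by (rule submodule_criterion) auto

lemma submodule_inter: "submodule A R M \<Longrightarrow> submodule B R M \<Longrightarrow> submodule (A \<inter> B) R M"
  by (rule submodule_criterion)
     (auto dest: submodule_subset intro: submodule_zero submodule_add submodule_smult)

lemma mem_set_add: "x \<in> A <+>\<^bsub>M\<^esub> B \<longleftrightarrow> (\<exists>y\<in>A. \<exists>z\<in>B. x = y \<oplus>\<^bsub>M\<^esub> z)"
  by (auto simp: set_add_def')

lemma submodule_set_add:
  assumes A: "submodule A R M" and B: "submodule B R M"
  shows "submodule (A <+>\<^bsub>M\<^esub> B) R M"
proof (rule submodule_criterion)
  show "A <+>\<^bsub>M\<^esub> B \<subseteq> carrier M" using submodule_mem[OF A] submodule_mem[OF B]
    by (auto simp: mem_set_add)
  show "\<zero>\<^bsub>M\<^esub> \<in> A <+>\<^bsub>M\<^esub> B" using submodule_zero[OF A] submodule_zero[OF B]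
    by (auto simp: mem_set_add intro!: bexI[of _ "\<zero>\<^bsub>M\<^esub>"])
next
  fix x y assume "x \<in> A <+>\<^bsub>M\<^esub> B" "y \<in> A <+>\<^bsub>M\<^esub> B"
  then obtain p q r s where *: "p \<in> A" "q \<in> B" "x = p \<oplus>\<^bsub>M\<^esub> q" "r \<in> A" "s \<in> B" "y = r \<oplus>\<^bsub>M\<^esub> s"
    by (auto simp: mem_set_add)
  have c: "p \<in> carrier M" "q \<in> carrier M" "r \<in> carrier M" "s \<in> carrier M"
    using * submodule_mem A B by auto
  have "x \<oplus>\<^bsub>M\<^esub> y = (p \<oplus>\<^bsub>M\<^esub> r) \<oplus>\<^bsub>M\<^esub> (q \<oplus>\<^bsub>M\<^esub> s)"
    using c by (simp add: * M.a_ac)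
  then show "x \<oplus>\<^bsub>M\<^esub> y \<in> A <+>\<^bsub>M\<^esub> B"
    using * A B submodule_add unfolding mem_set_add by blast
next
  fix r x assume r: "r \<in> carrier R" and "x \<in> A <+>\<^bsub>M\<^esub> B"
  then obtain p q where *: "p \<in> A" "q \<in> B" "x = p \<oplus>\<^bsub>M\<^esub> q"
    by (auto simp: mem_set_add)
  have "r \<odot>\<^bsub>M\<^esub> x = r \<odot>\<^bsub>M\<^esub> p \<oplus>\<^bsub>M\<^esub> r \<odot>\<^bsub>M\<^esub> q"
    using r * submodule_mem A B by (simp add: smult_r_distr)
  then show "r \<odot>\<^bsub>M\<^esub> x \<in> A <+>\<^bsub>M\<^esub> B"
    using * r A B submodule_smult unfolding mem_set_add by blast
qed

lemma set_add_upper1: "submodule A R M \<Longrightarrow> submodule B R M \<Longrightarrow> A \<subseteq> A <+>\<^bsub>M\<^esub> B"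
  unfolding mem_set_add subset_iff using submodule_zero[of B] submodule_mem[of A] M.r_zero by metis

lemma set_add_upper2: "submodule A R M \<Longrightarrow> submodule B R M \<Longrightarrow> B \<subseteq> A <+>\<^bsub>M\<^esub> B"
  unfolding mem_set_add subset_iff using submodule_zero[of A] submodule_mem[of B] M.l_zero by metis

lemma set_add_least: "submodule C R M \<Longrightarrow> A \<subseteq> C \<Longrightarrow> B \<subseteq> C \<Longrightarrow> A <+>\<^bsub>M\<^esub> B \<subseteq> C"
  unfolding mem_set_add subset_iff using submodule_add by blast

lemma set_add_mono: "A \<subseteq> A' \<Longrightarrow> B \<subseteq> B' \<Longrightarrow> A <+>\<^bsub>M\<^esub> B \<subseteq> A' <+>\<^bsub>M\<^esub> B'"
  by (fastforce simp: mem_set_add)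

lemma submodule_mspan:
  assumes "S \<subseteq> carrier M"
  shows "submodule (mspan R M S) R M"
proof (rule submodule_criterion)
  have "submodule (carrier M) R M" by (rule carrier_is_submodule)
  then show "mspan R M S \<subseteq> carrier M" using assms unfolding mspan_def by blast
  show "\<zero>\<^bsub>M\<^esub> \<in> mspan R M S" unfolding mspan_def using submodule_zero by blast
  show "x \<oplus>\<^bsub>M\<^esub> y \<in> mspan R M S" if "x \<in> mspan R M S" "y \<in> mspan R M S" for x y
    using that unfolding mspan_def by (simp add: submodule_add)
  show "r \<odot>\<^bsub>M\<^esub> x \<in> mspan R M S" if "r \<in> carrier R" "x \<in> mspan R M S" for r x
    using that unfolding mspan_def by (simp add: submodule_smult)
qed

lemma mspan_superset: "S \<subseteq> mspan R M S"
  by (auto simp: mspan_def)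

lemma mspan_least: "submodule N R M \<Longrightarrow> S \<subseteq> N \<Longrightarrow> mspan R M S \<subseteq> N"
  by (auto simp: mspan_def)

lemma mspan_mono: "S \<subseteq> T \<Longrightarrow> mspan R M S \<subseteq> mspan R M T"
  by (auto simp: mspan_def)

lemma submodule_cyclic:
  assumes "x \<in> carrier M"
  shows "submodule ((\<lambda>r. r \<odot>\<^bsub>M\<^esub> x) ` carrier R) R M"
proof (rule submodule_criterion)
  have "\<zero>\<^bsub>M\<^esub> = \<zero> \<odot>\<^bsub>M\<^esub> x" using assms by simp
  then show "\<zero>\<^bsub>M\<^esub> \<in> (\<lambda>r. r \<odot>\<^bsub>M\<^esub> x) ` carrier R" by blast
  show "y \<oplus>\<^bsub>M\<^esub> z \<in> (\<lambda>r. r \<odot>\<^bsub>M\<^esub> x) ` carrier R"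
    if "y \<in> (\<lambda>r. r \<odot>\<^bsub>M\<^esub> x) ` carrier R" "z \<in> (\<lambda>r. r \<odot>\<^bsub>M\<^esub> x) ` carrier R" for y z
  proof -
    from that obtain r t where "r \<in> carrier R" "t \<in> carrier R" "y = r \<odot>\<^bsub>M\<^esub> x" "z = t \<odot>\<^bsub>M\<^esub> x"
      by auto
    then show ?thesis using smult_l_distr[of r t x] assms by (intro image_eqI[of _ _ "r \<oplus> t"]) auto
  qed
  show "r \<odot>\<^bsub>M\<^esub> y \<in> (\<lambda>r. r \<odot>\<^bsub>M\<^esub> x) ` carrier R"
    if r: "r \<in> carrier R" and "y \<in> (\<lambda>r. r \<odot>\<^bsub>M\<^esub> x) ` carrier R" for r y
  proof -
    from that obtain t where "t \<in> carrier R" "y = t \<odot>\<^bsub>M\<^esub> x" by auto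
    then show ?thesis using r smult_assoc1[of r t x] assms by (intro image_eqI[of _ _ "r \<otimes> t"]) auto
  qed
qed (use assms in auto)

lemma mem_cyclic_self: "x \<in> carrier M \<Longrightarrow> x \<in> (\<lambda>r. r \<odot>\<^bsub>M\<^esub> x) ` carrier R"
  by (rule image_eqI[of _ _ "\<one>"]) simp_all

text \<open>Allows chain conditions and lengths of \<open>B\<close> to be read off inside
  \<open>M\<close>, without a change of the ambient module.\<close>

lemma submodule_restrict_iff:
  assumes B: "submodule B R M"
  shows "submodule N R (M\<lparr>carrier := B\<rparr>) \<longleftrightarrow> submodule N R M \<and> N \<subseteq> B"
proof -
  interpret B: plain_module R "M\<lparr>carrier := B\<rparr>"
    using submodule.submodule_is_module[OF B] module_axioms by (blast intro: plain_module.intro)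
  show ?thesis
  proof
    assume N: "submodule N R (M\<lparr>carrier := B\<rparr>)"
    then have NB: "N \<subseteq> B" using B.submodule_subset by simp
    have "submodule N R M"
    proof (rule submodule_criterion)
      show "N \<subseteq> carrier M" using NB submodule_subset[OF B] by blast
      show "\<zero>\<^bsub>M\<^esub> \<in> N" using B.submodule_zero[OF N] by simp
      show "x \<oplus>\<^bsub>M\<^esub> y \<in> N" if "x \<in> N" "y \<in> N" for x y using B.submodule_add[OF N that] by simp
      show "r \<odot>\<^bsub>M\<^esub> x \<in> N" if "r \<in> carrier R" "x \<in> N" for r x using B.submodule_smult[OF N that] by simp
    qed
    then show "submodule N R M \<and> N \<subseteq> B" using NB by simp
  next
    assume N: "submodule N R M \<and> N \<subseteq> B"
    show "submodule N R (M\<lparr>carrier := B\<rparr>)"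
      by (rule B.submodule_criterion)
         (use N submodule_zero[of N] submodule_add[of N] submodule_smult[of N] in \<open>simp_all\<close>)
  qed
qed

lemma module_restrict: "submodule B R M \<Longrightarrow> module R (M\<lparr>carrier := B\<rparr>)"
  using submodule.submodule_is_module module_axioms by blast

end

text \<open>Homomorphisms without the extensionality that \<open>mhom\<close> demands: compositions,
  restrictions of the domain and pointwise combinations remain \<open>lin\<close> as they stand, and
  \<open>restrict_mhom\<close> returns to \<open>mhom\<close> where functions have to be
  compared.\<close>

definition lin :: "('a, 'r) ring_scheme \<Rightarrow> ('a, 'b) module \<Rightarrow> ('a, 'c) module \<Rightarrow> ('b \<Rightarrow> 'c) \<Rightarrow> bool" where
  "lin R M N f \<longleftrightarrow> f \<in> carrier M \<rightarrow> carrier N \<and>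
     (\<forall>x\<in>carrier M. \<forall>y\<in>carrier M. f (x \<oplus>\<^bsub>M\<^esub> y) = f x \<oplus>\<^bsub>N\<^esub> f y) \<and>
     (\<forall>a\<in>carrier R. \<forall>x\<in>carrier M. f (a \<odot>\<^bsub>M\<^esub> x) = a \<odot>\<^bsub>N\<^esub> f x)"

lemma linI:
  assumes "\<And>x. x \<in> carrier M \<Longrightarrow> f x \<in> carrier N"
    "\<And>x y. x \<in> carrier M \<Longrightarrow> y \<in> carrier M \<Longrightarrow> f (x \<oplus>\<^bsub>M\<^esub> y) = f x \<oplus>\<^bsub>N\<^esub> f y"
    "\<And>a x. a \<in> carrier R \<Longrightarrow> x \<in> carrier M \<Longrightarrow> f (a \<odot>\<^bsub>M\<^esub> x) = a \<odot>\<^bsub>N\<^esub> f x"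
  shows "lin R M N f"
  using assms by (auto simp: lin_def)

lemma lin_closed: "lin R M N f \<Longrightarrow> x \<in> carrier M \<Longrightarrow> f x \<in> carrier N"
  by (auto simp: lin_def)

lemma lin_add: "lin R M N f \<Longrightarrow> x \<in> carrier M \<Longrightarrow> y \<in> carrier M \<Longrightarrow> f (x \<oplus>\<^bsub>M\<^esub> y) = f x \<oplus>\<^bsub>N\<^esub> f y"
  by (auto simp: lin_def)

lemma lin_smult: "lin R M N f \<Longrightarrow> a \<in> carrier R \<Longrightarrow> x \<in> carrier M \<Longrightarrow> f (a \<odot>\<^bsub>M\<^esub> x) = a \<odot>\<^bsub>N\<^esub> f x"
  by (auto simp: lin_def)

lemma mhom_iff_lin: "f \<in> mhom R M N \<longleftrightarrow> lin R M N f \<and> f \<in> extensional (carrier M)"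
  by (auto simp: mhom_def lin_def PiE_def)

lemma mhom_lin: "f \<in> mhom R M N \<Longrightarrow> lin R M N f"
  by (simp add: mhom_iff_lin)

lemma mhom_eqI: "f \<in> mhom R M N \<Longrightarrow> g \<in> mhom R M N' \<Longrightarrow> (\<And>x. x \<in> carrier M \<Longrightarrow> f x = g x) \<Longrightarrow> f = g"
  by (auto simp: mhom_iff_lin intro: extensionalityI)

lemma lin_cong: "module R M \<Longrightarrow> (\<And>x. x \<in> carrier M \<Longrightarrow> f x = g x) \<Longrightarrow> lin R M N f \<Longrightarrow> lin R M N g"
proof -
  assume "module R M" and eq: "\<And>x. x \<in> carrier M \<Longrightarrow> f x = g x" and f: "lin R M N f"
  interpret plain_module R M by (rule plain_module.intro) fact
  show "lin R M N g"
  proof (rule linI)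
    show "g x \<in> carrier N" if "x \<in> carrier M" for x using that eq[of x] lin_closed[OF f] by metis
    show "g (x \<oplus>\<^bsub>M\<^esub> y) = g x \<oplus>\<^bsub>N\<^esub> g y" if "x \<in> carrier M" "y \<in> carrier M" for x y
      using that eq[of x] eq[of y] eq[of "x \<oplus>\<^bsub>M\<^esub> y"] lin_add[OF f, of x y] by simp
    show "g (r \<odot>\<^bsub>M\<^esub> x) = r \<odot>\<^bsub>N\<^esub> g x" if "r \<in> carrier R" "x \<in> carrier M" for r x
      using that eq[of x] eq[of "r \<odot>\<^bsub>M\<^esub> x"] lin_smult[OF f, of r x] by simp
  qed
qed

lemma restrict_mhom: "module R M \<Longrightarrow> lin R M N f \<Longrightarrow> restrict f (carrier M) \<in> mhom R M N"
  by (auto simp: mhom_iff_lin intro: lin_cong[of R M f])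

lemma lin_zero:
  assumes "module R M" "module R N" "lin R M N f"
  shows "f \<zero>\<^bsub>M\<^esub> = \<zero>\<^bsub>N\<^esub>"
proof -
  interpret M: plain_module R M by (rule plain_module.intro) fact
  interpret N: plain_module R N by (rule plain_module.intro) fact
  have "f (\<zero>\<^bsub>R\<^esub> \<odot>\<^bsub>M\<^esub> \<zero>\<^bsub>M\<^esub>) = \<zero>\<^bsub>R\<^esub> \<odot>\<^bsub>N\<^esub> f \<zero>\<^bsub>M\<^esub>"
    by (rule lin_smult[OF assms(3)]) auto
  then show ?thesis using lin_closed[OF assms(3)] by simp
qed

lemma lin_neg:
  assumes "module R M" "module R N" "lin R M N f" "x \<in> carrier M"
  shows "f (\<ominus>\<^bsub>M\<^esub> x) = \<ominus>\<^bsub>N\<^esub> f x"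
proof -
  interpret M: plain_module R M by (rule plain_module.intro) fact
  interpret N: plain_module R N by (rule plain_module.intro) fact
  have "f (\<ominus>\<^bsub>M\<^esub> x \<oplus>\<^bsub>M\<^esub> x) = f (\<ominus>\<^bsub>M\<^esub> x) \<oplus>\<^bsub>N\<^esub> f x"
    using assms(4) by (intro lin_add[OF assms(3)]) simp_all
  then have "f (\<ominus>\<^bsub>M\<^esub> x) \<oplus>\<^bsub>N\<^esub> f x = \<zero>\<^bsub>N\<^esub>"
    using assms(4) lin_zero[OF assms(1-3)] by (simp add: M.l_neg)
  then show ?thesis
    using assms(4) N.minus_equality lin_closed[OF assms(3)] M.a_inv_closed by metis
qed

lemma lin_minus:
  assumes "module R M" "module R N" "lin R M N f" "x \<in> carrier M" "y \<in> carrier M"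
  shows "f (x \<ominus>\<^bsub>M\<^esub> y) = f x \<ominus>\<^bsub>N\<^esub> f y"
proof -
  interpret M: plain_module R M by (rule plain_module.intro) fact
  interpret N: plain_module R N by (rule plain_module.intro) fact
  show ?thesis
    using assms(4,5) lin_add[OF assms(3), of x "\<ominus>\<^bsub>M\<^esub> y"] lin_neg[OF assms(1-3), of y]
    by (simp add: a_minus_def)
qed

lemma lin_comp: "lin R M N f \<Longrightarrow> lin R N P g \<Longrightarrow> lin R M P (\<lambda>x. g (f x))"
  by (auto simp: lin_def Pi_iff)

lemma (in plain_module) lin_scale: "c \<in> carrier R \<Longrightarrow> lin R M M (\<lambda>x. c \<odot>\<^bsub>M\<^esub> x)"
  by (rule linI) (simp_all add: smult_r_distr smult_commute)

lemma lin_restrict_dom: "lin R M N f \<Longrightarrow> B \<subseteq> carrier M \<Longrightarrow> lin R (M\<lparr>carrier := B\<rparr>) N f"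
  by (auto simp: lin_def Pi_iff subset_iff)

lemma submodule_lin_image:
  assumes M: "module R M" and N: "module R N" and f: "lin R M N f" and A: "submodule A R M"
  shows "submodule (f ` A) R N"
proof -
  interpret M: plain_module R M by (rule plain_module.intro) fact
  interpret N: plain_module R N by (rule plain_module.intro) fact
  note Am = M.submodule_mem[OF A]
  show ?thesis
  proof (rule N.submodule_criterion)
    show "f ` A \<subseteq> carrier N" using Am lin_closed[OF f] by auto
    show "\<zero>\<^bsub>N\<^esub> \<in> f ` A" using lin_zero[OF M N f] M.submodule_zero[OF A] by force
    show "x \<oplus>\<^bsub>N\<^esub> y \<in> f ` A" if "x \<in> f ` A" "y \<in> f ` A" for x y
    proof -
      from that obtain u v where "u \<in> A" "v \<in> A" "x = f u" "y = f v" by auto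
      then show ?thesis using lin_add[OF f, of u v] M.submodule_add[OF A, of u v] Am
        by (intro image_eqI[of _ _ "u \<oplus>\<^bsub>M\<^esub> v"]) simp_all
    qed
    show "r \<odot>\<^bsub>N\<^esub> x \<in> f ` A" if "r \<in> carrier R" "x \<in> f ` A" for r x
    proof -
      from that obtain u where "u \<in> A" "x = f u" by auto
      then show ?thesis using that(1) lin_smult[OF f, of r u] M.submodule_smult[OF A, of r u] Am
        by (intro image_eqI[of _ _ "r \<odot>\<^bsub>M\<^esub> u"]) simp_all
    qed
  qed
qed

lemma submodule_lin_vimage:
  assumes M: "module R M" and N: "module R N" and f: "lin R M N f"
    and A: "submodule A R M" and B: "submodule B R N"
  shows "submodule {x \<in> A. f x \<in> B} R M"
proof -
  interpret M: plain_module R M by (rule plain_module.intro) fact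
  interpret N: plain_module R N by (rule plain_module.intro) fact
  note Am = M.submodule_mem[OF A]
  show ?thesis
  proof (rule M.submodule_criterion)
    show "{x \<in> A. f x \<in> B} \<subseteq> carrier M" using Am by blast
    show "\<zero>\<^bsub>M\<^esub> \<in> {x \<in> A. f x \<in> B}"
      using M.submodule_zero[OF A] N.submodule_zero[OF B] lin_zero[OF M N f] by simp
    show "x \<oplus>\<^bsub>M\<^esub> y \<in> {x \<in> A. f x \<in> B}" if "x \<in> {x \<in> A. f x \<in> B}" "y \<in> {x \<in> A. f x \<in> B}" for x y
      using that Am lin_add[OF f, of x y] M.submodule_add[OF A] N.submodule_add[OF B] by simp
    show "r \<odot>\<^bsub>M\<^esub> x \<in> {x \<in> A. f x \<in> B}" if "r \<in> carrier R" "x \<in> {x \<in> A. f x \<in> B}" for r x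
      using that Am lin_smult[OF f, of r x] M.submodule_smult[OF A] N.submodule_smult[OF B] by simp
  qed
qed

lemma (in plain_module) submodule_scale: "submodule A R M \<Longrightarrow> c \<in> carrier R \<Longrightarrow> submodule ((\<lambda>x. c \<odot>\<^bsub>M\<^esub> x) ` A) R M"
  using submodule_lin_image[OF module_axioms module_axioms lin_scale] by blast

section \<open>Length of intervals of submodules\<close>

lemma plain_moduleI: "module R M \<Longrightarrow> plain_module R M"
  by (rule plain_module.intro)

lemma chain_sup_upper:
  assumes "\<And>i. i \<le> n \<Longrightarrow> P (c i)" "\<And>i. i < n \<Longrightarrow> c i \<subset> c (Suc i)"
  shows "enat n \<le> chain_sup P"
  unfolding chain_sup_def by (rule SUP_upper) (use assms in blast)

lemma chain_sup_least:
  assumes "\<And>n c. (\<And>i. i \<le> n \<Longrightarrow> P (c i)) \<Longrightarrow> (\<And>i. i < n \<Longrightarrow> c i \<subset> c (Suc i)) \<Longrightarrow> enat n \<le> L"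
  shows "chain_sup P \<le> L"
  unfolding chain_sup_def
proof (rule SUP_least)
  fix n assume "n \<in> {n. \<exists>c. (\<forall>i\<le>n. P (c i)) \<and> (\<forall>i<n. c i \<subset> c (Suc i))}"
  then obtain c where "\<forall>i\<le>n. P (c i)" "\<forall>i<n. c i \<subset> c (Suc i)" by blast
  then show "enat n \<le> L" by (intro assms[of n c]) auto
qed

lemma chain_sup_transfer:
  assumes P: "\<And>U. P U \<Longrightarrow> Q (F U)" and strict: "\<And>U Y. P U \<Longrightarrow> P Y \<Longrightarrow> U \<subset> Y \<Longrightarrow> F U \<subset> F Y"
  shows "chain_sup P \<le> chain_sup Q"
proof (rule chain_sup_least)
  fix n c assume c: "\<And>i. i \<le> n \<Longrightarrow> P (c i)" "\<And>i. i < n \<Longrightarrow> c i \<subset> c (Suc i)"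
  show "enat n \<le> chain_sup Q"
  proof (rule chain_sup_upper[of n Q "\<lambda>i. F (c i)"])
    show "Q (F (c i))" if "i \<le> n" for i using P c that by blast
    show "F (c i) \<subset> F (c (Suc i))" if "i < n" for i
      using strict[of "c i" "c (Suc i)"] c that by (simp add: Suc_leI)
  qed
qed

text \<open>The length of \<open>B\<close>/\<open>A\<close>, measured by chains of submodules of
  \<open>M\<close> between \<open>A\<close> and \<open>B\<close>. Lengths of actual quotient modules
  occur only where the given definitions produce them, and
  \<open>module_length_quot_restrict\<close> removes them there.\<close>

definition ilen :: "('a, 'r) ring_scheme \<Rightarrow> ('a, 'b) module \<Rightarrow> 'b set \<Rightarrow> 'b set \<Rightarrow> enat" where
  "ilen R M A B = chain_sup (\<lambda>N. submodule N R M \<and> A \<subseteq> N \<and> N \<subseteq> B)"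

lemma ilen_mono: "A' \<subseteq> A \<Longrightarrow> B \<subseteq> B' \<Longrightarrow> ilen R M A B \<le> ilen R M A' B'"
  unfolding ilen_def by (rule chain_sup_transfer[where F = "\<lambda>U. U"]) auto

text \<open>A chain that ends inside \<open>U\<close> is prolonged by \<open>Y\<close>. The bound
  has content only when the right-hand side is a finite number \<open>s\<close>, and then chains up
  to \<open>U\<close> have length at most \<open>s - 1\<close>.\<close>

lemma ilen_strict:
  assumes U: "submodule U R M" and Y: "submodule Y R M" and "A \<subseteq> U" "U \<subset> Y"
  shows "ilen R M A U + 1 \<le> ilen R M A Y"
proof (cases "ilen R M A Y")
  case (enat s)
  have step: "n + 1 \<le> s" if c: "\<And>i. i \<le> n \<Longrightarrow> submodule (c i) R M \<and> A \<subseteq> c i \<and> c i \<subseteq> U"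
    "\<And>i. i < n \<Longrightarrow> c i \<subset> c (Suc i)" for n c
  proof -
    have "enat (Suc n) \<le> ilen R M A Y"
      unfolding ilen_def
    proof (rule chain_sup_upper[where c = "\<lambda>i. if i \<le> n then c i else Y"])
      fix i show "i \<le> Suc n \<Longrightarrow> submodule (if i \<le> n then c i else Y) R M
        \<and> A \<subseteq> (if i \<le> n then c i else Y) \<and> (if i \<le> n then c i else Y) \<subseteq> Y"
        using c(1)[of i] assms by auto
      show "i < Suc n \<Longrightarrow> (if i \<le> n then c i else Y) \<subset> (if Suc i \<le> n then c (Suc i) else Y)"
        using c(2)[of i] c(1)[of i] assms by (cases "i = n") auto
    qed
    then show ?thesis using enat by simp
  qed
  have s: "1 \<le> s" using step[of 0 "\<lambda>_. U"] assms by simp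
  have "ilen R M A U \<le> enat (s - 1)"
    unfolding ilen_def
  proof (rule chain_sup_least)
    fix n c assume c: "\<And>i. i \<le> n \<Longrightarrow> submodule (c i) R M \<and> A \<subseteq> c i \<and> c i \<subseteq> U" "\<And>i. i < n \<Longrightarrow> c i \<subset> c (Suc i)"
    have "n + 1 \<le> s" by (rule step[of n c]) (use c in blast)+
    then show "enat n \<le> enat (s - 1)" by simp
  qed
  then have "ilen R M A U + 1 \<le> enat (s - 1) + 1" by (rule add_right_mono)
  also have "\<dots> = enat s" using s by (simp add: one_enat_def)
  finally show ?thesis using enat by simp
qed simp

lemma ilen_self: "ilen R M A A = 0"
proof -
  have "ilen R M A A \<le> 0" unfolding ilen_def
  proof (rule chain_sup_least)
    fix n c assume c: "\<And>i. i \<le> n \<Longrightarrow> submodule (c i) R M \<and> A \<subseteq> c i \<and> c i \<subseteq> A" "\<And>i. i < n \<Longrightarrow> c i \<subset> c (Suc i)"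
    show "enat n \<le> 0"
    proof (cases n)
      case (Suc m)
      then show ?thesis using c(1)[of 0] c(1)[of 1] c(2)[of 0] by auto
    qed (simp add: zero_enat_def)
  qed
  then show ?thesis by simp
qed

lemma ilen_zero_eq:
  assumes "submodule A R M" "submodule B R M" "A \<subseteq> B" "ilen R M A B = 0"
  shows "A = B"
  using ilen_strict[of A R M B A] assms by (auto simp: ilen_self)

context plain_module
begin

text \<open>Chains are not concatenated: along a chain from \<open>B\<close> to \<open>C\<close> the
  length over \<open>A\<close> is at least that of \<open>B\<close> at the start and, by
  \<open>ilen_strict\<close>, grows by at least one at each step.\<close>

lemma ilen_add_lower:
  assumes A: "submodule A R M" and B: "submodule B R M" and C: "submodule C R M" and "A \<subseteq> B" "B \<subseteq> C"
  shows "ilen R M A B + ilen R M B C \<le> ilen R M A C"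
proof (cases "ilen R M A C")
  case (enat s)
  have le: "ilen R M A B \<le> enat s" using ilen_mono[of A A B C R M] assms enat by simp
  then obtain k where k: "ilen R M A B = enat k" "k \<le> s" by (metis enat_ile enat_ord_simps(1))
  have "ilen R M B C \<le> enat (s - k)"
    unfolding ilen_def
  proof (rule chain_sup_least)
    fix n c assume c: "\<And>i. i \<le> n \<Longrightarrow> submodule (c i) R M \<and> B \<subseteq> c i \<and> c i \<subseteq> C" "\<And>i. i < n \<Longrightarrow> c i \<subset> c (Suc i)"
    have "i \<le> n \<Longrightarrow> enat (k + i) \<le> ilen R M A (c i)" for i
    proof (induction i)
      case 0
      then show ?case using c(1)[of 0] k(1) ilen_mono[of A A B "c 0" R M] by simp
    next
      case (Suc i)
      then have "ilen R M A (c i) + 1 \<le> ilen R M A (c (Suc i))"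
        using c(1)[of i] c(1)[of "Suc i"] c(2)[of i] assms by (intro ilen_strict) auto
      moreover have "enat (k + i) + 1 \<le> ilen R M A (c i) + 1"
        using Suc by (intro add_right_mono) auto
      ultimately have "enat (k + i) + 1 \<le> ilen R M A (c (Suc i))" by (rule order_trans[rotated])
      then show ?case by (simp add: one_enat_def)
    qed
    from this[of n] have "enat (k + n) \<le> ilen R M A (c n)" by simp
    also have "\<dots> \<le> ilen R M A C" using c(1)[of n] by (intro ilen_mono) auto
    finally show "enat n \<le> enat (s - k)" using enat by simp
  qed
  then have "enat k + ilen R M B C \<le> enat k + enat (s - k)" by (rule add_left_mono)
  then show ?thesis using k enat by simp
qed simp

text \<open>Modular law. If the sums with \<open>B\<close> agree, an element of \<open>Y\<close> is
  x + b with x in \<open>U\<close> and b in \<open>B\<close>; then b lies in \<open>Y\<close> and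
  \<open>B\<close>, hence in \<open>U\<close> if the intersections agree too.\<close>

lemma modular_strict:
  assumes U: "submodule U R M" and Y: "submodule Y R M" and B: "submodule B R M" and "U \<subset> Y"
  shows "U \<inter> B \<subset> Y \<inter> B \<or> U <+>\<^bsub>M\<^esub> B \<subset> Y <+>\<^bsub>M\<^esub> B"
proof (rule ccontr)
  assume "\<not> ?thesis"
  then have 1: "U \<inter> B = Y \<inter> B" and 2: "U <+>\<^bsub>M\<^esub> B = Y <+>\<^bsub>M\<^esub> B"
    using \<open>U \<subset> Y\<close> set_add_mono[of U Y B B] by auto
  have "Y \<subseteq> U"
  proof
    fix y assume y: "y \<in> Y"
    then have "y \<in> U <+>\<^bsub>M\<^esub> B" using 2 set_add_upper1[OF Y B] by auto
    then obtain x b where *: "x \<in> U" "b \<in> B" "y = x \<oplus>\<^bsub>M\<^esub> b" by (auto simp: mem_set_add)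
    then have "b \<in> Y" using y \<open>U \<subset> Y\<close> submodule_add_cancel_left[OF Y, of b x] submodule_mem[OF B] by auto
    then have "b \<in> U" using 1 * by auto
    then show "y \<in> U" using * submodule_add[OF U] by simp
  qed
  then show False using \<open>U \<subset> Y\<close> by auto
qed

text \<open>Each member of a chain is replaced by its intersection and its sum with
  \<open>B\<close>. By \<open>modular_strict\<close> one of the two grows at each step, so the
  lengths that they cut out below and above \<open>B\<close> add up to at least the index of the
  member.\<close>

lemma ilen_add_upper:
  assumes A: "submodule A R M" and B: "submodule B R M" and C: "submodule C R M" and "A \<subseteq> B" "B \<subseteq> C"
  shows "ilen R M A C \<le> ilen R M A B + ilen R M B C"
  unfolding ilen_def[of R M A C]
proof (rule chain_sup_least)
  fix n c assume c: "\<And>i. i \<le> n \<Longrightarrow> submodule (c i) R M \<and> A \<subseteq> c i \<and> c i \<subseteq> C" "\<And>i. i < n \<Longrightarrow> c i \<subset> c (Suc i)"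
  let ?r = "\<lambda>N. ilen R M A (N \<inter> B) + ilen R M B (N <+>\<^bsub>M\<^esub> B)"
  have "i \<le> n \<Longrightarrow> enat i \<le> ?r (c i)" for i
  proof (induction i)
    case (Suc i)
    let ?U = "c i" and ?Y = "c (Suc i)"
    have U: "submodule ?U R M" "A \<subseteq> ?U" and Y: "submodule ?Y R M" "A \<subseteq> ?Y" and XY: "?U \<subset> ?Y"
      using c(1)[of i] c(1)[of "Suc i"] c(2)[of i] Suc.prems by auto
    note sm = submodule_inter[OF U(1) B] submodule_inter[OF Y(1) B]
      submodule_set_add[OF U(1) B] submodule_set_add[OF Y(1) B]
    have m1: "ilen R M A (?U \<inter> B) \<le> ilen R M A (?Y \<inter> B)" using XY by (intro ilen_mono) auto
    have m2: "ilen R M B (?U <+>\<^bsub>M\<^esub> B) \<le> ilen R M B (?Y <+>\<^bsub>M\<^esub> B)"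
      using XY by (intro ilen_mono set_add_mono) auto
    have "?r ?U + 1 \<le> ?r ?Y"
      using modular_strict[OF U(1) Y(1) B XY]
    proof
      assume "?U \<inter> B \<subset> ?Y \<inter> B"
      then have "ilen R M A (?U \<inter> B) + 1 \<le> ilen R M A (?Y \<inter> B)"
        using U Y \<open>A \<subseteq> B\<close> by (intro ilen_strict sm) auto
      from add_mono[OF this m2] show ?thesis by (simp add: ac_simps)
    next
      assume "?U <+>\<^bsub>M\<^esub> B \<subset> ?Y <+>\<^bsub>M\<^esub> B"
      then have "ilen R M B (?U <+>\<^bsub>M\<^esub> B) + 1 \<le> ilen R M B (?Y <+>\<^bsub>M\<^esub> B)"
        using set_add_upper2[OF U(1) B] by (intro ilen_strict sm) auto
      from add_mono[OF m1 this] show ?thesis by (simp add: ac_simps)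
    qed
    moreover have "enat i + 1 \<le> ?r ?U + 1" using Suc by (intro add_right_mono) auto
    ultimately have "enat i + 1 \<le> ?r ?Y" by (rule order_trans[rotated])
    then show ?case by (simp add: one_enat_def)
  qed (simp flip: zero_enat_def)
  from this[of n] have "enat n \<le> ?r (c n)" by simp
  also have "\<dots> \<le> ilen R M A B + ilen R M B C"
    using c(1)[of n] set_add_least[OF C, of "c n" B] \<open>B \<subseteq> C\<close> by (intro add_mono ilen_mono) auto
  finally show "enat n \<le> ilen R M A B + ilen R M B C" .
qed

lemma ilen_add:
  assumes "submodule A R M" "submodule B R M" "submodule C R M" "A \<subseteq> B" "B \<subseteq> C"
  shows "ilen R M A C = ilen R M A B + ilen R M B C"
  using ilen_add_lower[OF assms] ilen_add_upper[OF assms] by (rule antisym[rotated])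

end

text \<open>The elements of \<open>B\<close> that \<open>h\<close> carries into \<open>A'\<close>
  lie in \<open>A\<close>, so \<open>B\<close>/\<open>A\<close> is a quotient of a module that
  embeds in \<open>B'\<close>/\<open>A'\<close>. Chains are transported by taking images and adding
  \<open>A'\<close>.\<close>

lemma ilen_lin_le:
  assumes M: "module R M" and N: "module R N" and h: "lin R M N h"
    and A: "submodule A R M" and B: "submodule B R M"
    and A': "submodule A' R N" and B': "submodule B' R N" and AB': "A' \<subseteq> B'"
    and hB: "\<And>x. x \<in> B \<Longrightarrow> h x \<in> B'" and hA: "\<And>x. x \<in> B \<Longrightarrow> h x \<in> A' \<Longrightarrow> x \<in> A"
  shows "ilen R M A B \<le> ilen R N A' B'"
proof -
  interpret M: plain_module R M by (rule plain_moduleI) fact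
  interpret N: plain_module R N by (rule plain_moduleI) fact
  let ?F = "\<lambda>U. h ` U <+>\<^bsub>N\<^esub> A'"
  show ?thesis
    unfolding ilen_def
  proof (rule chain_sup_transfer[where F = ?F])
    fix U assume U: "submodule U R M \<and> A \<subseteq> U \<and> U \<subseteq> B"
    then have hX: "submodule (h ` U) R N" using submodule_lin_image[OF M N h] by blast
    show "submodule (?F U) R N \<and> A' \<subseteq> ?F U \<and> ?F U \<subseteq> B'"
      using N.submodule_set_add[OF hX A'] N.set_add_upper2[OF hX A']
        N.set_add_least[OF B' _ AB', of "h ` U"] U hB by blast
  next
    fix U Y assume U: "submodule U R M \<and> A \<subseteq> U \<and> U \<subseteq> B" and Y: "submodule Y R M \<and> A \<subseteq> Y \<and> Y \<subseteq> B"
      and XY: "U \<subset> Y"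
    have hY: "submodule (h ` Y) R N" using Y submodule_lin_image[OF M N h] by blast
    have sub: "?F U \<subseteq> ?F Y" using XY by (intro N.set_add_mono) auto
    obtain y where y: "y \<in> Y" "y \<notin> U" using XY by auto
    have "h y \<in> ?F Y" using y N.set_add_upper1[OF hY A'] by auto
    moreover have "h y \<notin> ?F U"
    proof
      assume "h y \<in> ?F U"
      then obtain x a where *: "x \<in> U" "a \<in> A'" "h y = h x \<oplus>\<^bsub>N\<^esub> a" by (auto simp: N.mem_set_add)
      have xy: "x \<in> carrier M" "y \<in> carrier M" "x \<in> B" "y \<in> B" using * y U Y M.submodule_mem by auto
      have "h (y \<ominus>\<^bsub>M\<^esub> x) = a"
        using xy * N.submodule_mem[OF A'] lin_closed[OF h]
        by (simp add: lin_minus[OF M N h] N.add_minus_cancel_left)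
      then have "y \<ominus>\<^bsub>M\<^esub> x \<in> A" using hA[of "y \<ominus>\<^bsub>M\<^esub> x"] * M.submodule_minus[OF B] xy by simp
      then have "y \<ominus>\<^bsub>M\<^esub> x \<in> U" using U by auto
      then show False using M.submodule_minus_cancel[of U y x] U * xy y by auto
    qed
    ultimately show "?F U \<subset> ?F Y" using sub by auto
  qed
qed

text \<open>Every class of \<open>B'\<close> modulo \<open>A'\<close> is represented by the image of
  an element of \<open>B\<close>, and \<open>A\<close> goes into \<open>A'\<close>; taking preimages
  in \<open>B\<close> therefore keeps a chain strict.\<close>

lemma ilen_lin_ge:
  assumes M: "module R M" and N: "module R N" and h: "lin R M N h"
    and A: "submodule A R M" and B: "submodule B R M" and AB: "A \<subseteq> B"
    and A': "submodule A' R N" and B': "submodule B' R N"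
    and hA: "\<And>x. x \<in> A \<Longrightarrow> h x \<in> A'"
    and hB: "\<And>y. y \<in> B' \<Longrightarrow> \<exists>x\<in>B. \<exists>z\<in>A'. y = h x \<oplus>\<^bsub>N\<^esub> z"
  shows "ilen R N A' B' \<le> ilen R M A B"
proof -
  interpret M: plain_module R M by (rule plain_moduleI) fact
  interpret N: plain_module R N by (rule plain_moduleI) fact
  let ?F = "\<lambda>U. {x \<in> B. h x \<in> U}"
  show ?thesis
    unfolding ilen_def
  proof (rule chain_sup_transfer[where F = ?F])
    fix U assume U: "submodule U R N \<and> A' \<subseteq> U \<and> U \<subseteq> B'"
    then show "submodule (?F U) R M \<and> A \<subseteq> ?F U \<and> ?F U \<subseteq> B"
      using submodule_lin_vimage[OF M N h B, of U] AB hA by blast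
  next
    fix U Y assume U: "submodule U R N \<and> A' \<subseteq> U \<and> U \<subseteq> B'" and Y: "submodule Y R N \<and> A' \<subseteq> Y \<and> Y \<subseteq> B'"
      and XY: "U \<subset> Y"
    obtain y where y: "y \<in> Y" "y \<notin> U" using XY by auto
    then obtain x z where *: "x \<in> B" "z \<in> A'" "y = h x \<oplus>\<^bsub>N\<^esub> z" using hB Y by blast
    have c: "h x \<in> carrier N" using * M.submodule_mem[OF B] lin_closed[OF h] by auto
    have "h x \<in> Y" using N.submodule_add_cancel[of Y "h x" z] * y Y c by auto
    moreover have "h x \<notin> U" using N.submodule_add[of U "h x" z] * y U by auto
    ultimately show "?F U \<subset> ?F Y" using XY * by blast
  qed
qed

lemma ilen_image:
  assumes M: "module R M" and N: "module R N" and h: "lin R M N h"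
    and A: "submodule A R M" and B: "submodule B R M" and AB: "A \<subseteq> B"
    and inj: "\<And>x. x \<in> B \<Longrightarrow> h x = \<zero>\<^bsub>N\<^esub> \<Longrightarrow> x = \<zero>\<^bsub>M\<^esub>"
  shows "ilen R N (h ` A) (h ` B) = ilen R M A B"
proof (rule antisym)
  interpret M: plain_module R M by (rule plain_moduleI[OF M])
  interpret N: plain_module R N by (rule plain_moduleI[OF N])
  note hA = submodule_lin_image[OF M N h A] and hB = submodule_lin_image[OF M N h B]
  show "ilen R N (h ` A) (h ` B) \<le> ilen R M A B"
  proof (rule ilen_lin_ge[OF M N h A B AB hA hB])
    fix y assume "y \<in> h ` B"
    then obtain x where x: "x \<in> B" "y = h x" by blast
    have "y = h x \<oplus>\<^bsub>N\<^esub> \<zero>\<^bsub>N\<^esub>" using x N.submodule_mem[OF hB] by simp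
    then show "\<exists>x\<in>B. \<exists>z\<in>h ` A. y = h x \<oplus>\<^bsub>N\<^esub> z" using x N.submodule_zero[OF hA] by blast
  qed blast
  show "ilen R M A B \<le> ilen R N (h ` A) (h ` B)"
  proof (rule ilen_lin_le[OF M N h A B hA hB image_mono[OF AB]])
    fix x assume x: "x \<in> B" "h x \<in> h ` A"
    then obtain y where y: "y \<in> A" "h x = h y" by blast
    have c: "x \<in> carrier M" "y \<in> carrier M" using x y M.submodule_mem A B by auto
    have "h (x \<ominus>\<^bsub>M\<^esub> y) = \<zero>\<^bsub>N\<^esub>"
      using lin_minus[OF M N h c] y N.minus_eq_zero_iff lin_closed[OF h] c by simp
    moreover have "x \<ominus>\<^bsub>M\<^esub> y \<in> B" using M.submodule_minus[OF B x(1)] y AB by blast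
    ultimately have "x = y" using inj M.minus_eq_zero_iff[OF c] by blast
    then show "x \<in> A" using y by simp
  qed blast
qed

section \<open>Noetherian modules\<close>

text \<open>The chain condition in its maximality form, because most finiteness arguments below
  choose a maximal counterexample or a maximal partial solution.\<close>

definition noeth :: "('a, 'r) ring_scheme \<Rightarrow> ('a, 'b) module \<Rightarrow> bool" where
  "noeth R M \<longleftrightarrow> module R M \<and>
     (\<forall>F. F \<noteq> {} \<and> (\<forall>N\<in>F. submodule N R M) \<longrightarrow> (\<exists>N\<in>F. \<forall>N'\<in>F. N \<subseteq> N' \<longrightarrow> N' = N))"

lemma noeth_module: "noeth R M \<Longrightarrow> module R M"
  by (simp add: noeth_def)

lemma noeth_maximal:
  assumes "noeth R M" "submodule N R M" "Q N"
  obtains N where "submodule N R M" "Q N" "\<And>N'. submodule N' R M \<Longrightarrow> Q N' \<Longrightarrow> N \<subseteq> N' \<Longrightarrow> N' = N"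
proof -
  let ?F = "{N. submodule N R M \<and> Q N}"
  have "?F \<noteq> {}" "\<forall>N\<in>?F. submodule N R M" using assms by auto
  then have "\<exists>N\<in>?F. \<forall>N'\<in>?F. N \<subseteq> N' \<longrightarrow> N' = N" using assms(1) unfolding noeth_def by presburger
  then show ?thesis using that by blast
qed

lemma noeth_chain:
  assumes "noeth R M" "\<And>n :: nat. submodule (F n) R M" "\<And>n. F n \<subseteq> F (Suc n)"
  obtains k where "\<And>n. F n \<subseteq> F k"
proof -
  obtain N where N: "N \<in> range F" and max: "\<And>N'. N' \<in> range F \<Longrightarrow> N \<subseteq> N' \<Longrightarrow> N' = N"
    using noeth_maximal[OF assms(1) assms(2), of "\<lambda>N. N \<in> range F"] assms(2) by (metis rangeE rangeI)
  then obtain k where k: "N = F k" by auto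
  have mono: "m \<le> n \<Longrightarrow> F m \<subseteq> F n" for m n using lift_Suc_mono_le[of F, OF assms(3)] by simp
  have "F n \<subseteq> F k" for n
    using max[of "F (max n k)"] mono[of n "max n k"] mono[of k "max n k"] k by auto
  then show ?thesis using that by blast
qed

lemma noeth_lin_inj:
  assumes N: "noeth R N" and M: "module R M" and h: "lin R M N h" and inj: "inj_on h (carrier M)"
  shows "noeth R M"
  unfolding noeth_def
proof (intro conjI allI impI M)
  fix F assume F: "F \<noteq> {} \<and> (\<forall>U\<in>F. submodule U R M)"
  note im = submodule_lin_image[OF M noeth_module[OF N] h]
  obtain U where U: "U \<in> F" using F by auto
  have hU: "submodule (h ` U) R N" "h ` U \<in> (`) h ` F" using im F U by auto
  obtain Y where Y: "Y \<in> (`) h ` F" "\<And>Y'. submodule Y' R N \<Longrightarrow> Y' \<in> (`) h ` F \<Longrightarrow> Y \<subseteq> Y' \<Longrightarrow> Y' = Y"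
    by (rule noeth_maximal[OF N, of "h ` U" "\<lambda>Y. Y \<in> (`) h ` F"]) (use hU in auto)
  then obtain U where U: "U \<in> F" "Y = h ` U" by auto
  show "\<exists>U\<in>F. \<forall>X'\<in>F. U \<subseteq> X' \<longrightarrow> X' = U"
  proof (intro bexI[OF _ U(1)] ballI impI)
    fix X' assume X': "X' \<in> F" "U \<subseteq> X'"
    then have "h ` X' = h ` U" using Y(2)[of "h ` X'"] U im F by blast
    moreover have "X' \<subseteq> carrier M" "U \<subseteq> carrier M"
      using F U X' plain_module.submodule_subset[OF plain_moduleI[OF M]] by auto
    ultimately show "X' = U" using inj_on_image_eq_iff[OF inj] by blast
  qed
qed

lemma noeth_lin_surj:
  assumes M: "noeth R M" and N: "module R N" and h: "lin R M N h" and surj: "carrier N \<subseteq> h ` carrier M"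
  shows "noeth R N"
  unfolding noeth_def
proof (intro conjI allI impI N)
  fix F assume F: "F \<noteq> {} \<and> (\<forall>U\<in>F. submodule U R N)"
  interpret M: plain_module R M by (rule plain_moduleI[OF noeth_module[OF M]])
  interpret N: plain_module R N by (rule plain_moduleI[OF N])
  let ?V = "\<lambda>U. {x \<in> carrier M. h x \<in> U}"
  have V: "submodule (?V U) R M" if "U \<in> F" for U
    using submodule_lin_vimage[OF noeth_module[OF M] N h M.carrier_is_submodule] that F by blast
  obtain U where U: "U \<in> F" using F by auto
  obtain Y where Y: "Y \<in> ?V ` F" "\<And>Y'. submodule Y' R M \<Longrightarrow> Y' \<in> ?V ` F \<Longrightarrow> Y \<subseteq> Y' \<Longrightarrow> Y' = Y"
    by (rule noeth_maximal[OF M V[OF U], of "\<lambda>Y. Y \<in> ?V ` F"]) (use U in auto)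
  then obtain U where U: "U \<in> F" "Y = ?V U" by auto
  show "\<exists>U\<in>F. \<forall>X'\<in>F. U \<subseteq> X' \<longrightarrow> X' = U"
  proof (intro bexI[OF _ U(1)] ballI impI)
    fix X' assume X': "X' \<in> F" "U \<subseteq> X'"
    then have eq: "?V X' = ?V U" using Y(2)[of "?V X'"] U V by blast
    have "X' \<subseteq> carrier N" using F X' N.submodule_subset by auto
    then have "X' \<subseteq> U" using surj eq by blast
    then show "X' = U" using X' by blast
  qed
qed

lemma noeth_restrict:
  assumes "noeth R M" "submodule B R M"
  shows "noeth R (M\<lparr>carrier := B\<rparr>)"
proof -
  interpret M: plain_module R M by (rule plain_moduleI[OF noeth_module[OF assms(1)]])
  have "B \<subseteq> carrier M" using M.submodule_subset assms(2) by blast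
  then have "lin R (M\<lparr>carrier := B\<rparr>) M (\<lambda>x. x)" by (auto simp: lin_def)
  then show ?thesis by (rule noeth_lin_inj[OF assms(1) M.module_restrict[OF assms(2)]]) simp
qed

text \<open>A maximal finitely generated submodule of \<open>N\<close> absorbs every further element
  of \<open>N\<close>.\<close>

lemma noeth_generators:
  assumes M: "noeth R M" and N: "submodule N R M"
  obtains S where "finite S" "S \<subseteq> N" "mspan R M S = N"
proof -
  interpret M: plain_module R M by (rule plain_moduleI[OF noeth_module[OF M]])
  have Nc: "N \<subseteq> carrier M" using M.submodule_subset[OF N] .
  obtain K where K: "\<exists>S. finite S \<and> S \<subseteq> N \<and> mspan R M S = K"
    and max: "\<And>K'. submodule K' R M \<Longrightarrow> \<exists>S. finite S \<and> S \<subseteq> N \<and> mspan R M S = K' \<Longrightarrow> K \<subseteq> K' \<Longrightarrow> K' = K"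
    by (rule noeth_maximal[OF M M.submodule_mspan[of "{}"], of "\<lambda>K. \<exists>S. finite S \<and> S \<subseteq> N \<and> mspan R M S = K"])
       auto
  then obtain S where S: "finite S" "S \<subseteq> N" "mspan R M S = K" by blast
  have "N \<subseteq> K"
  proof
    fix x assume x: "x \<in> N"
    let ?K = "mspan R M (insert x S)"
    have "?K = K"
    proof (rule max)
      show "submodule ?K R M" using S x Nc by (intro M.submodule_mspan) auto
      show "\<exists>T. finite T \<and> T \<subseteq> N \<and> mspan R M T = ?K" using S x by (intro exI[of _ "insert x S"]) auto
      show "K \<subseteq> ?K" using M.mspan_mono[of S "insert x S"] S by auto
    qed
    then show "x \<in> K" using M.mspan_superset[of "insert x S"] by auto
  qed
  moreover have "K \<subseteq> N" using M.mspan_least[OF N S(2)] S(3) by simp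
  ultimately show ?thesis using that S by blast
qed

lemma self_module_simps [simp]:
  "carrier (self_module R) = carrier R" "\<zero>\<^bsub>self_module R\<^esub> = \<zero>\<^bsub>R\<^esub>"
  "add (self_module R) = add R" "smult (self_module R) = monoid.mult R"
  by (simp_all add: self_module_def)

lemma module_self: "cring R \<Longrightarrow> module R (self_module R)"
proof -
  assume "cring R"
  then interpret cring R .
  show ?thesis
  proof (rule moduleI)
    show "abelian_group (self_module R)"
      by (rule abelian_groupI) (auto simp: a_ac intro: bexI[of _ "\<ominus>\<^bsub>R\<^esub> x" for x] l_neg)
  qed (auto simp: is_cring l_distr r_distr m_assoc)
qed

lemma submodule_self_iff:
  assumes "cring R"
  shows "submodule J R (self_module R) \<longleftrightarrow> ideal J R"
proof -
  interpret R: cring R by fact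
  interpret M: plain_module R "self_module R" by (rule plain_moduleI[OF module_self[OF assms]])
  show ?thesis
  proof
    assume J: "submodule J R (self_module R)"
    have sub: "J \<subseteq> carrier R" using M.submodule_subset[OF J] by simp
    show "ideal J R"
    proof (rule idealI[OF R.ring_axioms])
      show "subgroup J (add_monoid R)"
        using submodule.axioms(1)[OF J] unfolding self_module_def subgroup_def
        by (simp add: m_inv_def)
      show "x \<otimes>\<^bsub>R\<^esub> a \<in> J" if "a \<in> J" "x \<in> carrier R" for a x
        using M.submodule_smult[OF J that(2,1)] by simp
      then show "a \<otimes>\<^bsub>R\<^esub> x \<in> J" if "a \<in> J" "x \<in> carrier R" for a x
        using that sub R.m_comm[of a x] by auto
    qed
  next
    assume "ideal J R"
    then interpret J: ideal J R .
    show "submodule J R (self_module R)"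
      by (rule M.submodule_criterion) (auto simp: J.I_l_closed)
  qed
qed

text \<open>Zorn's lemma supplies a maximal member of the family: in a noetherian ring the union of
  a nonempty chain of ideals belongs to the chain.\<close>

lemma noeth_self:
  assumes "cring R" "noetherian_ring R"
  shows "noeth R (self_module R)"
  unfolding noeth_def
proof (intro conjI allI impI module_self assms)
  fix F assume F: "F \<noteq> {} \<and> (\<forall>U\<in>F. submodule U R (self_module R))"
  then have F': "F \<noteq> {}" "\<And>U. U \<in> F \<Longrightarrow> ideal U R" using submodule_self_iff[OF assms(1)] by auto
  have "\<exists>M\<in>F. \<forall>U\<in>F. M \<subseteq> U \<longrightarrow> U = M"
  proof (rule subset_Zorn_nonempty)
    fix C assume C: "C \<noteq> {}" "subset.chain F C"
    then have "subset.chain {I. ideal I R} C" using F'(2) unfolding subset_chain_def by (simp add: subset_iff)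
    then have "\<Union>C \<in> C" by (rule noetherian_ring.ideal_chain_is_trivial[OF assms(2) C(1)])
    moreover have "C \<subseteq> F" using C unfolding subset_chain_def by simp
    ultimately show "\<Union>C \<in> F" by (rule rev_subsetD)
  qed (rule F'(1))
  then show "\<exists>U\<in>F. \<forall>X'\<in>F. U \<subseteq> X' \<longrightarrow> X' = U" .
qed

lemma (in plain_module) submodule_colon:
  assumes N: "submodule N R M" and x: "x \<in> carrier M"
  shows "submodule {r \<in> carrier R. r \<odot>\<^bsub>M\<^esub> x \<in> N} R (self_module R)"
proof -
  have h: "lin R (self_module R) M (\<lambda>r. r \<odot>\<^bsub>M\<^esub> x)"
    by (rule linI) (use x in \<open>simp_all add: smult_l_distr smult_assoc1\<close>)
  interpret S: plain_module R "self_module R" by (rule plain_moduleI[OF module_self[OF R.is_cring]])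
  show ?thesis
    using submodule_lin_vimage[OF S.module_axioms module_axioms h S.carrier_is_submodule N] by simp
qed

text \<open>Nested submodules coincide as soon as they have the same intersection with
  \<open>A\<close> and the same ideal of scalars r for which r x lies in their sum with
  \<open>A\<close>. Both invariants live in noetherian modules, so the first is made maximal, and
  then the second among the members of \<open>F\<close> that attain the first maximum.\<close>

lemma noeth_extend:
  assumes R: "noeth R (self_module R)" and M: "module R M" and A: "submodule A R M"
    and nA: "noeth R (M\<lparr>carrier := A\<rparr>)" and x: "x \<in> carrier M"
    and gen: "\<And>y. y \<in> carrier M \<Longrightarrow> \<exists>u\<in>A. \<exists>r\<in>carrier R. y = u \<oplus>\<^bsub>M\<^esub> r \<odot>\<^bsub>M\<^esub> x"
  shows "noeth R M"
  unfolding noeth_def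
proof (intro conjI allI impI M)
  interpret M: plain_module R M by (rule plain_moduleI[OF M])
  fix F assume F: "F \<noteq> {} \<and> (\<forall>U\<in>F. submodule U R M)"
  let ?C = "\<lambda>U. {r \<in> carrier R. r \<odot>\<^bsub>M\<^esub> x \<in> U <+>\<^bsub>M\<^esub> A}"
  have C: "submodule (?C U) R (self_module R)" if "U \<in> F" for U
    using M.submodule_colon[OF M.submodule_set_add[OF _ A] x, of U] that F by blast
  have I: "submodule (U \<inter> A) R (M\<lparr>carrier := A\<rparr>)" if "U \<in> F" for U
    using M.submodule_restrict_iff[OF A] M.submodule_inter[OF _ A, of U] that F by blast
  obtain X0 where X0: "X0 \<in> F" using F by auto
  obtain A1 where A1: "\<exists>U\<in>F. A1 = U \<inter> A"
    and max1: "\<And>A2. submodule A2 R (M\<lparr>carrier := A\<rparr>) \<Longrightarrow> \<exists>U\<in>F. A2 = U \<inter> A \<Longrightarrow> A1 \<subseteq> A2 \<Longrightarrow> A2 = A1"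
    by (rule noeth_maximal[OF nA I[OF X0], of "\<lambda>A1. \<exists>U\<in>F. A1 = U \<inter> A"]) (use X0 in auto)
  obtain X1 where X1: "X1 \<in> F" "A1 = X1 \<inter> A" using A1 by blast
  obtain J where J: "\<exists>U\<in>F. U \<inter> A = A1 \<and> J = ?C U"
    and max2: "\<And>J'. submodule J' R (self_module R) \<Longrightarrow> \<exists>U\<in>F. U \<inter> A = A1 \<and> J' = ?C U \<Longrightarrow> J \<subseteq> J' \<Longrightarrow> J' = J"
    by (rule noeth_maximal[OF R C[OF X1(1)], of "\<lambda>J. \<exists>U\<in>F. U \<inter> A = A1 \<and> J = ?C U"]) (use X1 in auto)
  obtain U where U: "U \<in> F" "U \<inter> A = A1" "J = ?C U" using J by blast
  show "\<exists>U\<in>F. \<forall>X'\<in>F. U \<subseteq> X' \<longrightarrow> X' = U"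
  proof (intro bexI[OF _ U(1)] ballI impI)
    fix X' assume X': "X' \<in> F" "U \<subseteq> X'"
    have sX: "submodule U R M" and sX': "submodule X' R M" using F U X' by auto
    have eA: "X' \<inter> A = A1" using max1[OF I[OF X'(1)]] U X' by blast
    have "?C X' = J" using max2[OF C[OF X'(1)]] U X' eA M.set_add_mono[of U X' A A] by blast
    then have eJ: "?C X' = ?C U" using U by simp
    have "X' \<subseteq> U"
    proof
      fix y assume y: "y \<in> X'"
      have yc: "y \<in> carrier M" using M.submodule_mem[OF sX' y] .
      obtain u r where ur: "u \<in> A" "r \<in> carrier R" "y = u \<oplus>\<^bsub>M\<^esub> r \<odot>\<^bsub>M\<^esub> x" using gen[OF yc] by blast
      have uc: "u \<in> carrier M" using M.submodule_mem[OF A ur(1)] .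
      have "y \<in> X' <+>\<^bsub>M\<^esub> A" using y M.set_add_upper1[OF sX' A] by blast
      then have "r \<odot>\<^bsub>M\<^esub> x \<in> X' <+>\<^bsub>M\<^esub> A"
        using M.submodule_add_cancel_left[OF M.submodule_set_add[OF sX' A], of "r \<odot>\<^bsub>M\<^esub> x" u]
          ur M.set_add_upper2[OF sX' A] x by auto
      then have "r \<in> ?C U" using eJ ur by blast
      then have "r \<odot>\<^bsub>M\<^esub> x \<in> U <+>\<^bsub>M\<^esub> A" by simp
      then have "y \<in> U <+>\<^bsub>M\<^esub> A"
        using M.submodule_add[OF M.submodule_set_add[OF sX A], of u "r \<odot>\<^bsub>M\<^esub> x"] ur
          M.set_add_upper2[OF sX A] by auto
      then obtain v w where vw: "v \<in> U" "w \<in> A" "y = v \<oplus>\<^bsub>M\<^esub> w" by (auto simp: M.mem_set_add)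
      have "w \<in> X'" using M.submodule_add_cancel_left[OF sX', of w v] vw y X' M.submodule_mem[OF A] by auto
      then have "w \<in> U" using vw eA U by auto
      then show "y \<in> U" using vw M.submodule_add[OF sX] by simp
    qed
    then show "X' = U" using X' by blast
  qed
qed

lemma noeth_fg:
  assumes R: "noeth R (self_module R)" and M: "module R M" and S: "finite S" "S \<subseteq> carrier M"
    and gen: "mspan R M S = carrier M"
  shows "noeth R M"
proof -
  interpret M: plain_module R M by (rule plain_moduleI[OF M])
  have "noeth R (M\<lparr>carrier := mspan R M S\<rparr>)" using S
  proof (induction S)
    case empty
    have "mspan R M {} \<subseteq> {\<zero>\<^bsub>M\<^esub>}" by (rule M.mspan_least) (simp_all add: M.submodule_zero_set)
    then have e: "mspan R M {} = {\<zero>\<^bsub>M\<^esub>}"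
      using M.submodule_zero[OF M.submodule_mspan[of "{}"]] by auto
    interpret Z: plain_module R "M\<lparr>carrier := {\<zero>\<^bsub>M\<^esub>}\<rparr>"
      by (rule plain_moduleI[OF M.module_restrict[OF M.submodule_zero_set]])
    have *: "U = {\<zero>\<^bsub>M\<^esub>}" if "submodule U R (M\<lparr>carrier := {\<zero>\<^bsub>M\<^esub>}\<rparr>)" for U
      using Z.submodule_subset[OF that] Z.submodule_zero[OF that] by auto
    have "\<exists>U\<in>F. \<forall>X'\<in>F. U \<subseteq> X' \<longrightarrow> X' = U"
      if "F \<noteq> {} \<and> (\<forall>U\<in>F. submodule U R (M\<lparr>carrier := {\<zero>\<^bsub>M\<^esub>}\<rparr>))" for F
    proof -
      from that obtain U where U: "U \<in> F" by blast
      show ?thesis using that * U by (intro bexI[OF _ U]) metis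
    qed
    then show ?case unfolding e noeth_def using Z.module_axioms by blast
  next
    case (insert x S)
    let ?B = "mspan R M (insert x S)" and ?A = "mspan R M S"
    have c: "x \<in> carrier M" "S \<subseteq> carrier M" using insert by auto
    have B: "submodule ?B R M" using c by (intro M.submodule_mspan) auto
    have A: "submodule ?A R M" using c by (intro M.submodule_mspan)
    have AB: "?A \<subseteq> ?B" by (intro M.mspan_mono) auto
    interpret B: plain_module R "M\<lparr>carrier := ?B\<rparr>" by (rule plain_moduleI[OF M.module_restrict[OF B]])
    have xB: "x \<in> ?B" using M.mspan_superset[of "insert x S"] by auto
    let ?C = "?A <+>\<^bsub>M\<^esub> (\<lambda>r. r \<odot>\<^bsub>M\<^esub> x) ` carrier R"
    have cyc: "submodule ((\<lambda>r. r \<odot>\<^bsub>M\<^esub> x) ` carrier R) R M" using M.submodule_cyclic c by blast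
    have "?B \<subseteq> ?C"
      using M.set_add_upper1[OF A cyc] M.set_add_upper2[OF A cyc] M.mem_cyclic_self[OF c(1)]
        M.mspan_superset[of S]
      by (intro M.mspan_least M.submodule_set_add A cyc) blast
    then show ?case
      using M.submodule_restrict_iff[OF B] A AB insert xB
      by (intro noeth_extend[OF R B.module_axioms, of ?A x]) (auto simp: M.mem_set_add)
  qed
  then show ?thesis using gen by simp
qed

section \<open>Multiplication of submodules by sets of scalars\<close>

text \<open>Here \<open>W\<close> is any set of scalars, so that the operator covers an ideal as
  well as a finite generating set of it; \<open>smul_generators\<close> identifies the two
  results.\<close>

definition smul :: "('a, 'r) ring_scheme \<Rightarrow> ('a, 'b) module \<Rightarrow> 'a set \<Rightarrow> 'b set \<Rightarrow> 'b set" where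
  "smul R M W N = mspan R M {w \<odot>\<^bsub>M\<^esub> x | w x. w \<in> W \<and> x \<in> N}"

context plain_module
begin

lemma submodule_smul: "W \<subseteq> carrier R \<Longrightarrow> N \<subseteq> carrier M \<Longrightarrow> submodule (smul R M W N) R M"
  unfolding smul_def by (rule submodule_mspan) auto

lemma smul_mem: "w \<in> W \<Longrightarrow> x \<in> N \<Longrightarrow> w \<odot>\<^bsub>M\<^esub> x \<in> smul R M W N"
  unfolding smul_def using mspan_superset[of "{w \<odot>\<^bsub>M\<^esub> x | w x. w \<in> W \<and> x \<in> N}"] by blast

lemma smul_least:
  assumes "submodule P R M" "\<And>w x. w \<in> W \<Longrightarrow> x \<in> N \<Longrightarrow> w \<odot>\<^bsub>M\<^esub> x \<in> P"
  shows "smul R M W N \<subseteq> P"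
  unfolding smul_def by (rule mspan_least) (use assms in auto)

lemma smul_mono: "W \<subseteq> W' \<Longrightarrow> N \<subseteq> N' \<Longrightarrow> smul R M W N \<subseteq> smul R M W' N'"
  unfolding smul_def by (rule mspan_mono) blast

lemma smul_set_add:
  assumes W: "W \<subseteq> carrier R" and A: "submodule A R M" and B: "submodule B R M"
  shows "smul R M W (A <+>\<^bsub>M\<^esub> B) \<subseteq> smul R M W A <+>\<^bsub>M\<^esub> smul R M W B"
proof (rule smul_least)
  show "submodule (smul R M W A <+>\<^bsub>M\<^esub> smul R M W B) R M"
    using submodule_subset[OF A] submodule_subset[OF B] W by (intro submodule_set_add submodule_smul) auto
  fix w x assume w: "w \<in> W" and "x \<in> A <+>\<^bsub>M\<^esub> B"
  then obtain p q where pq: "p \<in> A" "q \<in> B" "x = p \<oplus>\<^bsub>M\<^esub> q" by (auto simp: mem_set_add)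
  have "w \<odot>\<^bsub>M\<^esub> x = w \<odot>\<^bsub>M\<^esub> p \<oplus>\<^bsub>M\<^esub> w \<odot>\<^bsub>M\<^esub> q"
    using pq w W submodule_mem[OF A] submodule_mem[OF B] by (auto simp: smult_r_distr)
  moreover have "w \<odot>\<^bsub>M\<^esub> p \<in> smul R M W A" "w \<odot>\<^bsub>M\<^esub> q \<in> smul R M W B"
    using pq w by (auto intro: smul_mem)
  ultimately show "w \<odot>\<^bsub>M\<^esub> x \<in> smul R M W A <+>\<^bsub>M\<^esub> smul R M W B"
    unfolding mem_set_add by blast
qed

end

lemma smul_image:
  assumes M: "module R M" and N: "module R N" and h: "lin R M N h" and W: "W \<subseteq> carrier R" and A: "A \<subseteq> carrier M"
  shows "smul R N W (h ` A) = h ` smul R M W A"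
proof
  interpret M: plain_module R M by (rule plain_moduleI[OF M])
  interpret N: plain_module R N by (rule plain_moduleI[OF N])
  have sA: "submodule (smul R M W A) R M" by (rule M.submodule_smul[OF W A])
  have hA: "h ` A \<subseteq> carrier N" using A lin_closed[OF h] by blast
  have hw: "h (w \<odot>\<^bsub>M\<^esub> x) = w \<odot>\<^bsub>N\<^esub> h x" if "w \<in> W" "x \<in> A" for w x
    using lin_smult[OF h, of w x] that W A by blast
  show "smul R N W (h ` A) \<subseteq> h ` smul R M W A"
  proof (rule N.smul_least[OF submodule_lin_image[OF M N h sA]])
    fix w y assume w: "w \<in> W" and "y \<in> h ` A"
    then obtain x where x: "x \<in> A" "y = h x" by blast
    show "w \<odot>\<^bsub>N\<^esub> y \<in> h ` smul R M W A"
      using hw[OF w x(1)] M.smul_mem[OF w x(1)] x(2) by (metis imageI)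
  qed
  have "smul R M W A \<subseteq> {x \<in> carrier M. h x \<in> smul R N W (h ` A)}"
  proof (rule M.smul_least[OF submodule_lin_vimage[OF M N h M.carrier_is_submodule N.submodule_smul[OF W hA]]])
    fix w x assume w: "w \<in> W" and x: "x \<in> A"
    show "w \<odot>\<^bsub>M\<^esub> x \<in> {x \<in> carrier M. h x \<in> smul R N W (h ` A)}"
      using N.smul_mem[OF w, of "h x" "h ` A"] hw[OF w x] w x W A by auto
  qed
  then show "h ` smul R M W A \<subseteq> smul R N W (h ` A)" by blast
qed

context plain_module
begin

lemma smul_scale:
  assumes W: "W \<subseteq> carrier R" and A: "submodule A R M" and c: "c \<in> carrier R"
  shows "smul R M W ((\<lambda>x. c \<odot>\<^bsub>M\<^esub> x) ` A) = (\<lambda>x. c \<odot>\<^bsub>M\<^esub> x) ` smul R M W A"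
  by (rule smul_image[OF module_axioms module_axioms lin_scale[OF c] W submodule_subset[OF A]])

text \<open>For a fixed x in \<open>N\<close> the scalars that carry x into \<open>W N\<close> form
  an ideal; it contains \<open>W\<close>, hence \<open>I\<close>.\<close>

lemma smul_generators:
  assumes W: "W \<subseteq> carrier R" and I: "mspan R (self_module R) W = I" and N: "submodule N R M"
  shows "smul R M I N = smul R M W N"
proof
  interpret S: plain_module R "self_module R" by (rule plain_moduleI[OF module_self[OF R.is_cring]])
  have Nc: "N \<subseteq> carrier M" by (rule submodule_subset[OF N])
  have s: "submodule (smul R M W N) R M" by (rule submodule_smul[OF W Nc])
  show "smul R M I N \<subseteq> smul R M W N"
  proof (rule smul_least[OF s])
    fix w x assume w: "w \<in> I" and x: "x \<in> N"
    have xc: "x \<in> carrier M" using x Nc by auto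
    have "I \<subseteq> {r \<in> carrier R. r \<odot>\<^bsub>M\<^esub> x \<in> smul R M W N}"
      unfolding I[symmetric]
    proof (rule S.mspan_least[OF submodule_colon[OF s xc]])
      show "W \<subseteq> {r \<in> carrier R. r \<odot>\<^bsub>M\<^esub> x \<in> smul R M W N}" using W x smul_mem by auto
    qed
    then show "w \<odot>\<^bsub>M\<^esub> x \<in> smul R M W N" using w by auto
  qed
  have "W \<subseteq> I" using S.mspan_superset[of W] I by simp
  then show "smul R M W N \<subseteq> smul R M I N" by (rule smul_mono) simp
qed

lemma smul_insert:
  assumes W: "insert w W \<subseteq> carrier R" and N: "submodule N R M"
  shows "smul R M (insert w W) N \<subseteq> smul R M W N <+>\<^bsub>M\<^esub> (\<lambda>x. w \<odot>\<^bsub>M\<^esub> x) ` N"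
proof -
  have 1: "submodule (smul R M W N) R M" using W submodule_subset[OF N] by (intro submodule_smul) auto
  have 2: "submodule ((\<lambda>x. w \<odot>\<^bsub>M\<^esub> x) ` N) R M" using W by (intro submodule_scale[OF N]) auto
  show ?thesis
    using set_add_upper1[OF 1 2] set_add_upper2[OF 1 2] smul_mem[of _ W _ N]
    by (intro smul_least submodule_set_add 1 2) blast
qed

section \<open>Families of submodules with a graded action\<close>

text \<open>The induction removes \<open>w\<close> from \<open>W\<close> by absorbing \<open>w Y\<close> into \<open>D\<close>.\<close>

lemma nilpotent_family_vanishes:
  assumes noe: "noeth R M" and W: "finite W" "W \<subseteq> carrier R"
    and D: "\<And>n. submodule (D n) R M" and Y: "\<And>n. submodule (Y n) R M"
    and WD: "\<And>w n x. w \<in> W \<Longrightarrow> x \<in> D n \<Longrightarrow> w \<odot>\<^bsub>M\<^esub> x \<in> D (Suc n)"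
    and WY: "\<And>w n x. w \<in> W \<Longrightarrow> x \<in> Y n \<Longrightarrow> w \<odot>\<^bsub>M\<^esub> x \<in> Y (Suc n)"
    and gen: "\<And>n. N \<le> n \<Longrightarrow> Y (Suc n) \<subseteq> smul R M W (Y n) <+>\<^bsub>M\<^esub> D (Suc n)"
    and nil: "\<And>w n x. w \<in> W \<Longrightarrow> x \<in> Y n \<Longrightarrow> \<exists>j. (w [^]\<^bsub>R\<^esub> (j::nat)) \<odot>\<^bsub>M\<^esub> x \<in> D (n + j)"
  shows "\<exists>n0\<ge>N. \<forall>n\<ge>n0. Y n \<subseteq> D n"
  using W D WD WY gen nil
proof (induction W arbitrary: D)
  case empty
  have Z: "smul R M {} (Y n) \<subseteq> {\<zero>\<^bsub>M\<^esub>}" for n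
    by (rule smul_least[OF submodule_zero_set]) auto
  have "Y (Suc n) \<subseteq> D (Suc n)" if "N \<le> n" for n
  proof -
    have "smul R M {} (Y n) <+>\<^bsub>M\<^esub> D (Suc n) \<subseteq> D (Suc n)"
      using Z[of n] submodule_zero[OF empty.prems(2)[of "Suc n"]]
      by (intro set_add_least[OF empty.prems(2)]) auto
    then show ?thesis using empty.prems(5)[OF that] by blast
  qed
  then show ?case
    by (metis Suc_le_D Suc_le_mono Suc_leD order_refl le_SucI)
next
  case (insert w W)
  note D = insert.prems(2)
  have w: "w \<in> carrier R" and Wc: "W \<subseteq> carrier R" using insert.prems(1) by auto
  have pw: "w [^]\<^bsub>R\<^esub> (j::nat) \<in> carrier R" for j using w by simp
  let ?w = "\<lambda>x. w \<odot>\<^bsub>M\<^esub> x"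
  \<comment> \<open>A term \<open>w Y k\<close> belongs to degree k + 1, hence the shift; degree 0
    has no predecessor and contributes only zero.\<close>
  define D' where "D' n = D n <+>\<^bsub>M\<^esub> (case n of 0 \<Rightarrow> {\<zero>\<^bsub>M\<^esub>} | Suc k \<Rightarrow> ?w ` Y k)" for n
  have wY: "submodule (?w ` Y k) R M" for k by (rule submodule_scale[OF Y w])
  have case_sub: "submodule (case n of 0 \<Rightarrow> {\<zero>\<^bsub>M\<^esub>} | Suc k \<Rightarrow> ?w ` Y k) R M" for n
    by (cases n) (simp_all add: submodule_zero_set wY)
  have D': "submodule (D' n) R M" for n unfolding D'_def by (rule submodule_set_add[OF D case_sub])
  have DD': "D n \<subseteq> D' n" for n unfolding D'_def by (rule set_add_upper1[OF D case_sub])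
  have "\<exists>n0\<ge>N. \<forall>n\<ge>n0. Y n \<subseteq> D' n"
  proof (rule insert.IH)
    show "v \<odot>\<^bsub>M\<^esub> x \<in> D' (Suc n)" if v: "v \<in> W" and x: "x \<in> D' n" for v n x
    proof -
      have vc: "v \<in> carrier R" using v Wc by auto
      from x obtain d y where dy: "d \<in> D n" "y \<in> (case n of 0 \<Rightarrow> {\<zero>\<^bsub>M\<^esub>} | Suc k \<Rightarrow> ?w ` Y k)" "x = d \<oplus>\<^bsub>M\<^esub> y"
        unfolding D'_def by (auto simp: mem_set_add)
      have c: "d \<in> carrier M" "y \<in> carrier M" using submodule_mem[OF D] submodule_mem[OF case_sub] dy by blast+
      have 1: "v \<odot>\<^bsub>M\<^esub> d \<in> D (Suc n)" using insert.prems(3) v dy by auto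
      have 2: "v \<odot>\<^bsub>M\<^esub> y \<in> ?w ` Y n"
      proof (cases n)
        case 0
        then show ?thesis using dy vc submodule_zero[OF wY] by simp
      next
        case (Suc k)
        then obtain z where z: "z \<in> Y k" "y = ?w z" using dy by auto
        have "v \<odot>\<^bsub>M\<^esub> z \<in> Y n" using insert.prems(4)[of v z k] v z Suc by auto
        moreover have "v \<odot>\<^bsub>M\<^esub> y = ?w (v \<odot>\<^bsub>M\<^esub> z)"
          unfolding z(2) using submodule_mem[OF Y z(1)] vc w by (intro smult_commute)
        ultimately show ?thesis by blast
      qed
      have "v \<odot>\<^bsub>M\<^esub> x = v \<odot>\<^bsub>M\<^esub> d \<oplus>\<^bsub>M\<^esub> v \<odot>\<^bsub>M\<^esub> y" using dy c vc by (simp add: smult_r_distr)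
      then show ?thesis unfolding D'_def mem_set_add using 1 2 by (intro bexI[of _ "v \<odot>\<^bsub>M\<^esub> d"] bexI[of _ "v \<odot>\<^bsub>M\<^esub> y"]) simp_all
    qed
    show "v \<odot>\<^bsub>M\<^esub> x \<in> Y (Suc n)" if "v \<in> W" "x \<in> Y n" for v n x
      using insert.prems(4) that by auto
    show "Y (Suc n) \<subseteq> smul R M W (Y n) <+>\<^bsub>M\<^esub> D' (Suc n)" if n: "N \<le> n" for n
    proof -
      have 1: "submodule (smul R M W (Y n)) R M" by (rule submodule_smul[OF Wc submodule_subset[OF Y]])
      have T: "submodule (smul R M W (Y n) <+>\<^bsub>M\<^esub> D' (Suc n)) R M" by (rule submodule_set_add[OF 1 D'])
      have "?w ` Y n \<subseteq> D' (Suc n)" unfolding D'_def using set_add_upper2[OF D wY] by simp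
      then have "smul R M W (Y n) <+>\<^bsub>M\<^esub> ?w ` Y n \<subseteq> smul R M W (Y n) <+>\<^bsub>M\<^esub> D' (Suc n)"
        by (rule set_add_mono[OF subset_refl])
      then have "smul R M (insert w W) (Y n) \<subseteq> smul R M W (Y n) <+>\<^bsub>M\<^esub> D' (Suc n)"
        using smul_insert[OF insert.prems(1) Y] by (rule subset_trans[rotated])
      moreover have "D (Suc n) \<subseteq> smul R M W (Y n) <+>\<^bsub>M\<^esub> D' (Suc n)"
        using DD' set_add_upper2[OF 1 D'] by blast
      ultimately have "smul R M (insert w W) (Y n) <+>\<^bsub>M\<^esub> D (Suc n) \<subseteq> smul R M W (Y n) <+>\<^bsub>M\<^esub> D' (Suc n)"
        by (rule set_add_least[OF T])
      then show ?thesis using insert.prems(5)[OF n] by blast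
    qed
    show "\<exists>j. (v [^]\<^bsub>R\<^esub> (j::nat)) \<odot>\<^bsub>M\<^esub> x \<in> D' (n + j)" if "v \<in> W" "x \<in> Y n" for v n x
      using insert.prems(6)[of v x n] that DD' by blast
  qed (use Wc D' in auto)
  then obtain n1 where n1: "N \<le> n1" "\<And>n. n1 \<le> n \<Longrightarrow> Y n \<subseteq> D' n" by blast
  \<comment> \<open>The part of \<open>Y n1\<close> that the j-th power of \<open>w\<close> carries
    into \<open>D\<close>. These submodules increase with j and exhaust \<open>Y n1\<close>, so by
    the chain condition one exponent \<open>k\<close> serves for all of \<open>Y n1\<close>.\<close>
  define F where "F j = {x \<in> Y n1. (w [^]\<^bsub>R\<^esub> (j::nat)) \<odot>\<^bsub>M\<^esub> x \<in> D (n1 + j)}" for j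
  have Fs: "submodule (F j) R M" for j
    unfolding F_def by (rule submodule_lin_vimage[OF module_axioms module_axioms lin_scale[OF pw] Y D])
  have Fm: "F j \<subseteq> F (Suc j)" for j
  proof
    fix x assume x: "x \<in> F j"
    then have xc: "x \<in> carrier M" using submodule_mem[OF Y] F_def by auto
    have "(w [^]\<^bsub>R\<^esub> Suc j) \<odot>\<^bsub>M\<^esub> x = w \<odot>\<^bsub>M\<^esub> ((w [^]\<^bsub>R\<^esub> j) \<odot>\<^bsub>M\<^esub> x)"
      using w pw xc by (simp add: smult_assoc1 smult_commute[of w])
    then show "x \<in> F (Suc j)" using x insert.prems(3)[of w _ "n1 + j"] unfolding F_def by auto
  qed
  obtain k where k: "\<And>j. F j \<subseteq> F k" using noeth_chain[where F = F, OF noe Fs Fm] by blast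
  have mono: "i \<le> j \<Longrightarrow> F i \<subseteq> F j" for i j using lift_Suc_mono_le[of F, OF Fm] by simp
  \<comment> \<open>The inclusion of \<open>Y\<close> in \<open>D\<close> plus \<open>w\<close>
    times the previous \<open>Y\<close> is iterated down to degree \<open>n1\<close>; the
    contribution of \<open>Y\<close> is thereby multiplied by an ever higher power of
    \<open>w\<close>.\<close>
  have step: "Y (n1 + j) \<subseteq> D (n1 + j) <+>\<^bsub>M\<^esub> (\<lambda>x. (w [^]\<^bsub>R\<^esub> j) \<odot>\<^bsub>M\<^esub> x) ` Y n1" for j
  proof (induction j)
    case 0
    have "(\<lambda>x. (w [^]\<^bsub>R\<^esub> (0::nat)) \<odot>\<^bsub>M\<^esub> x) ` Y n1 = Y n1"
      using submodule_mem[OF Y] by (auto simp: image_iff)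
    then show ?case using set_add_upper2[OF D Y] by simp
  next
    case (Suc j)
    show ?case
    proof
      fix x assume "x \<in> Y (n1 + Suc j)"
      then have "x \<in> D' (Suc (n1 + j))" using n1(2)[of "n1 + Suc j"] by auto
      then obtain d y where dy: "d \<in> D (Suc (n1 + j))" "y \<in> Y (n1 + j)" "x = d \<oplus>\<^bsub>M\<^esub> ?w y"
        unfolding D'_def by (auto simp: mem_set_add)
      then obtain e z where ez: "e \<in> D (n1 + j)" "z \<in> Y n1" "y = e \<oplus>\<^bsub>M\<^esub> (w [^]\<^bsub>R\<^esub> j) \<odot>\<^bsub>M\<^esub> z"
        using subsetD[OF Suc dy(2)] by (auto simp: mem_set_add)
      have c: "d \<in> carrier M" "e \<in> carrier M" "z \<in> carrier M"
        using dy ez submodule_mem[OF D] submodule_mem[OF Y] by blast+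
      have "x = (d \<oplus>\<^bsub>M\<^esub> ?w e) \<oplus>\<^bsub>M\<^esub> (w [^]\<^bsub>R\<^esub> Suc j) \<odot>\<^bsub>M\<^esub> z"
        using c w pw dy ez by (simp add: smult_assoc1 smult_commute[of w] smult_r_distr M.a_assoc)
      moreover have "d \<oplus>\<^bsub>M\<^esub> ?w e \<in> D (n1 + Suc j)"
        using submodule_add[OF D dy(1)] insert.prems(3)[of w e "n1 + j"] ez by simp
      ultimately show "x \<in> D (n1 + Suc j) <+>\<^bsub>M\<^esub> (\<lambda>x. (w [^]\<^bsub>R\<^esub> Suc j) \<odot>\<^bsub>M\<^esub> x) ` Y n1"
        using ez by (auto simp: mem_set_add)
    qed
  qed
  have "Y n \<subseteq> D n" if n: "n1 + k \<le> n" for n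
  proof -
    obtain j where j: "n = n1 + j" "k \<le> j" using n by (metis le_Suc_ex add_le_imp_le_left add.assoc le_add1)
    have "(w [^]\<^bsub>R\<^esub> j) \<odot>\<^bsub>M\<^esub> x \<in> D n" if x: "x \<in> Y n1" for x
    proof -
      obtain i where "(w [^]\<^bsub>R\<^esub> i) \<odot>\<^bsub>M\<^esub> x \<in> D (n1 + i)" using insert.prems(6)[of w x n1] x by auto
      then have "x \<in> F i" using x F_def by simp
      then have "x \<in> F j" using k mono[OF j(2)] by blast
      then show ?thesis using F_def j by simp
    qed
    then have "D n <+>\<^bsub>M\<^esub> (\<lambda>x. (w [^]\<^bsub>R\<^esub> j) \<odot>\<^bsub>M\<^esub> x) ` Y n1 \<subseteq> D n"
      by (intro set_add_least[OF D]) auto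
    then show ?thesis using step[of j] j by blast
  qed
  then show ?case using n1(1) by (intro exI[of _ "n1 + k"]) auto
qed

lemma bounded_mono_enat_eventually_const:
  fixes f :: "nat \<Rightarrow> enat"
  assumes mono: "\<And>n. f n \<le> f (Suc n)" and bound: "\<And>n. N \<le> n \<Longrightarrow> f n \<le> enat L"
  obtains n1 where "N \<le> n1" "\<And>n. n1 \<le> n \<Longrightarrow> f n = f n1"
proof -
  have m: "i \<le> j \<Longrightarrow> f i \<le> f j" for i j using lift_Suc_mono_le[of f, OF mono] by simp
  let ?S = "f ` {N..}"
  have fin: "finite ?S" by (rule finite_subset[OF _ finite_enat_bounded[of "f ` {N..}" L]]) (use bound in auto)
  obtain n1 where n1: "N \<le> n1" "f n1 = Max ?S" using Max_in[OF fin] by auto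
  have "f n = f n1" if "n1 \<le> n" for n
    using m[OF that] Max_ge[OF fin, of "f n"] n1 that by (intro antisym) auto
  then show ?thesis using that n1 by blast
qed

text \<open>Elements of \<open>W - V\<close> act nilpotently on \<open>Y\<close> modulo \<open>D\<close>. For \<open>w\<close> in \<open>V\<close> let \<open>K\<close> be the
  \<open>w\<close>-torsion of \<open>Y\<close> modulo \<open>D\<close>. As \<open>w\<close> is injective modulo \<open>K\<close>, the inequality for \<open>K\<close> implies the
  one for \<open>Y\<close>. Moreover the lengths of \<open>Y n\<close> modulo \<open>K n\<close> increase and are bounded, hence become
  constant; from then on \<open>Y (n + 1)\<close> is \<open>w Y n + K (n + 1)\<close>, which forces \<open>K\<close> to be generated in
  bounded degree as well, so that the induction hypothesis applies to \<open>K\<close>.\<close>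

lemma eventually_ilen_le_smul:
  assumes noe: "noeth R M" and W: "finite W" "W \<subseteq> carrier R" and V: "finite V" "V \<subseteq> W"
    and D: "\<And>n. submodule (D n) R M" and Y: "\<And>n. submodule (Y n) R M" and DY: "\<And>n. D n \<subseteq> Y n"
    and WD: "\<And>w n x. w \<in> W \<Longrightarrow> x \<in> D n \<Longrightarrow> w \<odot>\<^bsub>M\<^esub> x \<in> D (Suc n)"
    and WY: "\<And>w n x. w \<in> W \<Longrightarrow> x \<in> Y n \<Longrightarrow> w \<odot>\<^bsub>M\<^esub> x \<in> Y (Suc n)"
    and gen: "\<And>n. N \<le> n \<Longrightarrow> Y (Suc n) \<subseteq> smul R M W (Y n) <+>\<^bsub>M\<^esub> D (Suc n)"
    and bound: "\<And>n. N \<le> n \<Longrightarrow> ilen R M (D n) (Y n) \<le> enat L"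
    and nil: "\<And>w n x. w \<in> W - V \<Longrightarrow> x \<in> Y n \<Longrightarrow> \<exists>j. (w [^]\<^bsub>R\<^esub> (j::nat)) \<odot>\<^bsub>M\<^esub> x \<in> D (n + j)"
  shows "\<exists>n0. \<forall>n\<ge>n0. \<forall>P. submodule P R M \<longrightarrow> D n \<subseteq> P \<longrightarrow> P \<subseteq> Y n \<longrightarrow>
     ilen R M (D n) P \<le> ilen R M (D (Suc n)) (smul R M W P <+>\<^bsub>M\<^esub> D (Suc n))"
  using V Y DY WY gen bound nil
proof (induction V arbitrary: Y N)
  \<comment> \<open>All of \<open>W\<close> acts nilpotently, so \<open>Y n\<close> and
    \<open>D n\<close> agree for large n and only \<open>P = D n\<close> remains.\<close>
  case empty
  have "\<exists>n0\<ge>N. \<forall>n\<ge>n0. Y n \<subseteq> D n"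
    by (rule nilpotent_family_vanishes[OF noe W D]) (use empty.prems WD in auto)
  then obtain n0 where n0: "\<And>n. n0 \<le> n \<Longrightarrow> Y n \<subseteq> D n" by blast
  show ?case
  proof (intro exI[of _ n0] allI impI)
    fix n P assume "n0 \<le> n" "D n \<subseteq> P" "P \<subseteq> Y n"
    then have "P = D n" using n0 by blast
    then show "ilen R M (D n) P \<le> ilen R M (D (Suc n)) (smul R M W P <+>\<^bsub>M\<^esub> D (Suc n))"
      by (simp add: ilen_self)
  qed
next
  case (insert w V)
  note Y = insert.prems(2) and DY = insert.prems(3) and WY = insert.prems(4)
    and gen = insert.prems(5) and bound = insert.prems(6) and nil = insert.prems(7)
  have wW: "w \<in> W" using insert.prems(1) by auto
  then have w: "w \<in> carrier R" using W by auto
  have pw: "w [^]\<^bsub>R\<^esub> (j::nat) \<in> carrier R" for j using w by simp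
  have pSuc: "(w [^]\<^bsub>R\<^esub> Suc j) \<odot>\<^bsub>M\<^esub> x = w \<odot>\<^bsub>M\<^esub> ((w [^]\<^bsub>R\<^esub> j) \<odot>\<^bsub>M\<^esub> x)" if "x \<in> carrier M" for j :: nat and x
    using w pw that by (simp add: smult_assoc1 smult_commute[of w])
  have pSuc': "(w [^]\<^bsub>R\<^esub> Suc j) \<odot>\<^bsub>M\<^esub> x = (w [^]\<^bsub>R\<^esub> j) \<odot>\<^bsub>M\<^esub> (w \<odot>\<^bsub>M\<^esub> x)" if "x \<in> carrier M" for j :: nat and x
    using w that by (simp add: smult_assoc1)
  \<comment> \<open>Elements killed by the j-th power of \<open>w\<close> modulo \<open>D\<close>;
    their union over j is the torsion submodule \<open>K n\<close>.\<close>
  define F where "F n j = {x \<in> Y n. (w [^]\<^bsub>R\<^esub> (j::nat)) \<odot>\<^bsub>M\<^esub> x \<in> D (n + j)}" for n j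
  have Fs: "submodule (F n j) R M" for n j
    unfolding F_def by (rule submodule_lin_vimage[OF module_axioms module_axioms lin_scale[OF pw] Y D])
  have Fm: "F n j \<subseteq> F n (Suc j)" for n j
    using pSuc submodule_mem[OF Y] WD[OF wW, of _ "n + j"] unfolding F_def by auto
  have mono: "i \<le> j \<Longrightarrow> F n i \<subseteq> F n j" for n i j using lift_Suc_mono_le[of "F n", OF Fm] by simp
  define K where "K n = (\<Union>j. F n j)" for n
  have K: "submodule (K n) R M" for n
  proof (rule submodule_criterion)
    show "K n \<subseteq> carrier M" unfolding K_def using submodule_subset[OF Fs] by blast
    show "\<zero>\<^bsub>M\<^esub> \<in> K n" unfolding K_def using submodule_zero[OF Fs] by blast
    show "x \<oplus>\<^bsub>M\<^esub> y \<in> K n" if "x \<in> K n" "y \<in> K n" for x y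
    proof -
      obtain i j where "x \<in> F n i" "y \<in> F n j" using \<open>x \<in> K n\<close> \<open>y \<in> K n\<close> K_def by auto
      then have "x \<in> F n (max i j)" "y \<in> F n (max i j)" using mono[of i "max i j"] mono[of j "max i j"] by auto
      then show ?thesis unfolding K_def using submodule_add[OF Fs] by blast
    qed
    show "r \<odot>\<^bsub>M\<^esub> x \<in> K n" if "r \<in> carrier R" "x \<in> K n" for r x
      using that unfolding K_def using submodule_smult[OF Fs] by blast
  qed
  have KY: "K n \<subseteq> Y n" for n by (auto simp: K_def F_def)
  have DK: "D n \<subseteq> K n" for n
  proof -
    have "D n \<subseteq> F n 0" using DY[of n] submodule_mem[OF D] unfolding F_def by auto
    then show ?thesis by (auto simp: K_def)
  qed
  \<comment> \<open>This makes multiplication by \<open>w\<close> injective from \<open>Y n\<close>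
    modulo \<open>K n\<close> into \<open>Y (n + 1)\<close> modulo \<open>K (n + 1)\<close>.\<close>
  have Kw: "x \<in> K n" if x: "x \<in> Y n" "w \<odot>\<^bsub>M\<^esub> x \<in> K (Suc n)" for x n
  proof -
    obtain j where "w \<odot>\<^bsub>M\<^esub> x \<in> F (Suc n) j" using x K_def by auto
    then have "x \<in> F n (Suc j)" using x pSuc'[OF submodule_mem[OF Y x(1)]] unfolding F_def by auto
    then show ?thesis by (auto simp: K_def)
  qed
  have WK: "v \<odot>\<^bsub>M\<^esub> x \<in> K (Suc n)" if v: "v \<in> W" and x: "x \<in> K n" for v n x
  proof -
    have vc: "v \<in> carrier R" using v W by auto
    obtain j where j: "x \<in> F n j" using x K_def by auto
    have xY: "x \<in> Y n" using x KY by auto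
    have "(w [^]\<^bsub>R\<^esub> j) \<odot>\<^bsub>M\<^esub> (v \<odot>\<^bsub>M\<^esub> x) = v \<odot>\<^bsub>M\<^esub> ((w [^]\<^bsub>R\<^esub> j) \<odot>\<^bsub>M\<^esub> x)"
      by (rule smult_commute[OF pw vc submodule_mem[OF Y xY]])
    then have "v \<odot>\<^bsub>M\<^esub> x \<in> F (Suc n) j" using j WY[OF v xY] WD[OF v, of _ "n + j"] unfolding F_def by auto
    then show ?thesis by (auto simp: K_def)
  qed
  have grow: "ilen R M (K n) (Y n) \<le> ilen R M (K (Suc n)) (Y (Suc n))" for n
    by (rule ilen_lin_le[OF module_axioms module_axioms lin_scale[OF w] K Y K Y KY])
       (use WY[OF wW] Kw in auto)
  have "ilen R M (K n) (Y n) \<le> enat L" if "N \<le> n" for n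
    using ilen_mono[OF DK subset_refl] bound[OF that] by (rule order_trans)
  then obtain n1 where n1: "N \<le> n1" "\<And>n. n1 \<le> n \<Longrightarrow> ilen R M (K n) (Y n) = ilen R M (K n1) (Y n1)"
    and fin: "ilen R M (K n1) (Y n1) \<le> enat L"
    using bounded_mono_enat_eventually_const[of "\<lambda>n. ilen R M (K n) (Y n)" N L, OF grow] by metis
  let ?w = "\<lambda>x. w \<odot>\<^bsub>M\<^esub> x"
  have wY: "submodule (?w ` Y n) R M" for n by (rule submodule_scale[OF Y w])
  \<comment> \<open>The image of \<open>Y n\<close> under \<open>w\<close> already accounts for the
    whole length of \<open>Y (n + 1)\<close> over \<open>K (n + 1)\<close>, which has stopped
    growing; as this length is finite, nothing is left outside
    \<open>w Y n + K (n + 1)\<close>.\<close>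
  have split: "Y (Suc n) \<subseteq> ?w ` Y n <+>\<^bsub>M\<^esub> K (Suc n)" if n: "n1 \<le> n" for n
  proof -
    let ?Z = "?w ` Y n <+>\<^bsub>M\<^esub> K (Suc n)"
    have Z: "submodule ?Z R M" by (rule submodule_set_add[OF wY K])
    have KZ: "K (Suc n) \<subseteq> ?Z" by (rule set_add_upper2[OF wY K])
    have ZY: "?Z \<subseteq> Y (Suc n)" using WY[OF wW] KY by (intro set_add_least[OF Y]) auto
    have "ilen R M (K n) (Y n) \<le> ilen R M (K (Suc n)) ?Z"
      by (rule ilen_lin_le[OF module_axioms module_axioms lin_scale[OF w] K Y K Z KZ])
         (use Kw set_add_upper1[OF wY K] in blast)+
    moreover have "ilen R M (K (Suc n)) (Y (Suc n)) = ilen R M (K (Suc n)) ?Z + ilen R M ?Z (Y (Suc n))"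
      by (rule ilen_add[OF K Z Y KZ ZY])
    ultimately have le: "ilen R M (K n) (Y n) + ilen R M ?Z (Y (Suc n)) \<le> ilen R M (K n) (Y n)"
      using n1(2)[of n] n1(2)[of "Suc n"] n by (simp add: add_right_mono)
    have "ilen R M (K n) (Y n) \<le> enat L" using n1(2)[OF n] fin by simp
    then have "ilen R M ?Z (Y (Suc n)) = 0"
      using le by (cases "ilen R M (K n) (Y n)"; cases "ilen R M ?Z (Y (Suc n))") (auto simp: zero_enat_def)
    then show ?thesis using ilen_zero_eq[OF Z Y ZY] by simp
  qed
  \<comment> \<open>The decomposition of \<open>Y\<close> is used one degree lower, hence
    \<open>Suc n1\<close>. Modulo \<open>W K n\<close> and \<open>D (n + 1)\<close> an element of
    \<open>K (n + 1)\<close> has the form \<open>w y\<close> with y in \<open>Y n\<close>. Then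
    \<open>w y\<close> lies in \<open>K (n + 1)\<close>, so y lies in \<open>K n\<close> and
    \<open>w y\<close> in \<open>W K n\<close>.\<close>
  have genK: "K (Suc n) \<subseteq> smul R M W (K n) <+>\<^bsub>M\<^esub> D (Suc n)" if n: "Suc n1 \<le> n" for n
  proof
    obtain m where m: "n = Suc m" "n1 \<le> m" using n by (metis Suc_le_D Suc_le_mono)
    have sY: "submodule (smul R M W (Y k)) R M" and sK: "submodule (smul R M W (K k)) R M" for k
      using submodule_smul[OF W(2)] submodule_subset[OF Y] submodule_subset[OF K] by auto
    fix x assume x: "x \<in> K (Suc n)"
    then obtain p d where pd: "p \<in> smul R M W (Y n)" "d \<in> D (Suc n)" "x = p \<oplus>\<^bsub>M\<^esub> d"
      using gen[of n] KY n n1(1) by (fastforce simp: mem_set_add)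
    have "smul R M W (Y n) \<subseteq> smul R M W (?w ` Y m <+>\<^bsub>M\<^esub> K n)"
      using split[OF m(2)] m by (intro smul_mono) auto
    also have "\<dots> \<subseteq> smul R M W (?w ` Y m) <+>\<^bsub>M\<^esub> smul R M W (K n)" by (rule smul_set_add[OF W(2) wY K])
    finally have "p \<in> smul R M W (?w ` Y m) <+>\<^bsub>M\<^esub> smul R M W (K n)" using pd(1) by blast
    then obtain q k where qk: "q \<in> smul R M W (?w ` Y m)" "k \<in> smul R M W (K n)" "p = q \<oplus>\<^bsub>M\<^esub> k"
      by (auto simp: mem_set_add)
    have "smul R M W (Y m) \<subseteq> Y n" using WY m by (intro smul_least[OF Y]) auto
    then obtain y where y: "y \<in> Y n" "q = ?w y" using qk(1) smul_scale[OF W(2) Y w] by auto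
    have kK: "k \<in> K (Suc n)" using qk(2) smul_least[OF K WK] by blast
    have dK: "d \<in> K (Suc n)" using pd DK by auto
    have c: "q \<in> carrier M" "k \<in> carrier M" "d \<in> carrier M"
      using y submodule_mem[OF Y] w kK dK submodule_mem[OF K] by auto
    have "x = q \<oplus>\<^bsub>M\<^esub> (k \<oplus>\<^bsub>M\<^esub> d)" using c pd qk by (simp add: M.a_assoc)
    then have "q \<in> K (Suc n)" using submodule_add_cancel[OF K c(1) submodule_add[OF K kK dK]] x by simp
    then have "y \<in> K n" using Kw y by simp
    then have "q \<in> smul R M W (K n)" using smul_mem[OF wW] y by simp
    then show "x \<in> smul R M W (K n) <+>\<^bsub>M\<^esub> D (Suc n)"
      using pd qk submodule_add[OF sK] by (auto simp: mem_set_add)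
  qed
  have "\<exists>n0. \<forall>n\<ge>n0. \<forall>P. submodule P R M \<longrightarrow> D n \<subseteq> P \<longrightarrow> P \<subseteq> K n \<longrightarrow>
     ilen R M (D n) P \<le> ilen R M (D (Suc n)) (smul R M W P <+>\<^bsub>M\<^esub> D (Suc n))"
  proof (rule insert.IH[of K "Suc n1"])
    show "ilen R M (D n) (K n) \<le> enat L" if "Suc n1 \<le> n" for n
      using ilen_mono[OF subset_refl KY] bound[of n] that n1 by (meson Suc_leD order_trans)
    show "\<exists>j. (v [^]\<^bsub>R\<^esub> (j::nat)) \<odot>\<^bsub>M\<^esub> x \<in> D (n + j)" if "v \<in> W - V" "x \<in> K n" for v n x
    proof (cases "v = w")
      case True
      then show ?thesis using that unfolding K_def F_def by blast
    next
      case False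
      then show ?thesis using that nil[of v x n] KY by auto
    qed
  qed (use insert.prems(1) K DK WK genK in auto)
  then obtain n0 where n0: "\<And>n P. n0 \<le> n \<Longrightarrow> submodule P R M \<Longrightarrow> D n \<subseteq> P \<Longrightarrow> P \<subseteq> K n \<Longrightarrow>
     ilen R M (D n) P \<le> ilen R M (D (Suc n)) (smul R M W P <+>\<^bsub>M\<^esub> D (Suc n))" by blast
  show ?case
  proof (intro exI[of _ n0] allI impI)
    fix n P assume n: "n0 \<le> n" and P: "submodule P R M" "D n \<subseteq> P" "P \<subseteq> Y n"
    let ?P = "P \<inter> K n" and ?Q = "smul R M W P <+>\<^bsub>M\<^esub> D (Suc n)"
    let ?S = "smul R M W ?P <+>\<^bsub>M\<^esub> D (Suc n)"
    have sP: "submodule ?P R M" by (rule submodule_inter[OF P(1) K])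
    have sW: "submodule (smul R M W P) R M" "submodule (smul R M W ?P) R M"
      using submodule_smul[OF W(2)] submodule_subset[OF P(1)] submodule_subset[OF sP] by auto
    have Q: "submodule ?Q R M" by (rule submodule_set_add[OF sW(1) D])
    have QK: "submodule (?Q \<inter> K (Suc n)) R M" by (rule submodule_inter[OF Q K])
    have DQ: "D (Suc n) \<subseteq> ?Q" by (rule set_add_upper2[OF sW(1) D])
    have 1: "ilen R M (D n) ?P \<le> ilen R M (D (Suc n)) ?S"
      by (rule n0[OF n sP]) (use P DK in auto)
    have "smul R M W ?P \<subseteq> smul R M W P" by (rule smul_mono) auto
    then have "?S \<subseteq> ?Q" by (rule set_add_mono) simp
    moreover have "?S \<subseteq> K (Suc n)" using WK DK by (intro set_add_least[OF K] smul_least[OF K]) auto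
    ultimately have 2: "ilen R M (D (Suc n)) ?S \<le> ilen R M (D (Suc n)) (?Q \<inter> K (Suc n))"
      by (intro ilen_mono) auto
    \<comment> \<open>Inside \<open>K\<close> the induction hypothesis has been applied; above
      \<open>K\<close> multiplication by \<open>w\<close> alone embeds the quotient of
      \<open>P\<close> by its part in \<open>K n\<close>.\<close>
    have 3: "ilen R M ?P P \<le> ilen R M (?Q \<inter> K (Suc n)) ?Q"
      by (rule ilen_lin_le[OF module_axioms module_axioms lin_scale[OF w] sP P(1) QK Q])
         (use Kw P smul_mem[OF wW] set_add_upper1[OF sW(1) D] in blast)+
    have "ilen R M (D n) P = ilen R M (D n) ?P + ilen R M ?P P"
      by (rule ilen_add[OF D sP P(1)]) (use P DK in auto)
    also have "\<dots> \<le> ilen R M (D (Suc n)) (?Q \<inter> K (Suc n)) + ilen R M (?Q \<inter> K (Suc n)) ?Q"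
      using 1 2 3 by (intro add_mono) auto
    also have "\<dots> = ilen R M (D (Suc n)) ?Q"
      by (rule ilen_add[OF D QK Q, symmetric]) (use DQ DK in auto)
    finally show "ilen R M (D n) P \<le> ilen R M (D (Suc n)) ?Q" .
  qed
qed

end

section \<open>Lengths along the powers of an ideal\<close>

text \<open>The submodule \<open>I^n M\<close> by iterated multiplication, so that powers of ideals
  do not intervene; \<open>ideal_pow_smult_eq\<close> identifies it with the one in the definition
  of multiplicity.\<close>

definition pow_smul :: "('a, 'r) ring_scheme \<Rightarrow> ('a, 'b) module \<Rightarrow> 'a set \<Rightarrow> nat \<Rightarrow> 'b set" where
  "pow_smul R M I n = (smul R M I ^^ n) (carrier M)"

lemma pow_smul_0 [simp]: "pow_smul R M I 0 = carrier M"
  by (simp add: pow_smul_def)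

lemma pow_smul_Suc [simp]: "pow_smul R M I (Suc n) = smul R M I (pow_smul R M I n)"
  by (simp add: pow_smul_def)

context plain_module
begin

lemma submodule_pow_smul: "I \<subseteq> carrier R \<Longrightarrow> submodule (pow_smul R M I n) R M"
  by (induction n) (simp_all add: carrier_is_submodule submodule_smul submodule_subset)

lemma ilen_scale:
  assumes c: "c \<in> carrier R" and inj: "\<And>x. x \<in> carrier M \<Longrightarrow> c \<odot>\<^bsub>M\<^esub> x = \<zero>\<^bsub>M\<^esub> \<Longrightarrow> x = \<zero>\<^bsub>M\<^esub>"
    and A: "submodule A R M" and B: "submodule B R M" and AB: "A \<subseteq> B"
  shows "ilen R M ((\<lambda>x. c \<odot>\<^bsub>M\<^esub> x) ` A) ((\<lambda>x. c \<odot>\<^bsub>M\<^esub> x) ` B) = ilen R M A B"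
  by (rule ilen_image[OF module_axioms module_axioms lin_scale[OF c] A B AB])
     (use inj submodule_mem[OF B] in blast)

end

lemma enat_add_cancel_le: "a + b \<le> a + c \<Longrightarrow> a \<noteq> \<infinity> \<Longrightarrow> b \<le> (c::enat)"
  by (cases a; cases b; cases c) auto

lemma enat_le_finite: "x \<le> y \<Longrightarrow> y \<noteq> \<infinity> \<Longrightarrow> x \<noteq> (\<infinity>::enat)"
  by (cases x) auto

text \<open>Dimension one is represented by its consequence \<open>a_fin\<close>. The scalar
  \<open>a\<close> is an arbitrary nonzerodivisor on \<open>M\<close> taken from \<open>I\<close>;
  it need not generate a reduction of \<open>I\<close>.\<close>

locale regular_scalar = plain_module R M
  for R :: "('a, 'r) ring_scheme" (structure) and M :: "('a, 'b) module" (structure) +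
  fixes I :: "'a set" and a :: 'a
  assumes R_noeth: "noeth R (self_module R)" and M_noeth: "noeth R M" and I: "ideal I R" and aI: "a \<in> I"
    and a_inj: "\<And>x. x \<in> carrier M \<Longrightarrow> a \<odot>\<^bsub>M\<^esub> x = \<zero>\<^bsub>M\<^esub> \<Longrightarrow> x = \<zero>\<^bsub>M\<^esub>"
    and a_fin: "ilen R M ((\<lambda>x. a \<odot>\<^bsub>M\<^esub> x) ` carrier M) (carrier M) \<noteq> \<infinity>"
begin

abbreviation Y :: "nat \<Rightarrow> 'b set" where "Y \<equiv> pow_smul R M I"

abbreviation sc :: "'a \<Rightarrow> 'b set \<Rightarrow> 'b set" where "sc c A \<equiv> (\<lambda>x. c \<odot>\<^bsub>M\<^esub> x) ` A"

lemma Ic: "I \<subseteq> carrier R" using additive_subgroup.a_subset[OF ideal.axioms(1)[OF I]] .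

lemma ac: "a \<in> carrier R" using Ic aI by auto

lemma pac: "a [^]\<^bsub>R\<^esub> (n::nat) \<in> carrier R" using ac by simp

lemma subY: "submodule (Y n) R M" by (rule submodule_pow_smul[OF Ic])

lemma sub_smul: "submodule A R M \<Longrightarrow> submodule (smul R M I A) R M"
  using submodule_smul[OF Ic] submodule_subset by blast

lemma sub_sc: "submodule A R M \<Longrightarrow> c \<in> carrier R \<Longrightarrow> submodule (sc c A) R M"
  by (rule submodule_scale)

lemma smul_le: "submodule A R M \<Longrightarrow> smul R M I A \<subseteq> A"
  using Ic by (intro smul_least) (auto intro: submodule_smult)

lemma sc_le: "submodule A R M \<Longrightarrow> c \<in> carrier R \<Longrightarrow> sc c A \<subseteq> A"
  using submodule_smult by blast

lemma sc_smul_le: "c \<in> I \<Longrightarrow> submodule A R M \<Longrightarrow> sc c A \<subseteq> smul R M I A"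
  using smul_mem by blast

lemma pow_inj: "x \<in> carrier M \<Longrightarrow> (a [^]\<^bsub>R\<^esub> (n::nat)) \<odot>\<^bsub>M\<^esub> x = \<zero>\<^bsub>M\<^esub> \<Longrightarrow> x = \<zero>\<^bsub>M\<^esub>"
proof (induction n)
  case (Suc n)
  then have "a \<odot>\<^bsub>M\<^esub> ((a [^]\<^bsub>R\<^esub> n) \<odot>\<^bsub>M\<^esub> x) = \<zero>\<^bsub>M\<^esub>"
    using ac by (simp add: smult_assoc1 smult_commute[of a])
  then show ?case using a_inj[of "(a [^]\<^bsub>R\<^esub> n) \<odot>\<^bsub>M\<^esub> x"] Suc ac by simp
qed simp

lemma sc_Suc: "submodule A R M \<Longrightarrow> sc (a [^]\<^bsub>R\<^esub> Suc j) A = sc a (sc (a [^]\<^bsub>R\<^esub> j) A)"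
  using ac submodule_mem by (force simp: image_image smult_assoc1 smult_commute[of a])

lemma sc_Suc': "submodule A R M \<Longrightarrow> sc (a [^]\<^bsub>R\<^esub> Suc j) A = sc (a [^]\<^bsub>R\<^esub> j) (sc a A)"
  using ac submodule_mem by (force simp: image_image smult_assoc1)

lemma sc_0: "submodule A R M \<Longrightarrow> sc (a [^]\<^bsub>R\<^esub> (0::nat)) A = A"
  using submodule_mem by (force simp: image_iff)

text \<open>The successive quotients of the submodules \<open>a^j M\<close> are copies of
  \<open>M\<close>/\<open>aM\<close>.\<close>

lemma ilen_pow_finite: "ilen R M (sc (a [^]\<^bsub>R\<^esub> (j::nat)) (carrier M)) (carrier M) \<noteq> \<infinity>"
proof (induction j)
  case 0
  then show ?case by (simp add: sc_0[OF carrier_is_submodule] ilen_self del: R.nat_pow_0)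
next
  case (Suc j)
  let ?P = "sc (a [^]\<^bsub>R\<^esub> j) (carrier M)"
  have P: "submodule ?P R M" by (rule sub_sc[OF carrier_is_submodule pac])
  have aM: "submodule (sc a (carrier M)) R M" by (rule sub_sc[OF carrier_is_submodule ac])
  have "ilen R M (sc (a [^]\<^bsub>R\<^esub> Suc j) (carrier M)) ?P = ilen R M (sc a (carrier M)) (carrier M)"
    unfolding sc_Suc'[OF carrier_is_submodule]
    by (rule ilen_scale[OF pac pow_inj aM carrier_is_submodule sc_le[OF carrier_is_submodule ac]])
  moreover have "ilen R M (sc (a [^]\<^bsub>R\<^esub> Suc j) (carrier M)) (carrier M) =
      ilen R M (sc (a [^]\<^bsub>R\<^esub> Suc j) (carrier M)) ?P + ilen R M ?P (carrier M)"
  proof (rule ilen_add[OF sub_sc[OF carrier_is_submodule pac] P carrier_is_submodule])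
    show "sc (a [^]\<^bsub>R\<^esub> Suc j) (carrier M) \<subseteq> ?P"
      unfolding sc_Suc[OF carrier_is_submodule] by (rule sc_le[OF P ac])
  qed (rule submodule_subset[OF P])
  ultimately show ?case using Suc a_fin by (metis plus_eq_infty_iff_enat)
qed

lemma pow_le_Y: "sc (a [^]\<^bsub>R\<^esub> (n::nat)) (carrier M) \<subseteq> Y n"
proof (induction n)
  case 0
  then show ?case by (simp add: sc_0[OF carrier_is_submodule] del: R.nat_pow_0)
next
  case (Suc n)
  have "sc (a [^]\<^bsub>R\<^esub> Suc n) (carrier M) \<subseteq> sc a (Y n)"
    unfolding sc_Suc[OF carrier_is_submodule] using Suc by blast
  also have "\<dots> \<subseteq> Y (Suc n)" using sc_smul_le[OF aI subY] by simp
  finally show ?case .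
qed

lemma ilen_Y_finite: "ilen R M (Y n) (carrier M) \<noteq> \<infinity>"
proof -
  have "ilen R M (Y n) (carrier M) \<le> ilen R M (sc (a [^]\<^bsub>R\<^esub> n) (carrier M)) (carrier M)"
    by (rule ilen_mono[OF pow_le_Y subset_refl])
  then show ?thesis using ilen_pow_finite by (rule enat_le_finite)
qed

text \<open>The length of \<open>M\<close>/\<open>aY n\<close> is computed once through
  \<open>Y n\<close> and once through \<open>aM\<close>. Multiplication by \<open>a\<close>
  identifies \<open>aM\<close>/\<open>aY n\<close> with \<open>M\<close>/\<open>Y n\<close>, whose
  finite length cancels.\<close>

lemma ilen_sc_Y: "ilen R M (sc a (Y n)) (Y n) = ilen R M (sc a (carrier M)) (carrier M)"
proof -
  note C = carrier_is_submodule
  note aC = sub_sc[OF C ac] and aY = sub_sc[OF subY[of n] ac]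
  have "ilen R M (sc a (Y n)) (sc a (carrier M)) = ilen R M (Y n) (carrier M)"
    by (rule ilen_scale[OF ac a_inj subY C submodule_subset[OF subY]])
  moreover have "ilen R M (sc a (Y n)) (carrier M) = ilen R M (sc a (Y n)) (Y n) + ilen R M (Y n) (carrier M)"
    by (rule ilen_add[OF aY subY C sc_le[OF subY ac] submodule_subset[OF subY]])
  moreover have "ilen R M (sc a (Y n)) (carrier M) =
      ilen R M (sc a (Y n)) (sc a (carrier M)) + ilen R M (sc a (carrier M)) (carrier M)"
    by (rule ilen_add[OF aY aC C image_mono[OF submodule_subset[OF subY]] sc_le[OF C ac]])
  ultimately show ?thesis using ilen_Y_finite[of n] by (simp add: add.commute[of _ "ilen R M (Y n) (carrier M)"])
qed

lemma smul_sc: "submodule A R M \<Longrightarrow> c \<in> carrier R \<Longrightarrow> smul R M I (sc c A) = sc c (smul R M I A)"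
  by (rule smul_scale[OF Ic])

text \<open>The graded result is applied with \<open>D n = aY n\<close> and with a finite generating
  set of \<open>I\<close> as both \<open>W\<close> and \<open>V\<close>, which leaves its nilpotence
  condition void. Since \<open>Y n\<close>/\<open>aY n\<close> has the same finite length for all n,
  a submodule whose length does not drop has a colength that does not rise.\<close>

lemma eventually_colength_smul_le:
  "\<exists>n0. \<forall>n\<ge>n0. \<forall>P. submodule P R M \<longrightarrow> sc a (Y n) \<subseteq> P \<longrightarrow> P \<subseteq> Y n \<longrightarrow>
     ilen R M (smul R M I P) (Y (Suc n)) \<le> ilen R M P (Y n)"
proof -
  have sI: "submodule I R (self_module R)" using I submodule_self_iff[OF R.is_cring] by simp
  obtain W where W: "finite W" "W \<subseteq> I" "mspan R (self_module R) W = I"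
    using noeth_generators[OF R_noeth sI] by metis
  have Wc: "W \<subseteq> carrier R" using W Ic by auto
  note gen = smul_generators[OF Wc W(3)]
  obtain L where L: "ilen R M (sc a (carrier M)) (carrier M) = enat L" using a_fin by auto
  have "\<exists>n0. \<forall>n\<ge>n0. \<forall>P. submodule P R M \<longrightarrow> sc a (Y n) \<subseteq> P \<longrightarrow> P \<subseteq> Y n \<longrightarrow>
     ilen R M (sc a (Y n)) P \<le> ilen R M (sc a (Y (Suc n))) (smul R M W P <+>\<^bsub>M\<^esub> sc a (Y (Suc n)))"
  proof (rule eventually_ilen_le_smul[OF M_noeth W(1) Wc W(1) subset_refl, where N = 0 and L = L])
    show "submodule (sc a (Y n)) R M" for n by (rule sub_sc[OF subY ac])
    show "submodule (Y n) R M" for n by (rule subY)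
    show "sc a (Y n) \<subseteq> Y n" for n by (rule sc_le[OF subY ac])
    show WY: "w \<odot>\<^bsub>M\<^esub> x \<in> Y (Suc n)" if "w \<in> W" "x \<in> Y n" for w n x
      using that W(2) by (auto intro: smul_mem)
    show "w \<odot>\<^bsub>M\<^esub> x \<in> sc a (Y (Suc n))" if w: "w \<in> W" and x: "x \<in> sc a (Y n)" for w n x
    proof -
      obtain y where y: "y \<in> Y n" "x = a \<odot>\<^bsub>M\<^esub> y" using x by auto
      have "w \<odot>\<^bsub>M\<^esub> x = a \<odot>\<^bsub>M\<^esub> (w \<odot>\<^bsub>M\<^esub> y)"
        unfolding y(2) using w Wc ac submodule_mem[OF subY y(1)] by (intro smult_commute) auto
      then show ?thesis using WY[OF w y(1)] by blast
    qed
    show "Y (Suc n) \<subseteq> smul R M W (Y n) <+>\<^bsub>M\<^esub> sc a (Y (Suc n))" for n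
      unfolding pow_smul_Suc gen[OF subY]
      by (rule set_add_upper1[OF submodule_smul[OF Wc submodule_subset[OF subY]]
            sub_sc[OF submodule_smul[OF Wc submodule_subset[OF subY]] ac]])
    show "ilen R M (sc a (Y n)) (Y n) \<le> enat L" for n using ilen_sc_Y L by simp
  qed auto
  then obtain n0 where n0: "\<And>n P. n0 \<le> n \<Longrightarrow> submodule P R M \<Longrightarrow> sc a (Y n) \<subseteq> P \<Longrightarrow> P \<subseteq> Y n \<Longrightarrow>
     ilen R M (sc a (Y n)) P \<le> ilen R M (sc a (Y (Suc n))) (smul R M W P <+>\<^bsub>M\<^esub> sc a (Y (Suc n)))" by blast
  show ?thesis
  proof (intro exI[of _ n0] allI impI)
    fix n P assume n: "n0 \<le> n" and P: "submodule P R M" "sc a (Y n) \<subseteq> P" "P \<subseteq> Y n"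
    let ?D = "sc a (Y n)" and ?D' = "sc a (Y (Suc n))" and ?Q = "smul R M I P"
    have Q: "submodule ?Q R M" by (rule sub_smul[OF P(1)])
    have D: "submodule ?D R M" "submodule ?D' R M" by (rule sub_sc[OF subY ac])+
    have DQ: "?D' \<subseteq> ?Q" using smul_mono[OF subset_refl P(2), of I] smul_sc[OF subY ac, of n] by simp
    have QY: "?Q \<subseteq> Y (Suc n)" using smul_mono[OF subset_refl P(3)] by simp
    have "smul R M W P <+>\<^bsub>M\<^esub> ?D' \<subseteq> ?Q" using DQ by (intro set_add_least[OF Q]) (simp_all add: gen[OF P(1)])
    then have 1: "ilen R M ?D P \<le> ilen R M ?D' ?Q"
      using n0[OF n P] ilen_mono[OF subset_refl, of "smul R M W P <+>\<^bsub>M\<^esub> ?D'" ?Q R M ?D'] by (meson order_trans)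
    have 2: "ilen R M ?D (Y n) = ilen R M ?D P + ilen R M P (Y n)" by (rule ilen_add[OF D(1) P(1) subY P(2,3)])
    have 3: "ilen R M ?D' (Y (Suc n)) = ilen R M ?D' ?Q + ilen R M ?Q (Y (Suc n))"
      by (rule ilen_add[OF D(2) Q subY DQ QY])
    have "ilen R M ?D P + ilen R M ?Q (Y (Suc n)) \<le> ilen R M ?D P + ilen R M P (Y n)"
      using 2 3 1 ilen_sc_Y[of n] ilen_sc_Y[of "Suc n"] by (metis add_right_mono)
    moreover have "ilen R M ?D P \<noteq> \<infinity>" using 2 ilen_sc_Y[of n] a_fin by (metis plus_eq_infty_iff_enat)
    ultimately show "ilen R M ?Q (Y (Suc n)) \<le> ilen R M P (Y n)" by (rule enat_add_cancel_le)
  qed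
qed

text \<open>The threshold is that of the case of \<open>a\<close> itself and serves all exponents at
  once, so that the exponent may later grow with n. For \<open>P\<close> containing
  \<open>a^(j+1) Y n\<close> put \<open>S = P + aY n\<close>. Above \<open>S\<close> the case of
  \<open>a\<close> applies. Below it, multiplication by \<open>a\<close> identifies
  \<open>Y n\<close>/\<open>P'\<close> with \<open>S\<close>/\<open>P\<close>, where
  \<open>P'\<close> contains \<open>a^j Y n\<close>.\<close>

lemma eventually_colength_smul_le_pow:
  "\<exists>n0. \<forall>n\<ge>n0. \<forall>j. \<forall>P. submodule P R M \<longrightarrow> sc (a [^]\<^bsub>R\<^esub> (j::nat)) (Y n) \<subseteq> P \<longrightarrow> P \<subseteq> Y n \<longrightarrow>
     ilen R M (smul R M I P) (Y (Suc n)) \<le> ilen R M P (Y n)"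
proof -
  obtain n0 where n0: "\<And>n P. n0 \<le> n \<Longrightarrow> submodule P R M \<Longrightarrow> sc a (Y n) \<subseteq> P \<Longrightarrow> P \<subseteq> Y n \<Longrightarrow>
     ilen R M (smul R M I P) (Y (Suc n)) \<le> ilen R M P (Y n)"
    using eventually_colength_smul_le by blast
  have "ilen R M (smul R M I P) (Y (Suc n)) \<le> ilen R M P (Y n)"
    if n: "n0 \<le> n" and P: "submodule P R M" "sc (a [^]\<^bsub>R\<^esub> (j::nat)) (Y n) \<subseteq> P" "P \<subseteq> Y n" for n j P
    using P
  proof (induction j arbitrary: P)
    case 0
    then have "P = Y n" using sc_0[OF subY] by auto
    then show ?case by (simp add: ilen_self)
  next
    case (Suc j)
    note P = Suc.prems
    let ?aY = "sc a (Y n)" and ?aY' = "sc a (Y (Suc n))" and ?S = "P <+>\<^bsub>M\<^esub> sc a (Y n)"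
    define P' where "P' = {x \<in> Y n. a \<odot>\<^bsub>M\<^esub> x \<in> P}"
    have aY: "submodule ?aY R M" "submodule ?aY' R M" by (rule sub_sc[OF subY ac])+
    have S: "submodule ?S R M" by (rule submodule_set_add[OF P(1) aY(1)])
    have PS: "P \<subseteq> ?S" by (rule set_add_upper1[OF P(1) aY(1)])
    have SY: "?S \<subseteq> Y n" by (rule set_add_least[OF subY P(3) sc_le[OF subY ac]])
    have P': "submodule P' R M" unfolding P'_def
      by (rule submodule_lin_vimage[OF module_axioms module_axioms lin_scale[OF ac] subY P(1)])
    have P'Y: "P' \<subseteq> Y n" by (auto simp: P'_def)
    have "sc (a [^]\<^bsub>R\<^esub> j) (Y n) \<subseteq> P'"
      using P(2) sc_le[OF subY pac] unfolding P'_def sc_Suc[OF subY] by blast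
    then have IH: "ilen R M (smul R M I P') (Y (Suc n)) \<le> ilen R M P' (Y n)"
      by (rule Suc.IH[OF P' _ P'Y])
    let ?IP = "smul R M I P" and ?IS = "smul R M I ?S"
    have IP: "submodule ?IP R M" and IS: "submodule ?IS R M" using sub_smul P(1) S by auto
    have IPS: "?IP \<subseteq> ?IS" by (rule smul_mono[OF subset_refl PS])
    have ISY: "?IS \<subseteq> Y (Suc n)" using smul_mono[OF subset_refl SY] by simp
    have top: "ilen R M ?IS (Y (Suc n)) \<le> ilen R M ?S (Y n)"
      by (rule n0[OF n S set_add_upper2[OF P(1) aY(1)] SY])
    \<comment> \<open>One has \<open>I S = I P + a Y (n + 1)\<close>, and \<open>a\<close> carries
      \<open>I P'\<close> into \<open>I P\<close>; so this quotient is covered by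
      \<open>Y (n + 1)\<close> modulo \<open>I P'\<close>.\<close>
    have "ilen R M ?IP ?IS \<le> ilen R M (smul R M I P') (Y (Suc n))"
    proof (rule ilen_lin_ge[OF module_axioms module_axioms lin_scale[OF ac] sub_smul[OF P'] subY _ IP IS])
      show "smul R M I P' \<subseteq> Y (Suc n)" using smul_mono[OF subset_refl P'Y] by simp
      have "sc a P' \<subseteq> P" by (auto simp: P'_def)
      then have "smul R M I (sc a P') \<subseteq> ?IP" by (rule smul_mono[OF subset_refl])
      then show "a \<odot>\<^bsub>M\<^esub> x \<in> ?IP" if "x \<in> smul R M I P'" for x
        using that smul_sc[OF P' ac] by blast
      have "?IS \<subseteq> ?IP <+>\<^bsub>M\<^esub> smul R M I ?aY" by (rule smul_set_add[OF Ic P(1) aY(1)])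
      also have "smul R M I ?aY = ?aY'" using smul_sc[OF subY ac] by simp
      finally have sub: "?IS \<subseteq> ?IP <+>\<^bsub>M\<^esub> ?aY'" .
      show "\<exists>x\<in>Y (Suc n). \<exists>z\<in>?IP. y = a \<odot>\<^bsub>M\<^esub> x \<oplus>\<^bsub>M\<^esub> z" if y: "y \<in> ?IS" for y
      proof -
        obtain z x where zx: "z \<in> ?IP" "x \<in> Y (Suc n)" "y = z \<oplus>\<^bsub>M\<^esub> a \<odot>\<^bsub>M\<^esub> x"
          using subsetD[OF sub y] by (auto simp: mem_set_add)
        then have "y = a \<odot>\<^bsub>M\<^esub> x \<oplus>\<^bsub>M\<^esub> z"
          using submodule_mem[OF IP zx(1)] submodule_mem[OF subY zx(2)] ac by (simp add: M.a_comm)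
        then show ?thesis using zx by blast
      qed
    qed
    also have "\<dots> \<le> ilen R M P' (Y n)" by (rule IH)
    also have "\<dots> \<le> ilen R M P ?S"
    proof (rule ilen_lin_le[OF module_axioms module_axioms lin_scale[OF ac] P' subY P(1) S PS])
      show "a \<odot>\<^bsub>M\<^esub> x \<in> ?S" if "x \<in> Y n" for x using set_add_upper2[OF P(1) aY(1)] that by blast
    qed (auto simp: P'_def)
    finally have bot: "ilen R M ?IP ?IS \<le> ilen R M P ?S" .
    have "ilen R M ?IP (Y (Suc n)) = ilen R M ?IP ?IS + ilen R M ?IS (Y (Suc n))"
      by (rule ilen_add[OF IP IS subY IPS ISY])
    also have "\<dots> \<le> ilen R M P ?S + ilen R M ?S (Y n)" by (rule add_mono[OF bot top])
    also have "\<dots> = ilen R M P (Y n)" by (rule ilen_add[OF P(1) S subY PS SY, symmetric])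
    finally show ?case .
  qed
  then show ?thesis by blast
qed

text \<open>Between \<open>a^n I M\<close> and \<open>I^n M\<close> lie both \<open>a^n M\<close>
  and \<open>I^(n+1) M\<close>, and the total length is the same along both routes. The colength of
  \<open>a^n I M\<close> in \<open>I^(n+1) M\<close> is at most that of \<open>a^n M\<close> in
  \<open>I^n M\<close>, so the remaining pieces compare the other way; \<open>a^n M\<close> modulo
  \<open>a^n I M\<close> is a copy of \<open>M\<close>/\<open>I M\<close>.\<close>

theorem eventually_colength_le_hilbert_function:
  "\<exists>n0. \<forall>n\<ge>n0. ilen R M (Y 1) (carrier M) \<le> ilen R M (Y (Suc n)) (Y n)"
proof -
  note C = carrier_is_submodule
  obtain n0 where n0: "\<And>n j P. n0 \<le> n \<Longrightarrow> submodule P R M \<Longrightarrow> sc (a [^]\<^bsub>R\<^esub> (j::nat)) (Y n) \<subseteq> P \<Longrightarrow> P \<subseteq> Y n \<Longrightarrow>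
     ilen R M (smul R M I P) (Y (Suc n)) \<le> ilen R M P (Y n)"
    using eventually_colength_smul_le_pow by blast
  have "ilen R M (Y 1) (carrier M) \<le> ilen R M (Y (Suc n)) (Y n)" if n: "n0 \<le> n" for n
  proof -
    \<comment> \<open>the factor \<open>a\<^sup>n\<close> moves a copy of \<open>M\<close> into \<open>I\<^sup>n M\<close>\<close>
    let ?P = "sc (a [^]\<^bsub>R\<^esub> n) (carrier M)"
    let ?Q = "sc (a [^]\<^bsub>R\<^esub> n) (Y 1)"
    have P: "submodule ?P R M" by (rule sub_sc[OF C pac])
    have Q: "submodule ?Q R M" by (rule sub_sc[OF subY pac])
    have QI: "smul R M I ?P = ?Q" using smul_sc[OF C pac] by simp
    have PY: "?P \<subseteq> Y n" by (rule pow_le_Y)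
    have QY: "?Q \<subseteq> Y (Suc n)" using smul_mono[OF subset_refl PY, of I] QI by simp
    have YY: "Y (Suc n) \<subseteq> Y n" using smul_le[OF subY] by simp
    have QP: "?Q \<subseteq> ?P" using submodule_subset[OF subY] by blast
    have 1: "ilen R M ?Q (Y (Suc n)) \<le> ilen R M ?P (Y n)"
      using n0[OF n P _ PY, of n] QI submodule_subset[OF subY] by (metis image_mono)
    have 2: "ilen R M ?Q ?P = ilen R M (Y 1) (carrier M)"
      by (rule ilen_scale[OF pac pow_inj subY C submodule_subset[OF subY]])
    have 3: "ilen R M ?Q (Y n) = ilen R M ?Q ?P + ilen R M ?P (Y n)" by (rule ilen_add[OF Q P subY QP PY])
    have 4: "ilen R M ?Q (Y n) = ilen R M ?Q (Y (Suc n)) + ilen R M (Y (Suc n)) (Y n)"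
      by (rule ilen_add[OF Q subY subY QY YY])
    have "ilen R M ?P (Y n) \<le> ilen R M ?P (carrier M)"
      by (rule ilen_mono[OF subset_refl submodule_subset[OF subY]])
    then have fin: "ilen R M ?P (Y n) \<noteq> \<infinity>"
      using ilen_pow_finite by (rule enat_le_finite)
    have "ilen R M ?P (Y n) + ilen R M (Y 1) (carrier M) = ilen R M ?Q (Y (Suc n)) + ilen R M (Y (Suc n)) (Y n)"
      using 2 3 4 by (simp add: add.commute)
    also have "\<dots> \<le> ilen R M ?P (Y n) + ilen R M (Y (Suc n)) (Y n)" using 1 by (rule add_right_mono)
    finally show ?thesis using fin by (rule enat_add_cancel_le)
  qed
  then show ?thesis by blast
qed

end

section \<open>One-dimensional local rings\<close>

text \<open>Locality is expressed by the invertibility of all elements outside \<open>m\<close>, the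
  form in which it is used; \<open>noeth_local_max_ideal\<close> derives it from the uniqueness of
  the maximal ideal.\<close>

locale noeth_local = cring R for R :: "('a, 'r) ring_scheme" (structure) +
  fixes m :: "'a set"
  assumes R_noeth: "noeth R (self_module R)"
    and m_ideal: "ideal m R" and m_proper: "\<one> \<notin> m"
    and unit: "\<And>r. r \<in> carrier R \<Longrightarrow> r \<notin> m \<Longrightarrow> \<exists>s\<in>carrier R. s \<otimes> r = \<one>"
begin

sublocale self: plain_module R "self_module R"
  by (rule plain_moduleI[OF module_self]) (rule is_cring)

lemma m_carrier: "m \<subseteq> carrier R"
  using additive_subgroup.a_subset[OF ideal.axioms(1)[OF m_ideal]] .

lemma m_smult: "r \<in> carrier R \<Longrightarrow> x \<in> m \<Longrightarrow> r \<otimes> x \<in> m"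
  using ideal.I_l_closed[OF m_ideal] by blast

lemma m_sub: "submodule m R (self_module R)"
  using m_ideal submodule_self_iff[OF is_cring] by blast

lemma one_minus_notin_m:
  assumes "x \<in> m" shows "\<one> \<ominus> x \<notin> m"
proof
  assume h: "\<one> \<ominus> x \<in> m"
  have "\<one> \<ominus>\<^bsub>R\<^esub> x \<oplus>\<^bsub>R\<^esub> x \<in> m"
    using additive_subgroup.a_closed[OF ideal.axioms(1)[OF m_ideal] h assms] .
  moreover have "\<one> \<ominus>\<^bsub>R\<^esub> x \<oplus>\<^bsub>R\<^esub> x = \<one>" using assms m_carrier
    by (auto simp: a_minus_def a_assoc l_neg)
  ultimately show False using m_proper by simp
qed

lemma unit_smult_mem:
  fixes M :: "('a, 'b) module"
  assumes M: "module R M" and A: "submodule A R M" and x: "x \<in> carrier M"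
    and r: "r \<in> carrier R" "r \<notin> m" and rx: "r \<odot>\<^bsub>M\<^esub> x \<in> A"
  shows "x \<in> A"
proof -
  interpret M: plain_module R M by (rule plain_moduleI[OF M])
  obtain s where s: "s \<in> carrier R" "s \<otimes> r = \<one>" using unit[OF r] by blast
  have "s \<odot>\<^bsub>M\<^esub> (r \<odot>\<^bsub>M\<^esub> x) = x" using s r x M.smult_assoc1[of s r x] by simp
  then show ?thesis using M.submodule_smult[OF A s(1) rx] by simp
qed

text \<open>Nakayama's lemma for a single element of the maximal ideal. A maximal proper submodule
  \<open>L\<close> above \<open>A\<close> has a simple quotient, which \<open>a\<close> kills, so
  \<open>A + aN\<close> would stay inside \<open>L\<close>.\<close>

lemma nakayama:
  assumes N: "noeth R N" and A: "submodule A R N" and a: "a \<in> m"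
    and gen: "\<And>y. y \<in> carrier N \<Longrightarrow> \<exists>u\<in>A. \<exists>z\<in>carrier N. y = u \<oplus>\<^bsub>N\<^esub> a \<odot>\<^bsub>N\<^esub> z"
  shows "A = carrier N"
proof (rule ccontr)
  assume ne: "A \<noteq> carrier N"
  interpret N: plain_module R N by (rule plain_moduleI[OF noeth_module[OF N]])
  have ac: "a \<in> carrier R" using a m_carrier by auto
  obtain L where L: "submodule L R N" "A \<subseteq> L \<and> L \<noteq> carrier N"
    and max: "\<And>L'. submodule L' R N \<Longrightarrow> A \<subseteq> L' \<and> L' \<noteq> carrier N \<Longrightarrow> L \<subseteq> L' \<Longrightarrow> L' = L"
    by (rule noeth_maximal[OF N A, of "\<lambda>L. A \<subseteq> L \<and> L \<noteq> carrier N"]) (use ne in auto)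
  obtain x where x: "x \<in> carrier N" "x \<notin> L" using L N.submodule_subset[OF L(1)] by auto
  have ext: "\<exists>l\<in>L. \<exists>r\<in>carrier R. z = l \<oplus>\<^bsub>N\<^esub> r \<odot>\<^bsub>N\<^esub> y"
    if y: "y \<in> carrier N" "y \<notin> L" and z: "z \<in> carrier N" for y z
  proof -
    let ?C = "(\<lambda>r. r \<odot>\<^bsub>N\<^esub> y) ` carrier R"
    have cyc: "submodule ?C R N" by (rule N.submodule_cyclic[OF y(1)])
    have s: "submodule (L <+>\<^bsub>N\<^esub> ?C) R N" by (rule N.submodule_set_add[OF L(1) cyc])
    have up: "L \<subseteq> L <+>\<^bsub>N\<^esub> ?C" "?C \<subseteq> L <+>\<^bsub>N\<^esub> ?C"
      using N.set_add_upper1[OF L(1) cyc] N.set_add_upper2[OF L(1) cyc] by auto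
    have "L <+>\<^bsub>N\<^esub> ?C \<noteq> L" using N.mem_cyclic_self[OF y(1)] y up by auto
    then have "L <+>\<^bsub>N\<^esub> ?C = carrier N" using max[OF s] up L by blast
    then show ?thesis using z by (auto simp: N.mem_set_add)
  qed
  \<comment> \<open>Otherwise x would be a multiple of \<open>a x\<close> modulo \<open>L\<close>;
    then \<open>1 - r a\<close>, a unit, would carry x into \<open>L\<close>.\<close>
  have ax: "a \<odot>\<^bsub>N\<^esub> x \<in> L"
  proof (rule ccontr)
    assume h: "a \<odot>\<^bsub>N\<^esub> x \<notin> L"
    obtain l r where lr: "l \<in> L" "r \<in> carrier R" "x = l \<oplus>\<^bsub>N\<^esub> r \<odot>\<^bsub>N\<^esub> (a \<odot>\<^bsub>N\<^esub> x)"
      using ext[OF _ h x(1)] x ac by auto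
    have lc: "l \<in> carrier N" using N.submodule_mem[OF L(1) lr(1)] .
    have ra: "r \<otimes> a \<in> m" using m_smult lr a by simp
    have "(\<one> \<ominus> r \<otimes> a) \<odot>\<^bsub>N\<^esub> x = x \<ominus>\<^bsub>N\<^esub> r \<odot>\<^bsub>N\<^esub> (a \<odot>\<^bsub>N\<^esub> x)"
      using x ac lr by (simp add: N.smult_minus_distr_left N.smult_assoc1)
    also have "\<dots> = l" using N.add_minus_cancel[OF lc, of "r \<odot>\<^bsub>N\<^esub> (a \<odot>\<^bsub>N\<^esub> x)"] lr x ac by simp
    finally have "(\<one> \<ominus> r \<otimes> a) \<odot>\<^bsub>N\<^esub> x \<in> L" using lr by simp
    then have "x \<in> L"
      using unit_smult_mem[OF N.module_axioms L(1) x(1) _ one_minus_notin_m[OF ra]] lr ac by simp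
    then show False using x by simp
  qed
  have aL: "a \<odot>\<^bsub>N\<^esub> z \<in> L" if z: "z \<in> carrier N" for z
  proof -
    obtain l r where lr: "l \<in> L" "r \<in> carrier R" "z = l \<oplus>\<^bsub>N\<^esub> r \<odot>\<^bsub>N\<^esub> x" using ext[OF x z] by blast
    have "a \<odot>\<^bsub>N\<^esub> z = a \<odot>\<^bsub>N\<^esub> l \<oplus>\<^bsub>N\<^esub> r \<odot>\<^bsub>N\<^esub> (a \<odot>\<^bsub>N\<^esub> x)"
      using lr x ac N.submodule_mem[OF L(1) lr(1)] by (simp add: N.smult_r_distr N.smult_commute[of a])
    then show ?thesis
      using N.submodule_add[OF L(1)] N.submodule_smult[OF L(1)] lr ax ac by simp
  qed
  have "carrier N \<subseteq> L"
  proof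
    fix y assume "y \<in> carrier N"
    then obtain u z where "u \<in> A" "z \<in> carrier N" "y = u \<oplus>\<^bsub>N\<^esub> a \<odot>\<^bsub>N\<^esub> z" using gen by blast
    then show "y \<in> L" using aL L N.submodule_add[OF L(1)] by auto
  qed
  then show False using L N.submodule_subset[OF L(1)] by auto
qed

end

text \<open>This makes \<open>R\<close>/\<open>aR\<close> a ring with a single prime. In dimension
  one every nonzerodivisor in \<open>m\<close> is such an element, by
  \<open>prime_over_nonzerodivisor\<close>.\<close>

locale local_parameter = noeth_local R m for R :: "('a, 'r) ring_scheme" (structure) and m +
  fixes a :: 'a
  assumes a_m: "a \<in> m" and prime_over_a: "\<And>p. primeideal p R \<Longrightarrow> a \<in> p \<Longrightarrow> p = m"
begin

lemma a_carrier [simp]: "a \<in> carrier R"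
  using a_m m_carrier by auto

text \<open>A maximal element among the annihilators of nonzero elements of \<open>B/A\<close> is a prime ideal that
  contains \<open>a\<close>.\<close>

lemma socle:
  fixes M :: "('a, 'b) module"
  assumes M: "module R M" and A: "submodule A R M" and B: "submodule B R M" and AB: "A \<subseteq> B" "A \<noteq> B"
    and aB: "\<And>x. x \<in> B \<Longrightarrow> a \<odot>\<^bsub>M\<^esub> x \<in> A"
  obtains x where "x \<in> B" "x \<notin> A" "\<And>r. r \<in> carrier R \<Longrightarrow> r \<odot>\<^bsub>M\<^esub> x \<in> A \<longleftrightarrow> r \<in> m"
proof -
  interpret M: plain_module R M by (rule plain_moduleI[OF M])
  let ?C = "\<lambda>x. {r \<in> carrier R. r \<odot>\<^bsub>M\<^esub> x \<in> A}"
  have C: "submodule (?C x) R (self_module R)" if "x \<in> B" for x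
    by (rule M.submodule_colon[OF A M.submodule_mem[OF B that]])
  obtain x0 where x0: "x0 \<in> B" "x0 \<notin> A" using AB by auto
  obtain J where J: "submodule J R (self_module R)" "\<exists>x\<in>B - A. J = ?C x"
    and max: "\<And>J'. submodule J' R (self_module R) \<Longrightarrow> \<exists>x\<in>B - A. J' = ?C x \<Longrightarrow> J \<subseteq> J' \<Longrightarrow> J' = J"
    by (rule noeth_maximal[OF R_noeth C[OF x0(1)], of "\<lambda>J. \<exists>x\<in>B - A. J = ?C x"]) (use x0 in auto)
  then obtain x where x: "x \<in> B" "x \<notin> A" "J = ?C x" by auto
  have xc: "x \<in> carrier M" using M.submodule_mem[OF B x(1)] .
  have "primeideal J R"
  proof (rule primeidealI)
    show "ideal J R" using J submodule_self_iff[OF is_cring] by blast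
    show "cring R" by (rule is_cring)
    have "\<one> \<notin> J" using x xc by simp
    then show "carrier R \<noteq> J" by auto
    fix r s assume rs: "r \<in> carrier R" "s \<in> carrier R" "r \<otimes> s \<in> J"
    show "r \<in> J \<or> s \<in> J"
    proof (rule disjCI)
      assume "s \<notin> J"
      then have sx: "s \<odot>\<^bsub>M\<^esub> x \<in> B" "s \<odot>\<^bsub>M\<^esub> x \<notin> A" using rs x M.submodule_smult[OF B] by auto
      have "J \<subseteq> ?C (s \<odot>\<^bsub>M\<^esub> x)"
        using x(3) rs xc M.submodule_smult[OF A rs(2)] by (auto simp: M.smult_commute[of _ s])
      then have "?C (s \<odot>\<^bsub>M\<^esub> x) = J" using max[OF C[OF sx(1)]] sx by blast
      moreover have "r \<in> ?C (s \<odot>\<^bsub>M\<^esub> x)" using rs x xc by (simp add: M.smult_assoc1)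
      ultimately show "r \<in> J" by blast
    qed
  qed
  moreover have "a \<in> J" using x aB by simp
  ultimately have "J = m" by (rule prime_over_a)
  then show ?thesis using that[of x] x by blast
qed

text \<open>A submodule of the interval beyond \<open>A\<close> has an element that involves x with
  a coefficient outside \<open>m\<close>, that is, a unit; so it contains x.\<close>

lemma ilen_simple:
  fixes M :: "('a, 'b) module"
  assumes M: "module R M" and A: "submodule A R M" and x: "x \<in> carrier M"
    and mx: "\<And>r. r \<in> m \<Longrightarrow> r \<odot>\<^bsub>M\<^esub> x \<in> A"
  shows "ilen R M A (A <+>\<^bsub>M\<^esub> (\<lambda>r. r \<odot>\<^bsub>M\<^esub> x) ` carrier R) \<le> 1"
  unfolding ilen_def
proof (rule chain_sup_least)
  interpret M: plain_module R M by (rule plain_moduleI[OF M])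
  let ?B = "A <+>\<^bsub>M\<^esub> (\<lambda>r. r \<odot>\<^bsub>M\<^esub> x) ` carrier R"
  have full: "N = ?B" if N: "submodule N R M" "A \<subset> N" "N \<subseteq> ?B" for N
  proof -
    obtain y where y: "y \<in> N" "y \<notin> A" using N by auto
    have "y \<in> ?B" using y N by blast
    then obtain u r where ur: "u \<in> A" "r \<in> carrier R" "y = u \<oplus>\<^bsub>M\<^esub> r \<odot>\<^bsub>M\<^esub> x"
      by (auto simp: M.mem_set_add)
    have "r \<notin> m" using ur y mx M.submodule_add[OF A] by auto
    moreover have "r \<odot>\<^bsub>M\<^esub> x \<in> N"
      using M.submodule_add_cancel_left[OF N(1), of "r \<odot>\<^bsub>M\<^esub> x" u] ur y N x by auto
    ultimately have xN: "x \<in> N" using unit_smult_mem[OF M N(1) x ur(2)] by blast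
    have "?B \<subseteq> N" using N xN M.submodule_smult[OF N(1)] by (intro M.set_add_least[OF N(1)]) auto
    then show ?thesis using N by auto
  qed
  fix n c assume c: "\<And>i. i \<le> n \<Longrightarrow> submodule (c i) R M \<and> A \<subseteq> c i \<and> c i \<subseteq> ?B" "\<And>i. i < n \<Longrightarrow> c i \<subset> c (Suc i)"
  show "enat n \<le> 1"
  proof (rule ccontr)
    assume "\<not> enat n \<le> 1"
    then have n: "2 \<le> n" by (simp add: one_enat_def)
    have "c 1 = ?B" using full[of "c 1"] c(1)[of 1] c(1)[of 0] c(2)[of 0] n by auto
    then show False using c(1)[of 2] c(2)[of 1] n by (auto simp: numeral_2_eq_2)
  qed
qed

text \<open>A maximal submodule of infinite colength could be enlarged by a socle element of the
  quotient, at the cost of length one only.\<close>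

lemma ilen_finite:
  assumes M: "noeth R M" and A: "submodule A R M" and aA: "\<And>x. x \<in> carrier M \<Longrightarrow> a \<odot>\<^bsub>M\<^esub> x \<in> A"
  shows "ilen R M A (carrier M) \<noteq> \<infinity>"
proof
  assume inf: "ilen R M A (carrier M) = \<infinity>"
  interpret M: plain_module R M by (rule plain_moduleI[OF noeth_module[OF M]])
  obtain B where B: "submodule B R M" "A \<subseteq> B \<and> ilen R M B (carrier M) = \<infinity>"
    and max: "\<And>B'. submodule B' R M \<Longrightarrow> A \<subseteq> B' \<and> ilen R M B' (carrier M) = \<infinity> \<Longrightarrow> B \<subseteq> B' \<Longrightarrow> B' = B"
    by (rule noeth_maximal[OF M A, of "\<lambda>B. A \<subseteq> B \<and> ilen R M B (carrier M) = \<infinity>"]) (use inf in auto)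
  have ne: "B \<noteq> carrier M" using B by (auto simp: ilen_self)
  obtain x where x: "x \<in> carrier M" "x \<notin> B" "\<And>r. r \<in> carrier R \<Longrightarrow> r \<odot>\<^bsub>M\<^esub> x \<in> B \<longleftrightarrow> r \<in> m"
    using socle[OF M.module_axioms B(1) M.carrier_is_submodule M.submodule_subset[OF B(1)] ne] aA B by auto
  let ?C = "(\<lambda>r. r \<odot>\<^bsub>M\<^esub> x) ` carrier R"
  let ?B = "B <+>\<^bsub>M\<^esub> ?C"
  have cyc: "submodule ?C R M" by (rule M.submodule_cyclic[OF x(1)])
  have B': "submodule ?B R M" by (rule M.submodule_set_add[OF B(1) cyc])
  have BB': "B \<subseteq> ?B" by (rule M.set_add_upper1[OF B(1) cyc])
  have xB: "x \<in> ?B" using M.set_add_upper2[OF B(1) cyc] M.mem_cyclic_self[OF x(1)] by auto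
  have "?B \<noteq> B" using xB x(2) by auto
  then have "ilen R M ?B (carrier M) \<noteq> \<infinity>" using max[OF B'] B(2) BB' by (meson subset_trans)
  moreover have "ilen R M B ?B \<noteq> \<infinity>"
  proof (rule enat_le_finite[OF ilen_simple[OF M.module_axioms B(1) x(1)]])
    show "r \<odot>\<^bsub>M\<^esub> x \<in> B" if "r \<in> m" for r using x(3) that m_carrier by blast
  qed (simp add: one_enat_def)
  moreover have "ilen R M B (carrier M) = ilen R M B ?B + ilen R M ?B (carrier M)"
    by (rule M.ilen_add[OF B(1) B' M.carrier_is_submodule BB' M.submodule_subset[OF B']])
  ultimately show False using B by auto
qed

text \<open>If the \<open>a\<close>-torsion were nonzero, it would contain a nonzero element
  annihilated by all of \<open>m\<close>, in particular by x.\<close>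

lemma nonzerodivisor_transfer:
  fixes M :: "('a, 'b) module"
  assumes M: "module R M" and x: "x \<in> m" and inj: "\<And>y. y \<in> carrier M \<Longrightarrow> x \<odot>\<^bsub>M\<^esub> y = \<zero>\<^bsub>M\<^esub> \<Longrightarrow> y = \<zero>\<^bsub>M\<^esub>"
    and y: "y \<in> carrier M" "a \<odot>\<^bsub>M\<^esub> y = \<zero>\<^bsub>M\<^esub>"
  shows "y = \<zero>\<^bsub>M\<^esub>"
proof (rule ccontr)
  assume ne: "y \<noteq> \<zero>\<^bsub>M\<^esub>"
  interpret M: plain_module R M by (rule plain_moduleI[OF M])
  let ?B = "{y \<in> carrier M. a \<odot>\<^bsub>M\<^esub> y \<in> {\<zero>\<^bsub>M\<^esub>}}"
  have B: "submodule ?B R M"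
    by (rule submodule_lin_vimage[OF M M M.lin_scale M.carrier_is_submodule M.submodule_zero_set]) simp
  obtain z where z: "z \<in> ?B" "z \<notin> {\<zero>\<^bsub>M\<^esub>}" "\<And>r. r \<in> carrier R \<Longrightarrow> r \<odot>\<^bsub>M\<^esub> z \<in> {\<zero>\<^bsub>M\<^esub>} \<longleftrightarrow> r \<in> m"
    by (rule socle[OF M M.submodule_zero_set B]) (use y ne in auto)
  have "x \<odot>\<^bsub>M\<^esub> z = \<zero>\<^bsub>M\<^esub>" using z(3)[of x] x m_carrier by auto
  then show False using inj[of z] z by auto
qed

end

text \<open>A prime strictly inside \<open>p\<close> is produced; if \<open>p\<close> differed from
  \<open>m\<close>, this would give a chain of primes of length two. The prime is an ideal maximal
  among those disjoint from a multiplicative set that combines the powers of \<open>a\<close> with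
  the complement of \<open>p\<close>.\<close>

lemma prime_over_nonzerodivisor:
  fixes R :: "('a, 'r) ring_scheme" (structure)
  assumes R: "noeth_local R m" and dim: "krull_dim R = 1"
    and a: "a \<in> carrier R" "\<And>x. x \<in> carrier R \<Longrightarrow> a \<otimes> x = \<zero> \<Longrightarrow> x = \<zero>"
    and p: "primeideal p R" "a \<in> p"
  shows "p = m"
proof (rule ccontr)
  assume pm: "p \<noteq> m"
  interpret noeth_local R m by fact
  interpret p: primeideal p R by fact
  have pa: "a [^] (i::nat) \<in> carrier R" for i using a by simp
  have pinj: "x = \<zero>" if "x \<in> carrier R" "a [^] (i::nat) \<otimes> x = \<zero>" for i x
    using that
  proof (induction i arbitrary: x)
    case (Suc i)
    have "a [^] i \<otimes> (a \<otimes> x) = \<zero>" using Suc.prems a by (simp add: m_assoc)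
    then have "a \<otimes> x = \<zero>" using Suc.prems(1) a(1) by (intro Suc.IH[of "a \<otimes> x"]) simp_all
    then show ?case by (rule a(2)[OF Suc.prems(1)])
  qed simp
  have one_p: "\<one> \<notin> p" using p.I_notcarr p.one_imp_carrier by blast
  \<comment> \<open>Containing the complement of \<open>p\<close>, it forces a disjoint ideal into
    \<open>p\<close>; containing \<open>a\<close>, it makes that ideal differ from \<open>p\<close>.
    It omits zero because \<open>a\<close> is a nonzerodivisor.\<close>
  define S where "S = {a [^] i \<otimes> s | (i::nat) s. s \<in> carrier R \<and> s \<notin> p}"
  have S_mult: "x \<otimes> y \<in> S" if xy: "x \<in> S" "y \<in> S" for x y
  proof -
    obtain i s where x: "s \<in> carrier R" "s \<notin> p" "x = a [^] (i::nat) \<otimes> s" using xy(1) S_def by auto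
    obtain j t where y: "t \<in> carrier R" "t \<notin> p" "y = a [^] (j::nat) \<otimes> t" using xy(2) S_def by auto
    have "x \<otimes> y = a [^] (i + j) \<otimes> (s \<otimes> t)"
      using x y pa a by (simp add: nat_pow_mult[symmetric] m_ac)
    moreover have "s \<otimes> t \<notin> p" using x y p.I_prime by blast
    ultimately show ?thesis using x y unfolding S_def by blast
  qed
  have S_zero: "\<zero> \<notin> S"
  proof
    assume "\<zero> \<in> S"
    then obtain i s where x: "s \<in> carrier R" "s \<notin> p" "a [^] (i::nat) \<otimes> s = \<zero>" unfolding S_def by force
    then show False using pinj[of s i] p.zero_closed by auto
  qed
  obtain q where q: "submodule q R (self_module R)" "q \<inter> S = {}"
    and max: "\<And>q'. submodule q' R (self_module R) \<Longrightarrow> q' \<inter> S = {} \<Longrightarrow> q \<subseteq> q' \<Longrightarrow> q' = q"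
    by (rule noeth_maximal[OF R_noeth self.submodule_zero_set, of "\<lambda>q. q \<inter> S = {}"]) (use S_zero in auto)
  have qc: "q \<subseteq> carrier R" using self.submodule_subset[OF q(1)] by simp
  have qp: "q \<subseteq> p"
  proof
    fix z assume z: "z \<in> q"
    show "z \<in> p"
    proof (rule ccontr)
      assume "z \<notin> p"
      then have "a [^] (0::nat) \<otimes> z \<in> S" using z qc unfolding S_def by blast
      then have "z \<in> S" using z qc by auto
      then show False using q z by blast
    qed
  qed
  have "a [^] (1::nat) \<otimes> \<one> \<in> S" using one_p unfolding S_def by blast
  then have aS: "a \<in> S" using a by simp
  have "q \<noteq> p" using aS p(2) q(2) by auto
  have "primeideal q R"
  proof (rule primeidealI)
    show "ideal q R" using q submodule_self_iff[OF is_cring] by blast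
    show "cring R" by (rule is_cring)
    show "carrier R \<noteq> q" using one_p qp by auto
    fix x y assume x: "x \<in> carrier R" and y: "y \<in> carrier R" and xy: "x \<otimes> y \<in> q"
    have meets: "\<exists>u\<in>q. \<exists>r\<in>carrier R. u \<oplus> r \<otimes> z \<in> S" if z: "z \<in> carrier R" "z \<notin> q" for z
    proof -
      let ?C = "(\<lambda>r. r \<odot>\<^bsub>self_module R\<^esub> z) ` carrier R"
      have zc: "z \<in> carrier (self_module R)" using z by simp
      have cyc: "submodule ?C R (self_module R)" by (rule self.submodule_cyclic[OF zc])
      let ?Q = "q <+>\<^bsub>self_module R\<^esub> ?C"
      have "z \<in> ?Q" using self.set_add_upper2[OF q(1) cyc] self.mem_cyclic_self[OF zc] by blast
      then have "?Q \<inter> S \<noteq> {}"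
        using max[OF self.submodule_set_add[OF q(1) cyc]] self.set_add_upper1[OF q(1) cyc] z by blast
      then show ?thesis by (auto simp: self.mem_set_add)
    qed
    show "x \<in> q \<or> y \<in> q"
    proof (rule ccontr)
      assume "\<not> (x \<in> q \<or> y \<in> q)"
      then obtain u r v t where *: "u \<in> q" "r \<in> carrier R" "u \<oplus> r \<otimes> x \<in> S" "v \<in> q" "t \<in> carrier R" "v \<oplus> t \<otimes> y \<in> S"
        using meets[OF x] meets[OF y] by blast
      have c: "u \<in> carrier R" "v \<in> carrier R" using * qc by auto
      have 1: "(u \<oplus> r \<otimes> x) \<otimes> (v \<oplus> t \<otimes> y) = (v \<oplus> t \<otimes> y) \<otimes> u \<oplus> ((r \<otimes> x) \<otimes> v \<oplus> (r \<otimes> t) \<otimes> (x \<otimes> y))"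
        using c x y * by (simp add: l_distr r_distr m_ac a_ac)
      have "(v \<oplus> t \<otimes> y) \<otimes> u \<in> q" "(r \<otimes> x) \<otimes> v \<in> q" "(r \<otimes> t) \<otimes> (x \<otimes> y) \<in> q"
        using self.submodule_smult[OF q(1), of "v \<oplus> t \<otimes> y" u] self.submodule_smult[OF q(1), of "r \<otimes> x" v]
          self.submodule_smult[OF q(1), of "r \<otimes> t" "x \<otimes> y"] * c x y xy by auto
      then have "(u \<oplus> r \<otimes> x) \<otimes> (v \<oplus> t \<otimes> y) \<in> q"
        unfolding 1 using self.submodule_add[OF q(1)] by simp
      then show False using S_mult *(3,6) q(2) by blast
    qed
  qed
  moreover have "p \<subset> m"
  proof -
    have "p \<subseteq> m"
    proof
      fix r assume r: "r \<in> p"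
      have rc: "r \<in> carrier R" using r p.a_subset by auto
      show "r \<in> m"
      proof (rule ccontr)
        assume "r \<notin> m"
        then obtain s where "s \<in> carrier R" "s \<otimes> r = \<one>" using unit rc by blast
        then show False using p.I_l_closed[OF r] one_p by metis
      qed
    qed
    then show ?thesis using pm by auto
  qed
  moreover have "primeideal m R"
  proof (rule primeidealI[OF m_ideal is_cring])
    show "carrier R \<noteq> m" using m_proper by auto
    fix x y assume xy: "x \<in> carrier R" "y \<in> carrier R" "x \<otimes> y \<in> m"
    show "x \<in> m \<or> y \<in> m"
    proof (rule disjCI)
      assume "y \<notin> m"
      then obtain s where s: "s \<in> carrier R" "s \<otimes> y = \<one>" using unit xy by blast
      have "s \<otimes> (x \<otimes> y) = x" using s xy m_lcomm[of s x y] by simp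
      then show "x \<in> m" using m_smult[OF s(1) xy(3)] by simp
    qed
  qed
  moreover have "q \<subset> p" using qp \<open>q \<noteq> p\<close> by auto
  ultimately have "enat 2 \<le> krull_dim R" unfolding krull_dim_def
    by (intro chain_sup_upper[where c = "\<lambda>i. if i = 0 then q else if i = 1 then p else m"])
       (use p in \<open>auto simp: less_Suc_eq numeral_2_eq_2\<close>)
  then show False using dim by (simp add: one_enat_def)
qed

text \<open>For a noninvertible r, an ideal maximal among those that contain r but not the unit
  element is a maximal ideal, hence the only one there is.\<close>

lemma noeth_local_max_ideal:
  fixes R :: "('a, 'r) ring_scheme" (structure)
  assumes "noetherian_local_ring R"
  shows "noeth_local R (max_ideal R)"
proof -
  interpret cring R using assms by (simp add: noetherian_local_ring_def)
  have noe: "noeth R (self_module R)"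
    using noeth_self[OF is_cring] assms by (simp add: noetherian_local_ring_def)
  interpret self: plain_module R "self_module R" by (rule plain_moduleI[OF module_self[OF is_cring]])
  have ex1: "\<exists>!m. maximalideal m R" using assms by (simp add: noetherian_local_ring_def)
  have m: "maximalideal (max_ideal R) R" unfolding max_ideal_def by (rule theI'[OF ex1])
  then interpret m: maximalideal "max_ideal R" R .
  show ?thesis
  proof unfold_locales
    show "noeth R (self_module R)" by fact
    show "\<one> \<notin> max_ideal R" using m.I_notcarr m.one_imp_carrier by blast
    fix r assume r: "r \<in> carrier R" "r \<notin> max_ideal R"
    show "\<exists>s\<in>carrier R. s \<otimes> r = \<one>"
    proof (rule ccontr)
      assume none: "\<not> ?thesis"
      let ?C = "(\<lambda>s. s \<odot>\<^bsub>self_module R\<^esub> r) ` carrier R"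
      have rc: "r \<in> carrier (self_module R)" using r by simp
      have C: "submodule ?C R (self_module R)" by (rule self.submodule_cyclic[OF rc])
      have C1: "r \<in> ?C \<and> \<one> \<notin> ?C" using none self.mem_cyclic_self[OF rc] by auto
      obtain n where n: "submodule n R (self_module R)" "r \<in> n \<and> \<one> \<notin> n"
        and max: "\<And>n'. submodule n' R (self_module R) \<Longrightarrow> r \<in> n' \<and> \<one> \<notin> n' \<Longrightarrow> n \<subseteq> n' \<Longrightarrow> n' = n"
        by (rule noeth_maximal[OF noe C, of "\<lambda>n. r \<in> n \<and> \<one> \<notin> n"]) (use C1 in auto)
      have "maximalideal n R"
      proof (rule maximalidealI)
        show "ideal n R" using n submodule_self_iff[OF is_cring] by blast
        show "carrier R \<noteq> n" using n by auto
        fix J assume J: "ideal J R" "n \<subseteq> J" "J \<subseteq> carrier R"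
        have sJ: "submodule J R (self_module R)" using J submodule_self_iff[OF is_cring] by blast
        show "J = n \<or> J = carrier R"
        proof (cases "\<one> \<in> J")
          case True
          then show ?thesis using ideal.one_imp_carrier[OF J(1)] by simp
        next
          case False
          then show ?thesis using max[OF sJ] n J by blast
        qed
      qed
      then have "n = max_ideal R" using m ex1 by blast
      then show False using n r by simp
    qed
  qed
qed

section \<open>Modules of homomorphisms and free modules\<close>

lemma noeth_zero_module:
  assumes M: "module R M" and Z: "carrier M = {\<zero>\<^bsub>M\<^esub>}"
  shows "noeth R M"
  unfolding noeth_def
proof (intro conjI allI impI M)
  interpret M: plain_module R M by (rule plain_moduleI[OF M])
  fix F assume F: "F \<noteq> {} \<and> (\<forall>N\<in>F. submodule N R M)"
  then obtain N where N: "N \<in> F" by blast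
  have "N' = carrier M" if "N' \<in> F" for N'
    using that F M.submodule_subset[of N'] M.submodule_zero[of N'] Z by auto
  then show "\<exists>N\<in>F. \<forall>N'\<in>F. N \<subseteq> N' \<longrightarrow> N' = N" using N by (intro bexI[OF _ N]) auto
qed

text \<open>First the image under \<open>h\<close> and then the intersection with the kernel is made
  maximal; nested submodules that agree in both are equal.\<close>

lemma noeth_kernel:
  assumes M: "module R M" and N: "noeth R N" and h: "lin R M N h"
    and K: "noeth R (M\<lparr>carrier := {x \<in> carrier M. h x = \<zero>\<^bsub>N\<^esub>}\<rparr>)"
  shows "noeth R M"
  unfolding noeth_def
proof (intro conjI allI impI M)
  interpret M: plain_module R M by (rule plain_moduleI[OF M])
  interpret N: plain_module R N by (rule plain_moduleI[OF noeth_module[OF N]])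
  let ?K = "{x \<in> carrier M. h x = \<zero>\<^bsub>N\<^esub>}"
  have sK: "submodule ?K R M"
    using submodule_lin_vimage[OF M N.module_axioms h M.carrier_is_submodule N.submodule_zero_set] by simp
  fix F assume F: "F \<noteq> {} \<and> (\<forall>U\<in>F. submodule U R M)"
  then obtain U0 where U0: "U0 \<in> F" by auto
  have im: "submodule (h ` U) R N" if "U \<in> F" for U
    using submodule_lin_image[OF M N.module_axioms h] F that by blast
  have ker: "submodule (U \<inter> ?K) R (M\<lparr>carrier := ?K\<rparr>)" if "U \<in> F" for U
    using M.submodule_restrict_iff[OF sK] M.submodule_inter[OF _ sK] F that by blast
  obtain I where I: "\<exists>U\<in>F. I = h ` U"
    and max1: "\<And>I'. submodule I' R N \<Longrightarrow> \<exists>U\<in>F. I' = h ` U \<Longrightarrow> I \<subseteq> I' \<Longrightarrow> I' = I"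
    by (rule noeth_maximal[OF N im[OF U0], of "\<lambda>I. \<exists>U\<in>F. I = h ` U"]) (use U0 in auto)
  then obtain U1 where U1: "U1 \<in> F" "h ` U1 = I" by auto
  obtain L where L: "\<exists>U\<in>F. h ` U = I \<and> L = U \<inter> ?K"
    and max2: "\<And>L'. submodule L' R (M\<lparr>carrier := ?K\<rparr>) \<Longrightarrow> \<exists>U\<in>F. h ` U = I \<and> L' = U \<inter> ?K \<Longrightarrow> L \<subseteq> L' \<Longrightarrow> L' = L"
    by (rule noeth_maximal[OF K ker[OF U1(1)], of "\<lambda>L. \<exists>U\<in>F. h ` U = I \<and> L = U \<inter> ?K"]) (use U1 in auto)
  then obtain U where U: "U \<in> F" "h ` U = I" "L = U \<inter> ?K" by auto
  show "\<exists>U\<in>F. \<forall>U'\<in>F. U \<subseteq> U' \<longrightarrow> U' = U"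
  proof (intro bexI[OF _ U(1)] ballI impI)
    fix U' assume U': "U' \<in> F" "U \<subseteq> U'"
    have s: "submodule U R M" "submodule U' R M" using F U U' by auto
    have hU: "h ` U' = I"
    proof (rule max1[OF im[OF U'(1)]])
      show "\<exists>U\<in>F. h ` U' = h ` U" using U' by auto
      show "I \<subseteq> h ` U'" using U U' by auto
    qed
    have LU: "U' \<inter> ?K = L"
    proof (rule max2[OF ker[OF U'(1)]])
      show "\<exists>U\<in>F. h ` U = I \<and> U' \<inter> ?K = U \<inter> ?K" using U' hU by auto
      show "L \<subseteq> U' \<inter> ?K" using U U' by auto
    qed
    have "U' \<subseteq> U"
    proof
      fix x assume x: "x \<in> U'"
      then have "h x \<in> h ` U" using hU U by auto
      then obtain y where y: "y \<in> U" "h x = h y" by auto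
      have c: "x \<in> carrier M" "y \<in> carrier M" using x y s M.submodule_mem by auto
      have "h (x \<ominus>\<^bsub>M\<^esub> y) = \<zero>\<^bsub>N\<^esub>"
        using c y lin_closed[OF h] by (simp add: lin_minus[OF M N.module_axioms h] N.minus_eq_zero_iff)
      moreover have "x \<ominus>\<^bsub>M\<^esub> y \<in> U'" using x y U' M.submodule_minus[OF s(2)] by auto
      ultimately have "x \<ominus>\<^bsub>M\<^esub> y \<in> U" using LU U(3) c by auto
      then show "x \<in> U" using M.submodule_minus_cancel[OF s(1) c(1) y(1)] by simp
    qed
    then show "U' = U" using U' by auto
  qed
qed

text \<open>The maps embed \<open>M\<close> into a finite power of \<open>N\<close>. The power
  itself is never formed: one map at a time is split off by \<open>noeth_kernel\<close>.\<close>

lemma noeth_jointly_injective: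
  assumes N: "noeth R N" and S: "finite S" and M: "module R M" and h: "\<And>s. s \<in> S \<Longrightarrow> lin R M N (h s)"
    and inj: "\<And>x. x \<in> carrier M \<Longrightarrow> (\<And>s. s \<in> S \<Longrightarrow> h s x = \<zero>\<^bsub>N\<^esub>) \<Longrightarrow> x = \<zero>\<^bsub>M\<^esub>"
  shows "noeth R M"
  using S M h inj
proof (induction S arbitrary: M)
  case empty
  interpret M: plain_module R M by (rule plain_moduleI[OF empty.prems(1)])
  show ?case by (rule noeth_zero_module[OF empty.prems(1)]) (use empty.prems(3) in auto)
next
  case (insert s S)
  interpret M: plain_module R M by (rule plain_moduleI[OF insert.prems(1)])
  interpret N: plain_module R N by (rule plain_moduleI[OF noeth_module[OF N]])
  let ?K = "{x \<in> carrier M. h s x = \<zero>\<^bsub>N\<^esub>}"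
  have sK: "submodule ?K R M"
    using submodule_lin_vimage[OF M.module_axioms N.module_axioms insert.prems(2) M.carrier_is_submodule
        N.submodule_zero_set] by simp
  have "noeth R (M\<lparr>carrier := ?K\<rparr>)"
  proof (rule insert.IH[OF M.module_restrict[OF sK]])
    show "lin R (M\<lparr>carrier := ?K\<rparr>) N (h t)" if "t \<in> S" for t
      using insert.prems(2) that by (intro lin_restrict_dom) auto
    show "x = \<zero>\<^bsub>M\<lparr>carrier := ?K\<rparr>\<^esub>"
      if "x \<in> carrier (M\<lparr>carrier := ?K\<rparr>)" "\<And>t. t \<in> S \<Longrightarrow> h t x = \<zero>\<^bsub>N\<^esub>" for x
      using that insert.prems(3)[of x] by auto
  qed
  then show ?case using noeth_kernel[OF M.module_axioms N insert.prems(2)[of s]] by simp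
qed

lemma Hom_module_simps:
  "carrier (Hom_module R M N) = mhom R M N"
  "\<zero>\<^bsub>Hom_module R M N\<^esub> = (\<lambda>x\<in>carrier M. \<zero>\<^bsub>N\<^esub>)"
  "f \<oplus>\<^bsub>Hom_module R M N\<^esub> g = (\<lambda>x\<in>carrier M. f x \<oplus>\<^bsub>N\<^esub> g x)"
  "r \<odot>\<^bsub>Hom_module R M N\<^esub> f = (\<lambda>x\<in>carrier M. r \<odot>\<^bsub>N\<^esub> f x)"
  by (simp_all add: Hom_module_def)

context
  fixes R :: "('a, 'r) ring_scheme" and M :: "('a, 'b) module" and N :: "('a, 'c) module"
  assumes M: "module R M" and N: "module R N"
begin

interpretation M: plain_module R M by (rule plain_moduleI[OF M])
interpretation N: plain_module R N by (rule plain_moduleI[OF N])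

lemma lin_pointwise_zero: "lin R M N (\<lambda>x. \<zero>\<^bsub>N\<^esub>)"
  by (rule linI) simp_all

lemma lin_pointwise_add: "lin R M N f \<Longrightarrow> lin R M N g \<Longrightarrow> lin R M N (\<lambda>x. f x \<oplus>\<^bsub>N\<^esub> g x)"
  by (rule linI) (simp_all add: lin_closed lin_add lin_smult N.smult_r_distr N.a_ac)

lemma lin_pointwise_smult: "r \<in> carrier R \<Longrightarrow> lin R M N f \<Longrightarrow> lin R M N (\<lambda>x. r \<odot>\<^bsub>N\<^esub> f x)"
  by (rule linI) (simp_all add: lin_closed lin_add lin_smult N.smult_r_distr N.smult_commute[of r])

lemma lin_pointwise_minus:
  assumes f: "lin R M N f" and g: "lin R M N g"
  shows "lin R M N (\<lambda>x. f x \<ominus>\<^bsub>N\<^esub> g x)"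
proof (rule linI)
  show "f x \<ominus>\<^bsub>N\<^esub> g x \<in> carrier N" if "x \<in> carrier M" for x using that f g by (simp add: lin_closed)
  show "f (x \<oplus>\<^bsub>M\<^esub> y) \<ominus>\<^bsub>N\<^esub> g (x \<oplus>\<^bsub>M\<^esub> y) = (f x \<ominus>\<^bsub>N\<^esub> g x) \<oplus>\<^bsub>N\<^esub> (f y \<ominus>\<^bsub>N\<^esub> g y)"
    if "x \<in> carrier M" "y \<in> carrier M" for x y
    using that f g by (simp add: lin_closed lin_add N.minus_add_distr)
  show "f (r \<odot>\<^bsub>M\<^esub> x) \<ominus>\<^bsub>N\<^esub> g (r \<odot>\<^bsub>M\<^esub> x) = r \<odot>\<^bsub>N\<^esub> (f x \<ominus>\<^bsub>N\<^esub> g x)"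
    if "r \<in> carrier R" "x \<in> carrier M" for r x
    using that f g by (simp add: lin_closed lin_smult N.smult_minus_distr)
qed

lemma module_Hom: "module R (Hom_module R M N)"
proof (rule moduleI)
  have ext: "f = g" if "f \<in> mhom R M N" "g \<in> mhom R M N" "\<And>x. x \<in> carrier M \<Longrightarrow> f x = g x" for f g
    using mhom_eqI[OF that] .
  have z: "(\<lambda>x\<in>carrier M. \<zero>\<^bsub>N\<^esub>) \<in> mhom R M N" by (rule restrict_mhom[OF M lin_pointwise_zero])
  have p: "(\<lambda>x\<in>carrier M. f x \<oplus>\<^bsub>N\<^esub> g x) \<in> mhom R M N" if "f \<in> mhom R M N" "g \<in> mhom R M N" for f g
    using that by (intro restrict_mhom[OF M] lin_pointwise_add mhom_lin)
  have s: "(\<lambda>x\<in>carrier M. r \<odot>\<^bsub>N\<^esub> f x) \<in> mhom R M N" if "r \<in> carrier R" "f \<in> mhom R M N" for r f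
    using that by (intro restrict_mhom[OF M] lin_pointwise_smult mhom_lin)
  have c: "f x \<in> carrier N" if "f \<in> mhom R M N" "x \<in> carrier M" for f x
    using lin_closed[OF mhom_lin[OF that(1)] that(2)] .
  show "cring R" by (rule M.R.is_cring)
  show "abelian_group (Hom_module R M N)"
  proof (rule abelian_groupI, unfold Hom_module_simps)
    show "(\<lambda>x\<in>carrier M. \<zero>\<^bsub>N\<^esub>) \<in> mhom R M N" by (rule z)
    fix f g h assume f: "f \<in> mhom R M N"
    show "(\<lambda>x\<in>carrier M. (\<lambda>x\<in>carrier M. \<zero>\<^bsub>N\<^esub>) x \<oplus>\<^bsub>N\<^esub> f x) = f"
      by (rule ext[OF p[OF z f] f]) (use c[OF f] in simp)
    show "\<exists>g\<in>mhom R M N. (\<lambda>x\<in>carrier M. g x \<oplus>\<^bsub>N\<^esub> f x) = (\<lambda>x\<in>carrier M. \<zero>\<^bsub>N\<^esub>)"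
    proof (rule bexI)
      show n: "(\<lambda>x\<in>carrier M. (\<ominus>\<^bsub>R\<^esub> \<one>\<^bsub>R\<^esub>) \<odot>\<^bsub>N\<^esub> f x) \<in> mhom R M N" by (rule s[OF _ f]) simp
      show "(\<lambda>x\<in>carrier M. (\<lambda>x\<in>carrier M. (\<ominus>\<^bsub>R\<^esub> \<one>\<^bsub>R\<^esub>) \<odot>\<^bsub>N\<^esub> f x) x \<oplus>\<^bsub>N\<^esub> f x) = (\<lambda>x\<in>carrier M. \<zero>\<^bsub>N\<^esub>)"
        by (rule ext[OF p[OF n f] z]) (use c[OF f] in \<open>simp add: N.smult_l_minus N.l_neg\<close>)
    qed
    assume g: "g \<in> mhom R M N"
    show fg: "(\<lambda>x\<in>carrier M. f x \<oplus>\<^bsub>N\<^esub> g x) \<in> mhom R M N" by (rule p[OF f g])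
    show "(\<lambda>x\<in>carrier M. f x \<oplus>\<^bsub>N\<^esub> g x) = (\<lambda>x\<in>carrier M. g x \<oplus>\<^bsub>N\<^esub> f x)"
      by (rule ext[OF fg p[OF g f]]) (use c[OF f] c[OF g] in \<open>simp add: N.a_comm\<close>)
    assume h: "h \<in> mhom R M N"
    show "(\<lambda>x\<in>carrier M. (\<lambda>x\<in>carrier M. f x \<oplus>\<^bsub>N\<^esub> g x) x \<oplus>\<^bsub>N\<^esub> h x) =
        (\<lambda>x\<in>carrier M. f x \<oplus>\<^bsub>N\<^esub> (\<lambda>x\<in>carrier M. g x \<oplus>\<^bsub>N\<^esub> h x) x)"
      by (rule ext[OF p[OF fg h] p[OF f p[OF g h]]]) (use c[OF f] c[OF g] c[OF h] in \<open>simp add: N.a_assoc\<close>)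
  qed
  fix r t f g
  show "f \<in> carrier (Hom_module R M N) \<Longrightarrow> r \<in> carrier R \<Longrightarrow> r \<odot>\<^bsub>Hom_module R M N\<^esub> f \<in> carrier (Hom_module R M N)"
    unfolding Hom_module_simps by (rule s)
  show "f \<in> carrier (Hom_module R M N) \<Longrightarrow> \<one>\<^bsub>R\<^esub> \<odot>\<^bsub>Hom_module R M N\<^esub> f = f"
    unfolding Hom_module_simps using c[of f] by (intro ext s) simp_all
  show "r \<in> carrier R \<Longrightarrow> t \<in> carrier R \<Longrightarrow> f \<in> carrier (Hom_module R M N) \<Longrightarrow>
      (r \<oplus>\<^bsub>R\<^esub> t) \<odot>\<^bsub>Hom_module R M N\<^esub> f = r \<odot>\<^bsub>Hom_module R M N\<^esub> f \<oplus>\<^bsub>Hom_module R M N\<^esub> t \<odot>\<^bsub>Hom_module R M N\<^esub> f"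
    unfolding Hom_module_simps using c[of f] by (intro ext s p) (auto simp: N.smult_l_distr)
  show "r \<in> carrier R \<Longrightarrow> f \<in> carrier (Hom_module R M N) \<Longrightarrow> g \<in> carrier (Hom_module R M N) \<Longrightarrow>
      r \<odot>\<^bsub>Hom_module R M N\<^esub> (f \<oplus>\<^bsub>Hom_module R M N\<^esub> g) = r \<odot>\<^bsub>Hom_module R M N\<^esub> f \<oplus>\<^bsub>Hom_module R M N\<^esub> r \<odot>\<^bsub>Hom_module R M N\<^esub> g"
    unfolding Hom_module_simps using c[of f] c[of g] by (intro ext s p) (auto simp: N.smult_r_distr)
  show "r \<in> carrier R \<Longrightarrow> t \<in> carrier R \<Longrightarrow> f \<in> carrier (Hom_module R M N) \<Longrightarrow>
      (r \<otimes>\<^bsub>R\<^esub> t) \<odot>\<^bsub>Hom_module R M N\<^esub> f = r \<odot>\<^bsub>Hom_module R M N\<^esub> (t \<odot>\<^bsub>Hom_module R M N\<^esub> f)"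
    unfolding Hom_module_simps using c[of f] by (intro ext s) (auto simp: N.smult_assoc1)
qed

lemma lin_eval: "x \<in> carrier M \<Longrightarrow> lin R (Hom_module R M N) N (\<lambda>f. f x)"
  by (rule linI) (auto simp: Hom_module_simps lin_closed[OF mhom_lin])

lemma lin_kernel: "lin R M N f \<Longrightarrow> submodule {x \<in> carrier M. f x = \<zero>\<^bsub>N\<^esub>} R M"
  using submodule_lin_vimage[OF M N _ M.carrier_is_submodule N.submodule_zero_set] by simp

lemma lin_equalizer:
  assumes f: "lin R M N f" and g: "lin R M N g"
  shows "submodule {x \<in> carrier M. f x = g x} R M"
proof -
  have "{x \<in> carrier M. f x = g x} = {x \<in> carrier M. f x \<ominus>\<^bsub>N\<^esub> g x = \<zero>\<^bsub>N\<^esub>}"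
    using lin_closed[OF f] lin_closed[OF g] N.minus_eq_zero_iff by auto
  then show ?thesis using lin_kernel[OF lin_pointwise_minus[OF f g]] by simp
qed

text \<open>A homomorphism is determined by its values at finitely many generators of
  \<open>M\<close>, so the evaluations there are jointly injective.\<close>

lemma noeth_Hom:
  assumes nM: "noeth R M" and nN: "noeth R N"
  shows "noeth R (Hom_module R M N)"
proof -
  obtain S where S: "finite S" "S \<subseteq> carrier M" "mspan R M S = carrier M"
    by (rule noeth_generators[OF nM M.carrier_is_submodule])
  show ?thesis
  proof (rule noeth_jointly_injective[OF nN S(1) module_Hom])
    show "lin R (Hom_module R M N) N (\<lambda>f. f s)" if "s \<in> S" for s using lin_eval S that by blast
    fix f assume "f \<in> carrier (Hom_module R M N)" and z: "\<And>s. s \<in> S \<Longrightarrow> f s = \<zero>\<^bsub>N\<^esub>"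
    then have f: "f \<in> mhom R M N" by (simp add: Hom_module_simps)
    have "mspan R M S \<subseteq> {x \<in> carrier M. f x = \<zero>\<^bsub>N\<^esub>}"
      using z S(2) by (intro M.mspan_least lin_kernel[OF mhom_lin[OF f]]) auto
    then have "f x = \<zero>\<^bsub>N\<^esub>" if "x \<in> carrier M" for x using S(3) that by auto
    then show "f = \<zero>\<^bsub>Hom_module R M N\<^esub>"
      unfolding Hom_module_simps
      by (intro mhom_eqI[OF f restrict_mhom[OF M lin_pointwise_zero]]) simp
  qed
qed

end

lemma (in plain_module) minus_eq_minus_imp:
  assumes c: "x \<in> carrier M" "y \<in> carrier M" "u \<in> carrier M" "v \<in> carrier M" and eq: "x \<ominus>\<^bsub>M\<^esub> y = u \<ominus>\<^bsub>M\<^esub> v"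
  shows "v \<oplus>\<^bsub>M\<^esub> x = u \<oplus>\<^bsub>M\<^esub> y"
proof -
  have "v \<oplus>\<^bsub>M\<^esub> x = v \<oplus>\<^bsub>M\<^esub> ((u \<ominus>\<^bsub>M\<^esub> v) \<oplus>\<^bsub>M\<^esub> y)"
    unfolding eq[symmetric] minus_add_cancel[OF c(1,2)] ..
  also have "\<dots> = ((u \<ominus>\<^bsub>M\<^esub> v) \<oplus>\<^bsub>M\<^esub> v) \<oplus>\<^bsub>M\<^esub> y"
    using c minus_closed'[OF c(3,4)] by (simp only: M.a_ac M.a_closed)
  also have "\<dots> = u \<oplus>\<^bsub>M\<^esub> y" unfolding minus_add_cancel[OF c(3,4)] ..
  finally show ?thesis .
qed

text \<open>Serves two kinds of extension: \<open>C\<close> is \<open>R\<close>, mapped by r to r x,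
  when one element x is adjoined to the domain; it is a free module, mapped by multiplication by
  \<open>a\<close>, when a map is to vanish on multiples of \<open>a\<close>.\<close>

lemma lin_glue:
  fixes Z :: "('a, 'b) module" and C :: "('a, 'e) module" and N :: "('a, 'c) module"
  assumes Z: "module R Z" and C: "module R C" and N: "module R N" and B: "submodule B R Z"
    and i: "lin R C Z i" and g: "lin R (Z\<lparr>carrier := B\<rparr>) N g" and h: "lin R C N h"
    and agree: "\<And>c. c \<in> carrier C \<Longrightarrow> i c \<in> B \<Longrightarrow> g (i c) = h c"
  obtains g' where "lin R (Z\<lparr>carrier := B <+>\<^bsub>Z\<^esub> i ` carrier C\<rparr>) N g'" "\<And>b. b \<in> B \<Longrightarrow> g' b = g b"
    "\<And>c. c \<in> carrier C \<Longrightarrow> g' (i c) = h c"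
proof -
  interpret Z: plain_module R Z by (rule plain_moduleI[OF Z])
  interpret C: plain_module R C by (rule plain_moduleI[OF C])
  interpret N: plain_module R N by (rule plain_moduleI[OF N])
  note Bc = Z.submodule_mem[OF B]
  have gB: "g b \<in> carrier N" if "b \<in> B" for b using lin_closed[OF g] that by simp
  have gadd: "g (b \<oplus>\<^bsub>Z\<^esub> b') = g b \<oplus>\<^bsub>N\<^esub> g b'" if "b \<in> B" "b' \<in> B" for b b' using lin_add[OF g] that by simp
  have gsmult: "g (r \<odot>\<^bsub>Z\<^esub> b) = r \<odot>\<^bsub>N\<^esub> g b" if "r \<in> carrier R" "b \<in> B" for r b using lin_smult[OF g] that by simp
  have gneg: "g (\<ominus>\<^bsub>Z\<^esub> b) = \<ominus>\<^bsub>N\<^esub> g b" if b: "b \<in> B" for b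
  proof -
    have n: "\<ominus>\<^bsub>Z\<^esub> b = (\<ominus>\<^bsub>R\<^esub> \<one>\<^bsub>R\<^esub>) \<odot>\<^bsub>Z\<^esub> b" using Bc[OF b] by (simp add: Z.smult_l_minus)
    show ?thesis unfolding n using gsmult[of "\<ominus>\<^bsub>R\<^esub> \<one>\<^bsub>R\<^esub>" b] b gB[OF b] by (simp add: N.smult_l_minus)
  qed
  \<comment> \<open>Well defined because two representations of an element give
    \<open>i (c' - c) = b - b'\<close> in \<open>B\<close>, where \<open>g\<close> and
    \<open>h\<close> agree.\<close>
  define g' where "g' y = (THE v. \<exists>b\<in>B. \<exists>c\<in>carrier C. y = b \<oplus>\<^bsub>Z\<^esub> i c \<and> v = g b \<oplus>\<^bsub>N\<^esub> h c)" for y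
  have g': "g' (b \<oplus>\<^bsub>Z\<^esub> i c) = g b \<oplus>\<^bsub>N\<^esub> h c" if b: "b \<in> B" and c: "c \<in> carrier C" for b c
    unfolding g'_def
  proof (rule the_equality)
    show "\<exists>b'\<in>B. \<exists>c'\<in>carrier C. b \<oplus>\<^bsub>Z\<^esub> i c = b' \<oplus>\<^bsub>Z\<^esub> i c' \<and> g b \<oplus>\<^bsub>N\<^esub> h c = g b' \<oplus>\<^bsub>N\<^esub> h c'"
      using b c by blast
    fix v assume "\<exists>b'\<in>B. \<exists>c'\<in>carrier C. b \<oplus>\<^bsub>Z\<^esub> i c = b' \<oplus>\<^bsub>Z\<^esub> i c' \<and> v = g b' \<oplus>\<^bsub>N\<^esub> h c'"
    then obtain b' c' where *: "b' \<in> B" "c' \<in> carrier C" "b \<oplus>\<^bsub>Z\<^esub> i c = b' \<oplus>\<^bsub>Z\<^esub> i c'" "v = g b' \<oplus>\<^bsub>N\<^esub> h c'"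
      by blast
    have cl: "i c \<in> carrier Z" "i c' \<in> carrier Z" "h c \<in> carrier N" "h c' \<in> carrier N"
      using c * lin_closed[OF i] lin_closed[OF h] by auto
    have eq: "i (c' \<ominus>\<^bsub>C\<^esub> c) = b \<ominus>\<^bsub>Z\<^esub> b'"
    proof -
      have "(b \<ominus>\<^bsub>Z\<^esub> b') \<oplus>\<^bsub>Z\<^esub> i c = (b \<oplus>\<^bsub>Z\<^esub> i c) \<ominus>\<^bsub>Z\<^esub> b'"
        using Bc[OF b] Bc[OF *(1)] cl(1) by (simp add: a_minus_def Z.a_ac)
      also have "\<dots> = i c'" unfolding *(3) using Bc * cl by (simp add: Z.add_minus_cancel_left)
      finally have "b \<ominus>\<^bsub>Z\<^esub> b' = i c' \<ominus>\<^bsub>Z\<^esub> i c"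
        using Z.add_minus_cancel[of "b \<ominus>\<^bsub>Z\<^esub> b'" "i c"] Bc b * cl by simp
      then show ?thesis using lin_minus[OF C Z i] c * by simp
    qed
    have "h (c' \<ominus>\<^bsub>C\<^esub> c) = g (b \<ominus>\<^bsub>Z\<^esub> b')"
      using agree[of "c' \<ominus>\<^bsub>C\<^esub> c"] eq Z.submodule_minus[OF B] b c * by simp
    also have "\<dots> = g b \<ominus>\<^bsub>N\<^esub> g b'"
      using gadd gneg b * Z.submodule_neg[OF B] by (simp add: a_minus_def)
    finally have "h c' \<ominus>\<^bsub>N\<^esub> h c = g b \<ominus>\<^bsub>N\<^esub> g b'" using lin_minus[OF C N h] c * by simp
    then have "g b' \<oplus>\<^bsub>N\<^esub> h c' = g b \<oplus>\<^bsub>N\<^esub> h c"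
      by (rule N.minus_eq_minus_imp[OF cl(4,3) gB[OF b] gB[OF *(1)]])
    then show "v = g b \<oplus>\<^bsub>N\<^esub> h c" using *(4) by simp
  qed
  have lin: "lin R (Z\<lparr>carrier := B <+>\<^bsub>Z\<^esub> i ` carrier C\<rparr>) N g'"
  proof (rule linI)
    fix x y r assume "x \<in> carrier (Z\<lparr>carrier := B <+>\<^bsub>Z\<^esub> i ` carrier C\<rparr>)"
    then obtain b c where x: "b \<in> B" "c \<in> carrier C" "x = b \<oplus>\<^bsub>Z\<^esub> i c" by (auto simp: Z.mem_set_add)
    note cx = Bc[OF x(1)] lin_closed[OF i x(2)] gB[OF x(1)] lin_closed[OF h x(2)]
    show "g' x \<in> carrier N" using x cx g' by simp
    show "g' (r \<odot>\<^bsub>Z\<lparr>carrier := B <+>\<^bsub>Z\<^esub> i ` carrier C\<rparr>\<^esub> x) = r \<odot>\<^bsub>N\<^esub> g' x" if r: "r \<in> carrier R"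
    proof -
      have "r \<odot>\<^bsub>Z\<^esub> x = r \<odot>\<^bsub>Z\<^esub> b \<oplus>\<^bsub>Z\<^esub> i (r \<odot>\<^bsub>C\<^esub> c)"
        using x cx r lin_smult[OF i r x(2)] by (simp add: Z.smult_r_distr)
      then show ?thesis
        using g'[OF Z.submodule_smult[OF B r x(1)] C.smult_closed[OF r x(2)]] g'[OF x(1,2)] x cx r
          gsmult[OF r x(1)] lin_smult[OF h r x(2)] by (simp add: N.smult_r_distr)
    qed
    assume "y \<in> carrier (Z\<lparr>carrier := B <+>\<^bsub>Z\<^esub> i ` carrier C\<rparr>)"
    then obtain b' c' where y: "b' \<in> B" "c' \<in> carrier C" "y = b' \<oplus>\<^bsub>Z\<^esub> i c'" by (auto simp: Z.mem_set_add)
    note cy = Bc[OF y(1)] lin_closed[OF i y(2)] gB[OF y(1)] lin_closed[OF h y(2)]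
    have "x \<oplus>\<^bsub>Z\<^esub> y = (b \<oplus>\<^bsub>Z\<^esub> b') \<oplus>\<^bsub>Z\<^esub> i (c \<oplus>\<^bsub>C\<^esub> c')"
      using x y cx cy lin_add[OF i x(2) y(2)] by (simp add: Z.a_ac)
    then show "g' (x \<oplus>\<^bsub>Z\<lparr>carrier := B <+>\<^bsub>Z\<^esub> i ` carrier C\<rparr>\<^esub> y) = g' x \<oplus>\<^bsub>N\<^esub> g' y"
      using g'[OF Z.submodule_add[OF B x(1) y(1)] C.M.a_closed[OF x(2) y(2)]] g'[OF x(1,2)] g'[OF y(1,2)]
        x y cx cy gadd[OF x(1) y(1)] lin_add[OF h x(2) y(2)] by (simp add: N.a_ac)
  qed
  show ?thesis
  proof (rule that[OF lin])
    show "g' b = g b" if b: "b \<in> B" for b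
      using g'[OF b C.M.zero_closed] lin_zero[OF C Z i] lin_zero[OF C N h] Bc[OF b] gB[OF b] by simp
    have z: "g \<zero>\<^bsub>Z\<^esub> = \<zero>\<^bsub>N\<^esub>"
      using lin_zero[OF Z.module_restrict[OF B] N g] by simp
    show "g' (i c) = h c" if c: "c \<in> carrier C" for c
      using g'[OF Z.submodule_zero[OF B] c] z lin_closed[OF i c] lin_closed[OF h c] by simp
  qed
qed

lemma lin_descend:
  fixes F :: "('a, 'b) module" and M :: "('a, 'd) module" and N :: "('a, 'c) module"
  assumes F: "module R F" and M: "module R M" and N: "module R N" and q: "lin R F M q"
    and surj: "\<And>x. x \<in> carrier M \<Longrightarrow> \<exists>c\<in>carrier F. q c = x"
    and L: "lin R F N L" and ker: "\<And>c. c \<in> carrier F \<Longrightarrow> q c = \<zero>\<^bsub>M\<^esub> \<Longrightarrow> L c = \<zero>\<^bsub>N\<^esub>"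
  obtains f where "lin R M N f" "\<And>c. c \<in> carrier F \<Longrightarrow> f (q c) = L c"
proof -
  interpret F: plain_module R F by (rule plain_moduleI[OF F])
  interpret M: plain_module R M by (rule plain_moduleI[OF M])
  interpret N: plain_module R N by (rule plain_moduleI[OF N])
  have eq: "L c = L c'" if c: "c \<in> carrier F" "c' \<in> carrier F" "q c = q c'" for c c'
  proof -
    have "q (c \<ominus>\<^bsub>F\<^esub> c') = \<zero>\<^bsub>M\<^esub>"
      using c lin_closed[OF q] by (simp add: lin_minus[OF F M q] M.minus_eq_zero_iff)
    then have "L (c \<ominus>\<^bsub>F\<^esub> c') = \<zero>\<^bsub>N\<^esub>" using ker c by simp
    then show ?thesis using c lin_closed[OF L] by (simp add: lin_minus[OF F N L] N.minus_eq_zero_iff)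
  qed
  define f where "f x = L (SOME c. c \<in> carrier F \<and> q c = x)" for x
  have f: "f (q c) = L c" if c: "c \<in> carrier F" for c
  proof -
    have "(SOME c'. c' \<in> carrier F \<and> q c' = q c) \<in> carrier F \<and> q (SOME c'. c' \<in> carrier F \<and> q c' = q c) = q c"
      by (rule someI[of _ c]) (use c in simp)
    then show ?thesis unfolding f_def using eq c by blast
  qed
  have "lin R M N f"
  proof (rule linI)
    fix x y r assume "x \<in> carrier M"
    then obtain c where x: "c \<in> carrier F" "x = q c" using surj by blast
    show "f x \<in> carrier N" using x f lin_closed[OF L] by simp
    show "f (r \<odot>\<^bsub>M\<^esub> x) = r \<odot>\<^bsub>N\<^esub> f x" if r: "r \<in> carrier R"
      using f[of "r \<odot>\<^bsub>F\<^esub> c"] f[of c] x r by (simp add: lin_smult[OF q] lin_smult[OF L])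
    assume "y \<in> carrier M"
    then obtain c' where y: "c' \<in> carrier F" "y = q c'" using surj by blast
    show "f (x \<oplus>\<^bsub>M\<^esub> y) = f x \<oplus>\<^bsub>N\<^esub> f y"
      using f[of "c \<oplus>\<^bsub>F\<^esub> c'"] f[of c] f[of c'] x y by (simp add: lin_add[OF q] lin_add[OF L])
  qed
  then show ?thesis using that f by blast
qed

lemma (in plain_module) submodule_annihilated:
  assumes I: "I \<subseteq> carrier R"
  shows "submodule {z \<in> carrier M. \<forall>r\<in>I. r \<odot>\<^bsub>M\<^esub> z = \<zero>\<^bsub>M\<^esub>} R M"
proof (rule submodule_criterion)
  have rc: "r \<in> carrier R" if "r \<in> I" for r using that I by auto
  show "\<zero>\<^bsub>M\<^esub> \<in> {z \<in> carrier M. \<forall>r\<in>I. r \<odot>\<^bsub>M\<^esub> z = \<zero>\<^bsub>M\<^esub>}" using rc by simp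
  show "x \<oplus>\<^bsub>M\<^esub> y \<in> {z \<in> carrier M. \<forall>r\<in>I. r \<odot>\<^bsub>M\<^esub> z = \<zero>\<^bsub>M\<^esub>}"
    if "x \<in> {z \<in> carrier M. \<forall>r\<in>I. r \<odot>\<^bsub>M\<^esub> z = \<zero>\<^bsub>M\<^esub>}" "y \<in> {z \<in> carrier M. \<forall>r\<in>I. r \<odot>\<^bsub>M\<^esub> z = \<zero>\<^bsub>M\<^esub>}" for x y
    using that rc by (simp add: smult_r_distr)
  show "t \<odot>\<^bsub>M\<^esub> x \<in> {z \<in> carrier M. \<forall>r\<in>I. r \<odot>\<^bsub>M\<^esub> z = \<zero>\<^bsub>M\<^esub>}"
    if "t \<in> carrier R" "x \<in> {z \<in> carrier M. \<forall>r\<in>I. r \<odot>\<^bsub>M\<^esub> z = \<zero>\<^bsub>M\<^esub>}" for t x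
    using that rc by (simp add: smult_commute[of _ t])
qed auto

lemma lin_evaluation:
  assumes M: "module R M" and N: "module R N"
  shows "lin R M (Hom_module R (Hom_module R M N) N) (\<lambda>x. \<lambda>f\<in>carrier (Hom_module R M N). f x)"
proof (rule linI)
  show "(\<lambda>f\<in>carrier (Hom_module R M N). f x) \<in> carrier (Hom_module R (Hom_module R M N) N)" if "x \<in> carrier M" for x
    using restrict_mhom[OF module_Hom[OF M N] lin_eval[OF M N that]] by (simp add: Hom_module_simps(1))
  show "(\<lambda>f\<in>carrier (Hom_module R M N). f (x \<oplus>\<^bsub>M\<^esub> y)) =
      (\<lambda>f\<in>carrier (Hom_module R M N). f x) \<oplus>\<^bsub>Hom_module R (Hom_module R M N) N\<^esub> (\<lambda>f\<in>carrier (Hom_module R M N). f y)"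
    if "x \<in> carrier M" "y \<in> carrier M" for x y
    unfolding Hom_module_simps(3) by (rule restrict_ext) (simp add: Hom_module_simps(1) lin_add[OF mhom_lin that])
  show "(\<lambda>f\<in>carrier (Hom_module R M N). f (r \<odot>\<^bsub>M\<^esub> x)) =
      r \<odot>\<^bsub>Hom_module R (Hom_module R M N) N\<^esub> (\<lambda>f\<in>carrier (Hom_module R M N). f x)"
    if "r \<in> carrier R" "x \<in> carrier M" for r x
    unfolding Hom_module_simps(4) by (rule restrict_ext) (simp add: Hom_module_simps(1) lin_smult[OF mhom_lin that])
qed

section \<open>Finite free modules\<close>

definition fun_module :: "('a, 'r) ring_scheme \<Rightarrow> 'b set \<Rightarrow> ('a, 'b \<Rightarrow> 'a) module" where
  "fun_module R S = \<lparr>carrier = S \<rightarrow>\<^sub>E carrier R, monoid.mult = undefined, one = undefined,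
     ring.zero = (\<lambda>x\<in>S. \<zero>\<^bsub>R\<^esub>), add = (\<lambda>f g. \<lambda>x\<in>S. f x \<oplus>\<^bsub>R\<^esub> g x),
     smult = (\<lambda>r f. \<lambda>x\<in>S. r \<otimes>\<^bsub>R\<^esub> f x)\<rparr>"

definition fun_unit :: "('a, 'r) ring_scheme \<Rightarrow> 'b set \<Rightarrow> 'b \<Rightarrow> 'b \<Rightarrow> 'a" where
  "fun_unit R S x = (\<lambda>y\<in>S. if y = x then \<one>\<^bsub>R\<^esub> else \<zero>\<^bsub>R\<^esub>)"

lemma fun_module_simps:
  "carrier (fun_module R S) = S \<rightarrow>\<^sub>E carrier R"
  "\<zero>\<^bsub>fun_module R S\<^esub> = (\<lambda>x\<in>S. \<zero>\<^bsub>R\<^esub>)"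
  "f \<oplus>\<^bsub>fun_module R S\<^esub> g = (\<lambda>x\<in>S. f x \<oplus>\<^bsub>R\<^esub> g x)"
  "r \<odot>\<^bsub>fun_module R S\<^esub> f = (\<lambda>x\<in>S. r \<otimes>\<^bsub>R\<^esub> f x)"
  by (simp_all add: fun_module_def)

context cring
begin

lemma module_fun: "module R (fun_module R S)"
proof (rule moduleI)
  have ext: "f = g" if "f \<in> S \<rightarrow>\<^sub>E carrier R" "g \<in> S \<rightarrow>\<^sub>E carrier R" "\<And>x. x \<in> S \<Longrightarrow> f x = g x" for f g
    using PiE_ext[OF that] .
  have c: "f x \<in> carrier R" if "f \<in> S \<rightarrow>\<^sub>E carrier R" "x \<in> S" for f x using PiE_mem[OF that] .
  show "abelian_group (fun_module R S)"
  proof (rule abelian_groupI, unfold fun_module_simps)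
    fix f g h assume f: "f \<in> S \<rightarrow>\<^sub>E carrier R"
    show "(\<lambda>x\<in>S. (\<lambda>x\<in>S. \<zero>) x \<oplus> f x) = f" by (rule ext[OF _ f]) (use c[OF f] in auto)
    show "\<exists>g\<in>S \<rightarrow>\<^sub>E carrier R. (\<lambda>x\<in>S. g x \<oplus> f x) = (\<lambda>x\<in>S. \<zero>)"
      by (rule bexI[of _ "\<lambda>x\<in>S. \<ominus> f x"]) (use c[OF f] in \<open>auto simp: l_neg cong: restrict_cong\<close>)
    assume g: "g \<in> S \<rightarrow>\<^sub>E carrier R"
    show "(\<lambda>x\<in>S. f x \<oplus> g x) \<in> S \<rightarrow>\<^sub>E carrier R" using c[OF f] c[OF g] by auto
    show "(\<lambda>x\<in>S. f x \<oplus> g x) = (\<lambda>x\<in>S. g x \<oplus> f x)"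
      using c[OF f] c[OF g] by (auto simp: a_comm cong: restrict_cong)
    assume h: "h \<in> S \<rightarrow>\<^sub>E carrier R"
    show "(\<lambda>x\<in>S. (\<lambda>x\<in>S. f x \<oplus> g x) x \<oplus> h x) = (\<lambda>x\<in>S. f x \<oplus> (\<lambda>x\<in>S. g x \<oplus> h x) x)"
      using c[OF f] c[OF g] c[OF h] by (auto simp: a_assoc cong: restrict_cong)
  qed auto
  fix r t f g
  show "f \<in> carrier (fun_module R S) \<Longrightarrow> r \<in> carrier R \<Longrightarrow> r \<odot>\<^bsub>fun_module R S\<^esub> f \<in> carrier (fun_module R S)"
    unfolding fun_module_simps using c by auto
  show "f \<in> carrier (fun_module R S) \<Longrightarrow> \<one> \<odot>\<^bsub>fun_module R S\<^esub> f = f"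
    unfolding fun_module_simps using c[of f] by (intro ext) auto
  show "r \<in> carrier R \<Longrightarrow> t \<in> carrier R \<Longrightarrow> f \<in> carrier (fun_module R S) \<Longrightarrow>
      (r \<oplus> t) \<odot>\<^bsub>fun_module R S\<^esub> f = r \<odot>\<^bsub>fun_module R S\<^esub> f \<oplus>\<^bsub>fun_module R S\<^esub> t \<odot>\<^bsub>fun_module R S\<^esub> f"
    unfolding fun_module_simps using c[of f] by (intro ext) (auto simp: l_distr)
  show "r \<in> carrier R \<Longrightarrow> f \<in> carrier (fun_module R S) \<Longrightarrow> g \<in> carrier (fun_module R S) \<Longrightarrow>
      r \<odot>\<^bsub>fun_module R S\<^esub> (f \<oplus>\<^bsub>fun_module R S\<^esub> g) = r \<odot>\<^bsub>fun_module R S\<^esub> f \<oplus>\<^bsub>fun_module R S\<^esub> r \<odot>\<^bsub>fun_module R S\<^esub> g"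
    unfolding fun_module_simps using c[of f] c[of g] by (intro ext) (auto simp: r_distr)
  show "r \<in> carrier R \<Longrightarrow> t \<in> carrier R \<Longrightarrow> f \<in> carrier (fun_module R S) \<Longrightarrow>
      (r \<otimes> t) \<odot>\<^bsub>fun_module R S\<^esub> f = r \<odot>\<^bsub>fun_module R S\<^esub> (t \<odot>\<^bsub>fun_module R S\<^esub> f)"
    unfolding fun_module_simps using c[of f] by (intro ext) (auto simp: m_assoc)
qed (rule is_cring)

lemma noeth_fun:
  assumes R: "noeth R (self_module R)" and S: "finite S"
  shows "noeth R (fun_module R S)"
proof (rule noeth_jointly_injective[OF R S module_fun, where h = "\<lambda>s f. f s"])
  show "lin R (fun_module R S) (self_module R) (\<lambda>f. f s)" if "s \<in> S" for s
    using that by (intro linI) (auto simp: fun_module_simps)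
  show "f = \<zero>\<^bsub>fun_module R S\<^esub>"
    if "f \<in> carrier (fun_module R S)" "\<And>s. s \<in> S \<Longrightarrow> f s = \<zero>\<^bsub>self_module R\<^esub>" for f
    using that unfolding fun_module_simps by (intro PiE_ext[of f S "\<lambda>_. carrier R"]) auto
qed

lemma fun_unit_closed: "fun_unit R S x \<in> carrier (fun_module R S)"
  by (auto simp: fun_unit_def fun_module_simps)

text \<open>Induction on a set \<open>T\<close> that contains the support: one coordinate at a time
  is cleared by subtracting a multiple of a unit vector.\<close>

lemma fun_module_generated:
  assumes S: "finite S" and N: "submodule N R (fun_module R S)"
    and units: "\<And>x. x \<in> S \<Longrightarrow> fun_unit R S x \<in> N" and c: "c \<in> carrier (fun_module R S)"
  shows "c \<in> N"
proof -
  interpret F: plain_module R "fun_module R S" by (rule plain_moduleI[OF module_fun])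
  have "c \<in> N" if "finite T" "T \<subseteq> S" "c \<in> carrier (fun_module R S)" "\<And>x. x \<in> S - T \<Longrightarrow> c x = \<zero>" for T c
    using that
  proof (induction T arbitrary: c)
    case empty
    then have "c = \<zero>\<^bsub>fun_module R S\<^esub>"
      unfolding fun_module_simps by (intro PiE_ext[of c S "\<lambda>_. carrier R"]) auto
    then show ?case using F.submodule_zero[OF N] by simp
  next
    case (insert x T)
    have cc: "c y \<in> carrier R" if "y \<in> S" for y
      using insert.prems(2) that unfolding fun_module_simps by (rule PiE_mem)
    define d where "d = (\<lambda>y\<in>S. if y = x then \<zero> else c y)"
    have d: "d \<in> carrier (fun_module R S)" using cc by (auto simp: d_def fun_module_simps)
    have dN: "d \<in> N"
    proof (rule insert.IH[OF _ d])
      show "T \<subseteq> S" using insert.prems by auto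
      show "d y = \<zero>" if "y \<in> S - T" for y using insert.prems(3)[of y] that by (auto simp: d_def)
    qed
    have xS: "x \<in> S" using insert.prems by auto
    have "c = d \<oplus>\<^bsub>fun_module R S\<^esub> c x \<odot>\<^bsub>fun_module R S\<^esub> fun_unit R S x"
    proof (rule PiE_ext[of _ S "\<lambda>_. carrier R"])
      show "c \<in> S \<rightarrow>\<^sub>E carrier R" using insert.prems(2) by (simp add: fun_module_simps)
      show "d \<oplus>\<^bsub>fun_module R S\<^esub> c x \<odot>\<^bsub>fun_module R S\<^esub> fun_unit R S x \<in> S \<rightarrow>\<^sub>E carrier R"
        using F.M.a_closed[OF d F.smult_closed[OF cc[OF xS] fun_unit_closed]] by (simp add: fun_module_simps(1))
      show "c y = (d \<oplus>\<^bsub>fun_module R S\<^esub> c x \<odot>\<^bsub>fun_module R S\<^esub> fun_unit R S x) y" if "y \<in> S" for y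
        using that cc xS by (auto simp: fun_module_simps d_def fun_unit_def)
    qed
    then show ?case
      using F.submodule_add[OF N dN F.submodule_smult[OF N cc[OF xS] units[OF xS]]] by simp
  qed
  from this[OF S subset_refl c] show ?thesis by blast
qed

end

text \<open>The vectors \<open>v\<close> are indexed by \<open>S\<close> instead of being its
  elements, so that the same map serves for generators of a module and for chosen preimages of
  them.\<close>

definition lincomb :: "('a, 'b) module \<Rightarrow> 'c set \<Rightarrow> ('c \<Rightarrow> 'b) \<Rightarrow> ('c \<Rightarrow> 'a) \<Rightarrow> 'b" where
  "lincomb M S v c = (\<Oplus>\<^bsub>M\<^esub>x\<in>S. c x \<odot>\<^bsub>M\<^esub> v x)"

context plain_module
begin

lemma lin_lincomb:
  assumes S: "finite S" and v: "\<And>x. x \<in> S \<Longrightarrow> v x \<in> carrier M"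
  shows "lin R (fun_module R S) M (lincomb M S v)"
proof (rule linI)
  have t: "(\<lambda>x. c x \<odot>\<^bsub>M\<^esub> v x) \<in> S \<rightarrow> carrier M" if "c \<in> carrier (fun_module R S)" for c
    using that v by (auto simp: fun_module_simps)
  show "lincomb M S v c \<in> carrier M" if "c \<in> carrier (fun_module R S)" for c
    unfolding lincomb_def by (rule M.finsum_closed[OF t[OF that]])
  show "lincomb M S v (c \<oplus>\<^bsub>fun_module R S\<^esub> d) = lincomb M S v c \<oplus>\<^bsub>M\<^esub> lincomb M S v d"
    if c: "c \<in> carrier (fun_module R S)" and d: "d \<in> carrier (fun_module R S)" for c d
  proof -
    have "lincomb M S v (c \<oplus>\<^bsub>fun_module R S\<^esub> d) = (\<Oplus>\<^bsub>M\<^esub>x\<in>S. c x \<odot>\<^bsub>M\<^esub> v x \<oplus>\<^bsub>M\<^esub> d x \<odot>\<^bsub>M\<^esub> v x)"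
      unfolding lincomb_def
      using t[OF c] t[OF d] c d v by (intro M.finsum_cong') (auto simp: fun_module_simps smult_l_distr PiE_iff)
    also have "\<dots> = lincomb M S v c \<oplus>\<^bsub>M\<^esub> lincomb M S v d"
      unfolding lincomb_def by (rule M.finsum_addf[OF t[OF c] t[OF d]])
    finally show ?thesis .
  qed
  show "lincomb M S v (r \<odot>\<^bsub>fun_module R S\<^esub> c) = r \<odot>\<^bsub>M\<^esub> lincomb M S v c"
    if r: "r \<in> carrier R" and c: "c \<in> carrier (fun_module R S)" for r c
  proof -
    have "lincomb M S v (r \<odot>\<^bsub>fun_module R S\<^esub> c) = (\<Oplus>\<^bsub>M\<^esub>x\<in>S. r \<odot>\<^bsub>M\<^esub> (c x \<odot>\<^bsub>M\<^esub> v x))"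
      unfolding lincomb_def
      using t[OF c] r c v by (intro M.finsum_cong') (auto simp: fun_module_simps smult_assoc1 PiE_iff)
    also have "\<dots> = r \<odot>\<^bsub>M\<^esub> lincomb M S v c"
      unfolding lincomb_def by (rule finsum_smult_ldistr[OF S r t[OF c], symmetric])
    finally show ?thesis .
  qed
qed

lemma lincomb_unit:
  assumes S: "finite S" and v: "\<And>x. x \<in> S \<Longrightarrow> v x \<in> carrier M" and x: "x \<in> S"
  shows "lincomb M S v (fun_unit R S x) = v x"
proof -
  have "lincomb M S v (fun_unit R S x) = (\<Oplus>\<^bsub>M\<^esub>y\<in>S. if x = y then v y else \<zero>\<^bsub>M\<^esub>)"
    unfolding lincomb_def using v by (intro M.finsum_cong') (auto simp: fun_unit_def)
  also have "\<dots> = v x" by (rule M.finsum_singleton[OF x S]) (use v in auto)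
  finally show ?thesis .
qed

end

section \<open>Quotient modules\<close>

locale module_quotient = plain_module R M
  for R :: "('a, 'r) ring_scheme" (structure) and M :: "('a, 'b) module" (structure) +
  fixes A :: "'b set"
  assumes A: "submodule A R M"
begin

abbreviation Q :: "('a, 'b set) module" where "Q \<equiv> quot_module M A"

abbreviation proj :: "'b \<Rightarrow> 'b set" where "proj x \<equiv> A +>\<^bsub>M\<^esub> x"

lemma mem_proj: "y \<in> proj x \<longleftrightarrow> (\<exists>h\<in>A. y = h \<oplus>\<^bsub>M\<^esub> x)"
  by (auto simp: a_r_coset_def')

lemma proj_self: "x \<in> carrier M \<Longrightarrow> x \<in> proj x"
  unfolding mem_proj using submodule_zero[OF A] by (intro bexI[of _ "\<zero>\<^bsub>M\<^esub>"]) simp_all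

lemma proj_eq_iff:
  assumes x: "x \<in> carrier M" and y: "y \<in> carrier M"
  shows "proj x = proj y \<longleftrightarrow> x \<ominus>\<^bsub>M\<^esub> y \<in> A"
proof
  assume "proj x = proj y"
  then obtain h where h: "h \<in> A" "x = h \<oplus>\<^bsub>M\<^esub> y" using proj_self[OF x] mem_proj by blast
  then show "x \<ominus>\<^bsub>M\<^esub> y \<in> A" using add_minus_cancel[OF submodule_mem[OF A h(1)] y] by simp
next
  have sub: "proj x \<subseteq> proj y" if "x \<in> carrier M" "y \<in> carrier M" "x \<ominus>\<^bsub>M\<^esub> y \<in> A" for x y
  proof
    fix u assume "u \<in> proj x"
    then obtain h where h: "h \<in> A" "u = h \<oplus>\<^bsub>M\<^esub> x" using mem_proj by blast
    have "u = (h \<oplus>\<^bsub>M\<^esub> (x \<ominus>\<^bsub>M\<^esub> y)) \<oplus>\<^bsub>M\<^esub> y"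
      using that h submodule_mem[OF A h(1)] minus_add_cancel[of x y] by (simp add: M.a_assoc)
    then show "u \<in> proj y" using mem_proj submodule_add[OF A h(1) that(3)] by blast
  qed
  assume xy: "x \<ominus>\<^bsub>M\<^esub> y \<in> A"
  have "y \<ominus>\<^bsub>M\<^esub> x = \<ominus>\<^bsub>M\<^esub> (x \<ominus>\<^bsub>M\<^esub> y)"
    using x y by (simp add: a_minus_def M.minus_add M.a_comm)
  then have "y \<ominus>\<^bsub>M\<^esub> x \<in> A" using submodule_neg[OF A xy] by simp
  then show "proj x = proj y" using sub[OF x y xy] sub[OF y x] by blast
qed

lemma Q_carrier: "carrier Q = proj ` carrier M"
  by (auto simp: quot_module_def A_RCOSETS_def')

lemma Q_zero: "\<zero>\<^bsub>Q\<^esub> = proj \<zero>\<^bsub>M\<^esub>"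
  using submodule_mem[OF A] by (force simp: quot_module_def mem_proj)

lemma Q_add: "x \<in> carrier M \<Longrightarrow> y \<in> carrier M \<Longrightarrow> proj x \<oplus>\<^bsub>Q\<^esub> proj y = proj (x \<oplus>\<^bsub>M\<^esub> y)"
proof -
  assume x: "x \<in> carrier M" and y: "y \<in> carrier M"
  have "u \<in> proj x <+>\<^bsub>M\<^esub> proj y \<longleftrightarrow> u \<in> proj (x \<oplus>\<^bsub>M\<^esub> y)" for u
  proof
    assume "u \<in> proj x <+>\<^bsub>M\<^esub> proj y"
    then obtain h k where hk: "h \<in> A" "k \<in> A" "u = (h \<oplus>\<^bsub>M\<^esub> x) \<oplus>\<^bsub>M\<^esub> (k \<oplus>\<^bsub>M\<^esub> y)"
      by (auto simp: mem_set_add mem_proj)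
    have "u = (h \<oplus>\<^bsub>M\<^esub> k) \<oplus>\<^bsub>M\<^esub> (x \<oplus>\<^bsub>M\<^esub> y)"
      using hk x y submodule_mem[OF A] by (simp add: M.a_ac)
    then show "u \<in> proj (x \<oplus>\<^bsub>M\<^esub> y)" using submodule_add[OF A hk(1,2)] mem_proj by blast
  next
    assume "u \<in> proj (x \<oplus>\<^bsub>M\<^esub> y)"
    then obtain h where h: "h \<in> A" "u = h \<oplus>\<^bsub>M\<^esub> (x \<oplus>\<^bsub>M\<^esub> y)" using mem_proj by blast
    then have "u = (h \<oplus>\<^bsub>M\<^esub> x) \<oplus>\<^bsub>M\<^esub> y" using x y submodule_mem[OF A] by (simp add: M.a_assoc)
    moreover have "h \<oplus>\<^bsub>M\<^esub> x \<in> proj x" using h mem_proj by blast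
    ultimately show "u \<in> proj x <+>\<^bsub>M\<^esub> proj y" using proj_self[OF y] unfolding mem_set_add by blast
  qed
  then show ?thesis by (auto simp: quot_module_def)
qed

lemma Q_smult: "r \<in> carrier R \<Longrightarrow> x \<in> carrier M \<Longrightarrow> r \<odot>\<^bsub>Q\<^esub> proj x = proj (r \<odot>\<^bsub>M\<^esub> x)"
proof -
  assume r: "r \<in> carrier R" and x: "x \<in> carrier M"
  have "proj (r \<odot>\<^bsub>M\<^esub> y) = proj (r \<odot>\<^bsub>M\<^esub> x)" if y: "y \<in> proj x" for y
  proof -
    obtain h where h: "h \<in> A" "y = h \<oplus>\<^bsub>M\<^esub> x" using y mem_proj by blast
    have hc: "h \<in> carrier M" using submodule_mem[OF A h(1)] .
    have "r \<odot>\<^bsub>M\<^esub> y \<ominus>\<^bsub>M\<^esub> r \<odot>\<^bsub>M\<^esub> x = r \<odot>\<^bsub>M\<^esub> h"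
      using h hc r x by (simp add: smult_r_distr add_minus_cancel)
    then show ?thesis using proj_eq_iff[of "r \<odot>\<^bsub>M\<^esub> y" "r \<odot>\<^bsub>M\<^esub> x"] h hc r x submodule_smult[OF A r h(1)] by simp
  qed
  then have "(\<Union>y\<in>proj x. proj (r \<odot>\<^bsub>M\<^esub> y)) = proj (r \<odot>\<^bsub>M\<^esub> x)" using proj_self[OF x] by blast
  then show ?thesis by (simp add: quot_module_def)
qed

lemma module_Q: "module R Q"
proof (rule moduleI)
  have rep: "\<exists>x\<in>carrier M. u = proj x" if "u \<in> carrier Q" for u using that Q_carrier by auto
  have mem: "proj x \<in> carrier Q" if "x \<in> carrier M" for x using that Q_carrier by auto
  show "cring R" by (rule R.is_cring)
  show "abelian_group Q"
  proof (rule abelian_groupI)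
    show "\<zero>\<^bsub>Q\<^esub> \<in> carrier Q" using mem Q_zero by simp
    fix u v w assume u: "u \<in> carrier Q"
    obtain x where x: "x \<in> carrier M" "u = proj x" using rep[OF u] by blast
    show "\<zero>\<^bsub>Q\<^esub> \<oplus>\<^bsub>Q\<^esub> u = u" using x by (simp add: Q_zero Q_add)
    show "\<exists>v\<in>carrier Q. v \<oplus>\<^bsub>Q\<^esub> u = \<zero>\<^bsub>Q\<^esub>"
      using x mem by (intro bexI[of _ "proj (\<ominus>\<^bsub>M\<^esub> x)"]) (simp_all add: Q_zero Q_add M.l_neg)
    assume v: "v \<in> carrier Q"
    obtain y where y: "y \<in> carrier M" "v = proj y" using rep[OF v] by blast
    show "u \<oplus>\<^bsub>Q\<^esub> v \<in> carrier Q" using x y mem by (simp add: Q_add)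
    show "u \<oplus>\<^bsub>Q\<^esub> v = v \<oplus>\<^bsub>Q\<^esub> u" using x y by (simp add: Q_add M.a_comm)
    assume w: "w \<in> carrier Q"
    obtain z where z: "z \<in> carrier M" "w = proj z" using rep[OF w] by blast
    show "u \<oplus>\<^bsub>Q\<^esub> v \<oplus>\<^bsub>Q\<^esub> w = u \<oplus>\<^bsub>Q\<^esub> (v \<oplus>\<^bsub>Q\<^esub> w)" using x y z by (simp add: Q_add M.a_assoc)
  qed
  fix r t u v assume r: "r \<in> carrier R" and u: "u \<in> carrier Q"
  obtain x where x: "x \<in> carrier M" "u = proj x" using rep[OF u] by blast
  show "r \<odot>\<^bsub>Q\<^esub> u \<in> carrier Q" using x r mem by (simp add: Q_smult)
  show "t \<in> carrier R \<Longrightarrow> (r \<oplus> t) \<odot>\<^bsub>Q\<^esub> u = r \<odot>\<^bsub>Q\<^esub> u \<oplus>\<^bsub>Q\<^esub> t \<odot>\<^bsub>Q\<^esub> u"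
    using x r by (simp add: Q_smult Q_add smult_l_distr)
  show "t \<in> carrier R \<Longrightarrow> (r \<otimes> t) \<odot>\<^bsub>Q\<^esub> u = r \<odot>\<^bsub>Q\<^esub> (t \<odot>\<^bsub>Q\<^esub> u)"
    using x r by (simp add: Q_smult smult_assoc1)
  assume v: "v \<in> carrier Q"
  obtain y where y: "y \<in> carrier M" "v = proj y" using rep[OF v] by blast
  show "r \<odot>\<^bsub>Q\<^esub> (u \<oplus>\<^bsub>Q\<^esub> v) = r \<odot>\<^bsub>Q\<^esub> u \<oplus>\<^bsub>Q\<^esub> r \<odot>\<^bsub>Q\<^esub> v"
    using x y r by (simp add: Q_smult Q_add smult_r_distr)
next
  fix u assume "u \<in> carrier Q"
  then obtain x where "x \<in> carrier M" "u = proj x" using Q_carrier by auto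
  then show "\<one> \<odot>\<^bsub>Q\<^esub> u = u" by (simp add: Q_smult)
qed

lemma lin_proj: "lin R M Q proj"
  by (rule linI) (auto simp: Q_carrier Q_add Q_smult)

lemma module_length_quot: "module_length R Q = ilen R M A (carrier M)"
proof -
  interpret Q: plain_module R Q by (rule plain_moduleI[OF module_Q])
  have "submodule N R Q \<longleftrightarrow> submodule N R Q \<and> {\<zero>\<^bsub>Q\<^esub>} \<subseteq> N \<and> N \<subseteq> carrier Q" for N
    using Q.submodule_zero[of N] Q.submodule_subset[of N] by auto
  then have "module_length R Q = ilen R Q {\<zero>\<^bsub>Q\<^esub>} (carrier Q)"
    unfolding module_length_def ilen_def by presburger
  also have "\<dots> = ilen R M A (carrier M)"
  proof (rule antisym)
    note C = carrier_is_submodule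
    have ker: "proj x = \<zero>\<^bsub>Q\<^esub> \<longleftrightarrow> x \<in> A" if "x \<in> carrier M" for x
      using that proj_eq_iff[of x "\<zero>\<^bsub>M\<^esub>"] add_minus_cancel[of x "\<zero>\<^bsub>M\<^esub>"] by (simp add: Q_zero)
    show "ilen R Q {\<zero>\<^bsub>Q\<^esub>} (carrier Q) \<le> ilen R M A (carrier M)"
    proof (rule ilen_lin_ge[OF module_axioms module_Q lin_proj A C submodule_subset[OF A]
          Q.submodule_zero_set Q.carrier_is_submodule])
      show "proj x \<in> {\<zero>\<^bsub>Q\<^esub>}" if "x \<in> A" for x using ker[OF submodule_mem[OF A that]] that by simp
      show "\<exists>x\<in>carrier M. \<exists>z\<in>{\<zero>\<^bsub>Q\<^esub>}. u = proj x \<oplus>\<^bsub>Q\<^esub> z" if "u \<in> carrier Q" for u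
      proof -
        have "u \<in> proj ` carrier M" using that Q_carrier by simp
        then obtain x where "x \<in> carrier M" "u = proj x" by auto
        then show ?thesis using that by (intro bexI[of _ x]) simp_all
      qed
    qed
    show "ilen R M A (carrier M) \<le> ilen R Q {\<zero>\<^bsub>Q\<^esub>} (carrier Q)"
      by (rule ilen_lin_le[OF module_axioms module_Q lin_proj A C Q.submodule_zero_set Q.carrier_is_submodule])
         (use ker Q_carrier in auto)
  qed
  finally show ?thesis .
qed

end

text \<open>Translates the lengths of quotient modules in the definitions of multiplicity and type
  into lengths of intervals of submodules.\<close>

lemma module_length_quot_restrict:
  assumes M: "module R M" and A: "submodule A R M" and B: "submodule B R M" and AB: "A \<subseteq> B"
  shows "module_length R (quot_module (M\<lparr>carrier := B\<rparr>) A) = ilen R M A B"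
proof -
  interpret M: plain_module R M by (rule plain_moduleI[OF M])
  have iff: "submodule N R (M\<lparr>carrier := B\<rparr>) \<longleftrightarrow> submodule N R M \<and> N \<subseteq> B" for N
    by (rule M.submodule_restrict_iff[OF B])
  interpret Q: module_quotient R "M\<lparr>carrier := B\<rparr>" A
    by (rule module_quotient.intro[OF plain_moduleI[OF M.module_restrict[OF B]] module_quotient_axioms.intro])
       (use A AB iff in simp)
  show ?thesis
    unfolding Q.module_length_quot ilen_def iff by (rule arg_cong[of _ _ chain_sup]) auto
qed

section \<open>Injective resolutions of a canonical ideal\<close>

lemma ideal_module_simps:
  "carrier (ideal_module R J) = J" "\<zero>\<^bsub>ideal_module R J\<^esub> = \<zero>\<^bsub>R\<^esub>"
  "x \<oplus>\<^bsub>ideal_module R J\<^esub> y = x \<oplus>\<^bsub>R\<^esub> y" "r \<odot>\<^bsub>ideal_module R J\<^esub> x = r \<otimes>\<^bsub>R\<^esub> x"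
  by simp_all

lemma module_ideal: "cring R \<Longrightarrow> ideal J R \<Longrightarrow> module R (ideal_module R J)"
  using plain_module.module_restrict[OF plain_moduleI[OF module_self]] submodule_self_iff by blast

text \<open>Both test modules live in the type of \<open>R\<close>. This is why injectivity is
  invoked below only for ideals, \<omega> among them, and for \<open>R\<close> itself.\<close>

lemma injective_moduleE:
  fixes A B :: "('a, 'a) module"
  assumes "injective_module R E" "module R A" "module R B" "i \<in> mhom R A B" "inj_on i (carrier A)" "f \<in> mhom R A E"
  obtains g where "g \<in> mhom R B E" "\<And>x. x \<in> carrier A \<Longrightarrow> g (i x) = f x"
proof -
  have "\<exists>g\<in>mhom R B E. \<forall>x\<in>carrier A. g (i x) = f x"
    using assms unfolding injective_module_def by presburger
  then show ?thesis using that by blast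
qed

text \<open>Baer's form of injectivity: the map extends from the ideal to \<open>R\<close>, and
  \<open>y\<close> is the image of the unit element.\<close>

lemma injective_extend:
  fixes R :: "('a, 'r) ring_scheme" (structure) and E :: "('a, 'c) module"
  assumes E: "injective_module R E" and J: "ideal J R" and f: "lin R (ideal_module R J) E f"
  obtains y where "y \<in> carrier E" "\<And>x. x \<in> J \<Longrightarrow> f x = x \<odot>\<^bsub>E\<^esub> y"
proof -
  have E_mod: "module R E" using E by (simp add: injective_module_def)
  interpret E: plain_module R E by (rule plain_moduleI[OF E_mod])
  have Jc: "J \<subseteq> carrier R" using additive_subgroup.a_subset[OF ideal.axioms(1)[OF J]] .
  note mJ = module_ideal[OF E.R.is_cring J] and mR = module_self[OF E.R.is_cring]
  let ?i = "\<lambda>x\<in>J. x" and ?f = "\<lambda>x\<in>J. f x"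
  have i: "?i \<in> mhom R (ideal_module R J) (self_module R)"
    using restrict_mhom[OF mJ, of "self_module R" "\<lambda>x. x"] Jc by (auto simp: lin_def)
  have f': "?f \<in> mhom R (ideal_module R J) E" using restrict_mhom[OF mJ f] by simp
  have inj: "inj_on ?i (carrier (ideal_module R J))" by (auto simp: inj_on_def)
  obtain g where g: "g \<in> mhom R (self_module R) E" "\<And>x. x \<in> carrier (ideal_module R J) \<Longrightarrow> g (?i x) = ?f x"
    using injective_moduleE[OF E mJ mR i inj f'] by blast
  have gl: "lin R (self_module R) E g" using g mhom_lin by blast
  have "f x = x \<odot>\<^bsub>E\<^esub> g \<one>" if x: "x \<in> J" for x
    using g(2)[of x] lin_smult[OF gl, of x \<one>] x Jc by auto
  then show ?thesis using that[of "g \<one>"] lin_closed[OF gl, of \<one>] by simp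
qed

text \<open>The map \<open>f\<close> is extended along multiplication by \<open>a\<close>, which is
  a monomorphism from \<open>N\<close> to itself.\<close>

lemma injective_divisible:
  fixes R :: "('a, 'r) ring_scheme" (structure) and E :: "('a, 'c) module" and N :: "('a, 'a) module"
  assumes E: "injective_module R E" and N: "module R N" and a: "a \<in> carrier R"
    and inj: "\<And>x. x \<in> carrier N \<Longrightarrow> a \<odot>\<^bsub>N\<^esub> x = \<zero>\<^bsub>N\<^esub> \<Longrightarrow> x = \<zero>\<^bsub>N\<^esub>" and f: "f \<in> mhom R N E"
  obtains g where "g \<in> mhom R N E" "\<And>x. x \<in> carrier N \<Longrightarrow> g (a \<odot>\<^bsub>N\<^esub> x) = f x"
proof -
  interpret N: plain_module R N by (rule plain_moduleI[OF N])
  let ?i = "\<lambda>x\<in>carrier N. a \<odot>\<^bsub>N\<^esub> x"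
  have i: "?i \<in> mhom R N N" by (rule restrict_mhom[OF N N.lin_scale[OF a]])
  have inj: "inj_on ?i (carrier N)"
  proof (rule inj_onI)
    fix x y assume *: "x \<in> carrier N" "y \<in> carrier N" "?i x = ?i y"
    then have "a \<odot>\<^bsub>N\<^esub> (x \<ominus>\<^bsub>N\<^esub> y) = \<zero>\<^bsub>N\<^esub>" using a by (simp add: N.smult_minus_distr N.minus_eq_zero_iff)
    then show "x = y" using inj[of "x \<ominus>\<^bsub>N\<^esub> y"] * N.minus_eq_zero_iff by simp
  qed
  obtain g where "g \<in> mhom R N E" "\<And>x. x \<in> carrier N \<Longrightarrow> g (?i x) = f x"
    using injective_moduleE[OF E N N i inj f] by blast
  then show ?thesis using that[of g] by auto
qed

text \<open>The resolution is one of \<omega> itself, whereas a canonical ideal is only isomorphic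
  to the module that is resolved; the augmentation is composed with the isomorphism beforehand. The
  type is read off in degree 1, the dimension of the ring.\<close>

locale canonical_resolution = local_parameter R m a
  for R :: "('a, 'r) ring_scheme" (structure) and m a +
  fixes \<omega> :: "'a set" and \<eta> :: "'a \<Rightarrow> 'c" and E :: "nat \<Rightarrow> ('a, 'c) module" and d :: "nat \<Rightarrow> 'c \<Rightarrow> 'c"
    and n :: nat
  assumes a_nzd: "\<And>x. x \<in> carrier R \<Longrightarrow> a \<otimes> x = \<zero> \<Longrightarrow> x = \<zero>"
    and m_max: "m = max_ideal R"
    and \<omega>_ideal: "ideal \<omega> R" and \<omega>_nonzero: "\<omega> \<noteq> {\<zero>}"
    and resolution: "injective_resolution R (ideal_module R \<omega>) \<eta> E d"
    and finite: "\<And>i. i > n \<Longrightarrow> carrier (E i) = {\<zero>\<^bsub>E i\<^esub>}"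
    and type_one: "module_length R (Ext_module R (residue_module R) E d 1) = 1"
begin

lemma E_injective: "injective_module R (E i)"
  using resolution by (simp add: injective_resolution_def)

sublocale E: plain_module R "E i" for i
  by (rule plain_moduleI) (use E_injective in \<open>simp add: injective_module_def\<close>)

lemma d_lin: "lin R (E i) (E (Suc i)) (d i)"
  by (rule mhom_lin) (use resolution in \<open>simp add: injective_resolution_def\<close>)

lemma d_closed [simp]: "e \<in> carrier (E i) \<Longrightarrow> d i e \<in> carrier (E (Suc i))"
  by (rule lin_closed[OF d_lin])

lemma d_smult: "r \<in> carrier R \<Longrightarrow> e \<in> carrier (E i) \<Longrightarrow> d i (r \<odot>\<^bsub>E i\<^esub> e) = r \<odot>\<^bsub>E (Suc i)\<^esub> d i e"
  by (rule lin_smult[OF d_lin])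

lemma d_add: "e \<in> carrier (E i) \<Longrightarrow> e' \<in> carrier (E i) \<Longrightarrow> d i (e \<oplus>\<^bsub>E i\<^esub> e') = d i e \<oplus>\<^bsub>E (Suc i)\<^esub> d i e'"
  by (rule lin_add[OF d_lin])

lemma d_minus: "e \<in> carrier (E i) \<Longrightarrow> e' \<in> carrier (E i) \<Longrightarrow> d i (e \<ominus>\<^bsub>E i\<^esub> e') = d i e \<ominus>\<^bsub>E (Suc i)\<^esub> d i e'"
  by (rule lin_minus[OF E.module_axioms E.module_axioms d_lin])

lemma d_zero: "d i \<zero>\<^bsub>E i\<^esub> = \<zero>\<^bsub>E (Suc i)\<^esub>"
  by (rule lin_zero[OF E.module_axioms E.module_axioms d_lin])

lemma image_d: "d i ` carrier (E i) = {x \<in> carrier (E (Suc i)). d (Suc i) x = \<zero>\<^bsub>E (Suc (Suc i))\<^esub>}"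
  using resolution unfolding injective_resolution_def by blast

lemma exact:
  assumes "e \<in> carrier (E (Suc i))" "d (Suc i) e = \<zero>\<^bsub>E (Suc (Suc i))\<^esub>"
  shows "\<exists>e'\<in>carrier (E i). d i e' = e"
proof -
  have "e \<in> d i ` carrier (E i)" using image_d assms by simp
  then show ?thesis by auto
qed

lemma dd: "e \<in> carrier (E i) \<Longrightarrow> d (Suc i) (d i e) = \<zero>\<^bsub>E (Suc (Suc i))\<^esub>"
  using image_d[of i] by blast

section \<open>Vanishing of Ext in degrees at least two\<close>

lemma divisible:
  assumes e: "e \<in> carrier (E i)"
  obtains e' where "e' \<in> carrier (E i)" "a \<odot>\<^bsub>E i\<^esub> e' = e"
proof -
  have f: "restrict (\<lambda>r. r \<odot>\<^bsub>E i\<^esub> e) (carrier (self_module R)) \<in> mhom R (self_module R) (E i)"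
    using e by (intro restrict_mhom[OF self.module_axioms] linI) (simp_all add: E.smult_l_distr E.smult_assoc1)
  obtain g where g: "g \<in> mhom R (self_module R) (E i)"
    "\<And>r. r \<in> carrier (self_module R) \<Longrightarrow> g (a \<odot>\<^bsub>self_module R\<^esub> r) = restrict (\<lambda>r. r \<odot>\<^bsub>E i\<^esub> e) (carrier (self_module R)) r"
    using injective_divisible[OF E_injective self.module_axioms a_carrier _ f] a_nzd by (metis self_module_simps(1,2,4))
  have "a \<odot>\<^bsub>E i\<^esub> g \<one> = g (a \<otimes> \<one>)" using lin_smult[OF mhom_lin[OF g(1)], of a \<one>] by simp
  also have "\<dots> = e" using g(2)[of \<one>] e by simp
  finally show ?thesis using that[of "g \<one>"] lin_closed[OF mhom_lin[OF g(1)], of \<one>] by simp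
qed

text \<open>The condition \<open>ann\<close> makes the map on \<open>J + R t\<close> that kills
  \<open>J\<close> and sends \<open>t\<close> to \<open>u\<close> well defined; injectivity extends
  it to \<open>R\<close>, and \<open>y\<close> is the image of the unit element.\<close>

lemma extend_by_element:
  assumes J: "ideal J R" and t: "t \<in> carrier R" and u: "u \<in> carrier (E i)"
    and ann: "\<And>r. r \<in> carrier R \<Longrightarrow> r \<otimes> t \<in> J \<Longrightarrow> r \<odot>\<^bsub>E i\<^esub> u = \<zero>\<^bsub>E i\<^esub>"
  obtains y where "y \<in> carrier (E i)" "\<And>x. x \<in> J \<Longrightarrow> x \<odot>\<^bsub>E i\<^esub> y = \<zero>\<^bsub>E i\<^esub>" "t \<odot>\<^bsub>E i\<^esub> y = u"
proof -
  have sJ: "submodule J R (self_module R)" using J submodule_self_iff[OF is_cring] by blast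
  have 1: "lin R (self_module R) (self_module R) (\<lambda>r. r \<otimes> t)" and 2: "lin R (self_module R) (E i) (\<lambda>r. r \<odot>\<^bsub>E i\<^esub> u)"
    using t u by (auto intro!: linI simp: l_distr m_assoc E.smult_l_distr E.smult_assoc1)
  have 3: "lin R (ideal_module R J) (E i) (\<lambda>r. \<zero>\<^bsub>E i\<^esub>)"
    by (rule lin_pointwise_zero[OF self.module_restrict[OF sJ] E.module_axioms])
  have agree: "\<zero>\<^bsub>E i\<^esub> = r \<odot>\<^bsub>E i\<^esub> u" if "r \<in> carrier (self_module R)" "r \<otimes> t \<in> J" for r
    using ann[of r] that by simp
  let ?C = "(\<lambda>r. r \<otimes> t) ` carrier (self_module R)"
  let ?K = "J <+>\<^bsub>self_module R\<^esub> ?C"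
  obtain f where f: "lin R (ideal_module R ?K) (E i) f" "\<And>b. b \<in> J \<Longrightarrow> f b = \<zero>\<^bsub>E i\<^esub>"
    "\<And>r. r \<in> carrier (self_module R) \<Longrightarrow> f (r \<otimes> t) = r \<odot>\<^bsub>E i\<^esub> u"
    using lin_glue[where i = "\<lambda>r. r \<otimes> t" and h = "\<lambda>r. r \<odot>\<^bsub>E i\<^esub> u" and g = "\<lambda>r. \<zero>\<^bsub>E i\<^esub>", OF self.module_axioms
        self.module_axioms E.module_axioms sJ 1 3 2 agree] by blast
  have C: "submodule ?C R (self_module R)"
    by (rule submodule_lin_image[OF self.module_axioms self.module_axioms 1 self.carrier_is_submodule])
  have K: "ideal ?K R" using self.submodule_set_add[OF sJ C] submodule_self_iff[OF is_cring] by blast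
  obtain y where y: "y \<in> carrier (E i)" "\<And>x. x \<in> ?K \<Longrightarrow> f x = x \<odot>\<^bsub>E i\<^esub> y"
    using injective_extend[OF E_injective K f(1)] by blast
  show ?thesis
  proof (rule that[OF y(1)])
    show "x \<odot>\<^bsub>E i\<^esub> y = \<zero>\<^bsub>E i\<^esub>" if "x \<in> J" for x
      using f(2)[OF that] y(2)[OF subsetD[OF self.set_add_upper1[OF sJ C] that]] by simp
    have "\<one> \<otimes> t \<in> ?C" by simp
    then show "t \<odot>\<^bsub>E i\<^esub> y = u"
      using f(3)[of \<one>] y(2)[OF subsetD[OF self.set_add_upper2[OF sJ C]]] t u by simp
  qed
qed

text \<open>\<open>lifts i J\<close> says that Ext in degree \<open>Suc i\<close> of \<open>R/J\<close> with values in \<open>\<omega>\<close> vanishes.\<close>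

definition lifts :: "nat \<Rightarrow> 'a set \<Rightarrow> bool" where
  "lifts i J \<longleftrightarrow> (\<forall>z\<in>carrier (E (Suc i)). d (Suc i) z = \<zero>\<^bsub>E (Suc (Suc i))\<^esub> \<longrightarrow>
      (\<forall>r\<in>J. r \<odot>\<^bsub>E (Suc i)\<^esub> z = \<zero>\<^bsub>E (Suc i)\<^esub>) \<longrightarrow>
      (\<exists>e\<in>carrier (E i). d i e = z \<and> (\<forall>r\<in>J. r \<odot>\<^bsub>E i\<^esub> e = \<zero>\<^bsub>E i\<^esub>)))"

text \<open>The case of the ideal \<open>a R\<close>. For a preimage \<open>e\<close> of
  \<open>z\<close> the element \<open>a e\<close> is a cycle, hence a boundary \<open>d e'\<close>;
  dividing \<open>e'\<close> by \<open>a\<close> yields the correction of \<open>e\<close>. As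
  \<open>e'\<close> lives one step below \<open>e\<close>, the argument starts in degree 2.\<close>

lemma lifts_parameter:
  assumes z: "z \<in> carrier (E (Suc (Suc k)))" "d (Suc (Suc k)) z = \<zero>\<^bsub>E (Suc (Suc (Suc k)))\<^esub>"
    and az: "a \<odot>\<^bsub>E (Suc (Suc k))\<^esub> z = \<zero>\<^bsub>E (Suc (Suc k))\<^esub>"
  obtains e where "e \<in> carrier (E (Suc k))" "d (Suc k) e = z" "a \<odot>\<^bsub>E (Suc k)\<^esub> e = \<zero>\<^bsub>E (Suc k)\<^esub>"
proof -
  obtain e where e: "e \<in> carrier (E (Suc k))" "d (Suc k) e = z" using exact[OF z] by blast
  have "d (Suc k) (a \<odot>\<^bsub>E (Suc k)\<^esub> e) = \<zero>\<^bsub>E (Suc (Suc k))\<^esub>" using e az by (simp add: d_smult)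
  then obtain e' where e': "e' \<in> carrier (E k)" "d k e' = a \<odot>\<^bsub>E (Suc k)\<^esub> e" using exact[of "a \<odot>\<^bsub>E (Suc k)\<^esub> e" k] e by auto
  obtain e'' where e'': "e'' \<in> carrier (E k)" "a \<odot>\<^bsub>E k\<^esub> e'' = e'" using divisible[OF e'(1)] by blast
  let ?e = "e \<ominus>\<^bsub>E (Suc k)\<^esub> d k e''"
  have "d (Suc k) ?e = z" using e e'' z by (simp add: d_minus dd) (metis E.add_minus_cancel E.M.r_zero E.M.zero_closed)
  moreover have "a \<odot>\<^bsub>E (Suc k)\<^esub> ?e = \<zero>\<^bsub>E (Suc k)\<^esub>"
    using e e' e'' by (simp add: E.smult_minus_distr d_smult[symmetric] E.minus_eq_zero_iff)
  ultimately show ?thesis using that[of ?e] e e'' by simp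
qed

text \<open>The long exact sequence for the residue field inside \<open>R\<close>/\<open>aR\<close>,
  carried out by hand: \<open>s\<close> generates a copy of the residue field there, the cokernel is
  governed by an ideal containing \<open>a\<close> in the next degree, and
  \<open>R\<close>/\<open>aR\<close> by \<open>lifts_parameter\<close>.\<close>

lemma lifts_max_ideal:
  assumes step: "\<And>J. ideal J R \<Longrightarrow> a \<in> J \<Longrightarrow> lifts (Suc (Suc k)) J"
  shows "lifts (Suc k) m"
  unfolding lifts_def
proof (intro ballI impI)
  fix z assume z: "z \<in> carrier (E (Suc (Suc k)))" "d (Suc (Suc k)) z = \<zero>\<^bsub>E (Suc (Suc (Suc k)))\<^esub>"
    and mz: "\<forall>r\<in>m. r \<odot>\<^bsub>E (Suc (Suc k))\<^esub> z = \<zero>\<^bsub>E (Suc (Suc k))\<^esub>"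
  let ?A = "(\<lambda>r. r \<odot>\<^bsub>self_module R\<^esub> a) ` carrier R"
  have A: "submodule ?A R (self_module R)" using self.submodule_cyclic[of a] by simp
  have Am: "?A \<subseteq> m" using a_m m_smult by auto
  have "?A \<noteq> carrier (self_module R)" using Am m_proper by auto
  then obtain s where s: "s \<in> carrier R" "\<And>r. r \<in> carrier R \<Longrightarrow> r \<otimes> s \<in> ?A \<longleftrightarrow> r \<in> m"
    using socle[OF self.module_axioms A self.carrier_is_submodule] self.submodule_subset[OF A]
    by (metis (no_types, lifting) a_carrier imageI m_comm self_module_simps(1,4))
  have iA: "ideal ?A R" using A submodule_self_iff[OF is_cring] by blast
  obtain y where y: "y \<in> carrier (E (Suc (Suc k)))" "\<And>x. x \<in> ?A \<Longrightarrow> x \<odot>\<^bsub>E (Suc (Suc k))\<^esub> y = \<zero>\<^bsub>E (Suc (Suc k))\<^esub>"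
    "s \<odot>\<^bsub>E (Suc (Suc k))\<^esub> y = z"
    using extend_by_element[OF iA s(1) z(1)] s(2) mz by blast
  \<comment> \<open>The annihilator of \<open>d y\<close> contains \<open>a\<close> and
    \<open>s\<close>, and this accounts for the cokernel. Lifting for it in the next degree changes
    \<open>y\<close> into the cycle \<open>?w\<close>, which still has product \<open>z\<close> with
    \<open>s\<close> and is killed by \<open>a\<close>.\<close>
  let ?J = "{r \<in> carrier R. r \<odot>\<^bsub>E (Suc (Suc (Suc k)))\<^esub> d (Suc (Suc k)) y \<in> {\<zero>\<^bsub>E (Suc (Suc (Suc k)))\<^esub>}}"
  have J: "ideal ?J R"
    using E.submodule_colon[OF E.submodule_zero_set d_closed[OF y(1)]] submodule_self_iff[OF is_cring] by blast
  have aA: "a \<in> ?A" using self.mem_cyclic_self[of a] by simp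
  have aJ: "a \<in> ?J" using y(2)[OF aA] y(1) by (simp add: d_smult[symmetric] d_zero)
  have sJ: "s \<in> ?J" using y s z by (simp add: d_smult[symmetric])
  obtain y' where y': "y' \<in> carrier (E (Suc (Suc k)))" "d (Suc (Suc k)) y' = d (Suc (Suc k)) y"
    "\<And>r. r \<in> ?J \<Longrightarrow> r \<odot>\<^bsub>E (Suc (Suc k))\<^esub> y' = \<zero>\<^bsub>E (Suc (Suc k))\<^esub>"
    using step[OF J aJ] d_closed[OF y(1)] dd[OF y(1)] unfolding lifts_def by blast
  let ?w = "y \<ominus>\<^bsub>E (Suc (Suc k))\<^esub> y'"
  have w: "?w \<in> carrier (E (Suc (Suc k)))" using y y' by simp
  have dw: "d (Suc (Suc k)) ?w = \<zero>\<^bsub>E (Suc (Suc (Suc k)))\<^esub>" using y y' by (simp add: d_minus E.minus_eq_zero_iff)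
  have aw: "a \<odot>\<^bsub>E (Suc (Suc k))\<^esub> ?w = \<zero>\<^bsub>E (Suc (Suc k))\<^esub>"
    using y y' aJ y(2)[OF aA] by (simp add: E.smult_minus_distr E.minus_eq_zero_iff)
  have sw: "s \<odot>\<^bsub>E (Suc (Suc k))\<^esub> ?w = z"
    using y y'(1) y'(3)[OF sJ] s z E.add_minus_cancel[of z "Suc (Suc k)" "\<zero>\<^bsub>E (Suc (Suc k))\<^esub>"] by (simp add: E.smult_minus_distr)
  obtain e where e: "e \<in> carrier (E (Suc k))" "d (Suc k) e = ?w" "a \<odot>\<^bsub>E (Suc k)\<^esub> e = \<zero>\<^bsub>E (Suc k)\<^esub>"
    using lifts_parameter[OF w dw aw] by blast
  \<comment> \<open>The product of \<open>s\<close> and \<open>e\<close> is annihilated by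
    \<open>m\<close> because \<open>m s\<close> lies in \<open>a R\<close>, which kills
    \<open>e\<close>.\<close>
  show "\<exists>e\<in>carrier (E (Suc k)). d (Suc k) e = z \<and> (\<forall>r\<in>m. r \<odot>\<^bsub>E (Suc k)\<^esub> e = \<zero>\<^bsub>E (Suc k)\<^esub>)"
  proof (intro bexI[of _ "s \<odot>\<^bsub>E (Suc k)\<^esub> e"] conjI ballI)
    show "d (Suc k) (s \<odot>\<^bsub>E (Suc k)\<^esub> e) = z" using e s sw by (simp add: d_smult)
    show "r \<odot>\<^bsub>E (Suc k)\<^esub> (s \<odot>\<^bsub>E (Suc k)\<^esub> e) = \<zero>\<^bsub>E (Suc k)\<^esub>" if r: "r \<in> m" for r
    proof -
      have rc: "r \<in> carrier R" using r m_carrier by auto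
      then obtain t where t: "t \<in> carrier R" "r \<otimes> s = t \<otimes> a" using s(2)[OF rc] r by auto
      have "r \<odot>\<^bsub>E (Suc k)\<^esub> (s \<odot>\<^bsub>E (Suc k)\<^esub> e) = (r \<otimes> s) \<odot>\<^bsub>E (Suc k)\<^esub> e"
        using rc s e by (simp add: E.smult_assoc1)
      then show ?thesis using t e by (simp add: E.smult_assoc1)
    qed
  qed (use e s in simp)
qed

text \<open>Let \<open>J\<close> be a maximal counterexample. A socle element \<open>t\<close> of
  \<open>R\<close>/\<open>J\<close> gives a copy of the residue field; a lift of \<open>t z\<close>
  is divided by \<open>t\<close> and its boundary subtracted from \<open>z\<close>. The corrected
  cycle is killed by \<open>t\<close> as well as by \<open>J\<close>, so a strictly larger ideal
  takes over.\<close>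

lemma lifts_from_max_ideal:
  assumes lm: "lifts i m" and J: "ideal J R" "a \<in> J"
  shows "lifts i J"
proof (rule ccontr)
  assume "\<not> lifts i J"
  moreover have sJ: "submodule J R (self_module R)" using J submodule_self_iff[OF is_cring] by blast
  ultimately obtain J where J: "submodule J R (self_module R)" "a \<in> J \<and> \<not> lifts i J"
    and max: "\<And>J'. submodule J' R (self_module R) \<Longrightarrow> a \<in> J' \<and> \<not> lifts i J' \<Longrightarrow> J \<subseteq> J' \<Longrightarrow> J' = J"
    using noeth_maximal[OF R_noeth sJ, of "\<lambda>J. a \<in> J \<and> \<not> lifts i J"] J(2) by blast
  have "lifts i J"
    unfolding lifts_def
  proof (intro ballI impI)
    fix z assume z: "z \<in> carrier (E (Suc i))" "d (Suc i) z = \<zero>\<^bsub>E (Suc (Suc i))\<^esub>"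
      and Jz: "\<forall>r\<in>J. r \<odot>\<^bsub>E (Suc i)\<^esub> z = \<zero>\<^bsub>E (Suc i)\<^esub>"
    show "\<exists>e\<in>carrier (E i). d i e = z \<and> (\<forall>r\<in>J. r \<odot>\<^bsub>E i\<^esub> e = \<zero>\<^bsub>E i\<^esub>)"
    proof (cases "J = carrier (self_module R)")
      case True
      then have "\<one> \<odot>\<^bsub>E (Suc i)\<^esub> z = \<zero>\<^bsub>E (Suc i)\<^esub>" using Jz by simp
      then have "z = \<zero>\<^bsub>E (Suc i)\<^esub>" using z by simp
      then show ?thesis using True d_zero by (intro bexI[of _ "\<zero>\<^bsub>E i\<^esub>"]) simp_all
    next
      case False
      have iJ: "ideal J R" using J submodule_self_iff[OF is_cring] by blast
      have aJ: "a \<odot>\<^bsub>self_module R\<^esub> x \<in> J" if "x \<in> carrier (self_module R)" for x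
        using self.submodule_smult[OF J(1), of x a] J that m_comm[of x a] by simp
      obtain t where t: "t \<in> carrier R" "t \<notin> J" "\<And>r. r \<in> carrier R \<Longrightarrow> r \<otimes> t \<in> J \<longleftrightarrow> r \<in> m"
        using socle[OF self.module_axioms J(1) self.carrier_is_submodule self.submodule_subset[OF J(1)] False aJ] by auto
      let ?z = "t \<odot>\<^bsub>E (Suc i)\<^esub> z"
      have "?z \<in> carrier (E (Suc i))" "d (Suc i) ?z = \<zero>\<^bsub>E (Suc (Suc i))\<^esub>" using t z by (simp_all add: d_smult)
      moreover have "\<forall>r\<in>m. r \<odot>\<^bsub>E (Suc i)\<^esub> ?z = \<zero>\<^bsub>E (Suc i)\<^esub>"
      proof
        fix r assume r: "r \<in> m"
        have rc: "r \<in> carrier R" using r m_carrier by auto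
        have "r \<odot>\<^bsub>E (Suc i)\<^esub> ?z = (r \<otimes> t) \<odot>\<^bsub>E (Suc i)\<^esub> z" using rc t z by (simp add: E.smult_assoc1)
        then show "r \<odot>\<^bsub>E (Suc i)\<^esub> ?z = \<zero>\<^bsub>E (Suc i)\<^esub>" using t(3)[OF rc] r Jz by simp
      qed
      ultimately obtain e1 where e1: "e1 \<in> carrier (E i)" "d i e1 = ?z" "\<forall>r\<in>m. r \<odot>\<^bsub>E i\<^esub> e1 = \<zero>\<^bsub>E i\<^esub>"
        using lm unfolding lifts_def by blast
      obtain e2 where e2: "e2 \<in> carrier (E i)" "\<And>x. x \<in> J \<Longrightarrow> x \<odot>\<^bsub>E i\<^esub> e2 = \<zero>\<^bsub>E i\<^esub>" "t \<odot>\<^bsub>E i\<^esub> e2 = e1"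
        using extend_by_element[OF iJ t(1) e1(1)] t(3) e1(3) by blast
      let ?w = "z \<ominus>\<^bsub>E (Suc i)\<^esub> d i e2"
      let ?J = "{r \<in> carrier R. r \<odot>\<^bsub>E (Suc i)\<^esub> ?w \<in> {\<zero>\<^bsub>E (Suc i)\<^esub>}}"
      have w: "?w \<in> carrier (E (Suc i))" using z e2 by simp
      have dw: "d (Suc i) ?w = \<zero>\<^bsub>E (Suc (Suc i))\<^esub>" using z e2 by (simp add: d_minus dd E.minus_eq_zero_iff)
      have J': "submodule ?J R (self_module R)" by (rule E.submodule_colon[OF E.submodule_zero_set w])
      have JJ: "J \<subseteq> ?J"
      proof
        fix r assume r: "r \<in> J"
        have rc: "r \<in> carrier R" using self.submodule_mem[OF J(1) r] by simp
        have "r \<odot>\<^bsub>E (Suc i)\<^esub> d i e2 = \<zero>\<^bsub>E (Suc i)\<^esub>" using e2(2)[OF r] d_smult[OF rc e2(1)] d_zero by simp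
        moreover have "r \<odot>\<^bsub>E (Suc i)\<^esub> z = \<zero>\<^bsub>E (Suc i)\<^esub>" using Jz r by simp
        ultimately have "r \<odot>\<^bsub>E (Suc i)\<^esub> ?w = \<zero>\<^bsub>E (Suc i)\<^esub>"
          using rc z e2(1) E.minus_eq_zero_iff by (simp add: E.smult_minus_distr)
        then show "r \<in> ?J" using rc by simp
      qed
      have "t \<in> ?J" using t z e1 e2 d_smult[OF t(1) e2(1)] by (simp add: E.smult_minus_distr E.minus_eq_zero_iff)
      then have "lifts i ?J" using max[OF J'] JJ J t by blast
      then obtain e3 where e3: "e3 \<in> carrier (E i)" "d i e3 = ?w" "\<forall>r\<in>?J. r \<odot>\<^bsub>E i\<^esub> e3 = \<zero>\<^bsub>E i\<^esub>"
        using w dw unfolding lifts_def by blast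
      show ?thesis
      proof (intro bexI[of _ "e3 \<oplus>\<^bsub>E i\<^esub> e2"] conjI ballI)
        show "d i (e3 \<oplus>\<^bsub>E i\<^esub> e2) = z" using e2 e3 z by (simp add: d_add E.minus_add_cancel)
        show "r \<odot>\<^bsub>E i\<^esub> (e3 \<oplus>\<^bsub>E i\<^esub> e2) = \<zero>\<^bsub>E i\<^esub>" if r: "r \<in> J" for r
        proof -
          have rc: "r \<in> carrier R" using self.submodule_mem[OF J(1) r] by simp
          have "r \<odot>\<^bsub>E i\<^esub> e3 = \<zero>\<^bsub>E i\<^esub>" using e3(3) JJ r by blast
          then show ?thesis using e2(1) e2(2)[OF r] e3(1) rc by (simp add: E.smult_r_distr)
        qed
      qed (use e2 e3 in simp)
    qed
  qed
  then show False using J by blast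
qed

text \<open>Descending induction on the degree, started at \<open>k = n\<close>, where the cycles
  live in a zero module. The index \<open>Suc k\<close> confines the claim to Ext in degrees at
  least 2.\<close>

lemma lifts_all:
  assumes "ideal J R" "a \<in> J"
  shows "lifts (Suc k) J"
proof (cases "k \<le> n")
  case True
  then show ?thesis using assms
  proof (induction k arbitrary: J rule: inc_induct)
    case base
    show ?case unfolding lifts_def
    proof (intro ballI impI)
      fix z assume "z \<in> carrier (E (Suc (Suc n)))"
      then have "z = \<zero>\<^bsub>E (Suc (Suc n))\<^esub>" using finite[of "Suc (Suc n)"] by auto
      moreover have "J \<subseteq> carrier R" using additive_subgroup.a_subset[OF ideal.axioms(1)[OF base(1)]] .
      ultimately show "\<exists>e\<in>carrier (E (Suc n)). d (Suc n) e = z \<and> (\<forall>r\<in>J. r \<odot>\<^bsub>E (Suc n)\<^esub> e = \<zero>\<^bsub>E (Suc n)\<^esub>)"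
        using d_zero by (intro bexI[of _ "\<zero>\<^bsub>E (Suc n)\<^esub>"]) auto
    qed
  next
    case (step k)
    then show ?case using lifts_from_max_ideal[OF lifts_max_ideal] by blast
  qed
next
  case False
  show ?thesis unfolding lifts_def
  proof (intro ballI impI)
    fix z assume "z \<in> carrier (E (Suc (Suc k)))"
    then have "z = \<zero>\<^bsub>E (Suc (Suc k))\<^esub>" using finite[of "Suc (Suc k)"] False by auto
    moreover have "J \<subseteq> carrier R" using additive_subgroup.a_subset[OF ideal.axioms(1)[OF assms(1)]] .
    ultimately show "\<exists>e\<in>carrier (E (Suc k)). d (Suc k) e = z \<and> (\<forall>r\<in>J. r \<odot>\<^bsub>E (Suc k)\<^esub> e = \<zero>\<^bsub>E (Suc k)\<^esub>)"
      using d_zero by (intro bexI[of _ "\<zero>\<^bsub>E (Suc k)\<^esub>"]) auto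
  qed
qed

end

section \<open>The reduction of a canonical ideal\<close>

context canonical_resolution
begin

lemma \<omega>_sub: "submodule \<omega> R (self_module R)"
  using \<omega>_ideal submodule_self_iff[OF is_cring] by blast

lemma \<omega>_carrier: "\<omega> \<subseteq> carrier R"
  using self.submodule_subset[OF \<omega>_sub] by simp

sublocale W: plain_module R "ideal_module R \<omega>"
  by (rule plain_moduleI[OF module_ideal[OF is_cring \<omega>_ideal]])

lemma \<omega>_mult: "r \<in> carrier R \<Longrightarrow> c \<in> \<omega> \<Longrightarrow> r \<otimes> c \<in> \<omega>"
  using ideal.I_l_closed[OF \<omega>_ideal] by blast

lemma \<eta>_mhom: "\<eta> \<in> mhom R (ideal_module R \<omega>) (E 0)"
  using resolution by (simp add: injective_resolution_def)

lemma \<eta>_closed: "c \<in> \<omega> \<Longrightarrow> \<eta> c \<in> carrier (E 0)"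
  using lin_closed[OF mhom_lin[OF \<eta>_mhom]] by simp

lemma \<eta>_smult: "r \<in> carrier R \<Longrightarrow> c \<in> \<omega> \<Longrightarrow> \<eta> (r \<otimes> c) = r \<odot>\<^bsub>E 0\<^esub> \<eta> c"
  using lin_smult[OF mhom_lin[OF \<eta>_mhom]] by simp

lemma \<eta>_minus: "b \<in> \<omega> \<Longrightarrow> c \<in> \<omega> \<Longrightarrow> \<eta> (b \<ominus>\<^bsub>ideal_module R \<omega>\<^esub> c) = \<eta> b \<ominus>\<^bsub>E 0\<^esub> \<eta> c"
  using lin_minus[OF W.module_axioms E.module_axioms mhom_lin[OF \<eta>_mhom]] by simp

lemma \<eta>_inj: "b \<in> \<omega> \<Longrightarrow> c \<in> \<omega> \<Longrightarrow> \<eta> b = \<eta> c \<Longrightarrow> b = c"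
  using resolution by (auto simp: injective_resolution_def inj_on_def)

lemma \<eta>_image: "\<eta> ` \<omega> = {x \<in> carrier (E 0). d 0 x = \<zero>\<^bsub>E 1\<^esub>}"
  using resolution by (simp add: injective_resolution_def)

lemma kernel_d0:
  assumes "e \<in> carrier (E 0)" "d 0 e = \<zero>\<^bsub>E (Suc 0)\<^esub>"
  obtains c where "c \<in> \<omega>" "e = \<eta> c"
proof -
  have "e \<in> \<eta> ` \<omega>" using \<eta>_image assms by simp
  then show ?thesis using that by auto
qed

lemma d_\<eta>: "c \<in> \<omega> \<Longrightarrow> d 0 (\<eta> c) = \<zero>\<^bsub>E (Suc 0)\<^esub>"
  using \<eta>_image by auto

lemma a_nzd_\<omega>: "c \<in> \<omega> \<Longrightarrow> a \<otimes> c = \<zero> \<Longrightarrow> c = \<zero>"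
  using a_nzd \<omega>_carrier by auto

lemma a_cancel: "b \<in> carrier R \<Longrightarrow> c \<in> carrier R \<Longrightarrow> a \<otimes> b = a \<otimes> c \<Longrightarrow> b = c"
proof -
  assume *: "b \<in> carrier R" "c \<in> carrier R" "a \<otimes> b = a \<otimes> c"
  then have "a \<otimes> (b \<ominus> c) = \<zero>" by (simp add: a_minus_def r_distr r_minus r_neg)
  then have "b \<ominus> c = \<zero>" using a_nzd * by simp
  then show ?thesis using * r_right_minus_eq by blast
qed

section \<open>The quotient of \<omega> by a\<omega> inside the resolution\<close>

lemma divide_\<eta>_exists: "\<exists>s\<in>mhom R (ideal_module R \<omega>) (E 0). \<forall>c\<in>\<omega>. s (a \<otimes> c) = \<eta> c"
proof -
  obtain g where "g \<in> mhom R (ideal_module R \<omega>) (E 0)"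
    "\<And>c. c \<in> carrier (ideal_module R \<omega>) \<Longrightarrow> g (a \<odot>\<^bsub>ideal_module R \<omega>\<^esub> c) = \<eta> c"
    using injective_divisible[OF E_injective W.module_axioms a_carrier _ \<eta>_mhom] a_nzd_\<omega>
    by (metis ideal_module_simps(1,2,4))
  then show ?thesis by (intro bexI[of _ g]) auto
qed

text \<open>A division of the augmentation by \<open>a\<close>, possible in the injective module
  \<open>E 0\<close>. Composed with \<open>d 0\<close> it annihilates exactly the multiples of
  \<open>a\<close> in \<omega>.\<close>

definition s :: "'a \<Rightarrow> 'c" where
  "s = (SOME s. s \<in> mhom R (ideal_module R \<omega>) (E 0) \<and> (\<forall>c\<in>\<omega>. s (a \<otimes> c) = \<eta> c))"

lemma s: "s \<in> mhom R (ideal_module R \<omega>) (E 0)" "c \<in> \<omega> \<Longrightarrow> s (a \<otimes> c) = \<eta> c"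
proof -
  have "\<exists>s. s \<in> mhom R (ideal_module R \<omega>) (E 0) \<and> (\<forall>c\<in>\<omega>. s (a \<otimes> c) = \<eta> c)"
    using divide_\<eta>_exists by blast
  from someI_ex[OF this, folded s_def]
  show "s \<in> mhom R (ideal_module R \<omega>) (E 0)" "c \<in> \<omega> \<Longrightarrow> s (a \<otimes> c) = \<eta> c" by auto
qed

lemma s_closed: "c \<in> \<omega> \<Longrightarrow> s c \<in> carrier (E 0)"
  using lin_closed[OF mhom_lin[OF s(1)]] by simp

lemma a_s: "c \<in> \<omega> \<Longrightarrow> a \<odot>\<^bsub>E 0\<^esub> s c = \<eta> c"
  using lin_smult[OF mhom_lin[OF s(1)], of a c] s(2)[of c] by simp

text \<open>The composite of \<open>s\<close> and \<open>d 0\<close> has kernel \<open>a\<omega>\<close>, so its image is a copy of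
  \<open>\<omega>/a\<omega>\<close> inside the second module of the resolution.\<close>

definition p :: "'a \<Rightarrow> 'c" where "p c = d 0 (s c)"

definition S :: "('a, 'c) module" where "S = (E (Suc 0))\<lparr>carrier := p ` \<omega>\<rparr>"

lemma p_lin: "lin R (ideal_module R \<omega>) (E (Suc 0)) p"
  unfolding p_def by (rule lin_comp[OF mhom_lin[OF s(1)] d_lin])

lemma S_sub: "submodule (p ` \<omega>) R (E (Suc 0))"
  using submodule_lin_image[OF W.module_axioms E.module_axioms p_lin W.carrier_is_submodule] by simp

sublocale S: plain_module R S
  unfolding S_def by (rule plain_moduleI[OF E.module_restrict[OF S_sub]])

lemma S_simps [simp]: "carrier S = p ` \<omega>" "\<zero>\<^bsub>S\<^esub> = \<zero>\<^bsub>E (Suc 0)\<^esub>" "x \<oplus>\<^bsub>S\<^esub> y = x \<oplus>\<^bsub>E (Suc 0)\<^esub> y"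
  "r \<odot>\<^bsub>S\<^esub> x = r \<odot>\<^bsub>E (Suc 0)\<^esub> x"
  by (simp_all add: S_def)

lemma p_lin_S: "lin R (ideal_module R \<omega>) S p"
  using lin_closed[OF p_lin] lin_add[OF p_lin] lin_smult[OF p_lin] by (intro linI) simp_all

lemma S_mem_E: "z \<in> carrier S \<Longrightarrow> z \<in> carrier (E (Suc 0))"
  using E.submodule_mem[OF S_sub] by simp

text \<open>If \<open>d 0\<close> kills \<open>s c\<close>, then \<open>s c\<close> is the image of
  some b in \<omega>; multiplying by \<open>a\<close> and using that \<eta> is injective gives
  \<open>c = a b\<close>.\<close>

lemma p_zero_iff:
  assumes c: "c \<in> \<omega>"
  shows "p c = \<zero>\<^bsub>E (Suc 0)\<^esub> \<longleftrightarrow> (\<exists>b\<in>\<omega>. c = a \<otimes> b)"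
proof
  assume "p c = \<zero>\<^bsub>E (Suc 0)\<^esub>"
  then obtain b where b: "b \<in> \<omega>" "s c = \<eta> b" using kernel_d0[OF s_closed[OF c]] p_def by auto
  have "\<eta> c = \<eta> (a \<otimes> b)" using a_s[OF c] b \<eta>_smult[of a b] by simp
  then show "\<exists>b\<in>\<omega>. c = a \<otimes> b" using \<eta>_inj[OF c \<omega>_mult[OF a_carrier b(1)]] b by blast
next
  assume "\<exists>b\<in>\<omega>. c = a \<otimes> b"
  then obtain b where "b \<in> \<omega>" "c = a \<otimes> b" by blast
  then show "p c = \<zero>\<^bsub>E (Suc 0)\<^esub>" using s(2)[of b] d_\<eta>[of b] by (simp add: p_def)
qed

lemma a_S: "z \<in> carrier S \<Longrightarrow> a \<odot>\<^bsub>E (Suc 0)\<^esub> z = \<zero>\<^bsub>E (Suc 0)\<^esub>"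
proof -
  assume "z \<in> carrier S"
  then obtain c where c: "c \<in> \<omega>" "z = p c" by auto
  have "a \<odot>\<^bsub>E (Suc 0)\<^esub> z = p (a \<otimes> c)" using lin_smult[OF p_lin, of a c] c by simp
  then show ?thesis using p_zero_iff[OF \<omega>_mult[OF a_carrier c(1)]] c by auto
qed

lemma d_S: "z \<in> carrier S \<Longrightarrow> d (Suc 0) z = \<zero>\<^bsub>E (Suc (Suc 0))\<^esub>"
  using dd[of _ 0] s_closed by (auto simp: p_def)

lemma p_minus: "b \<in> \<omega> \<Longrightarrow> c \<in> \<omega> \<Longrightarrow> p (b \<ominus>\<^bsub>ideal_module R \<omega>\<^esub> c) = p b \<ominus>\<^bsub>E (Suc 0)\<^esub> p c"
  using lin_minus[OF W.module_axioms E.module_axioms p_lin] by simp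

text \<open>Baer's criterion for \<omega>/a\<omega> over \<open>R\<close>/\<open>aR\<close>: by
  \<open>fa\<close> the map factors through \<open>J\<close> modulo \<open>aR\<close>. Injectivity
  extends it into \<open>E 1\<close>, the vanishing of Ext in degree 2 makes the extension a cycle,
  and \<open>fa\<close> brings it back into \<open>S\<close>.\<close>

lemma baer_S:
  assumes J: "ideal J R" "a \<in> J" and f: "lin R (ideal_module R J) S f" and fa: "f a = \<zero>\<^bsub>S\<^esub>"
  obtains z where "z \<in> carrier S" "\<And>x. x \<in> J \<Longrightarrow> f x = x \<odot>\<^bsub>S\<^esub> z"
proof -
  have Jc: "J \<subseteq> carrier R" using additive_subgroup.a_subset[OF ideal.axioms(1)[OF J(1)]] .
  have fE: "lin R (ideal_module R J) (E (Suc 0)) f"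
    using lin_closed[OF f] lin_add[OF f] lin_smult[OF f] S_mem_E by (intro linI) simp_all
  have fS: "f x \<in> carrier S" if "x \<in> J" for x using lin_closed[OF f] that by simp
  obtain y where y: "y \<in> carrier (E (Suc 0))" "\<And>x. x \<in> J \<Longrightarrow> f x = x \<odot>\<^bsub>E (Suc 0)\<^esub> y"
    using injective_extend[OF E_injective J(1) fE] by blast
  have "\<forall>x\<in>J. x \<odot>\<^bsub>E (Suc (Suc 0))\<^esub> d (Suc 0) y = \<zero>\<^bsub>E (Suc (Suc 0))\<^esub>"
  proof
    fix x assume x: "x \<in> J"
    then have "x \<odot>\<^bsub>E (Suc (Suc 0))\<^esub> d (Suc 0) y = d (Suc 0) (f x)" using y(2)[OF x] y(1) Jc d_smult[of x y "Suc 0"] by auto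
    then show "x \<odot>\<^bsub>E (Suc (Suc 0))\<^esub> d (Suc 0) y = \<zero>\<^bsub>E (Suc (Suc 0))\<^esub>" using d_S[OF fS[OF x]] by simp
  qed
  \<comment> \<open>Index 0 stands for Ext in degree 2 of \<open>R\<close>/\<open>J\<close>, applied
    to the cycle \<open>d y\<close>, which \<open>J\<close> annihilates.\<close>
  then obtain y' where y': "y' \<in> carrier (E (Suc 0))" "d (Suc 0) y' = d (Suc 0) y"
    "\<And>x. x \<in> J \<Longrightarrow> x \<odot>\<^bsub>E (Suc 0)\<^esub> y' = \<zero>\<^bsub>E (Suc 0)\<^esub>"
    using lifts_all[OF J, of 0] d_closed[OF y(1)] dd[OF y(1)] unfolding lifts_def by blast
  let ?w = "y \<ominus>\<^bsub>E (Suc 0)\<^esub> y'"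
  have w: "?w \<in> carrier (E (Suc 0))" using y y' by simp
  have "d (Suc 0) ?w = \<zero>\<^bsub>E (Suc (Suc 0))\<^esub>" using y y' by (simp add: d_minus E.minus_eq_zero_iff)
  then obtain e where e: "e \<in> carrier (E 0)" "d 0 e = ?w" using exact[OF w] by blast
  have xw: "x \<odot>\<^bsub>E (Suc 0)\<^esub> ?w = f x" if x: "x \<in> J" for x
  proof -
    have xc: "x \<in> carrier R" using x Jc by auto
    have "f x \<in> carrier (E (Suc 0))" using fS[OF x] S_mem_E by simp
    then show ?thesis
      using xc y(1) y(2)[OF x] y'(1) y'(3)[OF x] E.add_minus_cancel[of "f x" "Suc 0" "\<zero>\<^bsub>E (Suc 0)\<^esub>"]
      by (simp add: E.smult_minus_distr)
  qed
  \<comment> \<open>As \<open>f a = 0\<close>, the element \<open>a e\<close> is a cycle and comes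
    from some c in \<omega>. Then \<open>p c\<close> is the element sought, since \<open>e\<close>
    and \<open>s c\<close> have the same product with \<open>a\<close>.\<close>
  have "d 0 (a \<odot>\<^bsub>E 0\<^esub> e) = \<zero>\<^bsub>E (Suc 0)\<^esub>" using e xw[OF J(2)] fa by (simp add: d_smult)
  then obtain c where c: "c \<in> \<omega>" "a \<odot>\<^bsub>E 0\<^esub> e = \<eta> c" using kernel_d0[of "a \<odot>\<^bsub>E 0\<^esub> e"] e by auto
  show ?thesis
  proof (rule that[of "p c"])
    show "p c \<in> carrier S" using c by simp
    fix x assume x: "x \<in> J"
    have xc: "x \<in> carrier R" using x Jc by auto
    obtain b where b: "b \<in> \<omega>" "f x = p b" using fS[OF x] by auto
    let ?u = "x \<odot>\<^bsub>E 0\<^esub> e \<ominus>\<^bsub>E 0\<^esub> s b"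
    have u: "?u \<in> carrier (E 0)" using xc e s_closed[OF b(1)] by simp
    have "d 0 ?u = \<zero>\<^bsub>E (Suc 0)\<^esub>"
      using xc e s_closed[OF b(1)] xw[OF x] b(2) p_def by (simp add: d_minus d_smult E.minus_eq_zero_iff)
    then obtain b' where b': "b' \<in> \<omega>" "?u = \<eta> b'" using kernel_d0[OF u] by blast
    have "\<eta> (a \<otimes> b') = a \<odot>\<^bsub>E 0\<^esub> ?u" using \<eta>_smult[of a b'] b' by simp
    also have "\<dots> = x \<odot>\<^bsub>E 0\<^esub> (a \<odot>\<^bsub>E 0\<^esub> e) \<ominus>\<^bsub>E 0\<^esub> a \<odot>\<^bsub>E 0\<^esub> s b"
      using xc e s_closed[OF b(1)] by (simp add: E.smult_minus_distr E.smult_commute[of a])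
    also have "\<dots> = \<eta> ((x \<otimes> c) \<ominus>\<^bsub>ideal_module R \<omega>\<^esub> b)"
      using c a_s[OF b(1)] \<eta>_smult[OF xc c(1)] \<eta>_minus[OF \<omega>_mult[OF xc c(1)] b(1)] by simp
    finally have "a \<otimes> b' = (x \<otimes> c) \<ominus>\<^bsub>ideal_module R \<omega>\<^esub> b"
      using \<eta>_inj[OF \<omega>_mult[OF a_carrier b'(1)]] W.minus_closed'[of "x \<otimes> c" b] \<omega>_mult[OF xc c(1)] b by simp
    moreover have "p (a \<otimes> b') = \<zero>\<^bsub>E (Suc 0)\<^esub>"
      using p_zero_iff[OF \<omega>_mult[OF a_carrier b'(1)]] b'(1) by blast
    ultimately have "p (x \<otimes> c) \<ominus>\<^bsub>E (Suc 0)\<^esub> p b = \<zero>\<^bsub>E (Suc 0)\<^esub>"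
      using p_minus[OF \<omega>_mult[OF xc c(1)] b(1)] by simp
    then have "p (x \<otimes> c) = p b"
      using E.minus_eq_zero_iff lin_closed[OF p_lin] \<omega>_mult[OF xc c(1)] b(1) by simp
    then show "f x = x \<odot>\<^bsub>S\<^esub> p c" using b lin_smult[OF p_lin xc, of c] c by simp
  qed
qed

text \<open>The difference of \<open>s c\<close> and \<open>e\<close> is a cycle, hence comes from
  \<omega>; multiplying by \<open>a\<close> removes \<open>e\<close> and shows that c is a multiple
  of \<open>a\<close>. This is why nonzero socle elements of \<open>S\<close> have nonzero classes
  in Ext of degree 1.\<close>

lemma socle_not_boundary:
  assumes z: "z \<in> carrier S" and e: "e \<in> carrier (E 0)" "d 0 e = z" and ae: "a \<odot>\<^bsub>E 0\<^esub> e = \<zero>\<^bsub>E 0\<^esub>"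
  shows "z = \<zero>\<^bsub>S\<^esub>"
proof -
  obtain c where c: "c \<in> \<omega>" "z = p c" using z by auto
  let ?u = "s c \<ominus>\<^bsub>E 0\<^esub> e"
  have sc: "s c \<in> carrier (E 0)" using s_closed[OF c(1)] .
  have "d 0 ?u = \<zero>\<^bsub>E (Suc 0)\<^esub>" using sc e c by (simp add: d_minus p_def E.minus_eq_zero_iff)
  then obtain b where b: "b \<in> \<omega>" "?u = \<eta> b" using kernel_d0[of ?u] sc e by auto
  have "\<eta> (a \<otimes> b) = a \<odot>\<^bsub>E 0\<^esub> ?u" using \<eta>_smult[of a b] b by simp
  also have "\<dots> = \<eta> c"
    using sc e ae a_s[OF c(1)] \<eta>_closed[OF c(1)] E.add_minus_cancel[of "\<eta> c" 0 "\<zero>\<^bsub>E 0\<^esub>"]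
    by (simp add: E.smult_minus_distr)
  finally have "c = a \<otimes> b" using \<eta>_inj \<omega>_mult[OF a_carrier b(1)] c(1) by metis
  then show ?thesis using p_zero_iff[OF c(1)] b c by auto
qed

section \<open>The residue field, its Ext in degree 1 and the socle of \<open>S\<close>\<close>

abbreviation k :: "('a, 'a set) module" where "k \<equiv> residue_module R"

lemma k_quotient: "module_quotient R (self_module R) m"
  by (rule module_quotient.intro[OF self.plain_module_axioms module_quotient_axioms.intro[OF m_sub]])

sublocale k: plain_module R "residue_module R"
  unfolding residue_module_def m_max[symmetric]
  by (rule plain_moduleI[OF module_quotient.module_Q[OF k_quotient]])

definition cl :: "'a \<Rightarrow> 'a set" where "cl r = m +>\<^bsub>self_module R\<^esub> r"

lemma k_carrier: "carrier k = cl ` carrier R"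
  using module_quotient.Q_carrier[OF k_quotient] unfolding residue_module_def m_max[symmetric] cl_def by simp

lemma k_add: "r \<in> carrier R \<Longrightarrow> t \<in> carrier R \<Longrightarrow> cl r \<oplus>\<^bsub>k\<^esub> cl t = cl (r \<oplus> t)"
  using module_quotient.Q_add[OF k_quotient] unfolding residue_module_def m_max[symmetric] cl_def by simp

lemma k_smult: "r \<in> carrier R \<Longrightarrow> t \<in> carrier R \<Longrightarrow> r \<odot>\<^bsub>k\<^esub> cl t = cl (r \<otimes> t)"
  using module_quotient.Q_smult[OF k_quotient] unfolding residue_module_def m_max[symmetric] cl_def by simp

lemma cl_eq_iff: "r \<in> carrier R \<Longrightarrow> t \<in> carrier R \<Longrightarrow> cl r = cl t \<longleftrightarrow> r \<ominus>\<^bsub>self_module R\<^esub> t \<in> m"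
  using module_quotient.proj_eq_iff[OF k_quotient] unfolding cl_def by simp

lemma k_zero: "\<zero>\<^bsub>k\<^esub> = cl \<zero>"
  using module_quotient.Q_zero[OF k_quotient] unfolding residue_module_def m_max[symmetric] cl_def by simp

lemma cl_m: "r \<in> m \<Longrightarrow> cl r = \<zero>\<^bsub>k\<^esub>"
  using cl_eq_iff[of r \<zero>] m_carrier self.add_minus_cancel[of r \<zero>] by (auto simp: k_zero)

text \<open>The homomorphism from the residue field that sends the class of \<open>1\<close> to \<open>z\<close>.\<close>

definition \<phi> :: "'c \<Rightarrow> 'a set \<Rightarrow> 'c" where
  "\<phi> z = (\<lambda>u\<in>carrier k. (SOME r. r \<in> carrier R \<and> cl r = u) \<odot>\<^bsub>E (Suc 0)\<^esub> z)"

context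
  fixes z assumes z: "z \<in> carrier S" "\<And>r. r \<in> m \<Longrightarrow> r \<odot>\<^bsub>E (Suc 0)\<^esub> z = \<zero>\<^bsub>E (Suc 0)\<^esub>"
begin

lemma \<phi>_cl: "r \<in> carrier R \<Longrightarrow> \<phi> z (cl r) = r \<odot>\<^bsub>E (Suc 0)\<^esub> z"
proof -
  assume r: "r \<in> carrier R"
  let ?t = "SOME t. t \<in> carrier R \<and> cl t = cl r"
  have t: "?t \<in> carrier R \<and> cl ?t = cl r" by (rule someI[of _ r]) (use r in simp)
  then have "?t \<ominus>\<^bsub>self_module R\<^esub> r \<in> m" using cl_eq_iff r by blast
  then have h: "(?t \<ominus>\<^bsub>self_module R\<^esub> r) \<odot>\<^bsub>E (Suc 0)\<^esub> z = \<zero>\<^bsub>E (Suc 0)\<^esub>" using z by simp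
  have "?t = (?t \<ominus>\<^bsub>self_module R\<^esub> r) \<oplus> r" using self.minus_add_cancel[of ?t r] t r by simp
  then have "?t \<odot>\<^bsub>E (Suc 0)\<^esub> z = (?t \<ominus>\<^bsub>self_module R\<^esub> r) \<odot>\<^bsub>E (Suc 0)\<^esub> z \<oplus>\<^bsub>E (Suc 0)\<^esub> r \<odot>\<^bsub>E (Suc 0)\<^esub> z"
    using E.smult_l_distr[of "?t \<ominus>\<^bsub>self_module R\<^esub> r" r z "Suc 0"] self.minus_closed'[of ?t r] t r S_mem_E[OF z(1)]
    by simp
  then show ?thesis using h r k_carrier S_mem_E[OF z(1)] by (simp add: \<phi>_def)
qed

lemma \<phi>_mhom: "\<phi> z \<in> mhom R k (E (Suc 0))"
  unfolding mhom_iff_lin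
proof
  show "\<phi> z \<in> extensional (carrier k)" by (simp add: \<phi>_def)
  show "lin R k (E (Suc 0)) (\<phi> z)"
    using S_mem_E[OF z(1)]
    by (intro linI) (auto simp: k_carrier \<phi>_cl k_add k_smult E.smult_l_distr E.smult_assoc1)
qed

lemma \<phi>_cycle: "\<phi> z \<in> Ext_cycles R k E d 1"
  using \<phi>_mhom d_S z S_mem_E[OF z(1)]
  by (auto simp: Ext_cycles_def k_carrier \<phi>_cl d_smult)

end

lemma Ext_cycles_sub: "submodule (Ext_cycles R k E d 1) R (Hom_module R k (E 1))"
proof -
  interpret H: plain_module R "Hom_module R k (E 1)"
    by (rule plain_moduleI[OF module_Hom[OF k.module_axioms E.module_axioms]])
  have mh: "lin R k (E 1) f" if "f \<in> mhom R k (E 1)" for f using that mhom_lin by blast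
  note c = lin_closed[OF mh]
  show ?thesis
  proof (rule H.submodule_criterion)
    show "Ext_cycles R k E d 1 \<subseteq> carrier (Hom_module R k (E 1))"
      by (auto simp: Ext_cycles_def Hom_module_simps)
    show "\<zero>\<^bsub>Hom_module R k (E 1)\<^esub> \<in> Ext_cycles R k E d 1"
      using H.M.zero_closed d_zero[of 1] by (simp add: Ext_cycles_def Hom_module_simps)
    show "f \<oplus>\<^bsub>Hom_module R k (E 1)\<^esub> g \<in> Ext_cycles R k E d 1"
      if f: "f \<in> Ext_cycles R k E d 1" and g: "g \<in> Ext_cycles R k E d 1" for f g
      using H.M.a_closed[of f g] f g c[of f] c[of g] d_add[of _ 1] d_zero[of 1]
      by (simp add: Ext_cycles_def Hom_module_simps)
    show "r \<odot>\<^bsub>Hom_module R k (E 1)\<^esub> f \<in> Ext_cycles R k E d 1"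
      if r: "r \<in> carrier R" and f: "f \<in> Ext_cycles R k E d 1" for r f
      using H.smult_closed[of r f] r f c[of f] d_smult[of r _ 1] by (simp add: Ext_cycles_def Hom_module_simps)
  qed
qed

lemma Ext_boundaries_sub: "submodule (Ext_boundaries R k E d 1) R (Hom_module R k (E 1))"
proof -
  note H0 = module_Hom[OF k.module_axioms E.module_axioms[of 0]]
  note H1 = module_Hom[OF k.module_axioms E.module_axioms[of "Suc 0"]]
  interpret H: plain_module R "Hom_module R k (E 0)" by (rule plain_moduleI[OF H0])
  have c: "f x \<in> carrier (E 0)" if "f \<in> mhom R k (E 0)" "x \<in> carrier k" for f x
    using lin_closed[OF mhom_lin[OF that(1)] that(2)] .
  have 1: "compose (carrier k) (d 0) f \<in> mhom R k (E (Suc 0))" if "f \<in> mhom R k (E 0)" for f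
    using restrict_mhom[OF k.module_axioms lin_comp[OF mhom_lin[OF that] d_lin]] by (simp add: compose_def)
  have "lin R (Hom_module R k (E 0)) (Hom_module R k (E (Suc 0))) (compose (carrier k) (d 0))"
    unfolding lin_def Hom_module_simps using 1 c
    by (auto simp: compose_def d_add d_smult cong: restrict_cong)
  from submodule_lin_image[OF H0 H1 this H.carrier_is_submodule]
  show ?thesis by (simp add: Ext_boundaries_def Hom_module_simps)
qed

lemma boundaries_le_cycles: "Ext_boundaries R k E d 1 \<subseteq> Ext_cycles R k E d 1"
proof
  fix f assume "f \<in> Ext_boundaries R k E d 1"
  then obtain h where h: "h \<in> mhom R k (E 0)" "f = compose (carrier k) (d 0) h"
    by (auto simp: Ext_boundaries_def)
  have c: "h x \<in> carrier (E 0)" if "x \<in> carrier k" for x using lin_closed[OF mhom_lin[OF h(1)] that] .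
  have "f \<in> mhom R k (E (Suc 0))"
    using restrict_mhom[OF k.module_axioms lin_comp[OF mhom_lin[OF h(1)] d_lin]] h by (simp add: compose_def)
  then show "f \<in> Ext_cycles R k E d 1" using c h dd[of _ 0] by (simp add: Ext_cycles_def compose_eq)
qed

lemma boundary_eval:
  assumes f: "f \<in> Ext_boundaries R k E d 1"
  obtains e where "e \<in> carrier (E 0)" "d 0 e = f (cl \<one>)" "\<And>r. r \<in> m \<Longrightarrow> r \<odot>\<^bsub>E 0\<^esub> e = \<zero>\<^bsub>E 0\<^esub>"
proof -
  obtain h where h: "h \<in> mhom R k (E 0)" "f = compose (carrier k) (d 0) h"
    using f by (auto simp: Ext_boundaries_def)
  note hl = mhom_lin[OF h(1)]
  have one: "cl \<one> \<in> carrier k" by (simp add: k_carrier)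
  show ?thesis
  proof (rule that[of "h (cl \<one>)"])
    show "h (cl \<one>) \<in> carrier (E 0)" by (rule lin_closed[OF hl one])
    show "d 0 (h (cl \<one>)) = f (cl \<one>)" using one h by (simp add: compose_eq)
    fix r assume r: "r \<in> m"
    then have rc: "r \<in> carrier R" using m_carrier by auto
    have "r \<odot>\<^bsub>E 0\<^esub> h (cl \<one>) = h (r \<odot>\<^bsub>k\<^esub> cl \<one>)" using lin_smult[OF hl rc one] by simp
    also have "\<dots> = h \<zero>\<^bsub>k\<^esub>" using k_smult[OF rc, of \<one>] cl_m[OF r] rc by simp
    also have "\<dots> = \<zero>\<^bsub>E 0\<^esub>" by (rule lin_zero[OF k.module_axioms E.module_axioms hl])
    finally show "r \<odot>\<^bsub>E 0\<^esub> h (cl \<one>) = \<zero>\<^bsub>E 0\<^esub>" .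
  qed
qed

text \<open>The map \<open>\<phi>\<close> carries the socle of \<open>S\<close> into the cycles, and
  by \<open>socle_not_boundary\<close> only zero becomes a boundary. A socle element outside the
  multiples of \<open>z\<close> would give a chain of length two between boundaries and cycles,
  against type one.\<close>

lemma socle_S:
  assumes z: "z \<in> carrier S" "\<And>r. r \<in> m \<Longrightarrow> r \<odot>\<^bsub>S\<^esub> z = \<zero>\<^bsub>S\<^esub>"
    and z': "z' \<in> carrier S" "\<And>r. r \<in> m \<Longrightarrow> r \<odot>\<^bsub>S\<^esub> z' = \<zero>\<^bsub>S\<^esub>" and nz: "z \<noteq> \<zero>\<^bsub>S\<^esub>"
  shows "\<exists>r\<in>carrier R. z' = r \<odot>\<^bsub>S\<^esub> z"
proof (rule ccontr)
  assume none: "\<not> ?thesis"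
  let ?H = "Hom_module R k (E 1)" and ?B = "Ext_boundaries R k E d 1" and ?Z = "Ext_cycles R k E d 1"
  interpret H: plain_module R ?H
    by (rule plain_moduleI[OF module_Hom[OF k.module_axioms E.module_axioms]])
  have z0: "\<And>r. r \<in> m \<Longrightarrow> r \<odot>\<^bsub>E (Suc 0)\<^esub> z = \<zero>\<^bsub>E (Suc 0)\<^esub>" and z0': "\<And>r. r \<in> m \<Longrightarrow> r \<odot>\<^bsub>E (Suc 0)\<^esub> z' = \<zero>\<^bsub>E (Suc 0)\<^esub>"
    using z z' by simp_all
  have E: "z \<in> carrier (E (Suc 0))" "z' \<in> carrier (E (Suc 0))" using z z' S_mem_E by auto
  note B = Ext_boundaries_sub and Z = Ext_cycles_sub
  have \<phi>Z: "\<phi> z \<in> ?Z" "\<phi> z' \<in> ?Z" using \<phi>_cycle[OF z(1) z0] \<phi>_cycle[OF z'(1) z0'] by auto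
  have \<phi>H: "\<phi> z \<in> carrier ?H" using H.submodule_mem[OF Z \<phi>Z(1)] .
  have one: "cl \<one> \<in> carrier k" by (simp add: k_carrier)
  let ?C = "(\<lambda>r. r \<odot>\<^bsub>?H\<^esub> \<phi> z) ` carrier R"
  let ?D = "?B <+>\<^bsub>?H\<^esub> ?C"
  have C: "submodule ?C R ?H" by (rule H.submodule_cyclic[OF \<phi>H])
  have D: "submodule ?D R ?H" by (rule H.submodule_set_add[OF B C])
  have BD: "?B \<subseteq> ?D" and CD: "?C \<subseteq> ?D" using H.set_add_upper1[OF B C] H.set_add_upper2[OF B C] by auto
  have DZ: "?D \<subseteq> ?Z"
    using H.submodule_smult[OF Z _ \<phi>Z(1)] by (intro H.set_add_least[OF Z boundaries_le_cycles]) auto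
  have "\<phi> z \<notin> ?B"
  proof
    assume "\<phi> z \<in> ?B"
    then obtain e where e: "e \<in> carrier (E 0)" "d 0 e = \<phi> z (cl \<one>)" "\<And>r. r \<in> m \<Longrightarrow> r \<odot>\<^bsub>E 0\<^esub> e = \<zero>\<^bsub>E 0\<^esub>"
      using boundary_eval by blast
    have "d 0 e = z" using e(2) \<phi>_cl[OF z(1) z0, of \<one>] E by simp
    then show False using socle_not_boundary[OF z(1) e(1) _ e(3)[OF a_m]] nz by simp
  qed
  then have s1: "?B \<subset> ?D" using BD CD H.mem_cyclic_self[OF \<phi>H] by blast
  \<comment> \<open>Evaluated at the class of one, such a relation makes \<open>z' - r z\<close>, an
    element of \<open>S\<close>, the image of an element of \<open>E 0\<close> killed by
    \<open>a\<close>; so it is zero.\<close>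
  have "\<phi> z' \<notin> ?D"
  proof
    assume "\<phi> z' \<in> ?D"
    then obtain b r where b: "b \<in> ?B" "r \<in> carrier R" "\<phi> z' = b \<oplus>\<^bsub>?H\<^esub> r \<odot>\<^bsub>?H\<^esub> \<phi> z"
      unfolding H.mem_set_add by blast
    obtain e where e: "e \<in> carrier (E 0)" "d 0 e = b (cl \<one>)" "\<And>r. r \<in> m \<Longrightarrow> r \<odot>\<^bsub>E 0\<^esub> e = \<zero>\<^bsub>E 0\<^esub>"
      using boundary_eval[OF b(1)] by blast
    have "z' = \<phi> z' (cl \<one>)" using \<phi>_cl[OF z'(1) z0', of \<one>] E by simp
    also have "\<dots> = d 0 e \<oplus>\<^bsub>E (Suc 0)\<^esub> r \<odot>\<^bsub>E (Suc 0)\<^esub> z"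
      using b one e \<phi>_cl[OF z(1) z0, of \<one>] E by (simp add: Hom_module_simps)
    finally have eq: "z' = d 0 e \<oplus>\<^bsub>E (Suc 0)\<^esub> r \<odot>\<^bsub>E (Suc 0)\<^esub> z" .
    have rz: "r \<odot>\<^bsub>E (Suc 0)\<^esub> z \<in> carrier S" using S.smult_closed[OF b(2) z(1)] by simp
    have "d 0 e = z' \<ominus>\<^bsub>E (Suc 0)\<^esub> r \<odot>\<^bsub>E (Suc 0)\<^esub> z"
      using eq e(1) b(2) E E.add_minus_cancel[of "d 0 e" "Suc 0" "r \<odot>\<^bsub>E (Suc 0)\<^esub> z"] by simp
    then have "d 0 e \<in> carrier S" using E.submodule_minus[OF S_sub] z' rz by simp
    then have "d 0 e = \<zero>\<^bsub>E (Suc 0)\<^esub>" using socle_not_boundary[OF _ e(1) refl e(3)[OF a_m]] by simp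
    then have "z' = r \<odot>\<^bsub>S\<^esub> z" using eq b(2) E by simp
    then show False using none b by blast
  qed
  then have s2: "?D \<subset> ?Z" using DZ \<phi>Z by blast
  have "1 \<le> ilen R ?H ?B ?D" using ilen_strict[OF B D subset_refl s1] unfolding ilen_self by simp
  from add_right_mono[OF this, of 1] ilen_strict[OF D Z BD s2]
  have "1 + 1 \<le> ilen R ?H ?B ?Z" by (rule order_trans)
  moreover have "ilen R ?H ?B ?Z = 1"
    using type_one module_length_quot_restrict[OF H.module_axioms B Z boundaries_le_cycles]
    by (simp add: Ext_module_def)
  ultimately show False by (simp add: one_enat_def)
qed

end

section \<open>Duality into a canonical ideal\<close>

context canonical_resolution
begin

lemma noeth_\<omega>: "noeth R (ideal_module R \<omega>)"
  by (rule noeth_restrict[OF R_noeth \<omega>_sub])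

lemma noeth_S: "noeth R S"
  by (rule noeth_lin_surj[OF noeth_\<omega> S.module_axioms p_lin_S]) simp

text \<open>Baer's argument with a maximal extension, furnished by the chain condition on
  \<open>Z\<close>. Adjoining x leads to a map on the ideal of those r for which r x lies in
  \<open>B\<close>; this ideal contains \<open>a\<close>, and \<open>fa\<close> makes
  \<open>baer_S\<close> applicable. The type of \<open>Z\<close> is arbitrary, as required for the
  module \<open>M\<close> and its duals.\<close>

lemma extend_S:
  assumes Z: "noeth R Z" and A: "submodule A R Z" and aZ: "\<And>z. z \<in> carrier Z \<Longrightarrow> a \<odot>\<^bsub>Z\<^esub> z \<in> A"
    and f: "lin R (Z\<lparr>carrier := A\<rparr>) S f" and fa: "\<And>z. z \<in> carrier Z \<Longrightarrow> f (a \<odot>\<^bsub>Z\<^esub> z) = \<zero>\<^bsub>S\<^esub>"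
  obtains g where "lin R Z S g" "\<And>x. x \<in> A \<Longrightarrow> g x = f x"
proof -
  interpret Z: plain_module R Z by (rule plain_moduleI[OF noeth_module[OF Z]])
  let ?Q = "\<lambda>B. A \<subseteq> B \<and> (\<exists>g. lin R (Z\<lparr>carrier := B\<rparr>) S g \<and> (\<forall>x\<in>A. g x = f x))"
  obtain B where B: "submodule B R Z" "?Q B"
    and max: "\<And>B'. submodule B' R Z \<Longrightarrow> ?Q B' \<Longrightarrow> B \<subseteq> B' \<Longrightarrow> B' = B"
    by (rule noeth_maximal[OF Z A, of ?Q]) (use f in auto)
  then obtain g where g: "lin R (Z\<lparr>carrier := B\<rparr>) S g" "\<And>x. x \<in> A \<Longrightarrow> g x = f x" and AB: "A \<subseteq> B" by auto
  have "B = carrier Z"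
  proof (rule ccontr)
    assume "B \<noteq> carrier Z"
    then obtain x where x: "x \<in> carrier Z" "x \<notin> B" using Z.submodule_subset[OF B(1)] by auto
    let ?J = "{r \<in> carrier R. r \<odot>\<^bsub>Z\<^esub> x \<in> B}"
    have J: "ideal ?J R" using Z.submodule_colon[OF B(1) x(1)] submodule_self_iff[OF is_cring] by blast
    have aJ: "a \<in> ?J" using aZ[OF x(1)] AB by auto
    have h: "lin R (ideal_module R ?J) S (\<lambda>r. g (r \<odot>\<^bsub>Z\<^esub> x))"
    proof (rule linI, unfold ideal_module_simps)
      show "g (r \<odot>\<^bsub>Z\<^esub> x) \<in> carrier S" if "r \<in> ?J" for r using lin_closed[OF g(1)] that by simp
      show "g ((r \<oplus> t) \<odot>\<^bsub>Z\<^esub> x) = g (r \<odot>\<^bsub>Z\<^esub> x) \<oplus>\<^bsub>S\<^esub> g (t \<odot>\<^bsub>Z\<^esub> x)" if "r \<in> ?J" "t \<in> ?J" for r t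
        using lin_add[OF g(1), of "r \<odot>\<^bsub>Z\<^esub> x" "t \<odot>\<^bsub>Z\<^esub> x"] that x by (simp add: Z.smult_l_distr)
      show "g ((r \<otimes> t) \<odot>\<^bsub>Z\<^esub> x) = r \<odot>\<^bsub>S\<^esub> g (t \<odot>\<^bsub>Z\<^esub> x)" if "r \<in> carrier R" "t \<in> ?J" for r t
        using lin_smult[OF g(1), of r "t \<odot>\<^bsub>Z\<^esub> x"] that x by (simp add: Z.smult_assoc1)
    qed
    have ha: "g (a \<odot>\<^bsub>Z\<^esub> x) = \<zero>\<^bsub>S\<^esub>" using g(2)[OF aZ[OF x(1)]] fa[OF x(1)] by simp
    obtain z where z: "z \<in> carrier S" "\<And>r. r \<in> ?J \<Longrightarrow> g (r \<odot>\<^bsub>Z\<^esub> x) = r \<odot>\<^bsub>S\<^esub> z"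
      using baer_S[OF J aJ h ha] by blast
    have 1: "lin R (self_module R) Z (\<lambda>r. r \<odot>\<^bsub>Z\<^esub> x)" and 2: "lin R (self_module R) S (\<lambda>r. r \<odot>\<^bsub>S\<^esub> z)"
      by (intro linI; use x z in \<open>simp add: Z.smult_l_distr Z.smult_assoc1\<close>)
         (intro linI; use S.smult_closed[OF _ z(1)] S.smult_l_distr[OF _ _ z(1)] S.smult_assoc1[OF _ _ z(1)] in simp)
    have agree: "g (r \<odot>\<^bsub>Z\<^esub> x) = r \<odot>\<^bsub>S\<^esub> z" if "r \<in> carrier (self_module R)" "r \<odot>\<^bsub>Z\<^esub> x \<in> B" for r
      using z(2)[of r] that by simp
    obtain g' where g': "lin R (Z\<lparr>carrier := B <+>\<^bsub>Z\<^esub> (\<lambda>r. r \<odot>\<^bsub>Z\<^esub> x) ` carrier (self_module R)\<rparr>) S g'"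
      "\<And>b. b \<in> B \<Longrightarrow> g' b = g b"
      using lin_glue[where i = "\<lambda>r. r \<odot>\<^bsub>Z\<^esub> x" and h = "\<lambda>r. r \<odot>\<^bsub>S\<^esub> z", OF Z.module_axioms
          self.module_axioms S.module_axioms B(1) 1 g(1) 2 agree] by blast
    let ?C = "(\<lambda>r. r \<odot>\<^bsub>Z\<^esub> x) ` carrier R"
    have C: "submodule ?C R Z" by (rule Z.submodule_cyclic[OF x(1)])
    have "B <+>\<^bsub>Z\<^esub> ?C = B"
    proof (rule max[OF Z.submodule_set_add[OF B(1) C]])
      show up: "B \<subseteq> B <+>\<^bsub>Z\<^esub> ?C" by (rule Z.set_add_upper1[OF B(1) C])
      show "?Q (B <+>\<^bsub>Z\<^esub> ?C)"
        using g' g(2) AB up by (intro conjI exI[of _ g']) auto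
    qed
    then show False using Z.set_add_upper2[OF B(1) C] Z.mem_cyclic_self[OF x(1)] x by blast
  qed
  then show ?thesis using that[of g] g by simp
qed

lemma p_surj: "z \<in> carrier S \<Longrightarrow> \<exists>c\<in>\<omega>. p c = z"
  by auto

text \<open>Values killed by \<open>p\<close> are multiples of \<open>a\<close>; since
  \<open>a\<close> is a nonzerodivisor the quotients are unique, and uniqueness makes them
  linear.\<close>

lemma lin_divide:
  assumes Y: "module R Y" and u: "lin R Y (ideal_module R \<omega>) u" and pu: "\<And>y. y \<in> carrier Y \<Longrightarrow> p (u y) = \<zero>\<^bsub>S\<^esub>"
  obtains w where "lin R Y (ideal_module R \<omega>) w" "\<And>y. y \<in> carrier Y \<Longrightarrow> u y = a \<otimes> w y"
proof -
  interpret Y: plain_module R Y by (rule plain_moduleI[OF Y])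
  have ex: "\<exists>b. b \<in> \<omega> \<and> u y = a \<otimes> b" if y: "y \<in> carrier Y" for y
    using p_zero_iff[of "u y"] pu[OF y] lin_closed[OF u y] by auto
  define w where "w y = (SOME b. b \<in> \<omega> \<and> u y = a \<otimes> b)" for y
  have w: "w y \<in> \<omega> \<and> u y = a \<otimes> w y" if "y \<in> carrier Y" for y
    unfolding w_def by (rule someI_ex[OF ex[OF that]])
  note wc = subsetD[OF \<omega>_carrier]
  have "lin R Y (ideal_module R \<omega>) w"
  proof (rule linI, unfold ideal_module_simps)
    show "w y \<in> \<omega>" if "y \<in> carrier Y" for y using w that by simp
    show "w (y \<oplus>\<^bsub>Y\<^esub> y') = w y \<oplus> w y'" if y: "y \<in> carrier Y" "y' \<in> carrier Y" for y y'
    proof (rule a_cancel)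
      show "w (y \<oplus>\<^bsub>Y\<^esub> y') \<in> carrier R" "w y \<oplus> w y' \<in> carrier R" using w wc y by auto
      show "a \<otimes> w (y \<oplus>\<^bsub>Y\<^esub> y') = a \<otimes> (w y \<oplus> w y')"
        using w[OF Y.M.a_closed[OF y]] w[OF y(1)] w[OF y(2)] lin_add[OF u y] wc by (simp add: r_distr)
    qed
    show "w (r \<odot>\<^bsub>Y\<^esub> y) = r \<otimes> w y" if r: "r \<in> carrier R" and y: "y \<in> carrier Y" for r y
    proof (rule a_cancel)
      show "w (r \<odot>\<^bsub>Y\<^esub> y) \<in> carrier R" "r \<otimes> w y \<in> carrier R" using w wc y r by auto
      show "a \<otimes> w (r \<odot>\<^bsub>Y\<^esub> y) = a \<otimes> (r \<otimes> w y)"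
        using w[OF Y.smult_closed[OF r y]] w[OF y] lin_smult[OF u r y] wc r by (simp add: m_lcomm)
    qed
  qed
  then show ?thesis using that w by blast
qed

text \<open>The obstruction lies in Ext of degree 1 of \<open>M\<close> with values in \<open>\<omega>\<close>: homomorphisms to \<open>\<omega>\<close> from the
  relation module \<open>K\<close> of a free cover, modulo those that extend to the free module. Injectivity of \<open>S\<close>
  makes multiplication by \<open>a\<close> surjective on it, so it vanishes by Nakayama's lemma.\<close>

lemma lift_to_\<omega>:
  assumes M: "noeth R M" and tf: "\<And>x. x \<in> carrier M \<Longrightarrow> a \<odot>\<^bsub>M\<^esub> x = \<zero>\<^bsub>M\<^esub> \<Longrightarrow> x = \<zero>\<^bsub>M\<^esub>"
    and h: "lin R M S h"
  obtains f where "f \<in> mhom R M (ideal_module R \<omega>)" "\<And>x. x \<in> carrier M \<Longrightarrow> p (f x) = h x"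
proof -
  interpret M: plain_module R M by (rule plain_moduleI[OF noeth_module[OF M]])
  let ?W = "ideal_module R \<omega>"
  obtain G where G: "finite G" "G \<subseteq> carrier M" "mspan R M G = carrier M"
    by (rule noeth_generators[OF M M.carrier_is_submodule])
  let ?F = "fun_module R G"
  interpret F: plain_module R ?F by (rule plain_moduleI[OF module_fun])
  have nF: "noeth R ?F" by (rule noeth_fun[OF R_noeth G(1)])
  have span: "L c = L' c"
    if N: "module R N" and L: "lin R ?F N L" "lin R ?F N L'"
      and e: "\<And>x. x \<in> G \<Longrightarrow> L (fun_unit R G x) = L' (fun_unit R G x)" and c: "c \<in> carrier ?F"
    for L L' c and N :: "('a, 'c) module"
  proof -
    have "c \<in> {c \<in> carrier ?F. L c = L' c}"
      by (rule fun_module_generated[OF G(1) lin_equalizer[OF F.module_axioms N L] _ c])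
         (use e fun_unit_closed in simp)
    then show ?thesis by simp
  qed
  define q where "q = lincomb M G (\<lambda>x. x)"
  have q: "lin R ?F M q" unfolding q_def by (rule M.lin_lincomb[OF G(1)]) (use G in auto)
  have q_unit: "q (fun_unit R G x) = x" if "x \<in> G" for x
    unfolding q_def by (rule M.lincomb_unit[OF G(1) _ that]) (use G in auto)
  have surj: "\<exists>c\<in>carrier ?F. q c = x" if x: "x \<in> carrier M" for x
  proof -
    have "mspan R M G \<subseteq> q ` carrier ?F"
    proof (rule M.mspan_least[OF submodule_lin_image[OF F.module_axioms M.module_axioms q F.carrier_is_submodule]])
      show "G \<subseteq> q ` carrier ?F" using q_unit fun_unit_closed by (metis image_eqI subsetI)
    qed
    then show ?thesis using G x by blast
  qed
  define K where "K = {c \<in> carrier ?F. q c = \<zero>\<^bsub>M\<^esub>}"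
  have K: "submodule K R ?F" unfolding K_def by (rule lin_kernel[OF F.module_axioms M.module_axioms q])
  have Kc: "K \<subseteq> carrier ?F" by (auto simp: K_def)
  let ?K = "?F\<lparr>carrier := K\<rparr>"
  have mK: "module R ?K" by (rule F.module_restrict[OF K])
  have nK: "noeth R ?K" by (rule noeth_restrict[OF nF K])
  interpret K: plain_module R ?K by (rule plain_moduleI[OF mK])
  let ?N = "Hom_module R ?K ?W"
  interpret N: plain_module R ?N by (rule plain_moduleI[OF module_Hom[OF mK W.module_axioms]])
  have nN: "noeth R ?N" by (rule noeth_Hom[OF mK W.module_axioms nK noeth_\<omega>])
  let ?H = "Hom_module R ?F ?W"
  interpret H: plain_module R ?H by (rule plain_moduleI[OF module_Hom[OF F.module_axioms W.module_axioms]])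
  have res: "restrict f K \<in> mhom R ?K ?W" if "lin R ?F ?W f" for f
    using restrict_mhom[OF mK lin_restrict_dom[OF that Kc]] by simp
  have reslin: "lin R ?H ?N (\<lambda>f. restrict f K)"
  proof (rule linI, unfold Hom_module_simps)
    show "restrict f K \<in> mhom R ?K ?W" if "f \<in> mhom R ?F ?W" for f using res mhom_lin that by blast
    show "restrict (\<lambda>x\<in>carrier ?F. f x \<oplus>\<^bsub>?W\<^esub> g x) K = (\<lambda>x\<in>carrier ?K. restrict f K x \<oplus>\<^bsub>?W\<^esub> restrict g K x)" for f g
      using Kc by (auto simp: restrict_def fun_eq_iff)
    show "restrict (\<lambda>x\<in>carrier ?F. r \<odot>\<^bsub>?W\<^esub> f x) K = (\<lambda>x\<in>carrier ?K. r \<odot>\<^bsub>?W\<^esub> restrict f K x)" for r f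
      using Kc by (auto simp: restrict_def fun_eq_iff)
  qed
  let ?Im = "(\<lambda>f. restrict f K) ` carrier ?H"
  have N0: "submodule ?Im R ?N"
    by (rule submodule_lin_image[OF H.module_axioms N.module_axioms reslin H.carrier_is_submodule])
  have free_lift: "\<exists>L. lin R ?F ?W L \<and> (\<forall>c\<in>carrier ?F. p (L c) = g c)" if g: "lin R ?F S g" for g
  proof -
    have "\<exists>v. \<forall>x\<in>G. v x \<in> \<omega> \<and> p (v x) = g (fun_unit R G x)"
      using p_surj[OF lin_closed[OF g fun_unit_closed]] by (intro bchoice) blast
    then obtain v where v: "\<And>x. x \<in> G \<Longrightarrow> v x \<in> \<omega>" "\<And>x. x \<in> G \<Longrightarrow> p (v x) = g (fun_unit R G x)" by blast
    have L: "lin R ?F ?W (lincomb ?W G v)" by (rule W.lin_lincomb[OF G(1)]) (use v in simp)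
    have "p (lincomb ?W G v c) = g c" if c: "c \<in> carrier ?F" for c
    proof (rule span[OF S.module_axioms lin_comp[OF L p_lin_S] g _ c])
      show "p (lincomb ?W G v (fun_unit R G x)) = g (fun_unit R G x)" if "x \<in> G" for x
        using W.lincomb_unit[OF G(1), of v x] v that by simp
    qed
    then show ?thesis using L by blast
  qed
  have "?Im = carrier ?N"
  proof (rule nakayama[OF nN N0 a_m])
    fix f assume "f \<in> carrier ?N"
    then have f: "f \<in> mhom R ?K ?W" by (simp add: Hom_module_simps)
    note fl = mhom_lin[OF f]
    have pf: "lin R ?K S (\<lambda>c. p (f c))" by (rule lin_comp[OF fl p_lin_S])
    have pz: "p \<zero> = \<zero>\<^bsub>S\<^esub>" using lin_zero[OF W.module_axioms S.module_axioms p_lin_S] by simp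
    \<comment> \<open>Torsion-freeness of \<open>M\<close> enters here: if \<open>a c\<close> is a
      relation, so is c. Hence \<open>p f\<close> vanishes on the intersection of \<open>K\<close>
      with \<open>aF\<close> and can be glued to the zero map on \<open>aF\<close>.\<close>
    have vanish: "p (f (a \<odot>\<^bsub>?F\<^esub> c)) = \<zero>\<^bsub>S\<^esub>" if c: "c \<in> carrier ?F" and ac: "a \<odot>\<^bsub>?F\<^esub> c \<in> K" for c
    proof -
      have "a \<odot>\<^bsub>M\<^esub> q c = \<zero>\<^bsub>M\<^esub>" using ac lin_smult[OF q a_carrier c] by (simp add: K_def)
      then have cK: "c \<in> carrier ?K" using tf[OF lin_closed[OF q c]] c by (simp add: K_def)
      have "f (a \<odot>\<^bsub>?F\<^esub> c) = a \<otimes> f c" using lin_smult[OF fl a_carrier cK] by simp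
      then show ?thesis using lin_closed[OF fl cK] p_zero_iff[of "a \<otimes> f c"] \<omega>_mult[of a "f c"] by auto
    qed
    have zl: "lin R ?F S (\<lambda>c. \<zero>\<^bsub>S\<^esub>)" by (rule lin_pointwise_zero[OF F.module_axioms S.module_axioms])
    let ?A = "K <+>\<^bsub>?F\<^esub> (\<lambda>c. a \<odot>\<^bsub>?F\<^esub> c) ` carrier ?F"
    have aF: "submodule ((\<lambda>c. a \<odot>\<^bsub>?F\<^esub> c) ` carrier ?F) R ?F"
      by (rule F.submodule_scale[OF F.carrier_is_submodule a_carrier])
    have A: "submodule ?A R ?F" by (rule F.submodule_set_add[OF K aF])
    obtain g where g: "lin R (?F\<lparr>carrier := ?A\<rparr>) S g" "\<And>c. c \<in> K \<Longrightarrow> g c = p (f c)"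
      "\<And>c. c \<in> carrier ?F \<Longrightarrow> g (a \<odot>\<^bsub>?F\<^esub> c) = \<zero>\<^bsub>S\<^esub>"
      using lin_glue[where g = "\<lambda>c. p (f c)" and h = "\<lambda>c. \<zero>\<^bsub>S\<^esub>", OF F.module_axioms F.module_axioms S.module_axioms
          K F.lin_scale[OF a_carrier] pf zl vanish]
      by blast
    have aA: "a \<odot>\<^bsub>?F\<^esub> c \<in> ?A" if "c \<in> carrier ?F" for c using F.set_add_upper2[OF K aF] that by blast
    \<comment> \<open>Injectivity of \<open>S\<close> extends the glued map to the free module, and
      freeness lifts it to \<open>L\<close> with values in \<omega>. On \<open>K\<close> the
      difference of \<open>f\<close> and \<open>L\<close> then has values in a\<omega>.\<close>
    obtain g1 where g1: "lin R ?F S g1" "\<And>c. c \<in> ?A \<Longrightarrow> g1 c = g c"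
      by (rule extend_S[OF nF A, of g]) (use aA g(1,3) in auto)
    obtain L where L: "lin R ?F ?W L" "\<And>c. c \<in> carrier ?F \<Longrightarrow> p (L c) = g1 c" using free_lift[OF g1(1)] by blast
    have LK: "lin R ?K ?W L" by (rule lin_restrict_dom[OF L(1) Kc])
    let ?u = "\<lambda>c. f c \<ominus>\<^bsub>?W\<^esub> L c"
    have u: "lin R ?K ?W ?u" by (rule lin_pointwise_minus[OF mK W.module_axioms fl LK])
    have pu: "p (?u c) = \<zero>\<^bsub>S\<^esub>" if c: "c \<in> carrier ?K" for c
    proof -
      have cK: "c \<in> K" using c by simp
      have "c \<in> ?A" "c \<in> carrier ?F" using F.set_add_upper1[OF K aF] cK Kc by blast+
      then have "p (L c) = p (f c)"
        using L(2)[of c] g1(2)[of c] g(2)[OF cK] by simp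
      then show ?thesis
        using lin_minus[OF W.module_axioms S.module_axioms p_lin_S lin_closed[OF fl c] lin_closed[OF LK c]]
          S.minus_eq_zero_iff[of "p (f c)" "p (f c)"] lin_closed[OF pf c] by simp
    qed
    obtain w where w: "lin R ?K ?W w" "\<And>c. c \<in> carrier ?K \<Longrightarrow> ?u c = a \<otimes> w c"
      using lin_divide[OF mK u pu] by blast
    show "\<exists>u\<in>?Im. \<exists>z\<in>carrier ?N. f = u \<oplus>\<^bsub>?N\<^esub> a \<odot>\<^bsub>?N\<^esub> z"
    proof (intro bexI)
      let ?L = "restrict L (carrier ?F)" and ?w = "restrict w (carrier ?K)"
      have LH: "?L \<in> carrier ?H" using restrict_mhom[OF F.module_axioms L(1)] by (simp add: Hom_module_simps)
      show 1: "restrict ?L K \<in> ?Im" using LH by blast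
      show 2: "?w \<in> carrier ?N" using restrict_mhom[OF mK w(1)] by (simp add: Hom_module_simps)
      have "restrict ?L K \<oplus>\<^bsub>?N\<^esub> a \<odot>\<^bsub>?N\<^esub> ?w \<in> mhom R ?K ?W"
        using N.M.a_closed[OF N.submodule_mem[OF N0 1] N.smult_closed[OF a_carrier 2]] by (simp add: Hom_module_simps(1))
      then show "f = restrict ?L K \<oplus>\<^bsub>?N\<^esub> a \<odot>\<^bsub>?N\<^esub> ?w"
      proof (rule mhom_eqI[OF f])
        fix c assume c: "c \<in> carrier ?K"
        have "f c = (f c \<ominus>\<^bsub>?W\<^esub> L c) \<oplus>\<^bsub>?W\<^esub> L c" using W.minus_add_cancel lin_closed[OF fl c] lin_closed[OF LK c] by simp
        also have "\<dots> = L c \<oplus>\<^bsub>?W\<^esub> (f c \<ominus>\<^bsub>?W\<^esub> L c)"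
          using W.M.a_comm lin_closed[OF u c] lin_closed[OF LK c] by blast
        finally show "f c = (restrict ?L K \<oplus>\<^bsub>?N\<^esub> a \<odot>\<^bsub>?N\<^esub> ?w) c"
          using c Kc w(2)[OF c] by (auto simp: Hom_module_simps)
      qed
    qed
  qed
  then have extend: "\<exists>L. lin R ?F ?W L \<and> (\<forall>c\<in>K. L c = w c)" if w: "lin R ?K ?W w" for w
  proof -
    have "restrict w (carrier ?K) \<in> ?Im"
      using restrict_mhom[OF mK w] \<open>?Im = carrier ?N\<close> by (simp add: Hom_module_simps)
    then obtain L where L: "L \<in> mhom R ?F ?W" "restrict w (carrier ?K) = restrict L K"
      by (auto simp: Hom_module_simps)
    have "L c = w c" if "c \<in> K" for c using fun_cong[OF L(2), of c] that by simp
    then show ?thesis using L(1) mhom_lin by blast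
  qed
  obtain L where L: "lin R ?F ?W L" "\<And>c. c \<in> carrier ?F \<Longrightarrow> p (L c) = h (q c)"
    using free_lift[OF lin_comp[OF q h]] by blast
  have "p (L c) = \<zero>\<^bsub>S\<^esub>" if "c \<in> carrier ?K" for c
    using L(2)[of c] that lin_zero[OF M.module_axioms S.module_axioms h] by (simp add: K_def)
  \<comment> \<open>On relations the lift \<open>L\<close> of \<open>h q\<close> is divisible by
    \<open>a\<close>. With the quotient \<open>w\<close> extended to \<open>L1\<close>, the
    correction of \<open>L\<close> by \<open>a L1\<close> is invisible to \<open>p\<close>, vanishes
    on \<open>K\<close> and so descends to \<open>M\<close>.\<close>
  then obtain w where w: "lin R ?K ?W w" "\<And>c. c \<in> carrier ?K \<Longrightarrow> L c = a \<otimes> w c"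
    using lin_divide[OF mK lin_restrict_dom[OF L(1) Kc]] by blast
  obtain L1 where L1: "lin R ?F ?W L1" "\<And>c. c \<in> K \<Longrightarrow> L1 c = w c" using extend[OF w(1)] by blast
  have aL1: "lin R ?F ?W (\<lambda>c. a \<odot>\<^bsub>?W\<^esub> L1 c)"
    by (rule lin_pointwise_smult[OF F.module_axioms W.module_axioms a_carrier L1(1)])
  let ?L = "\<lambda>c. L c \<ominus>\<^bsub>?W\<^esub> a \<odot>\<^bsub>?W\<^esub> L1 c"
  have L2: "lin R ?F ?W ?L" by (rule lin_pointwise_minus[OF F.module_axioms W.module_axioms L(1) aL1])
  have ker: "?L c = \<zero>\<^bsub>?W\<^esub>" if c: "c \<in> carrier ?F" "q c = \<zero>\<^bsub>M\<^esub>" for c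
  proof -
    have "c \<in> K" using c by (simp add: K_def)
    then have "L c = a \<odot>\<^bsub>?W\<^esub> L1 c" using w(2) L1(2) by simp
    then show ?thesis using W.minus_eq_zero_iff[OF lin_closed[OF L(1) c(1)] lin_closed[OF aL1 c(1)]] by simp
  qed
  obtain f where f: "lin R M ?W f" "\<And>c. c \<in> carrier ?F \<Longrightarrow> f (q c) = ?L c"
    using lin_descend[OF F.module_axioms M.module_axioms W.module_axioms q surj L2 ker] by blast
  have pf: "p (f x) = h x" if x: "x \<in> carrier M" for x
  proof -
    obtain c where c: "c \<in> carrier ?F" "q c = x" using surj[OF x] by blast
    have "p (a \<odot>\<^bsub>?W\<^esub> L1 c) = \<zero>\<^bsub>S\<^esub>"
      using lin_closed[OF L1(1) c(1)] lin_closed[OF aL1 c(1)] p_zero_iff[of "a \<otimes> L1 c"] by auto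
    then have "p (f x) = p (L c) \<ominus>\<^bsub>S\<^esub> \<zero>\<^bsub>S\<^esub>"
      using f(2)[OF c(1)] c lin_minus[OF W.module_axioms S.module_axioms p_lin_S lin_closed[OF L(1) c(1)] lin_closed[OF aL1 c(1)]]
      by simp
    also have "\<dots> = p (L c)"
      using S.add_minus_cancel[of "p (L c)" "\<zero>\<^bsub>S\<^esub>"] lin_closed[OF p_lin_S lin_closed[OF L(1) c(1)]]
        S.M.r_zero S.M.zero_closed by metis
    finally show ?thesis using L(2)[OF c(1)] c by simp
  qed
  show ?thesis
    by (rule that[OF restrict_mhom[OF M.module_axioms f(1)]]) (use pf in simp)
qed

end

section \<open>Biduality modulo \<open>a\<close> and its lift to \<open>R\<close>\<close>

context canonical_resolution
begin

text \<open>If \<open>S\<close> were zero, \<omega> would equal a\<omega> and vanish by Nakayama's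
  lemma; a nonzero \<open>S\<close> is killed by \<open>a\<close> and therefore has a socle.\<close>

lemma S_socle_element:
  obtains z where "z \<in> carrier S" "z \<noteq> \<zero>\<^bsub>S\<^esub>" "\<And>r. r \<in> m \<Longrightarrow> r \<odot>\<^bsub>S\<^esub> z = \<zero>\<^bsub>S\<^esub>"
proof -
  have ne: "{\<zero>\<^bsub>S\<^esub>} \<noteq> carrier S"
  proof
    assume z: "{\<zero>\<^bsub>S\<^esub>} = carrier S"
    have "{\<zero>\<^bsub>ideal_module R \<omega>\<^esub>} = carrier (ideal_module R \<omega>)"
    proof (rule nakayama[OF noeth_\<omega> W.submodule_zero_set a_m])
      fix y assume "y \<in> carrier (ideal_module R \<omega>)"
      then have y: "y \<in> \<omega>" by simp
      then have "p y = \<zero>\<^bsub>S\<^esub>" using z by auto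
      then obtain b where b: "b \<in> \<omega>" "y = a \<otimes> b" using p_zero_iff[OF y] by auto
      then have "y = \<zero>\<^bsub>ideal_module R \<omega>\<^esub> \<oplus>\<^bsub>ideal_module R \<omega>\<^esub> a \<odot>\<^bsub>ideal_module R \<omega>\<^esub> b"
        using y \<omega>_carrier by auto
      then show "\<exists>u\<in>{\<zero>\<^bsub>ideal_module R \<omega>\<^esub>}. \<exists>z\<in>carrier (ideal_module R \<omega>).
          y = u \<oplus>\<^bsub>ideal_module R \<omega>\<^esub> a \<odot>\<^bsub>ideal_module R \<omega>\<^esub> z" using b by auto
    qed
    then show False using \<omega>_nonzero by simp
  qed
  have sub: "{\<zero>\<^bsub>S\<^esub>} \<subseteq> carrier S" using S.M.zero_closed by blast
  have az: "a \<odot>\<^bsub>S\<^esub> x \<in> {\<zero>\<^bsub>S\<^esub>}" if "x \<in> carrier S" for x using a_S[OF that] by simp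
  obtain z where z: "z \<in> carrier S" "z \<notin> {\<zero>\<^bsub>S\<^esub>}" "\<And>r. r \<in> carrier R \<Longrightarrow> r \<odot>\<^bsub>S\<^esub> z \<in> {\<zero>\<^bsub>S\<^esub>} \<longleftrightarrow> r \<in> m"
    using socle[OF S.module_axioms S.submodule_zero_set S.carrier_is_submodule sub ne az] by blast
  then show ?thesis using that[of z] m_carrier by blast
qed

text \<open>The annihilator of x modulo \<open>aM\<close> lies in \<open>m\<close>, so x can be sent
  to a nonzero socle element of \<open>S\<close> while \<open>aM\<close> goes to zero; injectivity
  of \<open>S\<close> extends this map to \<open>M\<close>.\<close>

lemma separate_mod_a:
  assumes M: "noeth R M" and x: "x \<in> carrier M" "x \<notin> (\<lambda>y. a \<odot>\<^bsub>M\<^esub> y) ` carrier M"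
  obtains h where "h \<in> mhom R M S" "h x \<noteq> \<zero>\<^bsub>S\<^esub>"
proof -
  interpret M: plain_module R M by (rule plain_moduleI[OF noeth_module[OF M]])
  let ?A = "(\<lambda>y. a \<odot>\<^bsub>M\<^esub> y) ` carrier M"
  have A: "submodule ?A R M" by (rule M.submodule_scale[OF M.carrier_is_submodule a_carrier])
  obtain z where z: "z \<in> carrier S" "z \<noteq> \<zero>\<^bsub>S\<^esub>" "\<And>r. r \<in> m \<Longrightarrow> r \<odot>\<^bsub>S\<^esub> z = \<zero>\<^bsub>S\<^esub>"
    using S_socle_element by blast
  have 0: "lin R (M\<lparr>carrier := ?A\<rparr>) S (\<lambda>y. \<zero>\<^bsub>S\<^esub>)"
    by (rule lin_pointwise_zero[OF M.module_restrict[OF A] S.module_axioms])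
  have 1: "lin R (self_module R) M (\<lambda>r. r \<odot>\<^bsub>M\<^esub> x)"
    by (intro linI) (use x in \<open>simp_all add: M.smult_l_distr M.smult_assoc1\<close>)
  have 2: "lin R (self_module R) S (\<lambda>r. r \<odot>\<^bsub>S\<^esub> z)"
    by (intro linI) (use S.smult_closed[OF _ z(1)] S.smult_l_distr[OF _ _ z(1)] S.smult_assoc1[OF _ _ z(1)] in simp_all)
  have agree: "\<zero>\<^bsub>S\<^esub> = r \<odot>\<^bsub>S\<^esub> z" if r: "r \<in> carrier (self_module R)" "r \<odot>\<^bsub>M\<^esub> x \<in> ?A" for r
  proof -
    have "r \<in> m" using unit_smult_mem[OF M.module_axioms A x(1) _ _ r(2)] r x by auto
    then show ?thesis using z(3) by simp
  qed
  let ?B = "?A <+>\<^bsub>M\<^esub> (\<lambda>r. r \<odot>\<^bsub>M\<^esub> x) ` carrier (self_module R)"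
  obtain g where g: "lin R (M\<lparr>carrier := ?B\<rparr>) S g" "\<And>y. y \<in> ?A \<Longrightarrow> g y = \<zero>\<^bsub>S\<^esub>"
    "\<And>r. r \<in> carrier (self_module R) \<Longrightarrow> g (r \<odot>\<^bsub>M\<^esub> x) = r \<odot>\<^bsub>S\<^esub> z"
    using lin_glue[where i = "\<lambda>r. r \<odot>\<^bsub>M\<^esub> x" and h = "\<lambda>r. r \<odot>\<^bsub>S\<^esub> z" and g = "\<lambda>y. \<zero>\<^bsub>S\<^esub>", OF M.module_axioms
        self.module_axioms S.module_axioms A 1 0 2 agree] by blast
  have C: "submodule ((\<lambda>r. r \<odot>\<^bsub>M\<^esub> x) ` carrier (self_module R)) R M" using M.submodule_cyclic[OF x(1)] by simp
  have B: "submodule ?B R M" by (rule M.submodule_set_add[OF A C])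
  have AB: "?A \<subseteq> ?B" by (rule M.set_add_upper1[OF A C])
  obtain h where h: "lin R M S h" "\<And>y. y \<in> ?B \<Longrightarrow> h y = g y"
    by (rule extend_S[OF M B, of g]) (use AB g(1,2) in auto)
  have xB: "x \<in> ?B" using M.set_add_upper2[OF A C] M.mem_cyclic_self[OF x(1)] by auto
  have "h x = z" using h(2)[OF xB] g(3)[of \<one>] x z S.smult_one[OF z(1)] by simp
  then show ?thesis using that[OF restrict_mhom[OF M.module_axioms h(1)]] x z by simp
qed

lemma ilen_socle_S: "ilen R S {\<zero>\<^bsub>S\<^esub>} {z \<in> carrier S. \<forall>r\<in>m. r \<odot>\<^bsub>S\<^esub> z = \<zero>\<^bsub>S\<^esub>} \<le> 1"
proof -
  let ?T = "{z \<in> carrier S. \<forall>r\<in>m. r \<odot>\<^bsub>S\<^esub> z = \<zero>\<^bsub>S\<^esub>}"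
  obtain z where z: "z \<in> carrier S" "z \<noteq> \<zero>\<^bsub>S\<^esub>" "\<And>r. r \<in> m \<Longrightarrow> r \<odot>\<^bsub>S\<^esub> z = \<zero>\<^bsub>S\<^esub>"
    using S_socle_element by blast
  let ?B = "{\<zero>\<^bsub>S\<^esub>} <+>\<^bsub>S\<^esub> (\<lambda>r. r \<odot>\<^bsub>S\<^esub> z) ` carrier R"
  have "?T \<subseteq> ?B"
  proof
    fix y assume y: "y \<in> ?T"
    then obtain r where r: "r \<in> carrier R" "y = r \<odot>\<^bsub>S\<^esub> z" using socle_S[OF z(1,3) _ _ z(2), of y] by blast
    then have "y = \<zero>\<^bsub>S\<^esub> \<oplus>\<^bsub>S\<^esub> r \<odot>\<^bsub>S\<^esub> z" using S.M.l_zero y by simp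
    then show "y \<in> ?B" unfolding S.mem_set_add using r by blast
  qed
  then have "ilen R S {\<zero>\<^bsub>S\<^esub>} ?T \<le> ilen R S {\<zero>\<^bsub>S\<^esub>} ?B" by (rule ilen_mono[OF subset_refl])
  also have "\<dots> \<le> 1"
    by (rule ilen_simple[OF S.module_axioms S.submodule_zero_set z(1)]) (use z(3) in blast)
  finally show ?thesis .
qed

text \<open>Matlis duality over the artinian ring \<open>R\<close>/\<open>aR\<close>, applied to
  \<open>M\<close>/\<open>aM\<close>: over that ring \<open>S\<close> is injective with simple
  socle, and maps from \<open>M\<close> to \<open>S\<close> kill \<open>aM\<close>.\<close>

abbreviation D :: "('a, 'e) module \<Rightarrow> ('a, 'e \<Rightarrow> 'c) module" where "D M \<equiv> Hom_module R M S"

text \<open>For \<open>A\<close> above \<open>aM\<close> the homomorphisms that vanish on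
  \<open>A\<close> have length at most the colength of \<open>A\<close>. When a socle element x is
  adjoined to a maximal counterexample \<open>A\<close>, evaluation at x embeds the homomorphisms
  lost, modulo those kept, into the socle of \<open>S\<close>, which has length at most one.\<close>

lemma ilen_D_le:
  fixes M :: "('a, 'e) module"
  assumes M: "noeth R M"
  shows "ilen R (D M) {\<zero>\<^bsub>D M\<^esub>} (carrier (D M)) \<le> ilen R M ((\<lambda>y. a \<odot>\<^bsub>M\<^esub> y) ` carrier M) (carrier M)"
proof -
  interpret M: plain_module R M by (rule plain_moduleI[OF noeth_module[OF M]])
  interpret D: plain_module R "D M" by (rule plain_moduleI[OF module_Hom[OF M.module_axioms S.module_axioms]])
  let ?aM = "(\<lambda>y. a \<odot>\<^bsub>M\<^esub> y) ` carrier M"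
  have aM: "submodule ?aM R M" by (rule M.submodule_scale[OF M.carrier_is_submodule a_carrier])
  define P where "P A = {f \<in> carrier (D M). \<forall>x\<in>A. f x = \<zero>\<^bsub>S\<^esub>}" for A
  have ev: "lin R (D M) S (\<lambda>f. f x)" if "x \<in> carrier M" for x
    by (rule lin_eval[OF M.module_axioms S.module_axioms that])
  have Psub: "submodule (P A) R (D M)" if A: "A \<subseteq> carrier M" for A
  proof (rule D.submodule_criterion)
    show "P A \<subseteq> carrier (D M)" by (auto simp: P_def)
    show "\<zero>\<^bsub>D M\<^esub> \<in> P A"
      using lin_zero[OF D.module_axioms S.module_axioms ev] A D.M.zero_closed unfolding P_def by blast
    show "f \<oplus>\<^bsub>D M\<^esub> g \<in> P A" if "f \<in> P A" "g \<in> P A" for f g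
    proof -
      have f: "f \<in> carrier (D M)" "g \<in> carrier (D M)" using that by (auto simp: P_def)
      have "(f \<oplus>\<^bsub>D M\<^esub> g) x = \<zero>\<^bsub>S\<^esub>" if x: "x \<in> A" for x
        using lin_add[OF ev f] x A \<open>f \<in> P A\<close> \<open>g \<in> P A\<close> S.M.l_zero[OF S.M.zero_closed] by (auto simp: P_def)
      then show ?thesis using D.M.a_closed[OF f] by (simp add: P_def)
    qed
    show "r \<odot>\<^bsub>D M\<^esub> f \<in> P A" if r: "r \<in> carrier R" and f: "f \<in> P A" for r f
    proof -
      have fc: "f \<in> carrier (D M)" using f by (simp add: P_def)
      have "(r \<odot>\<^bsub>D M\<^esub> f) x = \<zero>\<^bsub>S\<^esub>" if x: "x \<in> A" for x
        using lin_smult[OF ev r fc] x A f S.smult_r_null[OF r] by (auto simp: P_def)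
      then show ?thesis using D.smult_closed[OF r fc] by (simp add: P_def)
    qed
  qed
  have le: "ilen R (D M) {\<zero>\<^bsub>D M\<^esub>} (P A) \<le> ilen R M A (carrier M)"
    if A0: "submodule A R M" "?aM \<subseteq> A" for A
  proof (rule ccontr)
    let ?Q = "\<lambda>A. ?aM \<subseteq> A \<and> \<not> ilen R (D M) {\<zero>\<^bsub>D M\<^esub>} (P A) \<le> ilen R M A (carrier M)"
    assume "\<not> ?thesis"
    then have QA: "?Q A" using A0 by simp
    obtain A where A: "submodule A R M" "?Q A"
      and max: "\<And>A'. submodule A' R M \<Longrightarrow> ?Q A' \<Longrightarrow> A \<subseteq> A' \<Longrightarrow> A' = A"
      using noeth_maximal[where Q = ?Q, OF M A0(1) QA] by blast
    have Ac: "A \<subseteq> carrier M" by (rule M.submodule_subset[OF A(1)])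
    have "A \<noteq> carrier M"
    proof
      assume eq: "A = carrier M"
      have "P A \<subseteq> {\<zero>\<^bsub>D M\<^esub>}"
      proof
        fix f assume f: "f \<in> P A"
        then have fm: "f \<in> mhom R M S" by (simp add: P_def Hom_module_simps)
        have "\<zero>\<^bsub>D M\<^esub> \<in> mhom R M S" using D.M.zero_closed by (simp add: Hom_module_simps(1))
        then have "f = \<zero>\<^bsub>D M\<^esub>"
          by (rule mhom_eqI[OF fm]) (use f eq in \<open>simp add: P_def Hom_module_simps\<close>)
        then show "f \<in> {\<zero>\<^bsub>D M\<^esub>}" by simp
      qed
      then have "ilen R (D M) {\<zero>\<^bsub>D M\<^esub>} (P A) \<le> ilen R (D M) {\<zero>\<^bsub>D M\<^esub>} {\<zero>\<^bsub>D M\<^esub>}" by (rule ilen_mono[OF subset_refl])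
      then show False using A by (simp add: ilen_self)
    qed
    have aA: "a \<odot>\<^bsub>M\<^esub> y \<in> A" if "y \<in> carrier M" for y using A(2) that by blast
    obtain x where x: "x \<in> carrier M" "x \<notin> A" "\<And>r. r \<in> carrier R \<Longrightarrow> r \<odot>\<^bsub>M\<^esub> x \<in> A \<longleftrightarrow> r \<in> m"
      using socle[OF M.module_axioms A(1) M.carrier_is_submodule Ac \<open>A \<noteq> carrier M\<close> aA] by blast
    let ?C = "(\<lambda>r. r \<odot>\<^bsub>M\<^esub> x) ` carrier R"
    let ?B = "A <+>\<^bsub>M\<^esub> ?C"
    have C: "submodule ?C R M" by (rule M.submodule_cyclic[OF x(1)])
    have B: "submodule ?B R M" by (rule M.submodule_set_add[OF A(1) C])
    have AB: "A \<subseteq> ?B" by (rule M.set_add_upper1[OF A(1) C])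
    have xB: "x \<in> ?B" using M.set_add_upper2[OF A(1) C] M.mem_cyclic_self[OF x(1)] by blast
    have Bc: "?B \<subseteq> carrier M" by (rule M.submodule_subset[OF B])
    have PBA: "P ?B \<subseteq> P A" using AB by (auto simp: P_def)
    have zB: "{\<zero>\<^bsub>D M\<^esub>} \<subseteq> P ?B" using D.submodule_zero[OF Psub[OF Bc]] by blast
    have IH: "ilen R (D M) {\<zero>\<^bsub>D M\<^esub>} (P ?B) \<le> ilen R M ?B (carrier M)"
      using max[OF B] AB A(2) xB x(2) by (metis subset_trans)
    have step: "ilen R (D M) (P ?B) (P A) \<le> 1"
    proof -
      let ?T = "{z \<in> carrier S. \<forall>r\<in>m. r \<odot>\<^bsub>S\<^esub> z = \<zero>\<^bsub>S\<^esub>}"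
      have T: "submodule ?T R S" by (rule S.submodule_annihilated[OF m_carrier])
      have zT: "{\<zero>\<^bsub>S\<^esub>} \<subseteq> ?T" using S.submodule_zero[OF T] by blast
      have "ilen R (D M) (P ?B) (P A) \<le> ilen R S {\<zero>\<^bsub>S\<^esub>} ?T"
      proof (rule ilen_lin_le[OF D.module_axioms S.module_axioms ev[OF x(1)] Psub[OF Bc] Psub[OF Ac]
            S.submodule_zero_set T zT])
        fix f assume f: "f \<in> P A"
        then have fl: "lin R M S f" using mhom_lin by (auto simp: P_def Hom_module_simps)
        have fA: "f y = \<zero>\<^bsub>S\<^esub>" if "y \<in> A" for y using f that unfolding P_def by blast
        have "r \<odot>\<^bsub>S\<^esub> f x = \<zero>\<^bsub>S\<^esub>" if r: "r \<in> m" for r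
        proof -
          have rc: "r \<in> carrier R" using r m_carrier by auto
          have "f (r \<odot>\<^bsub>M\<^esub> x) = \<zero>\<^bsub>S\<^esub>" using fA x(3)[OF rc] r by blast
          then show ?thesis using lin_smult[OF fl rc x(1)] by metis
        qed
        then show "f x \<in> ?T" using lin_closed[OF fl x(1)] by blast
        assume "f x \<in> {\<zero>\<^bsub>S\<^esub>}"
        then have fx: "f x = \<zero>\<^bsub>S\<^esub>" by blast
        have ker: "submodule {y \<in> carrier M. f y = \<zero>\<^bsub>S\<^esub>} R M" by (rule lin_kernel[OF M.module_axioms S.module_axioms fl])
        have "?C \<subseteq> {y \<in> carrier M. f y = \<zero>\<^bsub>S\<^esub>}"
          using M.submodule_smult[OF ker] x(1) fx by blast
        moreover have "A \<subseteq> {y \<in> carrier M. f y = \<zero>\<^bsub>S\<^esub>}" using fA Ac by blast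
        ultimately have "?B \<subseteq> {y \<in> carrier M. f y = \<zero>\<^bsub>S\<^esub>}" by (intro M.set_add_least[OF ker])
        then show "f \<in> P ?B" using f unfolding P_def by blast
      qed
      then show ?thesis using ilen_socle_S by (rule order_trans)
    qed
    have "ilen R (D M) {\<zero>\<^bsub>D M\<^esub>} (P A) = ilen R (D M) {\<zero>\<^bsub>D M\<^esub>} (P ?B) + ilen R (D M) (P ?B) (P A)"
      by (rule D.ilen_add[OF D.submodule_zero_set Psub[OF Bc] Psub[OF Ac] zB PBA])
    also have "\<dots> \<le> ilen R M ?B (carrier M) + 1" by (rule add_mono[OF IH step])
    also have "\<dots> \<le> ilen R M ?B (carrier M) + ilen R M A ?B"
    proof (rule add_left_mono)
      have "A \<subset> ?B" using AB xB x(2) by blast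
      from ilen_strict[OF A(1) B subset_refl this] show "1 \<le> ilen R M A ?B" by (simp add: ilen_self)
    qed
    also have "\<dots> = ilen R M A (carrier M)"
      using M.ilen_add[OF A(1) B M.carrier_is_submodule AB Bc] by (simp add: add.commute)
    finally show False using A(2) by blast
  qed
  have "P ?aM = carrier (D M)"
  proof -
    have "f (a \<odot>\<^bsub>M\<^esub> y) = \<zero>\<^bsub>S\<^esub>" if f: "f \<in> carrier (D M)" and y: "y \<in> carrier M" for f y
    proof -
      have fl: "lin R M S f" using f mhom_lin by (simp add: Hom_module_simps)
      show ?thesis using lin_smult[OF fl a_carrier y] a_S[OF lin_closed[OF fl y]] by simp
    qed
    then show ?thesis by (auto simp: P_def)
  qed
  then show ?thesis using le[OF aM subset_refl] by simp
qed

lemma noeth_D: "noeth R M \<Longrightarrow> noeth R (D M)"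
  using noeth_Hom[OF noeth_module S.module_axioms _ noeth_S] by blast

text \<open>Evaluation embeds \<open>M\<close>/\<open>aM\<close> into the double dual by
  \<open>separate_mod_a\<close>, while \<open>ilen_D_le\<close>, used for \<open>M\<close> and for
  \<open>D M\<close>, bounds the length of the double dual by that of
  \<open>M\<close>/\<open>aM\<close>. As this length is finite, evaluation is surjective.\<close>

lemma D_biduality:
  fixes M :: "('a, 'e) module"
  assumes M: "noeth R M" and \<Theta>: "\<Theta> \<in> mhom R (D M) S"
  obtains x where "x \<in> carrier M" "\<And>h. h \<in> mhom R M S \<Longrightarrow> \<Theta> h = h x"
proof -
  interpret M: plain_module R M by (rule plain_moduleI[OF noeth_module[OF M]])
  note nD = noeth_D[OF M]
  interpret D: plain_module R "D M" by (rule plain_moduleI[OF noeth_module[OF nD]])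
  interpret DD: plain_module R "D (D M)" by (rule plain_moduleI[OF noeth_module[OF noeth_D[OF nD]]])
  let ?aM = "(\<lambda>y. a \<odot>\<^bsub>M\<^esub> y) ` carrier M"
  have aM: "submodule ?aM R M" by (rule M.submodule_scale[OF M.carrier_is_submodule a_carrier])
  let ?ev = "\<lambda>x. \<lambda>h\<in>carrier (D M). h x"
  have ev: "lin R M (D (D M)) ?ev" by (rule lin_evaluation[OF M.module_axioms S.module_axioms])
  let ?I = "?ev ` carrier M"
  have I: "submodule ?I R (D (D M))"
    by (rule submodule_lin_image[OF M.module_axioms DD.module_axioms ev M.carrier_is_submodule])
  have Isub: "?I \<subseteq> carrier (D (D M))" by (rule DD.submodule_subset[OF I])
  have zI: "{\<zero>\<^bsub>D (D M)\<^esub>} \<subseteq> ?I" using DD.submodule_zero[OF I] by blast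
  have 1: "ilen R M ?aM (carrier M) \<le> ilen R (D (D M)) {\<zero>\<^bsub>D (D M)\<^esub>} ?I"
  proof (rule ilen_lin_le[OF M.module_axioms DD.module_axioms ev aM M.carrier_is_submodule DD.submodule_zero_set I zI])
    show "?ev x \<in> ?I" if "x \<in> carrier M" for x using that by blast
    fix x assume x: "x \<in> carrier M" "?ev x \<in> {\<zero>\<^bsub>D (D M)\<^esub>}"
    have z: "h x = \<zero>\<^bsub>S\<^esub>" if h: "h \<in> mhom R M S" for h
    proof -
      have "?ev x h = \<zero>\<^bsub>D (D M)\<^esub> h" using x by simp
      then show ?thesis using h by (simp add: Hom_module_simps)
    qed
    show "x \<in> ?aM"
    proof (rule ccontr)
      assume "x \<notin> ?aM"
      then obtain h where "h \<in> mhom R M S" "h x \<noteq> \<zero>\<^bsub>S\<^esub>" using separate_mod_a[OF M x(1)] by blast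
      then show False using z by blast
    qed
  qed
  have fin: "ilen R M ?aM (carrier M) \<noteq> \<infinity>"
    by (rule ilen_finite[OF M aM]) blast
  have "ilen R (D (D M)) {\<zero>\<^bsub>D (D M)\<^esub>} (carrier (D (D M))) \<le> ilen R (D M) ((\<lambda>y. a \<odot>\<^bsub>D M\<^esub> y) ` carrier (D M)) (carrier (D M))"
    by (rule ilen_D_le[OF nD])
  also have "\<dots> \<le> ilen R (D M) {\<zero>\<^bsub>D M\<^esub>} (carrier (D M))"
  proof (rule ilen_mono[OF _ subset_refl])
    show "{\<zero>\<^bsub>D M\<^esub>} \<subseteq> (\<lambda>y. a \<odot>\<^bsub>D M\<^esub> y) ` carrier (D M)"
      using D.submodule_zero[OF D.submodule_scale[OF D.carrier_is_submodule a_carrier]] by blast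
  qed
  also have "\<dots> \<le> ilen R M ?aM (carrier M)" by (rule ilen_D_le[OF M])
  finally have 2: "ilen R (D (D M)) {\<zero>\<^bsub>D (D M)\<^esub>} (carrier (D (D M))) \<le> ilen R M ?aM (carrier M)" .
  have 3: "ilen R (D (D M)) {\<zero>\<^bsub>D (D M)\<^esub>} (carrier (D (D M))) =
      ilen R (D (D M)) {\<zero>\<^bsub>D (D M)\<^esub>} ?I + ilen R (D (D M)) ?I (carrier (D (D M)))"
    by (rule DD.ilen_add[OF DD.submodule_zero_set I DD.carrier_is_submodule zI Isub])
  have "ilen R M ?aM (carrier M) + ilen R (D (D M)) ?I (carrier (D (D M))) \<le>
      ilen R (D (D M)) {\<zero>\<^bsub>D (D M)\<^esub>} ?I + ilen R (D (D M)) ?I (carrier (D (D M)))"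
    by (rule add_right_mono[OF 1])
  also have "\<dots> \<le> ilen R M ?aM (carrier M) + 0"
    using 2 unfolding 3 add_0_right .
  finally have "ilen R M ?aM (carrier M) + ilen R (D (D M)) ?I (carrier (D (D M))) \<le> ilen R M ?aM (carrier M) + 0" .
  then have "ilen R (D (D M)) ?I (carrier (D (D M))) \<le> 0" using fin by (rule enat_add_cancel_le)
  then have "?I = carrier (D (D M))" using ilen_zero_eq[OF I DD.carrier_is_submodule Isub] by simp
  then have "\<Theta> \<in> ?I" using \<Theta> by (simp add: Hom_module_simps(1))
  then obtain x where "x \<in> carrier M" "\<Theta> = ?ev x" by blast
  then show ?thesis using that[of x] by (simp add: Hom_module_simps(1))
qed

text \<open>An element outside \<open>aM\<close> is detected by a map to \<open>S\<close>, which
  lifts to \<omega>. So an element of the common kernel \<open>K\<close> is \<open>a z\<close>, and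
  z lies in \<open>K\<close> again because \<open>a\<close> is a nonzerodivisor on \<omega>; thus
  \<open>K = a K\<close> and Nakayama's lemma applies.\<close>

lemma \<omega>_separates:
  assumes M: "noeth R M" and tf: "\<And>x. x \<in> carrier M \<Longrightarrow> a \<odot>\<^bsub>M\<^esub> x = \<zero>\<^bsub>M\<^esub> \<Longrightarrow> x = \<zero>\<^bsub>M\<^esub>"
    and x: "x \<in> carrier M" and fx: "\<And>f. f \<in> mhom R M (ideal_module R \<omega>) \<Longrightarrow> f x = \<zero>"
  shows "x = \<zero>\<^bsub>M\<^esub>"
proof -
  interpret M: plain_module R M by (rule plain_moduleI[OF noeth_module[OF M]])
  define K where "K = {x \<in> carrier M. \<forall>f\<in>mhom R M (ideal_module R \<omega>). f x = \<zero>}"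
  have K: "submodule K R M"
  proof (rule M.submodule_criterion)
    show "K \<subseteq> carrier M" by (auto simp: K_def)
    show "\<zero>\<^bsub>M\<^esub> \<in> K" using lin_zero[OF M.module_axioms W.module_axioms mhom_lin] by (simp add: K_def)
    show "x \<oplus>\<^bsub>M\<^esub> y \<in> K" if "x \<in> K" "y \<in> K" for x y
    proof -
      have xy: "x \<in> carrier M" "y \<in> carrier M" "\<forall>f\<in>mhom R M (ideal_module R \<omega>). f x = \<zero> \<and> f y = \<zero>"
        using that by (auto simp: K_def)
      then have "f (x \<oplus>\<^bsub>M\<^esub> y) = \<zero>" if "f \<in> mhom R M (ideal_module R \<omega>)" for f
      proof -
        have "f x = \<zero>" "f y = \<zero>" using xy(3) that by blast+
        then show ?thesis using lin_add[OF mhom_lin[OF that] xy(1,2)] by simp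
      qed
      then show ?thesis using xy by (simp add: K_def)
    qed
    show "r \<odot>\<^bsub>M\<^esub> x \<in> K" if "r \<in> carrier R" "x \<in> K" for r x
    proof -
      have x: "x \<in> carrier M" "\<forall>f\<in>mhom R M (ideal_module R \<omega>). f x = \<zero>"
        using \<open>x \<in> K\<close> by (auto simp: K_def)
      then have "f (r \<odot>\<^bsub>M\<^esub> x) = \<zero>" if "f \<in> mhom R M (ideal_module R \<omega>)" for f
      proof -
        have "f x = \<zero>" using x(2) that by blast
        then show ?thesis using lin_smult[OF mhom_lin[OF that] \<open>r \<in> carrier R\<close> x(1)] \<open>r \<in> carrier R\<close> by simp
      qed
      then show ?thesis using x \<open>r \<in> carrier R\<close> by (simp add: K_def)
    qed
  qed
  let ?K = "M\<lparr>carrier := K\<rparr>"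
  interpret K: plain_module R ?K by (rule plain_moduleI[OF M.module_restrict[OF K]])
  have "{\<zero>\<^bsub>?K\<^esub>} = carrier ?K"
  proof (rule nakayama[OF noeth_restrict[OF M K] K.submodule_zero_set a_m])
    fix y assume "y \<in> carrier ?K"
    then have y: "y \<in> carrier M" "\<And>f. f \<in> mhom R M (ideal_module R \<omega>) \<Longrightarrow> f y = \<zero>" by (auto simp: K_def)
    have "y \<in> (\<lambda>y. a \<odot>\<^bsub>M\<^esub> y) ` carrier M"
    proof (rule ccontr)
      assume "y \<notin> (\<lambda>y. a \<odot>\<^bsub>M\<^esub> y) ` carrier M"
      then obtain h where h: "h \<in> mhom R M S" "h y \<noteq> \<zero>\<^bsub>S\<^esub>" using separate_mod_a[OF M y(1)] by blast
      obtain f where f: "f \<in> mhom R M (ideal_module R \<omega>)" "\<And>x. x \<in> carrier M \<Longrightarrow> p (f x) = h x"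
        using lift_to_\<omega>[OF M tf mhom_lin[OF h(1)]] by blast
      have "h y = p \<zero>" using f(2)[OF y(1)] y(2)[OF f(1)] by simp
      then show False using h lin_zero[OF W.module_axioms S.module_axioms p_lin_S] by simp
    qed
    then obtain z where z: "z \<in> carrier M" "y = a \<odot>\<^bsub>M\<^esub> z" by blast
    have "f z = \<zero>" if f: "f \<in> mhom R M (ideal_module R \<omega>)" for f
      using lin_smult[OF mhom_lin[OF f] a_carrier z(1)] y(2)[OF f] z(2) a_nzd_\<omega> lin_closed[OF mhom_lin[OF f] z(1)]
      by simp
    then have zK: "z \<in> K" using z by (simp add: K_def)
    have "y = \<zero>\<^bsub>?K\<^esub> \<oplus>\<^bsub>?K\<^esub> a \<odot>\<^bsub>?K\<^esub> z" using z by simp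
    then show "\<exists>u\<in>{\<zero>\<^bsub>?K\<^esub>}. \<exists>z\<in>carrier ?K. y = u \<oplus>\<^bsub>?K\<^esub> a \<odot>\<^bsub>?K\<^esub> z" using zK by auto
  qed
  moreover have "x \<in> K" using x fx by (simp add: K_def)
  ultimately show ?thesis by auto
qed

text \<open>By \<open>lift_to_\<omega>\<close> and \<open>lin_divide\<close>, \<open>D M\<close> is
  the \<omega>-dual of \<open>M\<close> reduced modulo \<open>a\<close>. So \<Phi> induces a
  functional on \<open>D M\<close>, which is evaluation at some x. Hence \<Phi> differs from
  evaluation at x by a multiple of \<open>a\<close>, and by Nakayama's lemma the evaluations fill
  the double dual.\<close>

theorem \<omega>_biduality:
  fixes M :: "('a, 'e) module"
  assumes M: "noeth R M" and tf: "\<And>x. x \<in> carrier M \<Longrightarrow> a \<odot>\<^bsub>M\<^esub> x = \<zero>\<^bsub>M\<^esub> \<Longrightarrow> x = \<zero>\<^bsub>M\<^esub>"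
    and \<Phi>: "\<Phi> \<in> mhom R (Hom_module R M (ideal_module R \<omega>)) (ideal_module R \<omega>)"
  obtains x where "x \<in> carrier M" "\<And>f. f \<in> mhom R M (ideal_module R \<omega>) \<Longrightarrow> \<Phi> f = f x"
proof -
  let ?W = "ideal_module R \<omega>"
  let ?V = "Hom_module R M ?W"
  let ?VV = "Hom_module R ?V ?W"
  interpret M: plain_module R M by (rule plain_moduleI[OF noeth_module[OF M]])
  have nV: "noeth R ?V" by (rule noeth_Hom[OF M.module_axioms W.module_axioms M noeth_\<omega>])
  interpret V: plain_module R ?V by (rule plain_moduleI[OF noeth_module[OF nV]])
  have nVV: "noeth R ?VV" by (rule noeth_Hom[OF V.module_axioms W.module_axioms nV noeth_\<omega>])
  interpret VV: plain_module R ?VV by (rule plain_moduleI[OF noeth_module[OF nVV]])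
  interpret D: plain_module R "D M" by (rule plain_moduleI[OF noeth_module[OF noeth_D[OF M]]])
  let ?ev = "\<lambda>x. \<lambda>f\<in>carrier ?V. f x"
  have evm: "?ev x \<in> mhom R ?V ?W" if "x \<in> carrier M" for x
    by (rule restrict_mhom[OF V.module_axioms lin_eval[OF M.module_axioms W.module_axioms that]])
  have ev: "lin R M ?VV ?ev" by (rule lin_evaluation[OF M.module_axioms W.module_axioms])
  let ?I = "?ev ` carrier M"
  have I: "submodule ?I R ?VV"
    by (rule submodule_lin_image[OF M.module_axioms VV.module_axioms ev M.carrier_is_submodule])
  let ?q = "\<lambda>f. \<lambda>x\<in>carrier M. p (f x)"
  have qm: "?q f \<in> mhom R M S" if "f \<in> mhom R M ?W" for f
    by (rule restrict_mhom[OF M.module_axioms lin_comp[OF mhom_lin[OF that] p_lin_S]])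
  have q: "lin R ?V (D M) ?q"
  proof (rule linI, unfold Hom_module_simps)
    show "?q f \<in> mhom R M S" if "f \<in> mhom R M ?W" for f by (rule qm[OF that])
    show "?q (\<lambda>x\<in>carrier M. f x \<oplus>\<^bsub>?W\<^esub> g x) = (\<lambda>x\<in>carrier M. ?q f x \<oplus>\<^bsub>S\<^esub> ?q g x)"
      if "f \<in> mhom R M ?W" "g \<in> mhom R M ?W" for f g
      using lin_add[OF p_lin_S lin_closed[OF mhom_lin[OF that(1)]] lin_closed[OF mhom_lin[OF that(2)]]]
      by (intro restrict_ext) simp
    show "?q (\<lambda>x\<in>carrier M. r \<odot>\<^bsub>?W\<^esub> f x) = (\<lambda>x\<in>carrier M. r \<odot>\<^bsub>S\<^esub> ?q f x)"
      if "r \<in> carrier R" "f \<in> mhom R M ?W" for r f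
      using lin_smult[OF p_lin_S that(1) lin_closed[OF mhom_lin[OF that(2)]]]
      by (intro restrict_ext) simp
  qed
  have q_surj: "\<exists>f\<in>carrier ?V. ?q f = h" if h: "h \<in> carrier (D M)" for h
  proof -
    have hm: "h \<in> mhom R M S" using h by (simp add: Hom_module_simps)
    obtain f where f: "f \<in> mhom R M ?W" "\<And>x. x \<in> carrier M \<Longrightarrow> p (f x) = h x"
      using lift_to_\<omega>[OF M tf mhom_lin[OF hm]] by blast
    have "?q f = h" by (rule mhom_eqI[OF qm[OF f(1)] hm]) (use f(2) in simp)
    then show ?thesis using f(1) by (intro bexI[of _ f]) (simp_all add: Hom_module_simps)
  qed
  have "?I = carrier ?VV"
  proof (rule nakayama[OF nVV I a_m])
    fix \<Phi> assume "\<Phi> \<in> carrier ?VV"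
    then have \<Phi>: "\<Phi> \<in> mhom R ?V ?W" by (simp add: Hom_module_simps(1))
    note \<Phi>l = mhom_lin[OF \<Phi>]
    have ker: "p (\<Phi> f) = \<zero>\<^bsub>S\<^esub>" if f: "f \<in> carrier ?V" "?q f = \<zero>\<^bsub>D M\<^esub>" for f
    proof -
      have fm: "f \<in> mhom R M ?W" using f by (simp add: Hom_module_simps)
      have "p (f x) = \<zero>\<^bsub>S\<^esub>" if x: "x \<in> carrier M" for x
        using fun_cong[OF f(2), of x] x by (simp add: Hom_module_simps)
      then obtain w where w: "lin R M ?W w" "\<And>x. x \<in> carrier M \<Longrightarrow> f x = a \<otimes> w x"
        using lin_divide[OF M.module_axioms mhom_lin[OF fm]] by blast
      let ?w = "restrict w (carrier M)"
      have wV: "?w \<in> carrier ?V" using restrict_mhom[OF M.module_axioms w(1)] by (simp add: Hom_module_simps)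
      have "a \<odot>\<^bsub>?V\<^esub> ?w \<in> mhom R M ?W" using V.smult_closed[OF a_carrier wV] by (simp add: Hom_module_simps(1))
      then have "f = a \<odot>\<^bsub>?V\<^esub> ?w" by (rule mhom_eqI[OF fm]) (use w(2) in \<open>simp add: Hom_module_simps\<close>)
      then have "\<Phi> f = a \<otimes> \<Phi> ?w" using lin_smult[OF \<Phi>l a_carrier wV] by simp
      moreover have "\<Phi> ?w \<in> \<omega>" using lin_closed[OF \<Phi>l wV] by simp
      ultimately show ?thesis using p_zero_iff[of "\<Phi> f"] \<omega>_mult[OF a_carrier] by auto
    qed
    obtain \<Theta> where \<Theta>: "lin R (D M) S \<Theta>" "\<And>f. f \<in> carrier ?V \<Longrightarrow> \<Theta> (?q f) = p (\<Phi> f)"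
      by (rule lin_descend[OF V.module_axioms D.module_axioms S.module_axioms q q_surj lin_comp[OF \<Phi>l p_lin_S] ker])
         auto
    obtain x where x: "x \<in> carrier M" "\<And>h. h \<in> mhom R M S \<Longrightarrow> restrict \<Theta> (carrier (D M)) h = h x"
      using D_biduality[OF M restrict_mhom[OF D.module_axioms \<Theta>(1)]] by blast
    have evl: "lin R ?V ?W (\<lambda>f. f x)" by (rule lin_eval[OF M.module_axioms W.module_axioms x(1)])
    let ?u = "\<lambda>f. \<Phi> f \<ominus>\<^bsub>?W\<^esub> f x"
    have u: "lin R ?V ?W ?u" by (rule lin_pointwise_minus[OF V.module_axioms W.module_axioms \<Phi>l evl])
    have pu: "p (?u f) = \<zero>\<^bsub>S\<^esub>" if f: "f \<in> carrier ?V" for f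
    proof -
      have fm: "f \<in> mhom R M ?W" using f by (simp add: Hom_module_simps)
      have "p (\<Phi> f) = p (f x)"
        using \<Theta>(2)[OF f] x(2)[OF qm[OF fm]] qm[OF fm] x(1) by (simp add: Hom_module_simps)
      then show ?thesis
        using lin_minus[OF W.module_axioms S.module_axioms p_lin_S lin_closed[OF \<Phi>l f] lin_closed[OF evl f]]
          S.minus_eq_zero_iff[OF lin_closed[OF p_lin_S lin_closed[OF evl f]] lin_closed[OF p_lin_S lin_closed[OF evl f]]]
        by simp
    qed
    obtain w where w: "lin R ?V ?W w" "\<And>f. f \<in> carrier ?V \<Longrightarrow> ?u f = a \<otimes> w f"
      using lin_divide[OF V.module_axioms u pu] by blast
    let ?w = "restrict w (carrier ?V)"
    have wVV: "?w \<in> carrier ?VV" using restrict_mhom[OF V.module_axioms w(1)] by (simp add: Hom_module_simps(1))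
    have evVV: "?ev x \<in> carrier ?VV" using evm[OF x(1)] by (simp add: Hom_module_simps(1))
    have "?ev x \<oplus>\<^bsub>?VV\<^esub> a \<odot>\<^bsub>?VV\<^esub> ?w \<in> mhom R ?V ?W"
      using VV.M.a_closed[OF evVV VV.smult_closed[OF a_carrier wVV]] by (simp only: Hom_module_simps(1))
    then have "\<Phi> = ?ev x \<oplus>\<^bsub>?VV\<^esub> a \<odot>\<^bsub>?VV\<^esub> ?w"
    proof (rule mhom_eqI[OF \<Phi>])
      fix f assume f: "f \<in> carrier ?V"
      note c = lin_closed[OF \<Phi>l f] lin_closed[OF evl f]
      have "\<Phi> f = ?u f \<oplus>\<^bsub>?W\<^esub> f x" using W.minus_add_cancel[OF c] by simp
      also have "\<dots> = f x \<oplus>\<^bsub>?W\<^esub> ?u f" by (rule W.M.a_comm[OF lin_closed[OF u f] c(2)])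
      also have "\<dots> = f x \<oplus>\<^bsub>?W\<^esub> a \<odot>\<^bsub>?W\<^esub> w f" using w(2)[OF f] by simp
      finally show "\<Phi> f = (?ev x \<oplus>\<^bsub>?VV\<^esub> a \<odot>\<^bsub>?VV\<^esub> ?w) f" using f by (simp add: Hom_module_simps(3,4))
    qed
    then show "\<exists>u\<in>?I. \<exists>z\<in>carrier ?VV. \<Phi> = u \<oplus>\<^bsub>?VV\<^esub> a \<odot>\<^bsub>?VV\<^esub> z" using x(1) wVV by blast
  qed
  then have "\<Phi> \<in> ?I" using \<Phi> by (simp add: Hom_module_simps(1))
  then obtain x where "x \<in> carrier M" "\<Phi> = ?ev x" by blast
  then show ?thesis using that[of x] by (simp add: Hom_module_simps(1))
qed

end

section \<open>Reflexivity of Ulrich modules\<close>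

lemma (in plain_module) smul_ideal_prod:
  assumes I: "ideal I R" and J: "ideal J R" and N: "submodule N R M"
  shows "smul R M (ideal_prod R J I) N = smul R M I (smul R M J N)"
proof
  have Ic: "I \<subseteq> carrier R" and Jc: "J \<subseteq> carrier R"
    using additive_subgroup.a_subset[OF ideal.axioms(1)[OF I]] additive_subgroup.a_subset[OF ideal.axioms(1)[OF J]] by auto
  have Nc: "N \<subseteq> carrier M" by (rule submodule_subset[OF N])
  have Pc: "ideal_prod R J I \<subseteq> carrier R" by (rule R.ideal_prod_in_carrier[OF J I])
  have sJ: "submodule (smul R M J N) R M" by (rule submodule_smul[OF Jc Nc])
  have sI: "submodule (smul R M I (smul R M J N)) R M" by (rule submodule_smul[OF Ic submodule_subset[OF sJ]])
  have sP: "submodule (smul R M (ideal_prod R J I) N) R M" by (rule submodule_smul[OF Pc Nc])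
  have ij: "(j \<otimes> i) \<odot>\<^bsub>M\<^esub> x = i \<odot>\<^bsub>M\<^esub> (j \<odot>\<^bsub>M\<^esub> x)" if "i \<in> I" "j \<in> J" "x \<in> N" for i j x
  proof -
    have c: "i \<in> carrier R" "j \<in> carrier R" "x \<in> carrier M" using that Ic Jc Nc by auto
    show ?thesis using smult_assoc1[OF c(1,2,3)] R.m_comm[OF c(1,2)] by simp
  qed
  show "smul R M (ideal_prod R J I) N \<subseteq> smul R M I (smul R M J N)"
  proof (rule smul_least[OF sI])
    fix r x assume r: "r \<in> ideal_prod R J I" and x: "x \<in> N"
    show "r \<odot>\<^bsub>M\<^esub> x \<in> smul R M I (smul R M J N)"
      using r
    proof (induction r rule: ideal_prod.induct)
      case (prod j i)
      then show ?case using ij x smul_mem by metis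
    next
      case (sum s1 s2)
      have c: "s1 \<in> carrier R" "s2 \<in> carrier R" "x \<in> carrier M" using sum.hyps Pc x Nc by auto
      show ?case unfolding smult_l_distr[OF c] by (rule submodule_add[OF sI sum.IH])
    qed
  qed
  show "smul R M I (smul R M J N) \<subseteq> smul R M (ideal_prod R J I) N"
  proof (rule smul_least[OF sP])
    fix i y assume i: "i \<in> I" and y: "y \<in> smul R M J N"
    have ic: "i \<in> carrier R" using i Ic by auto
    have "smul R M J N \<subseteq> {y \<in> carrier M. i \<odot>\<^bsub>M\<^esub> y \<in> smul R M (ideal_prod R J I) N}"
    proof (rule smul_least[OF submodule_lin_vimage[OF module_axioms module_axioms lin_scale[OF ic] carrier_is_submodule sP]])
      fix j x assume j: "j \<in> J" and x: "x \<in> N"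
      have "i \<odot>\<^bsub>M\<^esub> (j \<odot>\<^bsub>M\<^esub> x) \<in> smul R M (ideal_prod R J I) N"
        using smul_mem[OF ideal_prod.prod[OF j i] x] ij[OF i j x] by metis
      then show "j \<odot>\<^bsub>M\<^esub> x \<in> {y \<in> carrier M. i \<odot>\<^bsub>M\<^esub> y \<in> smul R M (ideal_prod R J I) N}"
        using j x Jc Nc by auto
    qed
    then show "i \<odot>\<^bsub>M\<^esub> y \<in> smul R M (ideal_prod R J I) N" using y by blast
  qed
qed

lemma ideal_smult_eq_smul: "ideal_smult R I M = smul R M I (carrier M)"
  by (simp add: ideal_smult_def smul_def)

lemma (in plain_module) ideal_pow_smult_eq:
  assumes I: "ideal I R"
  shows "ideal_pow_smult R I n M = pow_smul R M I n"
proof -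
  interpret I: comm_monoid "ideals_set R" by (rule R.ideals_set_is_comm_monoid)
  have Ic: "I \<in> carrier (ideals_set R)" using I by (simp add: ideals_set_def)
  have pow: "ideal (I [^]\<^bsub>ideals_set R\<^esub> n) R" for n :: nat
    using I.nat_pow_closed[OF Ic, of n] by (simp add: ideals_set_def)
  show ?thesis
    unfolding ideal_pow_smult_def ideal_smult_eq_smul
  proof (induction n)
    case 0
    have "carrier M \<subseteq> smul R M (carrier R) (carrier M)"
    proof
      fix x assume x: "x \<in> carrier M"
      then show "x \<in> smul R M (carrier R) (carrier M)" using smul_mem[of \<one> "carrier R" x "carrier M"] by simp
    qed
    moreover have "smul R M (carrier R) (carrier M) \<subseteq> carrier M" by (rule smul_least[OF carrier_is_submodule]) simp
    moreover have "I [^]\<^bsub>ideals_set R\<^esub> (0::nat) = carrier R" using I.nat_pow_0[of I] by (simp add: ideals_set_def)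
    ultimately show ?case by simp
  next
    case (Suc n)
    have "I [^]\<^bsub>ideals_set R\<^esub> Suc n = ideal_prod R (I [^]\<^bsub>ideals_set R\<^esub> n) I"
      using I.nat_pow_Suc[of I n] by (simp add: ideals_set_def)
    then show ?case using smul_ideal_prod[OF I pow[of n] carrier_is_submodule] Suc.IH by simp
  qed
qed

text \<open>Positive depth yields a nonempty regular sequence. Its first element is regular on
  \<open>M\<close> modulo the submodule belonging to the empty sequence; that submodule is zero, and
  the quotient by zero is traced back to \<open>M\<close>.\<close>

lemma regular_element_exists:
  fixes R :: "('a, 'r) ring_scheme" (structure) and M :: "('a, 'b) module"
  assumes M: "maximal_CM R M" and dim: "krull_dim R = 1"
  obtains x where "x \<in> max_ideal R" "x \<in> carrier R" "\<And>y. y \<in> carrier M \<Longrightarrow> x \<odot>\<^bsub>M\<^esub> y = \<zero>\<^bsub>M\<^esub> \<Longrightarrow> y = \<zero>\<^bsub>M\<^esub>"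
proof -
  interpret M: plain_module R M
    by (rule plain_moduleI) (use M in \<open>simp add: maximal_CM_def fg_module_def\<close>)
  have depth: "depth R M = 1" using M dim by (simp add: maximal_CM_def)
  have "\<exists>xs. set xs \<subseteq> max_ideal R \<and> regular_sequence R M xs \<and> xs \<noteq> []"
  proof (rule ccontr)
    assume h: "\<not> ?thesis"
    have "depth R M \<le> 0" unfolding depth_def
      by (rule SUP_least) (use h in \<open>auto simp: zero_enat_def\<close>)
    then show False using depth by simp
  qed
  then obtain xs where xs: "set xs \<subseteq> max_ideal R" "regular_sequence R M xs" "xs \<noteq> []" by blast
  let ?J = "genideal R (set (take 0 xs))"
  let ?A = "ideal_smult R ?J M"
  let ?x = "xs ! 0"
  have nzd: "nzd_on R (quot_module M ?A) ?x"
    using xs unfolding regular_sequence_def by blast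
  have J: "?J \<subseteq> {\<zero>}" unfolding genideal_def using M.R.zeroideal by auto
  have "?A \<subseteq> {\<zero>\<^bsub>M\<^esub>}"
    unfolding ideal_smult_eq_smul using J by (intro M.smul_least[OF M.submodule_zero_set]) auto
  moreover have "submodule ?A R M"
    unfolding ideal_smult_eq_smul using J M.R.zero_closed by (intro M.submodule_smul) auto
  ultimately have A: "?A = {\<zero>\<^bsub>M\<^esub>}" using M.submodule_zero by blast
  interpret Q: module_quotient R M "{\<zero>\<^bsub>M\<^esub>}"
    by (rule module_quotient.intro[OF M.plain_module_axioms module_quotient_axioms.intro[OF M.submodule_zero_set]])
  have xc: "?x \<in> carrier R" using nzd by (simp add: nzd_on_def)
  show ?thesis
  proof (rule that[of ?x])
    show "?x \<in> max_ideal R" using xs by auto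
    show "?x \<in> carrier R" by (rule xc)
    fix y assume y: "y \<in> carrier M" "?x \<odot>\<^bsub>M\<^esub> y = \<zero>\<^bsub>M\<^esub>"
    have "?x \<odot>\<^bsub>quot_module M ?A\<^esub> Q.proj y = \<zero>\<^bsub>quot_module M ?A\<^esub>"
      unfolding A using Q.Q_smult[OF xc y(1)] y Q.Q_zero by simp
    moreover have "Q.proj y \<in> carrier (quot_module M ?A)" unfolding A using Q.Q_carrier y by simp
    ultimately have "Q.proj y = \<zero>\<^bsub>quot_module M ?A\<^esub>" using nzd unfolding nzd_on_def by blast
    then have "Q.proj y = Q.proj \<zero>\<^bsub>M\<^esub>" unfolding A Q.Q_zero .
    then show "y = \<zero>\<^bsub>M\<^esub>"
      using Q.proj_eq_iff[OF y(1) M.M.zero_closed] M.minus_eq_zero_iff[OF y(1) M.M.zero_closed] by simp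
  qed
qed

section \<open>The bidual of \<open>M\<close> multiplied by \<omega>, and the comparison of
  lengths\<close>

context canonical_resolution
begin

text \<open>Biduality for the module \<open>R\<close>: an endomorphism l becomes the functional that
  sends f to \<open>l (f \<one>)\<close>, which must be evaluation at some r. Testing it on the map
  that sends t to \<open>t \<otimes> c\<close> gives the claim.\<close>

lemma End_\<omega>:
  assumes l: "lin R (ideal_module R \<omega>) (ideal_module R \<omega>) l"
  obtains r where "r \<in> carrier R" "\<And>c. c \<in> \<omega> \<Longrightarrow> l c = r \<otimes> c"
proof -
  let ?W = "ideal_module R \<omega>"
  let ?V = "Hom_module R (self_module R) ?W"
  interpret V: plain_module R ?V by (rule plain_moduleI[OF module_Hom[OF self.module_axioms W.module_axioms]])
  have ev: "lin R ?V ?W (\<lambda>f. f \<one>)" using lin_eval[OF self.module_axioms W.module_axioms, of \<one>] by simp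
  have "restrict (\<lambda>f. l (f \<one>)) (carrier ?V) \<in> mhom R ?V ?W"
    by (rule restrict_mhom[OF V.module_axioms lin_comp[OF ev l]])
  then obtain r where r: "r \<in> carrier (self_module R)"
    "\<And>f. f \<in> mhom R (self_module R) ?W \<Longrightarrow> restrict (\<lambda>f. l (f \<one>)) (carrier ?V) f = f r"
    using \<omega>_biduality[OF R_noeth] a_nzd by (metis self_module_simps(1,2,4))
  have "l c = r \<otimes> c" if c: "c \<in> \<omega>" for c
  proof -
    have cc: "c \<in> carrier R" using c \<omega>_carrier by auto
    have "lin R (self_module R) ?W (\<lambda>t. t \<otimes> c)"
      by (rule linI) (use c cc \<omega>_mult in \<open>simp_all add: l_distr m_assoc\<close>)
    from restrict_mhom[OF self.module_axioms this]
    have f: "(\<lambda>t\<in>carrier R. t \<otimes> c) \<in> mhom R (self_module R) ?W" by simp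
    show ?thesis using r(2)[OF f] f r(1) cc by (simp add: Hom_module_simps)
  qed
  then show ?thesis using that r by simp
qed

text \<open>Multiplication by \<open>v\<close> turns the values of \<Phi> into elements of \<omega>.
  Through the restriction of functionals from \<open>M\<close> to \<omega>M the product becomes an
  element of the \<omega>-bidual of \<omega>M, hence evaluation at an element of \<omega>M.\<close>

theorem bidual_scaled_into_image:
  fixes M :: "('a, 'e) module"
  assumes M: "noeth R M" and tf: "\<And>x. x \<in> carrier M \<Longrightarrow> a \<odot>\<^bsub>M\<^esub> x = \<zero>\<^bsub>M\<^esub> \<Longrightarrow> x = \<zero>\<^bsub>M\<^esub>"
    and w: "w \<in> \<omega>" "\<And>r. r \<in> carrier R \<Longrightarrow> w \<otimes> r = \<zero> \<Longrightarrow> r = \<zero>"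
    and \<Phi>: "\<Phi> \<in> carrier (dual_module R (dual_module R M))" and v: "v \<in> \<omega>"
  shows "v \<odot>\<^bsub>dual_module R (dual_module R M)\<^esub> \<Phi> \<in>
    (\<lambda>x. \<lambda>f\<in>carrier (dual_module R M). f x) ` smul R M \<omega> (carrier M)"
proof -
  let ?R = "self_module R" and ?W = "ideal_module R \<omega>"
  interpret M: plain_module R M by (rule plain_moduleI[OF noeth_module[OF M]])
  let ?G = "Hom_module R M ?R"
  interpret G: plain_module R ?G by (rule plain_moduleI[OF module_Hom[OF M.module_axioms self.module_axioms]])
  have vc: "v \<in> carrier R" using v \<omega>_carrier by auto
  have wc: "w \<in> carrier R" using w \<omega>_carrier by auto
  have w_cancel: "r = t" if "r \<in> carrier R" "t \<in> carrier R" "w \<otimes> r = w \<otimes> t" for r t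
  proof -
    have "w \<otimes> (r \<ominus> t) = \<zero>" using that wc by (simp add: a_minus_def r_distr r_minus r_neg)
    then have "r \<ominus> t = \<zero>" using w that by simp
    then show ?thesis using that r_right_minus_eq by blast
  qed
  have \<Phi>m: "\<Phi> \<in> mhom R ?G ?R" using \<Phi> by (simp add: dual_module_def Hom_module_simps(1))
  note \<Phi>l = mhom_lin[OF \<Phi>m]
  define N where "N = smul R M \<omega> (carrier M)"
  have N: "submodule N R M" unfolding N_def by (rule M.submodule_smul[OF \<omega>_carrier subset_refl])
  have Nmem: "c \<odot>\<^bsub>M\<^esub> x \<in> N" if "c \<in> \<omega>" "x \<in> carrier M" for c x unfolding N_def by (rule M.smul_mem[OF that])
  have Nc: "N \<subseteq> carrier M" by (rule M.submodule_subset[OF N])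
  let ?N = "M\<lparr>carrier := N\<rparr>"
  have nN: "noeth R ?N" by (rule noeth_restrict[OF M N])
  interpret N: plain_module R ?N by (rule plain_moduleI[OF noeth_module[OF nN]])
  let ?V = "Hom_module R ?N ?W"
  interpret V: plain_module R ?V by (rule plain_moduleI[OF module_Hom[OF N.module_axioms W.module_axioms]])
  have gN: "g x \<in> \<omega>" if g: "g \<in> mhom R M ?R" and x: "x \<in> N" for g x
  proof -
    have "N \<subseteq> {x \<in> carrier M. g x \<in> \<omega>}"
      unfolding N_def
    proof (rule M.smul_least[OF submodule_lin_vimage[OF M.module_axioms self.module_axioms mhom_lin[OF g] M.carrier_is_submodule \<omega>_sub]])
      fix c x assume c: "c \<in> \<omega>" and x: "x \<in> carrier M"
      have cc: "c \<in> carrier R" using c \<omega>_carrier by auto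
      have gx: "g x \<in> carrier R" using lin_closed[OF mhom_lin[OF g] x] by simp
      have "g (c \<odot>\<^bsub>M\<^esub> x) = c \<otimes> g x" using lin_smult[OF mhom_lin[OF g] cc x] by simp
      also have "\<dots> = g x \<otimes> c" by (rule m_comm[OF cc gx])
      finally show "c \<odot>\<^bsub>M\<^esub> x \<in> {x \<in> carrier M. g x \<in> \<omega>}" using \<omega>_mult[OF gx c] cc x by simp
    qed
    then show ?thesis using x by blast
  qed
  let ?q = "\<lambda>g. restrict g N"
  have qm: "?q g \<in> mhom R ?N ?W" if g: "g \<in> mhom R M ?R" for g
  proof -
    have "lin R ?N ?R g" by (rule lin_restrict_dom[OF mhom_lin[OF g] Nc])
    then have "lin R ?N ?W g" using gN[OF g] by (auto simp: lin_def)
    from restrict_mhom[OF N.module_axioms this] show ?thesis by simp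
  qed
  have q: "lin R ?G ?V ?q"
  proof (rule linI, unfold Hom_module_simps)
    show "?q g \<in> mhom R ?N ?W" if "g \<in> mhom R M ?R" for g by (rule qm[OF that])
    show "?q (\<lambda>x\<in>carrier M. f x \<oplus>\<^bsub>?R\<^esub> g x) = (\<lambda>x\<in>carrier ?N. ?q f x \<oplus>\<^bsub>?W\<^esub> ?q g x)" for f g
      using Nc by (auto simp: restrict_def fun_eq_iff)
    show "?q (\<lambda>x\<in>carrier M. r \<odot>\<^bsub>?R\<^esub> f x) = (\<lambda>x\<in>carrier ?N. r \<odot>\<^bsub>?W\<^esub> ?q f x)" for r f
      using Nc by (auto simp: restrict_def fun_eq_iff)
  qed
  text \<open>A homomorphism \<open>f\<close> from \<open>\<omega>M\<close> to \<open>\<omega>\<close> extends to \<open>M\<close>, since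
    \<open>c \<mapsto> f (c x)\<close> is an endomorphism of \<open>\<omega>\<close>, hence multiplication by an element of \<open>R\<close>.\<close>
  have q_surj: "\<exists>g\<in>carrier ?G. ?q g = f" if f: "f \<in> carrier ?V" for f
  proof -
    have fm: "f \<in> mhom R ?N ?W" using f by (simp add: Hom_module_simps)
    note fl = mhom_lin[OF fm]
    have "\<exists>r. r \<in> carrier R \<and> (\<forall>c\<in>\<omega>. f (c \<odot>\<^bsub>M\<^esub> x) = r \<otimes> c)" if x: "x \<in> carrier M" for x
    proof -
      have 1: "lin R ?W ?N (\<lambda>c. c \<odot>\<^bsub>M\<^esub> x)"
      proof (rule linI)
        fix c assume "c \<in> carrier ?W"
        then have c: "c \<in> \<omega>" "c \<in> carrier R" using \<omega>_carrier by auto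
        show "c \<odot>\<^bsub>M\<^esub> x \<in> carrier ?N" using Nmem[OF c(1) x] by simp
        show "r \<in> carrier R \<Longrightarrow> (r \<odot>\<^bsub>?W\<^esub> c) \<odot>\<^bsub>M\<^esub> x = r \<odot>\<^bsub>?N\<^esub> (c \<odot>\<^bsub>M\<^esub> x)" for r
          using c x by (simp add: M.smult_assoc1)
        fix c' assume "c' \<in> carrier ?W"
        then have "c' \<in> carrier R" using \<omega>_carrier by auto
        then show "(c \<oplus>\<^bsub>?W\<^esub> c') \<odot>\<^bsub>M\<^esub> x = c \<odot>\<^bsub>M\<^esub> x \<oplus>\<^bsub>?N\<^esub> c' \<odot>\<^bsub>M\<^esub> x"
          using c x by (simp add: M.smult_l_distr)
      qed
      show ?thesis using End_\<omega>[OF lin_comp[OF 1 fl]] by metis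
    qed
    then obtain g where g: "\<And>x. x \<in> carrier M \<Longrightarrow> g x \<in> carrier R"
      "\<And>x c. x \<in> carrier M \<Longrightarrow> c \<in> \<omega> \<Longrightarrow> f (c \<odot>\<^bsub>M\<^esub> x) = g x \<otimes> c"
      by metis
    \<comment> \<open>The value \<open>g x\<close> is determined by its product with the
      nonzerodivisor \<open>w\<close>; linearity of \<open>g\<close> is therefore checked after
      multiplication by \<open>w\<close>, where it is that of \<open>f\<close>.\<close>
    have wg: "w \<otimes> g x = f (w \<odot>\<^bsub>M\<^esub> x)" if "x \<in> carrier M" for x
      using g(2)[OF that w(1)] m_comm[OF g(1)[OF that] wc] by simp
    have gl: "lin R M ?R g"
    proof (rule linI)
      fix x y r assume x: "x \<in> carrier M"
      show "g x \<in> carrier ?R" using g(1)[OF x] by simp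
      have wx: "w \<odot>\<^bsub>M\<^esub> x \<in> carrier ?N" using Nmem[OF w(1) x] by simp
      show "g (r \<odot>\<^bsub>M\<^esub> x) = r \<odot>\<^bsub>?R\<^esub> g x" if r: "r \<in> carrier R"
      proof -
        have "w \<otimes> g (r \<odot>\<^bsub>M\<^esub> x) = f (r \<odot>\<^bsub>?N\<^esub> (w \<odot>\<^bsub>M\<^esub> x))"
          using wg[of "r \<odot>\<^bsub>M\<^esub> x"] x r wc M.smult_commute[of w r x] by simp
        also have "\<dots> = r \<otimes> (w \<otimes> g x)" using lin_smult[OF fl r wx] wg[OF x] by simp
        also have "\<dots> = w \<otimes> (r \<otimes> g x)" by (rule m_lcomm[OF r wc g(1)[OF x]])
        finally show ?thesis using w_cancel[of "g (r \<odot>\<^bsub>M\<^esub> x)" "r \<otimes> g x"] g(1) x r by simp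
      qed
      assume y: "y \<in> carrier M"
      have wy: "w \<odot>\<^bsub>M\<^esub> y \<in> carrier ?N" using Nmem[OF w(1) y] by simp
      have "w \<otimes> g (x \<oplus>\<^bsub>M\<^esub> y) = f (w \<odot>\<^bsub>M\<^esub> x \<oplus>\<^bsub>?N\<^esub> w \<odot>\<^bsub>M\<^esub> y)"
        using wg[of "x \<oplus>\<^bsub>M\<^esub> y"] x y wc by (simp add: M.smult_r_distr)
      also have "\<dots> = w \<otimes> (g x \<oplus> g y)"
        using lin_add[OF fl wx wy] wg[OF x] wg[OF y] r_distr[OF g(1)[OF x] g(1)[OF y] wc] by simp
      finally show "g (x \<oplus>\<^bsub>M\<^esub> y) = g x \<oplus>\<^bsub>?R\<^esub> g y"
        using w_cancel[of "g (x \<oplus>\<^bsub>M\<^esub> y)" "g x \<oplus> g y"] g(1) x y by simp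
    qed
    let ?g = "restrict g (carrier M)"
    have gm: "?g \<in> mhom R M ?R" by (rule restrict_mhom[OF M.module_axioms gl])
    have "N \<subseteq> {x \<in> carrier ?N. g x = f x}"
    proof -
      have "g x \<in> \<omega>" if "x \<in> N" for x using gN[OF gm that] subsetD[OF Nc that] by simp
      then have glN: "lin R ?N ?W g"
        using lin_restrict_dom[OF gl Nc] by (auto simp: lin_def)
      have "submodule {x \<in> carrier ?N. g x = f x} R ?N" by (rule lin_equalizer[OF N.module_axioms W.module_axioms glN fl])
      then have s: "submodule {x \<in> carrier ?N. g x = f x} R M" using M.submodule_restrict_iff[OF N] by blast
      show ?thesis
        unfolding N_def
      proof (rule M.smul_least[OF s[unfolded N_def]])
        fix c x assume c: "c \<in> \<omega>" and x: "x \<in> carrier M"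
        have cc: "c \<in> carrier R" using c \<omega>_carrier by auto
        have "g (c \<odot>\<^bsub>M\<^esub> x) = f (c \<odot>\<^bsub>M\<^esub> x)"
          using lin_smult[OF gl cc x] g(2)[OF x c] m_comm[OF cc g(1)[OF x]] by simp
        then show "c \<odot>\<^bsub>M\<^esub> x \<in> {x \<in> carrier (M\<lparr>carrier := smul R M \<omega> (carrier M)\<rparr>). g x = f x}"
          using Nmem[OF c x] by (simp add: N_def)
      qed
    qed
    then have "?q ?g = f" using Nc by (intro mhom_eqI[OF qm[OF gm] fm]) auto
    then show ?thesis using gm by (intro bexI[of _ ?g]) (simp_all add: Hom_module_simps)
  qed
  have L: "lin R ?G ?W (\<lambda>g. v \<otimes> \<Phi> g)"
  proof (rule linI)
    fix f g r assume f: "f \<in> carrier ?G"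
    have \<Phi>f: "\<Phi> f \<in> carrier R" using lin_closed[OF \<Phi>l f] by simp
    show "v \<otimes> \<Phi> f \<in> carrier ?W" using \<omega>_mult[OF \<Phi>f v] m_comm[OF vc \<Phi>f] by simp
    show "r \<in> carrier R \<Longrightarrow> v \<otimes> \<Phi> (r \<odot>\<^bsub>?G\<^esub> f) = r \<odot>\<^bsub>?W\<^esub> (v \<otimes> \<Phi> f)"
      using lin_smult[OF \<Phi>l _ f, of r] vc \<Phi>f m_lcomm[of v r "\<Phi> f"] by simp
    assume g: "g \<in> carrier ?G"
    have \<Phi>g: "\<Phi> g \<in> carrier R" using lin_closed[OF \<Phi>l g] by simp
    show "v \<otimes> \<Phi> (f \<oplus>\<^bsub>?G\<^esub> g) = v \<otimes> \<Phi> f \<oplus>\<^bsub>?W\<^esub> v \<otimes> \<Phi> g"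
      using lin_add[OF \<Phi>l f g] r_distr[OF \<Phi>f \<Phi>g vc] by simp
  qed
  \<comment> \<open>Restriction to \<omega>M is injective: a functional that vanishes on
    \<open>w M\<close> vanishes, as \<open>w\<close> is a nonzerodivisor.\<close>
  have ker: "v \<otimes> \<Phi> g = \<zero>\<^bsub>?W\<^esub>" if g: "g \<in> carrier ?G" "?q g = \<zero>\<^bsub>?V\<^esub>" for g
  proof -
    have gm: "g \<in> mhom R M ?R" using g by (simp add: Hom_module_simps)
    have "g x = \<zero>" if x: "x \<in> carrier M" for x
    proof -
      have wx: "w \<odot>\<^bsub>M\<^esub> x \<in> N" by (rule Nmem[OF w(1) x])
      have "g (w \<odot>\<^bsub>M\<^esub> x) = \<zero>" using fun_cong[OF g(2), of "w \<odot>\<^bsub>M\<^esub> x"] wx by (simp add: Hom_module_simps)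
      then show ?thesis using lin_smult[OF mhom_lin[OF gm] wc x] w(2)[of "g x"] lin_closed[OF mhom_lin[OF gm] x] by simp
    qed
    moreover have "\<zero>\<^bsub>?G\<^esub> \<in> mhom R M ?R" using G.M.zero_closed by (simp only: Hom_module_simps(1))
    ultimately have "g = \<zero>\<^bsub>?G\<^esub>" by (intro mhom_eqI[OF gm]) (simp_all add: Hom_module_simps)
    then show ?thesis using lin_zero[OF G.module_axioms self.module_axioms \<Phi>l] vc by simp
  qed
  obtain \<Psi> where \<Psi>: "lin R ?V ?W \<Psi>" "\<And>g. g \<in> carrier ?G \<Longrightarrow> \<Psi> (?q g) = v \<otimes> \<Phi> g"
    by (rule lin_descend[OF G.module_axioms V.module_axioms W.module_axioms q q_surj L ker]) auto
  have tfN: "x = \<zero>\<^bsub>?N\<^esub>" if "x \<in> carrier ?N" "a \<odot>\<^bsub>?N\<^esub> x = \<zero>\<^bsub>?N\<^esub>" for x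
    using tf[of x] that Nc by auto
  obtain z where z: "z \<in> carrier ?N" "\<And>f. f \<in> mhom R ?N ?W \<Longrightarrow> restrict \<Psi> (carrier ?V) f = f z"
    using \<omega>_biduality[OF nN tfN restrict_mhom[OF V.module_axioms \<Psi>(1)]] by blast
  have zN: "z \<in> N" using z(1) by simp
  have "v \<otimes> \<Phi> g = g z" if g: "g \<in> carrier ?G" for g
  proof -
    have gm: "g \<in> mhom R M ?R" using g by (simp add: Hom_module_simps)
    show ?thesis using z(2)[OF qm[OF gm]] \<Psi>(2)[OF g] qm[OF gm] zN by (simp add: Hom_module_simps)
  qed
  then have "v \<odot>\<^bsub>dual_module R (dual_module R M)\<^esub> \<Phi> = (\<lambda>f\<in>carrier (dual_module R M). f z)"
    unfolding dual_module_def Hom_module_simps(4) by (intro restrict_ext) simp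
  then show ?thesis using zN unfolding N_def by blast
qed

text \<open>The assumption \<open>fin\<close> is what dimension one contributes to the count of
  lengths; its type is that of the bidual, on whose Hilbert function the estimate is made. The
  nonzerodivisor \<open>w\<close> lies in \<omega>, whereas \<open>a\<close> serves the
  duality.\<close>

theorem Ulrich_reflexive:
  fixes M :: "('a, 'e) module"
  assumes M: "noeth R M" and tf: "\<And>x. x \<in> carrier M \<Longrightarrow> a \<odot>\<^bsub>M\<^esub> x = \<zero>\<^bsub>M\<^esub> \<Longrightarrow> x = \<zero>\<^bsub>M\<^esub>"
    and w: "w \<in> \<omega>" "\<And>r. r \<in> carrier R \<Longrightarrow> w \<otimes> r = \<zero> \<Longrightarrow> r = \<zero>"
    and fin: "\<And>Z :: ('a, ('e \<Rightarrow> 'a) \<Rightarrow> 'a) module. noeth R Z \<Longrightarrow> ilen R Z ((\<lambda>z. w \<odot>\<^bsub>Z\<^esub> z) ` carrier Z) (carrier Z) \<noteq> \<infinity>"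
    and mult: "has_multiplicity R \<omega> M (module_length R (quot_module M (ideal_smult R \<omega> M)))"
  shows "reflexive_module R M"
proof -
  interpret M: plain_module R M by (rule plain_moduleI[OF noeth_module[OF M]])
  let ?R = "self_module R"
  define G where "G = dual_module R M"
  have GH: "G = Hom_module R M ?R" by (simp add: G_def dual_module_def)
  have nG: "noeth R G" unfolding GH by (rule noeth_Hom[OF M.module_axioms self.module_axioms M R_noeth])
  define T where "T = dual_module R G"
  have TH: "T = Hom_module R G ?R" by (simp add: T_def dual_module_def)
  have nT: "noeth R T" unfolding TH by (rule noeth_Hom[OF noeth_module[OF nG] self.module_axioms nG R_noeth])
  interpret G: plain_module R G by (rule plain_moduleI[OF noeth_module[OF nG]])
  interpret T: plain_module R T by (rule plain_moduleI[OF noeth_module[OF nT]])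
  have wc: "w \<in> carrier R" using w \<omega>_carrier by auto
  define e where "e = (\<lambda>x. \<lambda>f\<in>carrier G. f x)"
  have e: "lin R M T e" unfolding e_def TH GH by (rule lin_evaluation[OF M.module_axioms self.module_axioms])
  \<comment> \<open>Homomorphisms to \<omega> are homomorphisms to \<open>R\<close>, so the
    separation of elements by \<omega> already shows that \<open>M\<close> embeds in its
    bidual.\<close>
  have e_inj: "x = \<zero>\<^bsub>M\<^esub>" if x: "x \<in> carrier M" "e x = \<zero>\<^bsub>T\<^esub>" for x
  proof (rule \<omega>_separates[OF M tf x(1)])
    fix f assume f: "f \<in> mhom R M (ideal_module R \<omega>)"
    then have "f \<in> mhom R M ?R" using \<omega>_carrier by (auto simp: mhom_def PiE_iff)
    then have "f \<in> carrier G" by (simp add: GH Hom_module_simps)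
    then show "f x = \<zero>" using fun_cong[OF x(2), of f] by (simp add: e_def TH Hom_module_simps)
  qed
  have w_inj: "\<Phi> = \<zero>\<^bsub>T\<^esub>" if \<Phi>: "\<Phi> \<in> carrier T" "w \<odot>\<^bsub>T\<^esub> \<Phi> = \<zero>\<^bsub>T\<^esub>" for \<Phi>
  proof -
    have \<Phi>m: "\<Phi> \<in> mhom R G ?R" using \<Phi> by (simp add: TH Hom_module_simps(1))
    have "\<zero>\<^bsub>T\<^esub> \<in> mhom R G ?R" using T.M.zero_closed by (simp add: TH Hom_module_simps(1))
    then show ?thesis
    proof (rule mhom_eqI[OF \<Phi>m])
      fix g assume g: "g \<in> carrier G"
      have "w \<otimes> \<Phi> g = \<zero>" using fun_cong[OF \<Phi>(2), of g] g by (simp add: TH Hom_module_simps)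
      then show "\<Phi> g = \<zero>\<^bsub>T\<^esub> g" using w(2)[of "\<Phi> g"] lin_closed[OF mhom_lin[OF \<Phi>m] g] g by (simp add: TH Hom_module_simps)
    qed
  qed
  interpret red: regular_scalar R T \<omega> w
    by (rule regular_scalar.intro[OF T.plain_module_axioms regular_scalar_axioms.intro])
       (fact R_noeth nT \<omega>_ideal w(1) w_inj fin[OF nT])+
  let ?I = "e ` carrier M"
  note I = submodule_lin_image[OF M.module_axioms T.module_axioms e M.carrier_is_submodule]
  have Ic: "?I \<subseteq> carrier T" by (rule T.submodule_subset[OF I])
  have im: "smul R T \<omega> (e ` A) = e ` smul R M \<omega> A" if "A \<subseteq> carrier M" for A
    by (rule smul_image[OF M.module_axioms T.module_axioms e \<omega>_carrier that])
  have X_sub: "submodule (pow_smul R M \<omega> n) R M" for n by (rule M.submodule_pow_smul[OF \<omega>_carrier])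
  have X_c: "pow_smul R M \<omega> n \<subseteq> carrier M" for n by (rule M.submodule_subset[OF X_sub])
  have sm: "submodule (smul R M \<omega> (carrier M)) R M" by (rule M.submodule_smul[OF \<omega>_carrier subset_refl])
  have top: "smul R T \<omega> (carrier T) = e ` smul R M \<omega> (carrier M)"
  proof
    show "smul R T \<omega> (carrier T) \<subseteq> e ` smul R M \<omega> (carrier M)"
    proof (rule T.smul_least[OF submodule_lin_image[OF M.module_axioms T.module_axioms e sm]])
      show "v \<odot>\<^bsub>T\<^esub> \<Phi> \<in> e ` smul R M \<omega> (carrier M)" if "v \<in> \<omega>" "\<Phi> \<in> carrier T" for v \<Phi>
        using bidual_scaled_into_image[OF M tf w, of \<Phi> v] that unfolding T_def G_def e_def by blast
    qed
    show "e ` smul R M \<omega> (carrier M) \<subseteq> smul R T \<omega> (carrier T)"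
      using T.smul_mono[OF subset_refl Ic, of \<omega>] im[OF subset_refl] by simp
  qed
  \<comment> \<open>The equality starts with exponent 1; for exponent 0 it would be the surjectivity
    that is to be proved.\<close>
  have Y: "pow_smul R T \<omega> (Suc n) = e ` pow_smul R M \<omega> (Suc n)" for n
  proof (induction n)
    case 0
    then show ?case using top by simp
  next
    case (Suc n)
    then show ?case using im[OF X_c[of "Suc n"]] by simp
  qed
  have step: "pow_smul R M \<omega> (Suc n) \<subseteq> pow_smul R M \<omega> n" for n
    using \<omega>_carrier M.submodule_smult[OF X_sub] by (simp, intro M.smul_least[OF X_sub]) auto
  have ilen_e: "ilen R T (e ` A) (e ` B) = ilen R M A B"
    if "submodule A R M" "submodule B R M" "A \<subseteq> B" for A B
    by (rule ilen_image[OF M.module_axioms T.module_axioms e that]) (use e_inj M.submodule_mem[OF that(2)] in blast)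
  have "eventually (\<lambda>n. ilen R M (pow_smul R M \<omega> (Suc n)) (pow_smul R M \<omega> n) = ilen R M (pow_smul R M \<omega> 1) (carrier M)) sequentially"
  proof -
    have "module_length R (quot_module (M\<lparr>carrier := ideal_pow_smult R \<omega> n M\<rparr>) (ideal_pow_smult R \<omega> (Suc n) M)) =
        ilen R M (pow_smul R M \<omega> (Suc n)) (pow_smul R M \<omega> n)" for n
      unfolding M.ideal_pow_smult_eq[OF \<omega>_ideal]
      by (rule module_length_quot_restrict[OF M.module_axioms X_sub X_sub step])
    moreover have "module_length R (quot_module M (ideal_smult R \<omega> M)) = ilen R M (pow_smul R M \<omega> 1) (carrier M)"
      using module_length_quot_restrict[OF M.module_axioms sm M.carrier_is_submodule M.submodule_subset[OF sm]]
      by (simp add: ideal_smult_eq_smul)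
    ultimately show ?thesis using mult unfolding has_multiplicity_def by simp
  qed
  then obtain n1 where n1: "\<And>n. n1 \<le> n \<Longrightarrow>
      ilen R M (pow_smul R M \<omega> (Suc n)) (pow_smul R M \<omega> n) = ilen R M (pow_smul R M \<omega> 1) (carrier M)"
    unfolding eventually_sequentially by blast
  obtain n0 where n0: "\<And>n. n0 \<le> n \<Longrightarrow> ilen R T (pow_smul R T \<omega> 1) (carrier T) \<le> ilen R T (pow_smul R T \<omega> (Suc n)) (pow_smul R T \<omega> n)"
    using red.eventually_colength_le_hilbert_function by blast
  \<comment> \<open>The successor keeps n positive, so that \<open>Y\<close> covers both exponents n
    and n + 1.\<close>
  define n where "n = Suc (max n0 n1)"
  have "ilen R T (pow_smul R T \<omega> 1) (carrier T) \<le> ilen R T (pow_smul R T \<omega> (Suc n)) (pow_smul R T \<omega> n)"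
    by (rule n0) (simp add: n_def)
  also have "\<dots> = ilen R M (pow_smul R M \<omega> (Suc n)) (pow_smul R M \<omega> n)"
    unfolding n_def Y by (rule ilen_e[OF X_sub X_sub step])
  also have "\<dots> = ilen R M (pow_smul R M \<omega> 1) (carrier M)" by (rule n1) (simp add: n_def)
  also have "\<dots> = ilen R T (pow_smul R T \<omega> 1) ?I"
    using ilen_e[OF X_sub[of 1] M.carrier_is_submodule X_c] Y[of 0] by simp
  finally have le: "ilen R T (pow_smul R T \<omega> 1) (carrier T) \<le> ilen R T (pow_smul R T \<omega> 1) ?I" .
  have Y1: "submodule (pow_smul R T \<omega> 1) R T" by (rule red.subY)
  have Y1I: "pow_smul R T \<omega> 1 \<subseteq> ?I" using Y[of 0] X_c[of 1] by auto
  have split: "ilen R T (pow_smul R T \<omega> 1) (carrier T) = ilen R T (pow_smul R T \<omega> 1) ?I + ilen R T ?I (carrier T)"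
    by (rule T.ilen_add[OF Y1 I T.carrier_is_submodule Y1I Ic])
  have fin1: "ilen R T (pow_smul R T \<omega> 1) ?I \<noteq> \<infinity>"
    by (rule enat_le_finite[OF ilen_mono[OF subset_refl Ic] red.ilen_Y_finite])
  have "ilen R T (pow_smul R T \<omega> 1) ?I + ilen R T ?I (carrier T) \<le> ilen R T (pow_smul R T \<omega> 1) ?I + 0"
    using le unfolding split add_0_right .
  then have "ilen R T ?I (carrier T) \<le> 0" using fin1 by (rule enat_add_cancel_le)
  then have surj: "?I = carrier T" using ilen_zero_eq[OF I T.carrier_is_submodule Ic] by simp
  have "inj_on e (carrier M)"
  proof (rule inj_onI)
    fix x y assume xy: "x \<in> carrier M" "y \<in> carrier M" "e x = e y"
    then have "e (x \<ominus>\<^bsub>M\<^esub> y) = \<zero>\<^bsub>T\<^esub>"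
      using lin_minus[OF M.module_axioms T.module_axioms e] T.minus_eq_zero_iff lin_closed[OF e] by simp
    then show "x = y" using e_inj[of "x \<ominus>\<^bsub>M\<^esub> y"] xy M.minus_eq_zero_iff by simp
  qed
  then have "bij_betw (restrict e (carrier M)) (carrier M) (carrier T)"
    using surj by (simp add: bij_betw_def inj_on_def)
  then have "restrict e (carrier M) \<in> miso R M T"
    using restrict_mhom[OF M.module_axioms e] by (simp add: miso_def)
  then show ?thesis by (simp add: reflexive_module_def e_def T_def G_def)
qed

end

theorem corollary4p28:
  fixes R :: "('a, 'r) ring_scheme"
    and \<omega> :: "'a set"
    and M :: "('a, 'b) module"
  assumes "CM_local_ring R"
    and "krull_dim R = 1"
    and "canonical_ideal TYPE('c) R \<omega>"
    and "Ulrich_module R \<omega> M"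
  shows "reflexive_module R M"
proof -
  note dim = assms(2)
  interpret noeth_local R "max_ideal R"
    by (rule noeth_local_max_ideal) (use assms(1) in \<open>simp add: CM_local_ring_def\<close>)
  have \<omega>_ideal: "ideal \<omega> R" using assms(3) by (simp add: canonical_ideal_def)
  interpret M: plain_module R M
    by (rule plain_moduleI) (use assms(4) in \<open>simp add: Ulrich_module_def maximal_CM_def fg_module_def\<close>)
  have M: "noeth R M"
    using assms(4) noeth_fg[OF R_noeth M.module_axioms]
    unfolding Ulrich_module_def maximal_CM_def fg_module_def by blast
  obtain a where a: "a \<in> max_ideal R" "a \<in> carrier R"
    "\<And>y. y \<in> carrier (self_module R) \<Longrightarrow> a \<odot>\<^bsub>self_module R\<^esub> y = \<zero>\<^bsub>self_module R\<^esub> \<Longrightarrow> y = \<zero>\<^bsub>self_module R\<^esub>"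
    using regular_element_exists[OF _ dim, of "self_module R"] assms(1) by (auto simp: CM_local_ring_def)
  have a_nzd: "x = \<zero>\<^bsub>R\<^esub>" if "x \<in> carrier R" "a \<otimes>\<^bsub>R\<^esub> x = \<zero>\<^bsub>R\<^esub>" for x using a(3)[of x] that by simp
  interpret local_parameter R "max_ideal R" a
    by (rule local_parameter.intro[OF noeth_local_axioms local_parameter_axioms.intro[OF a(1)]])
       (rule prime_over_nonzerodivisor[OF noeth_local_axioms dim a(2) a_nzd])
  \<comment> \<open>The depth of \<open>M\<close> is one, so some element of the maximal ideal is
    regular on \<open>M\<close>; torsion-freeness then passes to \<open>a\<close>.\<close>
  obtain y where y: "y \<in> max_ideal R" "\<And>x. x \<in> carrier M \<Longrightarrow> y \<odot>\<^bsub>M\<^esub> x = \<zero>\<^bsub>M\<^esub> \<Longrightarrow> x = \<zero>\<^bsub>M\<^esub>"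
    using regular_element_exists[OF _ dim, of M] assms(4) by (auto simp: Ulrich_module_def)
  have tf: "x = \<zero>\<^bsub>M\<^esub>" if "x \<in> carrier M" "a \<odot>\<^bsub>M\<^esub> x = \<zero>\<^bsub>M\<^esub>" for x
    by (rule nonzerodivisor_transfer[OF M.module_axioms y that])
  obtain w where w: "w \<in> \<omega>" "nzd_on R (self_module R) w" using assms(4) by (auto simp: Ulrich_module_def)
  have wc: "w \<in> carrier R" and w_nzd: "\<And>r. r \<in> carrier R \<Longrightarrow> w \<otimes>\<^bsub>R\<^esub> r = \<zero>\<^bsub>R\<^esub> \<Longrightarrow> r = \<zero>\<^bsub>R\<^esub>"
    using w(2) by (auto simp: nzd_on_def)
  \<comment> \<open>If \<open>w\<close> lies outside the maximal ideal, it is a unit, \<omega> is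
    all of \<open>R\<close>, and the quotient is zero; otherwise \<open>w\<close> is itself a
    parameter of the local ring.\<close>
  have fin: "ilen R Z ((\<lambda>z. w \<odot>\<^bsub>Z\<^esub> z) ` carrier Z) (carrier Z) \<noteq> \<infinity>"
    if Z: "noeth R Z" for Z :: "('a, ('b \<Rightarrow> 'a) \<Rightarrow> 'a) module"
  proof -
    interpret Z: plain_module R Z by (rule plain_moduleI[OF noeth_module[OF Z]])
    have wZ: "submodule ((\<lambda>z. w \<odot>\<^bsub>Z\<^esub> z) ` carrier Z) R Z" by (rule Z.submodule_scale[OF Z.carrier_is_submodule wc])
    show ?thesis
    proof (cases "w \<in> max_ideal R")
      case True
      interpret w: local_parameter R "max_ideal R" w
        by (rule local_parameter.intro[OF noeth_local_axioms local_parameter_axioms.intro[OF True]])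
           (rule prime_over_nonzerodivisor[OF noeth_local_axioms dim wc w_nzd])
      show ?thesis by (rule w.ilen_finite[OF Z wZ]) blast
    next
      case False
      have "z \<in> (\<lambda>z. w \<odot>\<^bsub>Z\<^esub> z) ` carrier Z" if "z \<in> carrier Z" for z
        by (rule unit_smult_mem[OF Z.module_axioms wZ that wc False]) (use that in blast)
      then have "(\<lambda>z. w \<odot>\<^bsub>Z\<^esub> z) ` carrier Z = carrier Z" using Z.submodule_subset[OF wZ] by blast
      then show ?thesis by (simp add: ilen_self)
    qed
  qed
  have mult: "has_multiplicity R \<omega> M (module_length R (quot_module M (ideal_smult R \<omega> M)))"
    using assms(4) unfolding Ulrich_module_def by blast
  obtain C :: "('a, 'a) module" and \<phi> where C: "canonical_module TYPE('c) R C" and \<phi>: "\<phi> \<in> miso R (ideal_module R \<omega>) C"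
    using assms(3) by (auto simp: canonical_ideal_def)
  obtain \<eta> :: "'a \<Rightarrow> 'c" and E d n t where res: "injective_resolution R C \<eta> E d"
    and n: "\<And>i. i > n \<Longrightarrow> carrier (E i) = {\<zero>\<^bsub>E i\<^esub>}" and t: "krull_dim R = enat t"
    and type: "module_length R (Ext_module R (residue_module R) E d t) = 1"
    using C unfolding canonical_module_def by blast
  have t1: "t = 1" using t dim by (simp add: one_enat_def)
  \<comment> \<open>The resolution of \<open>C\<close> becomes one of \<omega> by composing the
    augmentation with the isomorphism; the injective modules and differentials stay the
    same.\<close>
  let ?\<eta> = "\<lambda>c\<in>\<omega>. \<eta> (\<phi> c)"
  have \<phi>m: "\<phi> \<in> mhom R (ideal_module R \<omega>) C" and \<phi>b: "bij_betw \<phi> \<omega> (carrier C)"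
    using \<phi> by (simp_all add: miso_def)
  have \<eta>m: "\<eta> \<in> mhom R C (E 0)" and \<eta>i: "inj_on \<eta> (carrier C)"
    using res by (simp_all add: injective_resolution_def)
  have 1: "?\<eta> \<in> mhom R (ideal_module R \<omega>) (E 0)"
    using restrict_mhom[OF module_ideal[OF is_cring \<omega>_ideal] lin_comp[OF mhom_lin[OF \<phi>m] mhom_lin[OF \<eta>m]]] by simp
  have "inj_on (\<eta> \<circ> \<phi>) \<omega>"
    using comp_inj_on[OF bij_betw_imp_inj_on[OF \<phi>b], of \<eta>] \<eta>i bij_betw_imp_surj_on[OF \<phi>b] by simp
  then have 2: "inj_on ?\<eta> \<omega>" by (simp add: inj_on_def)
  have 3: "?\<eta> ` \<omega> = \<eta> ` carrier C"
    using bij_betw_imp_surj_on[OF \<phi>b] by (auto simp: image_image[symmetric])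
  have res': "injective_resolution R (ideal_module R \<omega>) ?\<eta> E d"
    using res 1 2 3 unfolding injective_resolution_def by simp
  have \<omega>_ne: "\<omega> \<noteq> {\<zero>\<^bsub>R\<^esub>}"
  proof
    assume "\<omega> = {\<zero>\<^bsub>R\<^esub>}"
    then have "\<one>\<^bsub>R\<^esub> = \<zero>\<^bsub>R\<^esub>" using w(1) w_nzd[of "\<one>\<^bsub>R\<^esub>"] by simp
    then show False using m_proper self.submodule_zero[OF m_sub] by simp
  qed
  interpret canonical_resolution R "max_ideal R" a \<omega> ?\<eta> E d n
    by (rule canonical_resolution.intro[OF local_parameter_axioms canonical_resolution_axioms.intro])
       (use a_nzd \<omega>_ideal \<omega>_ne res' n type t1 in simp_all)
  show ?thesis
    by (rule Ulrich_reflexive[OF M tf w(1) w_nzd fin mult])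
qed

end
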